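(* Fix $m_0\in(0,1)$ and let $(\eta^N)_N$, $\eta^N\in\Omega_N$, be a sequence of configurations such that $\widehat m(\pi^N(\eta^N))\to m_0$ as $N\to\infty$. Then: (i) for any closed subset $\mathcal{F}$ of $\mathcal{D}^T_{[0,1]}$, $$\limsup_{N\to\infty}\frac1N\log\tilde{\mathbb{P}}_{\delta_{\eta^N}}\big[(\widehat m(\pi^N_t))_{0\le t\le T}\in\mathcal{F}\big]\le-\inf_{a\in\mathcal{F}}I_T(a|m_0);$$ (ii) for any open subset $\mathcal{O}$ of $\mathcal{D}^T_{[0,1]}$, $$\liminf_{N\to\infty}\frac1N\log\tilde{\mathbb{P}}_{\delta_{\eta^N}}\big[(\widehat m(\pi^N_t))_{0\le t\le T}\in\mathcal{O}\big]\ge-\inf_{a\in\mathcal{O}}I_T(a|m_0).$$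
   Context: Fix $T>0$, $0<\alpha,\beta<1$, and set $\gamma=(\alpha+\beta)/2$. For $N\ge 3$ let $\Sigma_N=\{1,\dots,N-1\}$, $\Omega_N=\{0,1\}^{\Sigma_N}$, $r_1=\alpha$, $r_{N-1}=\beta$. For $f:\Omega_N\to\mathbb{R}$ define $(\mathcal{L}_{N,0}f)(\eta)=\sum_{x=1}^{N-2}(f(\eta^{x,x+1})-f(\eta))$ and $(\mathcal{L}_{N,b}f)(\eta)=\sum_{x\in\{1,N-1\}}[r_x(1-\eta(x))+(1-r_x)\eta(x)](f(\eta^x)-f(\eta))$, where $\eta^{x,x+1}$ is obtained from $\eta$ by exchanging the values at $x$ and $x+1$, and $\eta^x$ by replacing $\eta(x)$ with $1-\eta(x)$. The accelerated process $(\zeta_t)_{t\in[0,T]}$ is the Markov process on $\Omega_N$ with generator $N^3\mathcal{L}_{N,0}+N\mathcal{L}_{N,b}$; $\tilde{\mathbb{P}}_{\mu}$ is its law when $\zeta_0\sim\mu$ (so $\tilde{\mathbb{P}}_{\delta_{\eta}}$ is the law started from $\eta$). The empirical measure is $\pi^N(\eta)=\frac1N\sum_{x=1}^{N-1}\eta(x)\delta_{x/N}$, $\pi_t^N=\pi^N(\zeta_t)$, and the total mass is $\widehat m(\pi)=\pi([0,1])$, so $\widehat m(\pi^N(\eta))=\frac1N\sum_{x=1}^{N-1}\eta(x)$. $\mathcal{D}^T_{[0,1]}$ is the set of right-continuous functions with left limits $a:[0,T]\to[0,1]$, with the Skorohod topology. For real-valued $G\in C^1([0,T])$ and $a\in\mathcal{D}^T_{[0,1]}$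 set $$J_{T,G}(a)=a_TG_T-a_0G_0-\int_0^Ta_s\,\partial_sG_s\,ds-\int_0^T\big[2\gamma(1-a_s)(e^{G_s}-1)+2(1-\gamma)a_s(e^{-G_s}-1)\big]ds.$$ Let $I_T(a)=\sup_{G\in C^1([0,T])}J_{T,G}(a)$, and for $m\in[0,1]$ let $I_T(a|m)=I_T(a)$ if $a(0)=m$ and $I_T(a|m)=+\infty$ otherwise. *)

theory Defs
  imports "HOL-Probability.Probability"
begin

section \<open>Cadlag paths and the Skorohod space\<close>

definition cadlag_on :: "real \<Rightarrow> (real \<Rightarrow> 'a::topological_space) \<Rightarrow> bool" where
  "cadlag_on T a \<longleftrightarrow>
     (\<forall>t\<in>{0..<T}. (a \<longlongrightarrow> a t) (at_right t)) \<and>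
     (\<forall>t\<in>{0<..T}. \<exists>l. (a \<longlongrightarrow> l) (at_left t))"

text \<open>Paths on \<open>[0,T]\<close> are represented by functions that are \<open>undefined\<close> outside \<open>[0,T]\<close>.\<close>

definition skorohod_paths :: "real \<Rightarrow> (real \<Rightarrow> real) set" where
  "skorohod_paths T = {a \<in> {0..T} \<rightarrow>\<^sub>E {0..1}. cadlag_on T a}"

text \<open>Increasing bijections of \<open>[0,T]\<close> onto itself; these are automatically homeomorphisms.\<close>

definition time_changes :: "real \<Rightarrow> (real \<Rightarrow> real) set" where
  "time_changes T = {l. strict_mono_on {0..T} l \<and> l ` {0..T} = {0..T}}"

definition skorohod_close :: "real \<Rightarrow> (real \<Rightarrow> real) \<Rightarrow> (real \<Rightarrow> real) \<Rightarrow> real \<Rightarrow> bool" where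
  "skorohod_close T a b r \<longleftrightarrow>
     0 \<le> r \<and> (\<exists>l\<in>time_changes T. \<forall>t\<in>{0..T}. \<bar>l t - t\<bar> \<le> r \<and> \<bar>a t - b (l t)\<bar> \<le> r)"

text \<open>The value \<open>0\<close> for functions that are not paths is a dummy; it only serves to make the
  function non-negative and symmetric everywhere, as the locale \<open>Metric_space\<close> requires.\<close>

definition skorohod_dist :: "real \<Rightarrow> (real \<Rightarrow> real) \<Rightarrow> (real \<Rightarrow> real) \<Rightarrow> real" where
  "skorohod_dist T a b =
     (if a \<in> skorohod_paths T \<and> b \<in> skorohod_paths T then Inf {r. skorohod_close T a b r} else 0)"

definition skorohod_topology :: "real \<Rightarrow> (real \<Rightarrow> real) topology" where
  "skorohod_topology T = Metric_space.mtopology (skorohod_paths T) (skorohod_dist T)"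

lemma id_time_change: "(\<lambda>t. t) \<in> time_changes T"
  by (auto simp: time_changes_def strict_mono_on_def)

lemma comp_time_change:
  assumes "l \<in> time_changes T" "k \<in> time_changes T"
  shows "(\<lambda>t. k (l t)) \<in> time_changes T"
proof -
  have "(\<lambda>t. k (l t)) ` {0..T} = k ` (l ` {0..T})" by auto
  moreover have "l t \<in> {0..T}" if "t \<in> {0..T}" for t
    using assms(1) that by (auto simp: time_changes_def)
  ultimately show ?thesis
    using assms by (simp add: time_changes_def strict_mono_on_def)
qed

lemma inv_time_change:
  assumes "l \<in> time_changes T"
  obtains k where "k \<in> time_changes T" "\<And>t. t \<in> {0..T} \<Longrightarrow> k t \<in> {0..T} \<and> l (k t) = t"
proof
  let ?k = "inv_into {0..T} l"
  have mono: "strict_mono_on {0..T} l" and im: "l ` {0..T} = {0..T}"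
    using assms by (auto simp: time_changes_def)
  have inj: "inj_on l {0..T}" using mono by (rule strict_mono_on_imp_inj_on)
  show *: "?k t \<in> {0..T} \<and> l (?k t) = t" if "t \<in> {0..T}" for t
    using that im by (metis f_inv_into_f inv_into_into)
  have "?k s < ?k t" if "s \<in> {0..T}" "t \<in> {0..T}" "s < t" for s t
  proof (rule ccontr)
    assume "\<not> ?k s < ?k t"
    then have "?k t = ?k s \<or> ?k t < ?k s" by linarith
    then have "l (?k t) \<le> l (?k s)"
      using mono * that unfolding strict_mono_on_def by (metis order.refl less_imp_le)
    then show False using * that by force
  qed
  moreover have "?k ` {0..T} = {0..T}"
    using inv_into_image_cancel[OF inj, of "{0..T}"] im by simp
  ultimately show "?k \<in> time_changes T"
    by (simp add: time_changes_def strict_mono_on_def)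
qed

lemma skorohod_closeI:
  assumes "0 \<le> r" "l \<in> time_changes T"
    and "\<And>t. t \<in> {0..T} \<Longrightarrow> \<bar>l t - t\<bar> \<le> r \<and> \<bar>a t - b (l t)\<bar> \<le> r"
  shows "skorohod_close T a b r"
  unfolding skorohod_close_def using assms by blast

lemma skorohod_close_sym:
  assumes "skorohod_close T a b r" shows "skorohod_close T b a r"
proof -
  from assms obtain l where r: "0 \<le> r" and l: "l \<in> time_changes T"
    and c: "\<And>t. t \<in> {0..T} \<Longrightarrow> \<bar>l t - t\<bar> \<le> r \<and> \<bar>a t - b (l t)\<bar> \<le> r"
    by (auto simp: skorohod_close_def)
  from inv_time_change[OF l] obtain k where k: "k \<in> time_changes T"
    "\<And>t. t \<in> {0..T} \<Longrightarrow> k t \<in> {0..T} \<and> l (k t) = t" by blast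
  have "\<bar>k t - t\<bar> \<le> r \<and> \<bar>b t - a (k t)\<bar> \<le> r" if "t \<in> {0..T}" for t
    using c[of "k t"] k(2)[OF that] by (auto simp: abs_minus_commute)
  then show ?thesis using r k by (intro skorohod_closeI[of r k])
qed

lemma skorohod_close_trans:
  assumes "skorohod_close T a b r" "skorohod_close T b c s"
  shows "skorohod_close T a c (r + s)"
proof -
  from assms(1) obtain l where r: "0 \<le> r" and l: "l \<in> time_changes T"
    and lc: "\<And>t. t \<in> {0..T} \<Longrightarrow> \<bar>l t - t\<bar> \<le> r \<and> \<bar>a t - b (l t)\<bar> \<le> r"
    by (auto simp: skorohod_close_def)
  from assms(2) obtain k where s: "0 \<le> s" and k: "k \<in> time_changes T"
    and kc: "\<And>t. t \<in> {0..T} \<Longrightarrow> \<bar>k t - t\<bar> \<le> s \<and> \<bar>b t - c (k t)\<bar> \<le> s"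
    by (auto simp: skorohod_close_def)
  have "\<bar>k (l t) - t\<bar> \<le> r + s \<and> \<bar>a t - c (k (l t))\<bar> \<le> r + s" if t: "t \<in> {0..T}" for t
  proof -
    have "l t \<in> {0..T}" using l t by (auto simp: time_changes_def)
    from lc[OF t] kc[OF this] show ?thesis by linarith
  qed
  then show ?thesis
    using r s comp_time_change[OF l k] by (intro skorohod_closeI[of _ "\<lambda>t. k (l t)"]) auto
qed

lemma skorohod_close_one:
  assumes "a \<in> skorohod_paths T" "b \<in> skorohod_paths T"
  shows "skorohod_close T a b 1"
proof -
  have "\<bar>a t - b t\<bar> \<le> 1" if "t \<in> {0..T}" for t
  proof -
    have "a t \<in> {0..1}" "b t \<in> {0..1}"
      using assms that by (auto simp: skorohod_paths_def PiE_def Pi_def)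
    then show ?thesis by auto
  qed
  then show ?thesis
    using id_time_change by (intro skorohod_closeI[of _ "\<lambda>t. t"]) auto
qed

lemma skorohod_dist_nonneg: "0 \<le> skorohod_dist T a b"
  unfolding skorohod_dist_def
  by (auto intro!: cInf_greatest dest: skorohod_close_one simp: skorohod_close_def[of T a b])

lemma skorohod_dist_le:
  assumes "a \<in> skorohod_paths T" "b \<in> skorohod_paths T" "skorohod_close T a b r"
  shows "skorohod_dist T a b \<le> r"
proof -
  have "bdd_below {r. skorohod_close T a b r}"
    by (rule bdd_belowI[of _ 0]) (simp add: skorohod_close_def)
  then show ?thesis using assms by (auto simp: skorohod_dist_def intro: cInf_lower)
qed

lemma skorohod_dist_lessD:
  assumes "a \<in> skorohod_paths T" "b \<in> skorohod_paths T" "skorohod_dist T a b < e"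
  obtains r where "skorohod_close T a b r" "r < e"
  using assms skorohod_close_one[OF assms(1,2)] cInf_lessD[of "{r. skorohod_close T a b r}" e]
  by (auto simp: skorohod_dist_def)

lemma skorohod_dist_zeroD:
  assumes a: "a \<in> skorohod_paths T" and b: "b \<in> skorohod_paths T"
    and z: "skorohod_dist T a b = 0"
  shows "a = b"
proof (rule PiE_ext)
  show "a \<in> {0..T} \<rightarrow>\<^sub>E {0..1}" "b \<in> {0..T} \<rightarrow>\<^sub>E {0..1}"
    using a b by (auto simp: skorohod_paths_def)
  fix t assume t: "t \<in> {0..T}"
  have "\<bar>a t - b t\<bar> \<le> e" if e: "0 < e" for e
  proof (cases "t = T")
    case True
    obtain r where r: "skorohod_close T a b r" "r < e"
      using skorohod_dist_lessD[OF a b, of e] z e by auto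
    then obtain l where l: "l \<in> time_changes T" and lc: "\<bar>a t - b (l t)\<bar> \<le> r"
      using t by (auto simp: skorohod_close_def)
    have "l T = T"
    proof -
      have "T \<in> l ` {0..T}" using l t by (auto simp: time_changes_def)
      then obtain u where u: "u \<in> {0..T}" "l u = T" by auto
      have "l T \<in> {0..T}" using l t True by (auto simp: time_changes_def)
      moreover have "u = T \<or> l u < l T"
        using u t l True unfolding time_changes_def strict_mono_on_def
        by (metis (mono_tags, lifting) atLeastAtMost_iff less_eq_real_def mem_Collect_eq)
      ultimately show ?thesis using u by auto
    qed
    then show ?thesis using lc r True by auto
  next
    case False
    then have t': "t \<in> {0..<T}" using t by auto
    then have "(a \<longlongrightarrow> a t) (at_right t)" "(b \<longlongrightarrow> b t) (at_right t)"
      using a b by (auto simp: skorohod_paths_def cadlag_on_def)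
    then have "eventually (\<lambda>s. dist (a s) (a t) < e/3 \<and> dist (b s) (b t) < e/3) (at_right t)"
      using e by (intro eventually_conj tendstoD) auto
    then obtain c where c: "c > t"
      "\<And>s. t < s \<Longrightarrow> s < c \<Longrightarrow> \<bar>a s - a t\<bar> < e/3 \<and> \<bar>b s - b t\<bar> < e/3"
      by (auto simp: eventually_at_right_field dist_real_def)
    define d where "d = (min c T - t) / 2"
    have d: "0 < d" "t + 2 * d \<le> c" "t + 2 * d \<le> T"
    proof -
      have "2 * d = min c T - t" by (simp add: d_def)
      then show "0 < d" "t + 2 * d \<le> c" "t + 2 * d \<le> T" using c(1) t' by auto
    qed
    obtain r where r: "skorohod_close T a b r" "r < min d (e/3)"
      using skorohod_dist_lessD[OF a b, of "min d (e/3)"] z e d by auto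
    moreover have "t + d \<in> {0..T}" using t d by auto
    ultimately obtain l where lc: "\<bar>l (t + d) - (t + d)\<bar> \<le> r" "\<bar>a (t + d) - b (l (t + d))\<bar> \<le> r"
      unfolding skorohod_close_def by blast
    have "\<bar>a (t + d) - a t\<bar> < e/3" using c(2)[of "t + d"] d by auto
    moreover have "\<bar>b (l (t + d)) - b t\<bar> < e/3"
      using c(2)[of "l (t + d)"] d lc(1) r(2) by auto
    ultimately show ?thesis using lc(2) r(2) by linarith
  qed
  then have "\<bar>a t - b t\<bar> \<le> 0" by (rule field_le_epsilon) simp
  then show "a t = b t" by simp
qed

lemma Metric_space_skorohod: "Metric_space (skorohod_paths T) (skorohod_dist T)"
proof
  fix a b
  show "0 \<le> skorohod_dist T a b" by (rule skorohod_dist_nonneg)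
  have "skorohod_close T a b = skorohod_close T b a" using skorohod_close_sym by blast
  then show "skorohod_dist T a b = skorohod_dist T b a" by (auto simp: skorohod_dist_def)
next
  fix a b assume a: "a \<in> skorohod_paths T" and b: "b \<in> skorohod_paths T"
  have "skorohod_close T a a 0" using id_time_change by (auto simp: skorohod_close_def)
  then have "skorohod_dist T a a = 0"
    using skorohod_dist_le[OF a a] skorohod_dist_nonneg[of T a a] by fastforce
  then show "skorohod_dist T a b = 0 \<longleftrightarrow> a = b"
    using skorohod_dist_zeroD[OF a b] by auto
next
  fix a b c
  assume a: "a \<in> skorohod_paths T" and b: "b \<in> skorohod_paths T" and c: "c \<in> skorohod_paths T"
  have "skorohod_dist T a c \<le> skorohod_dist T a b + skorohod_dist T b c + e" if e: "0 < e" for e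
  proof -
    obtain r where r: "skorohod_close T a b r" "r < skorohod_dist T a b + e/2"
      using skorohod_dist_lessD[OF a b, of "skorohod_dist T a b + e/2"] e by auto
    obtain s where s: "skorohod_close T b c s" "s < skorohod_dist T b c + e/2"
      using skorohod_dist_lessD[OF b c, of "skorohod_dist T b c + e/2"] e by auto
    show ?thesis
      using skorohod_dist_le[OF a c skorohod_close_trans[OF r(1) s(1)]] r(2) s(2) by linarith
  qed
  then show "skorohod_dist T a c \<le> skorohod_dist T a b + skorohod_dist T b c"
    by (rule field_le_epsilon)
qed

lemma topspace_skorohod_topology [simp]: "topspace (skorohod_topology T) = skorohod_paths T"
  by (simp add: skorohod_topology_def Metric_space.topspace_mtopology[OF Metric_space_skorohod])


section \<open>Markov processes with a given generator\<close>

text \<open>The semigroup \<open>exp (t L)\<close> of an operator acting on functions on a finite state space.\<close>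

definition semigroup_of :: "(('s \<Rightarrow> real) \<Rightarrow> 's \<Rightarrow> real) \<Rightarrow> real \<Rightarrow> ('s \<Rightarrow> real) \<Rightarrow> 's \<Rightarrow> real" where
  "semigroup_of L t f x = (\<Sum>n. t ^ n / fact n * (L ^^ n) f x)"

definition transition_prob :: "(('s \<Rightarrow> real) \<Rightarrow> 's \<Rightarrow> real) \<Rightarrow> real \<Rightarrow> 's \<Rightarrow> 's \<Rightarrow> real" where
  "transition_prob L t x y = semigroup_of L t (indicator {y}) x"

text \<open>\<open>Z\<close> is a cadlag Markov process on \<open>[0,T]\<close> with finite state space \<open>S\<close>, initial
  distribution \<open>\<mu>\<close> and generator \<open>L\<close>, realised on the probability space \<open>M\<close>. The law of the
  process on path space is determined by the finite-dimensional distributions.\<close>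

definition markov_process ::
  "real \<Rightarrow> 's::topological_space set \<Rightarrow> (('s \<Rightarrow> real) \<Rightarrow> 's \<Rightarrow> real) \<Rightarrow> 's pmf \<Rightarrow>
   'w measure \<Rightarrow> (real \<Rightarrow> 'w \<Rightarrow> 's) \<Rightarrow> bool" where
  "markov_process T S L \<mu> M Z \<longleftrightarrow>
     prob_space M \<and>
     (\<forall>t\<in>{0..T}. Z t \<in> measurable M (count_space S)) \<and>
     (\<forall>\<omega>\<in>space M. cadlag_on T (\<lambda>t. Z t \<omega>)) \<and>
     (\<forall>k t x. t 0 = 0 \<and> (\<forall>i<k. t i \<le> t (Suc i)) \<and> t k \<le> T \<and> (\<forall>i\<le>k. x i \<in> S) \<longrightarrow>
        measure M {\<omega> \<in> space M. \<forall>i\<le>k. Z (t i) \<omega> = x i} =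
        pmf \<mu> (x 0) * (\<Prod>i<k. transition_prob L (t (Suc i) - t i) (x i) (x (Suc i))))"


section \<open>The boundary driven exclusion process\<close>

text \<open>A configuration has value \<open>undefined\<close> outside \<open>{1..N - 1}\<close>. On this finite set of functions
  the product topology of type \<open>nat \<Rightarrow> nat\<close> is the discrete one.\<close>

definition configs :: "nat \<Rightarrow> (nat \<Rightarrow> nat) set" where
  "configs N = {1..N - 1} \<rightarrow>\<^sub>E {0, 1}"

definition swap :: "nat \<Rightarrow> nat \<Rightarrow> (nat \<Rightarrow> nat) \<Rightarrow> nat \<Rightarrow> nat" where
  "swap x y \<eta> = \<eta>(x := \<eta> y, y := \<eta> x)"

definition flip :: "nat \<Rightarrow> (nat \<Rightarrow> nat) \<Rightarrow> nat \<Rightarrow> nat" where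
  "flip x \<eta> = \<eta>(x := 1 - \<eta> x)"

definition bulk_gen :: "nat \<Rightarrow> ((nat \<Rightarrow> nat) \<Rightarrow> real) \<Rightarrow> (nat \<Rightarrow> nat) \<Rightarrow> real" where
  "bulk_gen N f \<eta> = (\<Sum>x = 1..N - 2. f (swap x (x + 1) \<eta>) - f \<eta>)"

definition boundary_rate :: "real \<Rightarrow> real \<Rightarrow> nat \<Rightarrow> real" where
  "boundary_rate \<alpha> \<beta> x = (if x = 1 then \<alpha> else \<beta>)"

definition boundary_gen ::
  "real \<Rightarrow> real \<Rightarrow> nat \<Rightarrow> ((nat \<Rightarrow> nat) \<Rightarrow> real) \<Rightarrow> (nat \<Rightarrow> nat) \<Rightarrow> real" where
  "boundary_gen \<alpha> \<beta> N f \<eta> =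
     (\<Sum>x\<in>{1, N - 1}.
        (boundary_rate \<alpha> \<beta> x * (1 - real (\<eta> x)) + (1 - boundary_rate \<alpha> \<beta> x) * real (\<eta> x)) *
        (f (flip x \<eta>) - f \<eta>))"

definition accelerated_gen ::
  "real \<Rightarrow> real \<Rightarrow> nat \<Rightarrow> ((nat \<Rightarrow> nat) \<Rightarrow> real) \<Rightarrow> (nat \<Rightarrow> nat) \<Rightarrow> real" where
  "accelerated_gen \<alpha> \<beta> N f \<eta> = real N ^ 3 * bulk_gen N f \<eta> + real N * boundary_gen \<alpha> \<beta> N f \<eta>"

text \<open>The image under \<open>x \<mapsto> x / N\<close> of the measure with weight \<open>\<eta> x / N\<close> at \<open>x\<close>, that is,
  the sum over \<open>x\<close> of \<open>\<eta> x / N\<close> times the Dirac measure at \<open>x / N\<close>.\<close>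

definition empirical_measure :: "nat \<Rightarrow> (nat \<Rightarrow> nat) \<Rightarrow> real measure" where
  "empirical_measure N \<eta> =
     distr (point_measure {1..N - 1} (\<lambda>x. ennreal (real (\<eta> x) / real N))) borel
       (\<lambda>x. real x / real N)"

definition total_mass :: "real measure \<Rightarrow> real" where
  "total_mass \<pi> = measure \<pi> {0..1}"

lemma total_mass_empirical_measure:
  "total_mass (empirical_measure N \<eta>) = (\<Sum>x = 1..N - 1. real (\<eta> x)) / real N"
proof -
  have *: "(\<lambda>x. real x / real N) -` {0..1} \<inter> space (point_measure {1..N - 1}
    (\<lambda>x. ennreal (real (\<eta> x) / real N))) = {1..N - 1}"
    by (auto simp: space_point_measure divide_le_eq)
  show ?thesis
    unfolding total_mass_def empirical_measure_def
    by (subst measure_distr; (subst *)?)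
      (simp_all add: Sigma_Algebra.measure_def emeasure_point_measure_finite sum_ennreal
        sum_nonneg flip: sum_divide_distrib)
qed


section \<open>The rate functional\<close>

text \<open>Derivatives at the end points of \<open>[0,T]\<close> are one-sided.\<close>

definition C1_on :: "real \<Rightarrow> (real \<Rightarrow> real) set" where
  "C1_on T = {G. \<exists>G'. continuous_on {0..T} G' \<and>
     (\<forall>s\<in>{0..T}. (G has_vector_derivative G' s) (at s within {0..T}))}"

definition J_functional :: "real \<Rightarrow> real \<Rightarrow> (real \<Rightarrow> real) \<Rightarrow> (real \<Rightarrow> real) \<Rightarrow> real" where
  "J_functional T \<gamma> G a =
     a T * G T - a 0 * G 0
     - integral {0..T} (\<lambda>s. a s * vector_derivative G (at s within {0..T}))
     - integral {0..T} (\<lambda>s. 2 * \<gamma> * (1 - a s) * (exp (G s) - 1)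
                           + 2 * (1 - \<gamma>) * a s * (exp (- G s) - 1))"

definition rate_I :: "real \<Rightarrow> real \<Rightarrow> (real \<Rightarrow> real) \<Rightarrow> ereal" where
  "rate_I T \<gamma> a = (SUP G\<in>C1_on T. ereal (J_functional T \<gamma> G a))"

definition rate_I_from :: "real \<Rightarrow> real \<Rightarrow> real \<Rightarrow> (real \<Rightarrow> real) \<Rightarrow> ereal" where
  "rate_I_from T \<gamma> m a = (if a 0 = m then rate_I T \<gamma> a else \<infinity>)"

text \<open>Logarithm of a non-negative number with \<open>log 0 = -\<infinity>\<close> (whereas \<open>ln 0 = 0\<close>).\<close>

definition ext_log :: "real \<Rightarrow> ereal" where
  "ext_log p = (if p = 0 then -\<infinity> else ereal (ln p))"

text \<open>The mass path of one trajectory \<open>\<zeta>\<close> of the process.\<close>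

definition mass_path :: "real \<Rightarrow> nat \<Rightarrow> (real \<Rightarrow> nat \<Rightarrow> nat) \<Rightarrow> real \<Rightarrow> real" where
  "mass_path T N \<zeta> = (\<lambda>t\<in>{0..T}. total_mass (empirical_measure N (\<zeta> t)))"

end

theory Submission imports Defs "HOL-Complex_Analysis.Great_Picard"
begin

text \<open>A time-dependent linear observable of the configuration, corrected by a profile with
  linear gradient, yields an exponential martingale in which the boundary occupations are replaced
  by the mean occupation. Since the exclusion dynamics is sped up by \<open>N\<^sup>3\<close>, the correction is of
  order one and \<open>E[exp (N J\<^sub>G)]\<close> is bounded above and below uniformly in \<open>N\<close>, for every \<open>C\<^sup>1\<close>
  function \<open>G\<close>.

  The upper bound follows from these moments by compactness, using a maximal inequality for
  exponential tightness. For the lower bound one tilts by \<open>exp (N J\<^sub>G)\<close>: a path solving the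
  equation driven by the field \<open>G\<close> is the only one at which \<open>G\<close> is optimal, so that the
  upper bound, applied to the tilted measures, shows that they concentrate there. Paths of finite
  rate are continuous and are approximated by such driven paths by mixing in the relaxation
  path and averaging in time, operations under which the convex rate functional increases
  by arbitrarily little.\<close>

section \<open>Semigroups of jump generators\<close>

text \<open>The hypothesis gives finite-dimensional distributions and cadlag paths, so probabilistic
  estimates are made on time grids and passed to the limit. The martingale property is proved only
  up to the factors \<open>exp 1\<close> and \<open>exp (- 1)\<close>, which disappear after taking
  logarithms and dividing by \<open>N\<close>. The obstacle is that the generator, applied to the
  exponential of \<open>N p\<close> times the mass, sees the occupations of the two boundary sites,
  while the rate functional sees the mass alone. The correction has coefficients
  \<open>c x / N^2\<close> with gradients of order \<open>N^(-2)\<close>. Its first-order bulk term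
  has order \<open>N\<close> and trades the boundary occupations for the mean; its second-order term
  is at most of order \<open>N^3 * N * N^(-4)\<close>, hence bounded. No tilted process is
  constructed. The total weight is at least \<open>exp (- C)\<close>, and the weight away from the
  driven path is exponentially small, so a neighbourhood of that path carries at least half of
  \<open>exp (- C)\<close>. There the density is at most \<open>exp (N (K + 2 e))\<close>, where
  \<open>K\<close> bounds the rate, and dividing by it bounds the probability from below.\<close>

locale jump_generator =
  fixes S :: "'s set" and L :: "('s \<Rightarrow> real) \<Rightarrow> 's \<Rightarrow> real"
    and J :: "'j set" and rate :: "'j \<Rightarrow> 's \<Rightarrow> real" and target :: "'j \<Rightarrow> 's \<Rightarrow> 's"
  assumes finite_S: "finite S"
    and rate_nonneg: "\<And>j x. j \<in> J \<Longrightarrow> x \<in> S \<Longrightarrow> 0 \<le> rate j x"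
    and target_in: "\<And>j x. j \<in> J \<Longrightarrow> x \<in> S \<Longrightarrow> target j x \<in> S"
    and L_eq: "\<And>f x. x \<in> S \<Longrightarrow> L f x = (\<Sum>j\<in>J. rate j x * (f (target j x) - f x))"
begin

text \<open>Any number that dominates the total jump rate at every state would serve; summing over
  all states gives one without taking a maximum.\<close>

definition rate_bound :: real where
  "rate_bound = (\<Sum>x\<in>S. \<Sum>j\<in>J. rate j x)"

lemma rate_bound_nonneg: "0 \<le> rate_bound"
  unfolding rate_bound_def by (intro sum_nonneg) (auto simp: rate_nonneg)

lemma total_rate_le: "x \<in> S \<Longrightarrow> (\<Sum>j\<in>J. rate j x) \<le> rate_bound"
  unfolding rate_bound_def
  by (rule member_le_sum) (auto intro!: sum_nonneg simp: rate_nonneg finite_S)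

lemma L_cong: "(\<And>y. y \<in> S \<Longrightarrow> f y = g y) \<Longrightarrow> x \<in> S \<Longrightarrow> L f x = L g x"
  by (simp add: L_eq target_in cong: sum.cong)

lemma L_abs_le:
  assumes f: "\<And>y. y \<in> S \<Longrightarrow> \<bar>f y\<bar> \<le> K" and x: "x \<in> S"
  shows "\<bar>L f x\<bar> \<le> 2 * rate_bound * K"
proof -
  have K: "0 \<le> K" using f[OF x] by linarith
  have "\<bar>L f x\<bar> \<le> (\<Sum>j\<in>J. \<bar>rate j x * (f (target j x) - f x)\<bar>)"
    unfolding L_eq[OF x] by (rule sum_abs)
  also have "\<dots> \<le> (\<Sum>j\<in>J. rate j x * (2 * K))"
  proof (rule sum_mono)
    fix j assume j: "j \<in> J"
    have "\<bar>f (target j x) - f x\<bar> \<le> 2 * K" using f[OF x] f[OF target_in[OF j x]] by linarith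
    then show "\<bar>rate j x * (f (target j x) - f x)\<bar> \<le> rate j x * (2 * K)"
      using rate_nonneg[OF j x] by (simp add: abs_mult mult_left_mono)
  qed
  also have "\<dots> = (\<Sum>j\<in>J. rate j x) * (2 * K)" by (simp add: sum_distrib_right)
  also have "\<dots> \<le> rate_bound * (2 * K)"
    using total_rate_le[OF x] K by (intro mult_right_mono) auto
  finally show ?thesis by simp
qed

lemma L_sum:
  assumes "x \<in> S"
  shows "L (\<lambda>y. \<Sum>i\<in>A. c i * g i y) x = (\<Sum>i\<in>A. c i * L (g i) x)"
proof -
  have "L (\<lambda>y. \<Sum>i\<in>A. c i * g i y) x
      = (\<Sum>j\<in>J. \<Sum>i\<in>A. c i * (rate j x * (g i (target j x) - g i x)))"
    unfolding L_eq[OF assms]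
    by (intro sum.cong refl) (simp add: sum_subtractf[symmetric] sum_distrib_left algebra_simps)
  also have "\<dots> = (\<Sum>i\<in>A. c i * L (g i) x)"
    unfolding L_eq[OF assms] by (subst sum.swap) (simp add: sum_distrib_left)
  finally show ?thesis .
qed

lemma iter_cong: "(\<And>y. y \<in> S \<Longrightarrow> f y = g y) \<Longrightarrow> x \<in> S \<Longrightarrow> (L ^^ n) f x = (L ^^ n) g x"
  by (induction n arbitrary: x) (auto intro: L_cong)

lemma iter_abs_le:
  assumes f: "\<And>y. y \<in> S \<Longrightarrow> \<bar>f y\<bar> \<le> K"
  shows "x \<in> S \<Longrightarrow> \<bar>(L ^^ n) f x\<bar> \<le> (2 * rate_bound) ^ n * K"
proof (induction n arbitrary: x)
  case (Suc n)
  show ?case using L_abs_le[OF Suc.IH Suc.prems] by (simp add: mult.assoc)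
qed (use f in simp)

lemma iter_sum: "x \<in> S \<Longrightarrow> (L ^^ n) (\<lambda>y. \<Sum>i\<in>A. c i * g i y) x = (\<Sum>i\<in>A. c i * (L ^^ n) (g i) x)"
proof (induction n arbitrary: x)
  case (Suc n)
  have "(L ^^ Suc n) (\<lambda>y. \<Sum>i\<in>A. c i * g i y) x = L (\<lambda>y. \<Sum>i\<in>A. c i * (L ^^ n) (g i) y) x"
    using Suc by (auto intro: L_cong)
  then show ?case using L_sum[OF Suc.prems, where g = "\<lambda>i. (L ^^ n) (g i)"] by simp
qed simp

lemma bounded_on_S: obtains K where "0 \<le> K" "\<And>y. y \<in> S \<Longrightarrow> \<bar>f y :: real\<bar> \<le> K"
proof
  show "0 \<le> (\<Sum>y\<in>S. \<bar>f y\<bar>)" by (simp add: sum_nonneg)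
  show "\<And>y. y \<in> S \<Longrightarrow> \<bar>f y\<bar> \<le> (\<Sum>y\<in>S. \<bar>f y\<bar>)"
    using finite_S member_le_sum[of _ S "\<lambda>y. \<bar>f y\<bar>"] by auto
qed

lemma term_abs_le:
  assumes f: "\<And>y. y \<in> S \<Longrightarrow> \<bar>f y\<bar> \<le> K" and x: "x \<in> S" and t: "0 \<le> t"
  shows "\<bar>t ^ n / fact n * (L ^^ n) f x\<bar> \<le> K * ((t * (2 * rate_bound)) ^ n / fact n)"
proof -
  have "\<bar>t ^ n / fact n * (L ^^ n) f x\<bar> = t ^ n / fact n * \<bar>(L ^^ n) f x\<bar>"
    using t by (simp add: abs_mult)
  also have "\<dots> \<le> t ^ n / fact n * ((2 * rate_bound) ^ n * K)"
    using iter_abs_le[OF f x] t by (intro mult_left_mono) auto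
  finally show ?thesis by (simp add: power_mult_distrib mult_ac)
qed

lemma exp_sums: "(\<lambda>n. K * ((c::real) ^ n / fact n)) sums (K * exp c)"
  using sums_mult[OF exp_converges[of c], of K] by (simp add: divide_inverse mult_ac)

lemma summable_terms:
  assumes x: "x \<in> S" and t: "0 \<le> t"
  shows "summable (\<lambda>n. t ^ n / fact n * (L ^^ n) f x)"
proof -
  obtain K where K: "\<And>y. y \<in> S \<Longrightarrow> \<bar>f y\<bar> \<le> K" using bounded_on_S[of f] by blast
  show ?thesis
    by (rule summable_comparison_test'[OF sums_summable[OF exp_sums[of K "t * (2 * rate_bound)"]], of 0])
       (use term_abs_le[OF K x t] in auto)
qed

lemma semigroup_cong:
  "(\<And>y. y \<in> S \<Longrightarrow> f y = g y) \<Longrightarrow> x \<in> S \<Longrightarrow> semigroup_of L t f x = semigroup_of L t g x"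
  unfolding semigroup_of_def using iter_cong[of f g x] by presburger

lemma semigroup_eq_sum:
  assumes x: "x \<in> S" and t: "0 \<le> t"
  shows "(\<Sum>y\<in>S. transition_prob L t x y * f y) = semigroup_of L t f x"
proof -
  have "semigroup_of L t f x = semigroup_of L t (\<lambda>z. \<Sum>y\<in>S. f y * indicator {y} z) x"
    by (rule semigroup_cong[OF _ x])
       (simp add: finite_S indicator_def sum.delta' if_distrib[of "(*) _"] cong: if_cong)
  also have "\<dots> = (\<Sum>n. \<Sum>y\<in>S. f y * (t ^ n / fact n * (L ^^ n) (indicator {y}) x))"
    unfolding semigroup_of_def by (simp add: iter_sum[OF x] sum_distrib_left mult_ac)
  also have "\<dots> = (\<Sum>y\<in>S. \<Sum>n. f y * (t ^ n / fact n * (L ^^ n) (indicator {y}) x))"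
    by (rule suminf_sum) (intro summable_mult summable_terms[OF x t])
  also have "\<dots> = (\<Sum>y\<in>S. transition_prob L t x y * f y)"
    unfolding transition_prob_def semigroup_of_def
    by (intro sum.cong refl) (simp only: suminf_mult[OF summable_terms[OF x t]] mult.commute)
  finally show ?thesis by simp
qed

text \<open>As \<open>t \<le> 1\<close>, every power from the second on is at most
  \<open>t^2\<close>, which comes out of the tail of the series. The rest is dominated by the
  exponential series at \<open>2 * rate_bound\<close>.\<close>

lemma semigroup_taylor:
  assumes f: "\<And>y. y \<in> S \<Longrightarrow> \<bar>f y\<bar> \<le> K" and x: "x \<in> S" and t: "0 \<le> t" "t \<le> 1"
  shows "\<bar>semigroup_of L t f x - (f x + t * L f x)\<bar> \<le> K * exp (2 * rate_bound) * t\<^sup>2"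
proof -
  define a where "a n = t ^ n / fact n * (L ^^ n) f x" for n
  have sa: "summable a" unfolding a_def by (rule summable_terms[OF x t(1)])
  have K: "0 \<le> K" using f[OF x] by linarith
  have "(\<Sum>n. a n) = (\<Sum>n. a (n + 2)) + (\<Sum>n<2. a n)"
    by (rule suminf_split_initial_segment[OF sa])
  moreover have "(\<Sum>n<2. a n) = f x + t * L f x"
    by (simp add: a_def numeral_2_eq_2)
  ultimately have "semigroup_of L t f x - (f x + t * L f x) = (\<Sum>n. a (n + 2))"
    unfolding semigroup_of_def a_def by linarith
  moreover have "\<bar>\<Sum>n. a (n + 2)\<bar> \<le> (\<Sum>n. \<bar>a (n + 2)\<bar>)"
  proof -
    have "summable (\<lambda>n. K * ((t * (2 * rate_bound)) ^ n / fact n))"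
      by (rule sums_summable[OF exp_sums])
    then have "summable (\<lambda>n. \<bar>a n\<bar>)"
      by (rule summable_comparison_test'[of _ 0]) (use term_abs_le[OF f x t(1)] in \<open>auto simp: a_def\<close>)
    then show ?thesis using summable_ignore_initial_segment[of "\<lambda>n. \<bar>a n\<bar>" 2]
      by (intro summable_rabs) auto
  qed
  moreover have "(\<Sum>n. \<bar>a (n + 2)\<bar>) \<le> t\<^sup>2 * (\<Sum>n. K * ((2 * rate_bound) ^ (n + 2) / fact (n + 2)))"
  proof -
    have s: "summable (\<lambda>n. K * ((2 * rate_bound) ^ (n + 2) / fact (n + 2)))"
      using summable_ignore_initial_segment[OF sums_summable[OF exp_sums[of K "2 * rate_bound"]], of 2]
      by simp
    have le: "\<bar>a (n + 2)\<bar> \<le> t\<^sup>2 * (K * ((2 * rate_bound) ^ (n + 2) / fact (n + 2)))" for n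
    proof -
      have "\<bar>a (n + 2)\<bar> \<le> K * ((t * (2 * rate_bound)) ^ (n + 2) / fact (n + 2))"
        unfolding a_def by (rule term_abs_le[OF f x t(1)])
      also have "\<dots> = t ^ (n + 2) * (K * ((2 * rate_bound) ^ (n + 2) / fact (n + 2)))"
        by (simp add: power_mult_distrib mult_ac)
      also have "\<dots> \<le> t\<^sup>2 * (K * ((2 * rate_bound) ^ (n + 2) / fact (n + 2)))"
        using t K rate_bound_nonneg by (intro mult_right_mono power_decreasing) auto
      finally show ?thesis .
    qed
    have "(\<Sum>n. \<bar>a (n + 2)\<bar>) \<le> (\<Sum>n. t\<^sup>2 * (K * ((2 * rate_bound) ^ (n + 2) / fact (n + 2))))"
      using le by (intro suminf_le summable_mult s summable_comparison_test'[OF summable_mult[OF s, of "t\<^sup>2"], of 0]) auto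
    then show ?thesis using suminf_mult[OF s, of "t\<^sup>2"] by simp
  qed
  moreover have "(\<Sum>n. K * ((2 * rate_bound) ^ (n + 2) / fact (n + 2))) \<le> K * exp (2 * rate_bound)"
  proof -
    have "K * exp (2 * rate_bound) = (\<Sum>n. K * ((2 * rate_bound) ^ n / fact n))"
      using exp_sums sums_unique by blast
    also have "\<dots> = (\<Sum>n. K * ((2 * rate_bound) ^ (n + 2) / fact (n + 2)))
        + (\<Sum>n<2. K * ((2 * rate_bound) ^ n / fact n))"
      by (rule suminf_split_initial_segment[OF sums_summable[OF exp_sums]])
    moreover have "0 \<le> (\<Sum>n<2. K * ((2 * rate_bound) ^ n / fact n))"
      using K rate_bound_nonneg by (intro sum_nonneg) auto
    ultimately show ?thesis by linarith
  qed
  ultimately show ?thesis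
    using mult_left_mono[of "\<Sum>n. K * ((2 * rate_bound) ^ (n + 2) / fact (n + 2))"
      "K * exp (2 * rate_bound)" "t\<^sup>2"] by (simp add: mult_ac)
qed

section \<open>Positivity and growth of the semigroup by uniformisation\<close>

definition Q :: "('s \<Rightarrow> real) \<Rightarrow> 's \<Rightarrow> real" where
  "Q f x = L f x + rate_bound * f x"

text \<open>The diagonal coefficient of \<open>Q\<close> is \<open>rate_bound\<close> minus the
  total rate, which is nonnegative. Thus all coefficients of \<open>Q\<close> are nonnegative, and
  so are the terms of its exponential series on nonnegative functions, although those of
  \<open>L\<close> may have either sign.\<close>

lemma Q_nonneg:
  assumes "\<And>y. y \<in> S \<Longrightarrow> 0 \<le> f y" "x \<in> S"
  shows "0 \<le> Q f x"
proof -
  have "Q f x = (\<Sum>j\<in>J. rate j x * f (target j x)) + (rate_bound - (\<Sum>j\<in>J. rate j x)) * f x"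
    unfolding Q_def L_eq[OF assms(2)]
    by (simp add: algebra_simps sum_subtractf sum_distrib_left)
  then show ?thesis
    using assms total_rate_le[OF assms(2)]
    by (auto intro!: add_nonneg_nonneg sum_nonneg mult_nonneg_nonneg rate_nonneg target_in)
qed

lemma iter_Q_nonneg:
  assumes "\<And>y. y \<in> S \<Longrightarrow> 0 \<le> f y"
  shows "x \<in> S \<Longrightarrow> 0 \<le> (Q ^^ n) f x"
  by (induction n arbitrary: x) (auto intro: Q_nonneg assms)

lemma Q_mono:
  assumes "\<And>y. y \<in> S \<Longrightarrow> f y \<le> g y" "x \<in> S"
  shows "Q f x \<le> Q g x"
proof -
  have "0 \<le> Q (\<lambda>y. g y - f y) x" using assms by (intro Q_nonneg) auto
  also have "\<dots> = Q g x - Q f x"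
    unfolding Q_def L_eq[OF assms(2)] by (simp add: algebra_simps sum_subtractf sum.distrib)
  finally show ?thesis by simp
qed

lemma iter_Q_le:
  assumes f: "\<And>y. y \<in> S \<Longrightarrow> 0 \<le> f y" and Lf: "\<And>y. y \<in> S \<Longrightarrow> L f y \<le> c * f y" and c: "0 \<le> c"
  shows "x \<in> S \<Longrightarrow> (Q ^^ n) f x \<le> (c + rate_bound) ^ n * f x"
proof (induction n arbitrary: x)
  case (Suc n)
  have "(Q ^^ Suc n) f x \<le> Q (\<lambda>y. (c + rate_bound) ^ n * f y) x"
    using Suc by (auto intro: Q_mono)
  also have "\<dots> = (c + rate_bound) ^ n * Q f x"
    unfolding Q_def L_eq[OF Suc.prems] by (simp add: algebra_simps sum_distrib_left)
  also have "\<dots> \<le> (c + rate_bound) ^ n * ((c + rate_bound) * f x)"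
    using Lf[OF Suc.prems] c rate_bound_nonneg
    by (intro mult_left_mono) (auto simp: Q_def algebra_simps)
  finally show ?case by (simp add: mult_ac)
qed simp

text \<open>\<open>exp (t L) = exp (- t c) exp (t Q)\<close> with \<open>Q = L + c\<close>, in terms of power series coefficients.\<close>

lemma iter_shift:
  "x \<in> S \<Longrightarrow> (L ^^ n) f x / fact n =
     (\<Sum>k\<le>n. (Q ^^ k) f x / fact k * ((- rate_bound) ^ (n - k) / fact (n - k)))"
proof (induction n arbitrary: x)
  case (Suc n)
  define b where "b k = (Q ^^ k) f x / fact k" for k
  define e where "e k = (- rate_bound) ^ k / fact k" for k :: nat
  have b: "real (Suc k) * b (Suc k) = Q ((Q ^^ k) f) x / fact k" for k
    by (simp add: b_def divide_simps)
  have e: "real (Suc k) * e (Suc k) = - rate_bound * e k" for k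
    by (simp add: e_def divide_simps)
  have IH: "(L ^^ n) f y = (\<Sum>k\<le>n. fact n * e (n - k) / fact k * (Q ^^ k) f y)" if "y \<in> S" for y
  proof -
    have "(L ^^ n) f y = fact n * ((L ^^ n) f y / fact n)" by simp
    also have "\<dots> = (\<Sum>k\<le>n. fact n * ((Q ^^ k) f y / fact k * e (n - k)))"
      unfolding Suc.IH[OF that] e_def by (rule sum_distrib_left)
    finally show ?thesis by (simp add: mult_ac)
  qed
  have "(L ^^ Suc n) f x = L (\<lambda>y. \<Sum>k\<le>n. fact n * e (n - k) / fact k * (Q ^^ k) f y) x"
    using IH Suc.prems by (auto intro: L_cong)
  also have "\<dots> = (\<Sum>k\<le>n. fact n * e (n - k) / fact k * L ((Q ^^ k) f) x)"
    by (rule L_sum[OF Suc.prems])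
  also have "\<dots> = (\<Sum>k\<le>n. fact n * (real (Suc k) * b (Suc k) * e (n - k) - rate_bound * b k * e (n - k)))"
  proof (intro sum.cong refl)
    fix k
    have "L ((Q ^^ k) f) x = Q ((Q ^^ k) f) x - rate_bound * (Q ^^ k) f x" by (simp add: Q_def)
    also have "\<dots> = fact k * (real (Suc k) * b (Suc k)) - rate_bound * (fact k * b k)"
      unfolding b by (simp add: b_def)
    finally show "fact n * e (n - k) / fact k * L ((Q ^^ k) f) x =
        fact n * (real (Suc k) * b (Suc k) * e (n - k) - rate_bound * b k * e (n - k))"
      by (simp add: right_diff_distrib mult_ac del: of_nat_Suc)
  qed
  finally have 1: "(L ^^ Suc n) f x / fact n =
      (\<Sum>k\<le>n. real (Suc k) * b (Suc k) * e (n - k) - rate_bound * b k * e (n - k))"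
    by (simp only: sum_distrib_left[symmetric]) simp
  \<comment> \<open>Writing \<open>n + 1\<close> as \<open>k + (n + 1 - k)\<close> splits the
    convolution in two. The recursions for \<open>b\<close> and \<open>e\<close> turn the first sum
    into the \<open>Q\<close> part and the second into the \<open>- rate_bound\<close> part of one
    more application of \<open>L\<close>.\<close>
  have "real (Suc n) * (\<Sum>k\<le>Suc n. b k * e (Suc n - k))
      = (\<Sum>k\<le>Suc n. real k * b k * e (Suc n - k)) + (\<Sum>k\<le>Suc n. real (Suc n - k) * b k * e (Suc n - k))"
    unfolding sum.distrib[symmetric] sum_distrib_left
    by (intro sum.cong refl) (simp add: of_nat_diff algebra_simps)
  also have "(\<Sum>k\<le>Suc n. real k * b k * e (Suc n - k)) = (\<Sum>k\<le>n. real (Suc k) * b (Suc k) * e (n - k))"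
    by (subst sum.atMost_Suc_shift) simp
  also have "(\<Sum>k\<le>Suc n. real (Suc n - k) * b k * e (Suc n - k)) = (\<Sum>k\<le>n. - rate_bound * b k * e (n - k))"
  proof -
    have "(\<Sum>k\<le>Suc n. real (Suc n - k) * b k * e (Suc n - k)) = (\<Sum>k\<le>n. real (Suc n - k) * b k * e (Suc n - k))"
      by simp
    also have "\<dots> = (\<Sum>k\<le>n. b k * (- rate_bound * e (n - k)))"
      by (intro sum.cong refl) (subst e[symmetric], simp add: Suc_diff_le)
    finally show ?thesis by (simp add: mult_ac)
  qed
  finally have "real (Suc n) * (\<Sum>k\<le>Suc n. b k * e (Suc n - k)) = (L ^^ Suc n) f x / fact n"
    unfolding 1 by (simp only: sum.distrib[symmetric]) simp
  moreover have "(L ^^ Suc n) f x / fact (Suc n) = (L ^^ Suc n) f x / fact n / real (Suc n)"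
    by (simp add: mult_ac del: funpow.simps)
  ultimately have "(L ^^ Suc n) f x / fact (Suc n) = (\<Sum>k\<le>Suc n. b k * e (Suc n - k))"
    by (metis nonzero_mult_div_cancel_left of_nat_eq_0_iff old.nat.distinct(2))
  then show ?case by (simp only: b_def e_def)
qed simp

lemma Q_abs_le:
  assumes f: "\<And>y. y \<in> S \<Longrightarrow> \<bar>f y\<bar> \<le> K" and x: "x \<in> S"
  shows "\<bar>Q f x\<bar> \<le> 3 * rate_bound * K"
proof -
  have "\<bar>Q f x\<bar> \<le> \<bar>L f x\<bar> + rate_bound * \<bar>f x\<bar>"
    unfolding Q_def using rate_bound_nonneg by (metis abs_mult abs_of_nonneg abs_triangle_ineq)
  then show ?thesis
    using L_abs_le[of f K x] f x mult_left_mono[OF f[OF x] rate_bound_nonneg]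
    by (auto simp: algebra_simps)
qed

lemma iter_Q_abs_le:
  assumes f: "\<And>y. y \<in> S \<Longrightarrow> \<bar>f y\<bar> \<le> K"
  shows "x \<in> S \<Longrightarrow> \<bar>(Q ^^ n) f x\<bar> \<le> (3 * rate_bound) ^ n * K"
proof (induction n arbitrary: x)
  case (Suc n)
  show ?case using Q_abs_le[OF Suc.IH Suc.prems] by (simp add: mult.assoc)
qed (use f in simp)

lemma summable_norm_Q_terms:
  assumes x: "x \<in> S" and t: "0 \<le> t"
  shows "summable (\<lambda>n. norm (t ^ n / fact n * (Q ^^ n) f x))"
proof -
  obtain K where K: "\<And>y. y \<in> S \<Longrightarrow> \<bar>f y\<bar> \<le> K" using bounded_on_S[of f] by blast
  have "norm (t ^ n / fact n * (Q ^^ n) f x) \<le> K * ((t * (3 * rate_bound)) ^ n / fact n)" for n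
  proof -
    have "norm (t ^ n / fact n * (Q ^^ n) f x) = t ^ n / fact n * \<bar>(Q ^^ n) f x\<bar>"
      using t by (simp add: abs_mult)
    also have "\<dots> \<le> t ^ n / fact n * ((3 * rate_bound) ^ n * K)"
      using iter_Q_abs_le[OF K x] t by (intro mult_left_mono) auto
    finally show ?thesis by (simp add: power_mult_distrib mult_ac)
  qed
  then show ?thesis
    by (intro summable_comparison_test'[OF sums_summable[OF exp_sums[of K "t * (3 * rate_bound)"]], of 0]) simp
qed

lemma semigroup_via_Q:
  assumes x: "x \<in> S" and t: "0 \<le> t"
  shows "semigroup_of L t f x = exp (- rate_bound * t) * (\<Sum>n. t ^ n / fact n * (Q ^^ n) f x)"
proof -
  define a where "a n = t ^ n / fact n * (Q ^^ n) f x" for n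
  define e where "e n = (- rate_bound * t) ^ n / fact n" for n :: nat
  have se: "e sums exp (- rate_bound * t)"
    using exp_sums[of 1 "- rate_bound * t"] unfolding e_def by simp
  have ne: "summable (\<lambda>n. norm (e n))"
  proof -
    have "(\<lambda>n. norm (e n)) = (\<lambda>n. 1 * ((rate_bound * t) ^ n / fact n))"
      using t rate_bound_nonneg by (auto simp: e_def power_abs abs_mult)
    then show ?thesis using sums_summable[OF exp_sums[of 1 "rate_bound * t"]] by simp
  qed
  have "(\<Sum>n. a n) * (\<Sum>n. e n) = (\<Sum>n. \<Sum>k\<le>n. a k * e (n - k))"
    by (rule Cauchy_product[OF _ ne]) (use summable_norm_Q_terms[OF x t] in \<open>simp add: a_def\<close>)
  also have "(\<lambda>n. \<Sum>k\<le>n. a k * e (n - k)) = (\<lambda>n. t ^ n / fact n * (L ^^ n) f x)"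
  proof
    fix n
    have "t ^ n / fact n * (L ^^ n) f x = t ^ n * ((L ^^ n) f x / fact n)" by simp
    also have "\<dots> = (\<Sum>k\<le>n. t ^ n * ((Q ^^ k) f x / fact k * ((- rate_bound) ^ (n - k) / fact (n - k))))"
      unfolding iter_shift[OF x] by (rule sum_distrib_left)
    also have "\<dots> = (\<Sum>k\<le>n. a k * e (n - k))"
    proof (intro sum.cong refl)
      fix k assume "k \<in> {..n}"
      then have "t ^ n = t ^ k * t ^ (n - k)" by (simp add: power_add[symmetric])
      then show "t ^ n * ((Q ^^ k) f x / fact k * ((- rate_bound) ^ (n - k) / fact (n - k))) = a k * e (n - k)"
        unfolding a_def e_def by (simp only: power_mult_distrib) (simp add: mult_ac)
    qed
    finally show "(\<Sum>k\<le>n. a k * e (n - k)) = t ^ n / fact n * (L ^^ n) f x" by simp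
  qed
  finally show ?thesis
    unfolding semigroup_of_def using sums_unique[OF se] by (simp add: a_def mult_ac)
qed

lemma semigroup_nonneg:
  assumes "\<And>y. y \<in> S \<Longrightarrow> 0 \<le> f y" "x \<in> S" "0 \<le> t"
  shows "0 \<le> semigroup_of L t f x"
  unfolding semigroup_via_Q[OF assms(2,3)]
  using assms by (intro mult_nonneg_nonneg suminf_nonneg summable_norm_cancel[OF summable_norm_Q_terms])
    (auto intro: iter_Q_nonneg)

lemma transition_prob_nonneg: "x \<in> S \<Longrightarrow> 0 \<le> t \<Longrightarrow> 0 \<le> transition_prob L t x y"
  unfolding transition_prob_def by (rule semigroup_nonneg) auto

text \<open>A Gronwall bound obtained from power series: \<open>Q f\<close> is at most
  \<open>(c + rate_bound) f\<close>, monotonicity of \<open>Q\<close> lets this iterate, and the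
  prefactor \<open>exp (- rate_bound * t)\<close> removes the contribution of the shift.\<close>

lemma semigroup_le_exp:
  assumes f: "\<And>y. y \<in> S \<Longrightarrow> 0 \<le> f y" and Lf: "\<And>y. y \<in> S \<Longrightarrow> L f y \<le> c * f y"
    and c: "0 \<le> c" and x: "x \<in> S" and t: "0 \<le> t"
  shows "semigroup_of L t f x \<le> exp (c * t) * f x"
proof -
  have "(\<Sum>n. t ^ n / fact n * (Q ^^ n) f x) \<le> (\<Sum>n. f x * (((c + rate_bound) * t) ^ n / fact n))"
  proof (intro suminf_le summable_norm_cancel[OF summable_norm_Q_terms[OF x t]] sums_summable[OF exp_sums])
    fix n
    have "t ^ n / fact n * (Q ^^ n) f x \<le> t ^ n / fact n * ((c + rate_bound) ^ n * f x)"
      using iter_Q_le[OF f Lf c x] t by (intro mult_left_mono) auto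
    then show "t ^ n / fact n * (Q ^^ n) f x \<le> f x * (((c + rate_bound) * t) ^ n / fact n)"
      by (simp add: power_mult_distrib mult_ac)
  qed
  also have "\<dots> = f x * exp ((c + rate_bound) * t)"
    using exp_sums sums_unique by metis
  finally have "semigroup_of L t f x \<le> exp (- rate_bound * t) * (f x * exp ((c + rate_bound) * t))"
    unfolding semigroup_via_Q[OF x t] by (intro mult_left_mono) auto
  also have "\<dots> = exp (c * t) * f x"
  proof -
    have "exp (- rate_bound * t) * exp ((c + rate_bound) * t) = exp (c * t)"
      by (simp add: mult_exp_exp algebra_simps)
    then show ?thesis by (simp add: mult.left_commute mult.commute[of "f x"])
  qed
  finally show ?thesis .
qed

end

section \<open>Riemann sums of right-continuous functions\<close>

text \<open>The sum is the integral of \<open>g\<close> composed with \<open>rho n\<close>, which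
  rounds up to the grid. Right end points are essential: \<open>rho n s\<close> approaches
  \<open>s\<close> from the right, where \<open>g\<close> is continuous, so the integrands converge
  pointwise and dominated convergence applies. At \<open>T\<close> rounding up changes
  nothing.\<close>

lemma right_continuous_riemann:
  fixes g :: "real \<Rightarrow> real"
  assumes T: "0 < T" and bd: "\<And>s. s \<in> {0..T} \<Longrightarrow> \<bar>g s\<bar> \<le> K"
    and rc: "\<And>s. s \<in> {0..<T} \<Longrightarrow> (g \<longlongrightarrow> g s) (at_right s)"
  shows right_continuous_integrable: "g integrable_on {0..T}"
    and "(\<lambda>n. \<Sum>i<Suc n. T / Suc n * g (Suc i * (T / Suc n))) \<longlonglongrightarrow> integral {0..T} g"
proof -
  define h where "h n = T / real (Suc n)" for n
  define rho where "rho n s = of_int \<lceil>s / h n\<rceil> * h n" for n s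
  have h: "0 < h n" "real (Suc n) * h n = T" for n using T by (auto simp: h_def field_simps)
  have rho: "s \<le> rho n s" "rho n s < s + h n" for n s
  proof -
    have "s / h n \<le> of_int \<lceil>s / h n\<rceil>" "of_int \<lceil>s / h n\<rceil> < s / h n + 1" by linarith+
    then have "s / h n * h n \<le> rho n s" "rho n s < (s / h n + 1) * h n"
      unfolding rho_def using h(1)[of n] by (simp_all only: mult_le_cancel_right_pos mult_less_cancel_right_pos)
    moreover have "s / h n * h n = s" "(s / h n + 1) * h n = s + h n"
      using h(1)[of n] by (simp_all add: field_simps)
    ultimately show "s \<le> rho n s" "rho n s < s + h n" by simp_all
  qed
  have rho_T: "rho n s \<le> T" if "s \<le> T" for n s
  proof -
    have "s / h n \<le> of_int (int (Suc n))" using that h[of n] by (simp add: field_simps)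
    then have "\<lceil>s / h n\<rceil> \<le> int (Suc n)" by (rule ceiling_le)
    then have "real_of_int \<lceil>s / h n\<rceil> \<le> real (Suc n)" by linarith
    then have "rho n s \<le> real (Suc n) * h n"
      unfolding rho_def using h(1)[of n] by (intro mult_right_mono) auto
    then show ?thesis using h(2) by simp
  qed
  have part: "((\<lambda>s. g (rho n s)) has_integral (\<Sum>i<k. h n * g (Suc i * h n))) {0..k * h n}" for n k
  proof (induction k)
    case (Suc k)
    have "((\<lambda>s. g (rho n s)) has_integral (h n * g (Suc k * h n))) (cbox (k * h n) (Suc k * h n))"
    proof (rule has_integral_spike_interior)
      show "((\<lambda>s. g (Suc k * h n)) has_integral (h n * g (Suc k * h n))) (cbox (k * h n) (Suc k * h n))"
        using has_integral_const_real[of "g (Suc k * h n)" "k * h n" "Suc k * h n"] h(1)[of n]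
        by (simp add: algebra_simps)
      fix s assume "s \<in> box (k * h n) (Suc k * h n)"
      then have "k * h n < s" "s < Suc k * h n" by auto
      then have "real_of_int (int k) < s / h n" "s / h n \<le> real_of_int (int (Suc k))"
        using h(1)[of n] by (auto simp: field_simps)
      then have "\<lceil>s / h n\<rceil> = int (Suc k)" by linarith
      then show "g (rho n s) = g (Suc k * h n)" by (simp add: rho_def)
    qed
    then show ?case
      using has_integral_combine[OF _ _ Suc, of "Suc k * h n"] h(1)[of n]
      by (auto simp: algebra_simps)
  next
    case 0
    then show ?case using has_integral_refl(1)[of "\<lambda>s. g (rho n s)" "0 :: real"] by simp
  qed
  have part_T: "((\<lambda>s. g (rho n s)) has_integral (\<Sum>i<Suc n. h n * g (Suc i * h n))) {0..T}" for n
    using part[of n "Suc n"] h(2)[of n] by (metis)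
  have lim: "(\<lambda>n. g (rho n s)) \<longlonglongrightarrow> g s" if s: "s \<in> {0..T}" for s
  proof (cases "s = T")
    case True
    have "rho n T = T" for n using rho(1)[of T n] rho_T[of T n] by simp
    then show ?thesis using True by simp
  next
    case False
    then have "(g \<longlongrightarrow> g s) (at_right s)" using s rc by auto
    then have at: "(g \<longlongrightarrow> g s) (at s within {s..})"
      unfolding tendsto_def eventually_at_topological
      by (metis (full_types) atLeast_iff greaterThan_iff order_le_less)
    have hl: "h \<longlonglongrightarrow> 0" unfolding h_def by (intro LIMSEQ_Suc lim_const_over_n)
    have "(\<lambda>n. rho n s) \<longlonglongrightarrow> s"
    proof (rule tendsto_sandwich[of "\<lambda>_. s" _ _ "\<lambda>n. s + h n"])
      show "(\<lambda>n. s + h n) \<longlonglongrightarrow> s" using tendsto_add[OF tendsto_const[of s] hl] by simp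
    qed (use rho less_imp_le[OF rho(2)] in \<open>auto intro!: always_eventually\<close>)
    \<comment> \<open>Cutting the argument at \<open>s\<close> turns right continuity of
      \<open>g\<close> into ordinary continuity, so that it can be composed with the sequence
      \<open>rho n s\<close>, which may also equal \<open>s\<close>.\<close>
    have "isCont (\<lambda>u. g (max s u)) s"
      unfolding isCont_def max.idem tendsto_def
    proof (intro allI impI)
      fix V assume V: "open V" "g s \<in> V"
      then have "eventually (\<lambda>u. g u \<in> V) (at_right s)"
        using \<open>(g \<longlongrightarrow> g s) (at_right s)\<close> by (auto simp: tendsto_def)
      then obtain b where "b > s" "\<And>u. s < u \<Longrightarrow> u < b \<Longrightarrow> g u \<in> V"
        by (auto simp: eventually_at_right_field)
      then show "\<forall>\<^sub>F u in at s. g (max s u) \<in> V"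
        unfolding eventually_at_topological using V
        by (intro exI[of _ "{..<b}"]) (auto simp: max_def)
    qed
    from isCont_tendsto_compose[OF this \<open>(\<lambda>n. rho n s) \<longlonglongrightarrow> s\<close>]
    show ?thesis using rho(1)[of s] by (simp add: max_def)
  qed
  have bd': "norm (g (rho n s)) \<le> K" if "s \<in> {0..T}" for n s
    using bd[of "rho n s"] rho(1)[of s n] rho_T[of s n] that by auto
  have i: "(\<lambda>s. g (rho n s)) integrable_on {0..T}" for n using part_T by blast
  have c: "(\<lambda>s. K) integrable_on {0..T}" by (rule integrable_const_ivl)
  show "g integrable_on {0..T}" by (rule dominated_convergence(1)[OF i c bd' lim])
  have "(\<lambda>n. integral {0..T} (\<lambda>s. g (rho n s))) \<longlonglongrightarrow> integral {0..T} g"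
    by (rule dominated_convergence(2)[OF i c bd' lim])
  moreover have "integral {0..T} (\<lambda>s. g (rho n s)) = (\<Sum>i<Suc n. h n * g (Suc i * h n))" for n
    by (rule integral_unique[OF part_T])
  ultimately show "(\<lambda>n. \<Sum>i<Suc n. T / Suc n * g (Suc i * (T / Suc n))) \<longlonglongrightarrow> integral {0..T} g"
    by (simp add: h_def)
qed

section \<open>Finite-state Markov processes\<close>

text \<open>\<open>discrete_S\<close> ties the topology of the state type to the finite set
  \<open>S\<close>: a right limit inside \<open>S\<close> is eventually attained, so trajectories
  are constant on a right neighbourhood of every time before \<open>T\<close>.\<close>

locale markov_chain = jump_generator S L J rate target
  for S :: "'s::topological_space set" and L :: "('s \<Rightarrow> real) \<Rightarrow> 's \<Rightarrow> real"
    and J :: "'j set" and rate :: "'j \<Rightarrow> 's \<Rightarrow> real" and target :: "'j \<Rightarrow> 's \<Rightarrow> 's" +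
  fixes T :: real and \<mu> :: "'s pmf" and M :: "'w measure" and Z :: "real \<Rightarrow> 'w \<Rightarrow> 's"
  assumes T_pos: "0 < T" and markov: "markov_process T S L \<mu> M Z"
    and discrete_S: "\<And>x. x \<in> S \<Longrightarrow> \<exists>U. open U \<and> x \<in> U \<and> U \<inter> S = {x}"
begin

sublocale prob_space M using markov by (simp add: markov_process_def)

lemma measurable_Z: "t \<in> {0..T} \<Longrightarrow> Z t \<in> measurable M (count_space S)"
  using markov by (simp add: markov_process_def)

lemma Z_in: "t \<in> {0..T} \<Longrightarrow> \<omega> \<in> space M \<Longrightarrow> Z t \<omega> \<in> S"
  using measurable_space[OF measurable_Z] by simp

lemma cadlag_Z: "\<omega> \<in> space M \<Longrightarrow> cadlag_on T (\<lambda>t. Z t \<omega>)"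
  using markov by (simp add: markov_process_def)

lemma fdd:
  assumes "t 0 = 0" "\<And>i. i < k \<Longrightarrow> t i \<le> t (Suc i)" "t k \<le> T" "\<And>i. i \<le> k \<Longrightarrow> x i \<in> S"
  shows "prob {\<omega> \<in> space M. \<forall>i\<le>k. Z (t i) \<omega> = x i} =
    pmf \<mu> (x 0) * (\<Prod>i<k. transition_prob L (t (Suc i) - t i) (x i) (x (Suc i)))"
  using markov assms unfolding markov_process_def by blast

lemma expectation_finite_valued:
  assumes X: "X \<in> measurable M (count_space A)" and A: "finite A"
  shows "expectation (\<lambda>\<omega>. h (X \<omega>)) = (\<Sum>a\<in>A. h a * prob {\<omega> \<in> space M. X \<omega> = a})"
proof -
  have ev: "{\<omega> \<in> space M. X \<omega> = a} \<in> events" for a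
  proof (cases "a \<in> A")
    case True
    then show ?thesis using measurable_sets[OF X, of "{a}"] by (simp add: vimage_def Int_def conj_commute)
  next
    case False
    then have e: "{\<omega> \<in> space M. X \<omega> = a} = {}" using measurable_space[OF X] by auto
    show ?thesis unfolding e by (rule sets.empty_sets)
  qed
  have "expectation (\<lambda>\<omega>. h (X \<omega>))
      = expectation (\<lambda>\<omega>. \<Sum>a\<in>A. h a * indicator {\<omega> \<in> space M. X \<omega> = a} \<omega>)"
  proof (rule Bochner_Integration.integral_cong[OF refl])
    fix \<omega> assume \<omega>: "\<omega> \<in> space M"
    then have "X \<omega> \<in> A" using measurable_space[OF X] by auto
    then show "h (X \<omega>) = (\<Sum>a\<in>A. h a * indicator {\<omega> \<in> space M. X \<omega> = a} \<omega>)"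
      using A \<omega> by (simp add: indicator_def if_distrib[of "(*) _"] sum.delta cong: if_cong)
  qed
  also have "\<dots> = (\<Sum>a\<in>A. h a * prob {\<omega> \<in> space M. X \<omega> = a})"
    using ev by (subst Bochner_Integration.integral_sum)
      (auto simp: emeasure_eq_measure intro!: integrable_mult_right integrable_real_indicator)
  finally show ?thesis .
qed



definition times :: "(nat \<Rightarrow> real) \<Rightarrow> nat \<Rightarrow> bool" where
  "times t k \<longleftrightarrow> t 0 = 0 \<and> (\<forall>i<k. t i \<le> t (Suc i)) \<and> t k \<le> T"

lemma times_mono: "times t k \<Longrightarrow> i \<le> j \<Longrightarrow> j \<le> k \<Longrightarrow> t i \<le> t j"
proof (induction j)
  case (Suc j)
  then show ?case
    by (cases "i = Suc j") (auto simp: times_def intro: order_trans[of _ "t j"])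
qed simp

lemma times_in: "times t k \<Longrightarrow> i \<le> k \<Longrightarrow> t i \<in> {0..T}"
  using times_mono[of t k 0 i] times_mono[of t k i k] by (auto simp: times_def)

lemma times_less: "times t (Suc k) \<Longrightarrow> times t k"
  by (auto simp: times_def)

text \<open>As a random variable with values in a finite set of restricted functions, the sampled
  history makes every functional of it measurable and integrable, and turns expectations into finite
  sums.\<close>

definition past :: "(nat \<Rightarrow> real) \<Rightarrow> nat \<Rightarrow> 'w \<Rightarrow> nat \<Rightarrow> 's" where
  "past t k \<omega> = (\<lambda>i\<in>{..k}. Z (t i) \<omega>)"

lemma past_apply [simp]: "i \<le> k \<Longrightarrow> past t k \<omega> i = Z (t i) \<omega>"
  by (simp add: past_def)

lemma event_past:
  assumes "times t k"
  shows "{\<omega> \<in> space M. \<forall>i\<le>k. Z (t i) \<omega> = x i} \<in> events"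
proof -
  have "{\<omega> \<in> space M. \<forall>i\<in>{..k}. Z (t i) \<omega> = x i} \<in> events"
  proof (rule sets.sets_Collect_finite_All)
    fix i assume i: "i \<in> {..k}"
    have m: "Z (t i) \<in> measurable M (count_space S)"
      using times_in[OF assms, of i] i by (intro measurable_Z) auto
    show "{\<omega> \<in> space M. Z (t i) \<omega> = x i} \<in> events"
    proof (cases "x i \<in> S")
      case True
      then show ?thesis using measurable_sets[OF m, of "{x i}"]
        by (simp add: vimage_def Int_def conj_commute)
    next
      case False
      have "Z (t i) \<omega> \<noteq> x i" if "\<omega> \<in> space M" for \<omega>
        using measurable_space[OF m that] False by (metis space_count_space)
      then have e: "{\<omega> \<in> space M. Z (t i) \<omega> = x i} = {}" by auto
      show ?thesis unfolding e by (rule sets.empty_sets)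
    qed
  qed simp
  then show ?thesis by (simp only: Ball_def atMost_iff)
qed

lemma past_eq_iff: "p \<in> {..k} \<rightarrow>\<^sub>E S \<Longrightarrow> past t k \<omega> = p \<longleftrightarrow> (\<forall>i\<le>k. Z (t i) \<omega> = p i)"
proof
  assume p: "p \<in> {..k} \<rightarrow>\<^sub>E S" and eq: "\<forall>i\<le>k. Z (t i) \<omega> = p i"
  show "past t k \<omega> = p"
  proof
    fix i show "past t k \<omega> i = p i"
      using eq PiE_arb[OF p, of i] by (cases "i \<le> k") (auto simp: past_def)
  qed
qed (metis past_apply)

lemma finite_paths: "finite ({..k::nat} \<rightarrow>\<^sub>E S)"
  by (intro finite_PiE finite_S) auto

lemma measurable_past:
  assumes "times t k"
  shows "past t k \<in> measurable M (count_space ({..k} \<rightarrow>\<^sub>E S))"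
proof (subst measurable_count_space_eq2[OF finite_paths], intro conjI ballI)
  show "past t k \<in> space M \<rightarrow> ({..k} \<rightarrow>\<^sub>E S)"
    using times_in[OF assms] Z_in by (auto simp: past_def)
  fix p assume p: "p \<in> {..k} \<rightarrow>\<^sub>E S"
  have "past t k -` {p} \<inter> space M = {\<omega> \<in> space M. \<forall>i\<le>k. Z (t i) \<omega> = p i}"
    using past_eq_iff[OF p] by auto
  then show "past t k -` {p} \<inter> space M \<in> events" by (simp only: event_past[OF assms])
qed

lemma measurable_past_real [measurable]:
  assumes "times t k"
  shows "(\<lambda>\<omega>. h (past t k \<omega>) :: real) \<in> borel_measurable M"
  by (rule measurable_compose[OF measurable_past[OF assms]]) simp

lemma integrable_past:
  assumes "times t k"
  shows "integrable M (\<lambda>\<omega>. h (past t k \<omega>) :: real)"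
proof -
  have "finite ((\<lambda>p. \<bar>h p\<bar>) ` ({..k} \<rightarrow>\<^sub>E S))" using finite_paths by simp
  then obtain K where K: "\<And>p. p \<in> {..k} \<rightarrow>\<^sub>E S \<Longrightarrow> \<bar>h p\<bar> \<le> K"
    by (metis (mono_tags, lifting) Max_ge image_eqI)
  show ?thesis
    by (rule integrable_const_bound[of _ K])
       (use K measurable_space[OF measurable_past[OF assms]] measurable_past_real[OF assms] in auto)
qed

text \<open>In the product formula for finite-dimensional distributions the last transition factor
  splits off, and summing it against the last variable produces the semigroup. \<open>\<Psi>\<close>
  may depend on the whole sampled history, which is what the maximal inequality requires.\<close>

lemma markov_property:
  assumes t: "times t (Suc k)"
  shows "expectation (\<lambda>\<omega>. \<Psi> (past t k \<omega>) (Z (t (Suc k)) \<omega>)) =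
    expectation (\<lambda>\<omega>. semigroup_of L (t (Suc k) - t k) (\<Psi> (past t k \<omega>)) (Z (t k) \<omega>))"
proof -
  let ?P = "{..k} \<rightarrow>\<^sub>E S" and ?d = "t (Suc k) - t k"
  have tk: "times t k" and d: "0 \<le> ?d" using t by (auto simp: times_def)
  define U where "U \<omega> = (past t k \<omega>, Z (t (Suc k)) \<omega>)" for \<omega>
  have fin: "finite (?P \<times> S)" using finite_paths finite_S by simp
  have evU: "{\<omega> \<in> space M. U \<omega> = (p, y)} =
      {\<omega> \<in> space M. \<forall>i\<le>Suc k. Z (t i) \<omega> = (p(Suc k := y)) i}" if "p \<in> ?P" for p y
    using past_eq_iff[OF that] by (auto simp: U_def le_Suc_eq)
  have U: "U \<in> measurable M (count_space (?P \<times> S))"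
  proof (subst measurable_count_space_eq2[OF fin], intro conjI ballI)
    show "U \<in> space M \<rightarrow> ?P \<times> S"
      using measurable_space[OF measurable_past[OF tk]] Z_in times_in[OF t, of "Suc k"]
      by (auto simp: U_def)
    fix a assume a: "a \<in> ?P \<times> S"
    then obtain p y where "a = (p, y)" "p \<in> ?P" by auto
    moreover have "U -` {a} \<inter> space M = {\<omega> \<in> space M. U \<omega> = a}" by auto
    ultimately show "U -` {a} \<inter> space M \<in> events"
      by (simp only: evU event_past[OF t])
  qed
  have prob_U: "prob {\<omega> \<in> space M. U \<omega> = (p, y)} =
      prob {\<omega> \<in> space M. past t k \<omega> = p} * transition_prob L ?d (p k) y"
    if p: "p \<in> ?P" and y: "y \<in> S" for p y
  proof -
    let ?x = "p(Suc k := y)"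
    have pS: "p i \<in> S" if "i \<le> k" for i using p that by auto
    have "prob {\<omega> \<in> space M. U \<omega> = (p, y)} =
      pmf \<mu> (?x 0) * (\<Prod>i<Suc k. transition_prob L (t (Suc i) - t i) (?x i) (?x (Suc i)))"
      unfolding evU[OF p] using t pS y by (intro fdd) (auto simp: times_def le_Suc_eq)
    also have "\<dots> = pmf \<mu> (p 0) * (\<Prod>i<k. transition_prob L (t (Suc i) - t i) (p i) (p (Suc i)))
        * transition_prob L ?d (p k) y"
      by simp
    also have "pmf \<mu> (p 0) * (\<Prod>i<k. transition_prob L (t (Suc i) - t i) (p i) (p (Suc i)))
        = prob {\<omega> \<in> space M. \<forall>i\<le>k. Z (t i) \<omega> = p i}"
      using tk pS by (intro fdd[symmetric]) (auto simp: times_def)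
    also have "{\<omega> \<in> space M. \<forall>i\<le>k. Z (t i) \<omega> = p i} = {\<omega> \<in> space M. past t k \<omega> = p}"
      using past_eq_iff[OF p] by auto
    finally show ?thesis .
  qed
  have "expectation (\<lambda>\<omega>. \<Psi> (past t k \<omega>) (Z (t (Suc k)) \<omega>)) = expectation (\<lambda>\<omega>. (case_prod \<Psi>) (U \<omega>))"
    by (simp add: U_def)
  also have "\<dots> = (\<Sum>a\<in>?P \<times> S. case_prod \<Psi> a * prob {\<omega> \<in> space M. U \<omega> = a})"
    by (rule expectation_finite_valued[OF U fin])
  also have "\<dots> = (\<Sum>p\<in>?P. \<Sum>y\<in>S. \<Psi> p y * prob {\<omega> \<in> space M. U \<omega> = (p, y)})"
    unfolding sum.cartesian_product by (intro sum.cong refl) auto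
  also have "\<dots> = (\<Sum>p\<in>?P. semigroup_of L ?d (\<Psi> p) (p k) * prob {\<omega> \<in> space M. past t k \<omega> = p})"
  proof (intro sum.cong refl)
    fix p assume p: "p \<in> ?P"
    then have "p k \<in> S" by auto
    show "(\<Sum>y\<in>S. \<Psi> p y * prob {\<omega> \<in> space M. U \<omega> = (p, y)}) =
        semigroup_of L ?d (\<Psi> p) (p k) * prob {\<omega> \<in> space M. past t k \<omega> = p}"
      unfolding semigroup_eq_sum[OF \<open>p k \<in> S\<close> d, symmetric] sum_distrib_right
      using prob_U[OF p] by (intro sum.cong refl) (simp add: mult_ac)
  qed
  also have "\<dots> = expectation (\<lambda>\<omega>. semigroup_of L ?d (\<Psi> (past t k \<omega>)) (past t k \<omega> k))"
    by (rule expectation_finite_valued[OF measurable_past[OF tk] finite_paths, symmetric])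
  finally show ?thesis by simp
qed

text \<open>A discrete Feynman-Kac bound: one-step inequalities multiply under the Markov property.
  The weights \<open>w\<close> are nonnegative, but \<open>f\<close> may have any sign, so that
  applying the lemma to \<open>- f\<close> yields lower bounds.\<close>

lemma expectation_prod_bounds:
  assumes t: "times t k" and w: "\<And>i y. y \<in> S \<Longrightarrow> 0 \<le> w i y" and c: "0 \<le> c"
    and f: "\<And>i x. i < k \<Longrightarrow> x \<in> S \<Longrightarrow> semigroup_of L (t (Suc i) - t i) (\<lambda>y. w (Suc i) y * f (Suc i) y) x \<le> c * f i x"
  shows "expectation (\<lambda>\<omega>. (\<Prod>i=1..k. w i (Z (t i) \<omega>)) * f k (Z (t k) \<omega>)) \<le> c ^ k * expectation (\<lambda>\<omega>. f 0 (Z 0 \<omega>))"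
  using t f
proof (induction k)
  case 0
  then show ?case by (simp add: times_def)
next
  case (Suc k)
  have tk: "times t k" using Suc.prems(1) by (rule times_less)
  have Zk: "Z (t i) \<omega> \<in> S" if "i \<le> k" "\<omega> \<in> space M" for i \<omega>
    using times_in[OF tk that(1)] that(2) Z_in by blast
  have eq: "(\<Prod>i=1..k. w i (past t k \<omega> i)) = (\<Prod>i=1..k. w i (Z (t i) \<omega>))" for \<omega>
    by (intro prod.cong) auto
  have "expectation (\<lambda>\<omega>. (\<Prod>i=1..Suc k. w i (Z (t i) \<omega>)) * f (Suc k) (Z (t (Suc k)) \<omega>))
      = expectation (\<lambda>\<omega>. (\<Prod>i=1..k. w i (past t k \<omega> i)) * (w (Suc k) (Z (t (Suc k)) \<omega>) * f (Suc k) (Z (t (Suc k)) \<omega>)))"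
    unfolding eq by (simp add: mult_ac)
  also have "\<dots> = expectation (\<lambda>\<omega>. semigroup_of L (t (Suc k) - t k)
      (\<lambda>y. (\<Prod>i=1..k. w i (past t k \<omega> i)) * (w (Suc k) y * f (Suc k) y)) (Z (t k) \<omega>))"
    by (rule markov_property[OF Suc.prems(1), of "\<lambda>p y. (\<Prod>i=1..k. w i (p i)) * (w (Suc k) y * f (Suc k) y)"])
  also have "\<dots> \<le> expectation (\<lambda>\<omega>. c * ((\<Prod>i=1..k. w i (Z (t i) \<omega>)) * f k (Z (t k) \<omega>)))"
  proof (rule integral_mono)
    have "integrable M (\<lambda>\<omega>. (\<lambda>p. semigroup_of L (t (Suc k) - t k)
      (\<lambda>y. (\<Prod>i=1..k. w i (p i)) * (w (Suc k) y * f (Suc k) y)) (p k)) (past t k \<omega>))"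
      by (rule integrable_past[OF tk])
    then show "integrable M (\<lambda>\<omega>. semigroup_of L (t (Suc k) - t k)
      (\<lambda>y. (\<Prod>i=1..k. w i (past t k \<omega> i)) * (w (Suc k) y * f (Suc k) y)) (Z (t k) \<omega>))" by simp
    have "integrable M (\<lambda>\<omega>. (\<lambda>p. c * ((\<Prod>i=1..k. w i (p i)) * f k (p k))) (past t k \<omega>))"
      by (rule integrable_past[OF tk])
    then show "integrable M (\<lambda>\<omega>. c * ((\<Prod>i=1..k. w i (Z (t i) \<omega>)) * f k (Z (t k) \<omega>)))"
      unfolding eq by simp
    fix \<omega> assume \<omega>: "\<omega> \<in> space M"
    let ?x = "Z (t k) \<omega>" and ?p = "\<Prod>i=1..k. w i (Z (t i) \<omega>)" and ?d = "t (Suc k) - t k"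
    have d: "0 \<le> ?d" using Suc.prems(1) by (simp add: times_def)
    have x: "?x \<in> S" using Zk[of k] \<omega> by simp
    have "semigroup_of L ?d (\<lambda>y. ?p * (w (Suc k) y * f (Suc k) y)) ?x
        = ?p * semigroup_of L ?d (\<lambda>y. w (Suc k) y * f (Suc k) y) ?x"
      unfolding semigroup_eq_sum[OF x d, symmetric] sum_distrib_left by (simp add: mult_ac)
    also have "\<dots> \<le> ?p * (c * f k ?x)"
      using Suc.prems(2)[of k ?x] x Zk[OF _ \<omega>] by (intro mult_left_mono prod_nonneg) (auto intro: w)
    finally show "semigroup_of L ?d (\<lambda>y. (\<Prod>i=1..k. w i (past t k \<omega> i)) * (w (Suc k) y * f (Suc k) y)) ?x
        \<le> c * (?p * f k ?x)" unfolding eq by (simp add: mult_ac)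
  qed
  also have "\<dots> = c * expectation (\<lambda>\<omega>. (\<Prod>i=1..k. w i (Z (t i) \<omega>)) * f k (Z (t k) \<omega>))" by simp
  also have "\<dots> \<le> c * (c ^ k * expectation (\<lambda>\<omega>. f 0 (Z 0 \<omega>)))"
    using Suc.IH[OF tk] Suc.prems(2) c by (intro mult_left_mono) auto
  finally show ?case by simp
qed

end

lemma uniform_bound_finite:
  fixes g :: "real \<Rightarrow> 's \<Rightarrow> real"
  assumes S: "finite S" and c: "\<And>x. x \<in> S \<Longrightarrow> continuous_on {0..T} (\<lambda>s. g s x)"
  obtains K where "0 \<le> K" "\<And>s x. s \<in> {0..T} \<Longrightarrow> x \<in> S \<Longrightarrow> \<bar>g s x\<bar> \<le> K"
proof -
  have "\<exists>K. \<forall>s\<in>{0..T}. \<bar>g s x\<bar> \<le> K" if x: "x \<in> S" for x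
  proof -
    have "bounded ((\<lambda>s. g s x) ` {0..T})"
      by (intro compact_imp_bounded compact_continuous_image c x) auto
    then show ?thesis by (auto simp: bounded_iff)
  qed
  then obtain K where K: "\<And>x s. x \<in> S \<Longrightarrow> s \<in> {0..T} \<Longrightarrow> \<bar>g s x\<bar> \<le> K x" by metis
  show thesis
  proof
    show "0 \<le> (\<Sum>x\<in>S. \<bar>K x\<bar>)" by (simp add: sum_nonneg)
    fix s x assume "s \<in> {0..T}" "x \<in> S"
    then show "\<bar>g s x\<bar> \<le> (\<Sum>x\<in>S. \<bar>K x\<bar>)"
      using K[of x s] member_le_sum[of x S "\<lambda>x. \<bar>K x\<bar>"] S by fastforce
  qed
qed

lemma uniform_continuity_finite:
  fixes g :: "real \<Rightarrow> 's \<Rightarrow> real"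
  assumes S: "finite S" and c: "\<And>x. x \<in> S \<Longrightarrow> continuous_on {0..T} (\<lambda>s. g s x)" and e: "0 < e"
  obtains d where "0 < d" "\<And>s u x. s \<in> {0..T} \<Longrightarrow> u \<in> {0..T} \<Longrightarrow> x \<in> S \<Longrightarrow> \<bar>s - u\<bar> < d \<Longrightarrow> \<bar>g s x - g u x\<bar> < e"
proof -
  have "\<exists>d>0. \<forall>s\<in>{0..T}. \<forall>u\<in>{0..T}. \<bar>s - u\<bar> < d \<longrightarrow> \<bar>g s x - g u x\<bar> < e" if x: "x \<in> S" for x
  proof -
    have "uniformly_continuous_on {0..T} (\<lambda>s. g s x)"
      by (intro compact_uniformly_continuous c x) auto
    then obtain d where "d > 0" "\<And>s u. s \<in> {0..T} \<Longrightarrow> u \<in> {0..T} \<Longrightarrow> dist u s < d \<Longrightarrow> dist (g u x) (g s x) < e"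
      using e unfolding uniformly_continuous_on_def by metis
    then show ?thesis
      unfolding dist_real_def by (intro exI[of _ d]) (metis abs_minus_commute)
  qed
  then obtain d where d: "\<And>x. x \<in> S \<Longrightarrow> 0 < d x"
    "\<And>x s u. x \<in> S \<Longrightarrow> s \<in> {0..T} \<Longrightarrow> u \<in> {0..T} \<Longrightarrow> \<bar>s - u\<bar> < d x \<Longrightarrow> \<bar>g s x - g u x\<bar> < e" by metis
  define m where "m = Min (insert 1 (d ` S))"
  have "0 < m" using S d(1) by (auto simp: m_def)
  moreover have "m \<le> d x" if "x \<in> S" for x using S that by (simp add: m_def)
  ultimately show thesis using d(2) by (intro that[of m]) force+
qed

lemma abs_exp_taylor: "\<bar>exp z - 1 - z\<bar> \<le> z\<^sup>2 * exp \<bar>z\<bar>" for z :: real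
proof -
  have "\<bar>exp z - (\<Sum>i<2. z ^ i / fact i)\<bar> \<le> \<bar>z\<bar> ^ 2 * exp \<bar>z\<bar> / fact 2" if "z \<noteq> 0"
  proof -
    obtain t where t: "\<bar>t\<bar> \<le> \<bar>z\<bar>" "exp z = (\<Sum>i<2. z ^ i / fact i) + exp t / fact 2 * z ^ 2"
      using Maclaurin_exp_le[of z 2] by auto
    have "\<bar>exp t / fact 2 * z ^ 2\<bar> = \<bar>z\<bar> ^ 2 * exp t / fact 2" by (simp add: abs_mult)
    also have "\<dots> \<le> \<bar>z\<bar> ^ 2 * exp \<bar>z\<bar> / fact 2"
      using t(1) by (intro divide_right_mono mult_left_mono) auto
    finally show ?thesis using t(2) by simp
  qed
  then have "\<bar>exp z - (\<Sum>i<2. z ^ i / fact i)\<bar> \<le> \<bar>z\<bar> ^ 2 * exp \<bar>z\<bar> / fact 2"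
    by (cases "z = 0") (auto simp: numeral_2_eq_2)
  also have "\<dots> \<le> z\<^sup>2 * exp \<bar>z\<bar>" by (simp add: fact_2)
  also have "(\<Sum>i<2. z ^ i / fact i) = 1 + z" by (simp add: numeral_2_eq_2)
  finally show ?thesis by (simp add: diff_diff_eq)
qed

section \<open>Maximal inequality for functions with controlled growth\<close>

context markov_chain
begin

lemma right_constant:
  assumes \<omega>: "\<omega> \<in> space M" and t: "t \<in> {0..<T}"
  shows "\<forall>\<^sub>F r in at_right t. Z r \<omega> = Z t \<omega>"
proof -
  have "Z t \<omega> \<in> S" using Z_in[OF _ \<omega>] t by auto
  then obtain U where U: "open U" "Z t \<omega> \<in> U" "U \<inter> S = {Z t \<omega>}" using discrete_S by blast
  have "((\<lambda>r. Z r \<omega>) \<longlongrightarrow> Z t \<omega>) (at_right t)"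
    using cadlag_Z[OF \<omega>] t by (auto simp: cadlag_on_def)
  then have "\<forall>\<^sub>F r in at_right t. Z r \<omega> \<in> U" using U by (auto simp: tendsto_def)
  moreover have "\<forall>\<^sub>F r in at_right t. r \<in> {t<..<T}"
    using t by (intro eventually_at_right_real) auto
  ultimately show ?thesis
  proof eventually_elim
    case (elim r)
    then show ?case using U(3) Z_in[OF _ \<omega>, of r] t by auto
  qed
qed

lemma event_past_pred:
  assumes t: "times t k"
  shows "{\<omega> \<in> space M. P (past t k \<omega>)} \<in> events"
proof -
  have "past t k -` {p \<in> {..k} \<rightarrow>\<^sub>E S. P p} \<inter> space M \<in> events"
    by (rule measurable_sets[OF measurable_past[OF t]]) auto
  also have "past t k -` {p \<in> {..k} \<rightarrow>\<^sub>E S. P p} \<inter> space M = {\<omega> \<in> space M. P (past t k \<omega>)}"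
    using measurable_space[OF measurable_past[OF t]] by (auto simp only: space_count_space)
  finally show ?thesis .
qed

text \<open>Doob's argument for the ratio of \<open>f\<close> to its random value at the starting
  time \<open>t 1\<close>. By \<open>semigroup_le_exp\<close> the ratio grows in mean by at most
  \<open>exp (c * h)\<close> over a step of length \<open>h\<close>; a frozen value stays put
  because \<open>L\<close> annihilates constants. Markov's inequality with level
  \<open>\<kappa>\<close> concludes.\<close>

lemma maximal_inequality_discrete:
  assumes t: "times t k" and k: "1 \<le> k" and f: "\<And>x. x \<in> S \<Longrightarrow> 0 < f x"
    and Lf: "\<And>x. x \<in> S \<Longrightarrow> L f x \<le> c * f x" and c: "0 \<le> c" and \<kappa>: "0 < \<kappa>"
  shows "prob {\<omega> \<in> space M. \<exists>i\<in>{1..k}. \<kappa> * f (Z (t 1) \<omega>) \<le> f (Z (t i) \<omega>)} \<le> exp (c * (t k - t 1)) / \<kappa>"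
proof -
  define B where "B k p \<longleftrightarrow> (\<exists>i\<in>{1..k}. \<kappa> * f (p 1) \<le> f (p i))" for k and p :: "nat \<Rightarrow> 's"
  \<comment> \<open>\<open>V\<close> plays the role of the stopped ratio: once the level has been
    reached it is replaced by the constant \<open>\<kappa>\<close>. The true ratio at that moment is
    at least \<open>\<kappa>\<close>, so freezing only lowers it.\<close>
  define V where "V k p = (if B k p then \<kappa> else f (p k) / f (p 1))" for k and p :: "nat \<Rightarrow> 's"
  have past_S: "past t k \<omega> i \<in> S" if "times t k" "\<omega> \<in> space M" "i \<le> k" for k \<omega> i
    using Z_in[OF times_in[OF that(1,3)] that(2)] that(3) by simp
  have main: "expectation (\<lambda>\<omega>. V k (past t k \<omega>)) \<le> exp (c * (t k - t 1))"
    using k t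
  proof (induction k rule: dec_induct)
    case base
    have "expectation (\<lambda>\<omega>. V 1 (past t 1 \<omega>)) \<le> expectation (\<lambda>\<omega>. 1)"
    proof (rule integral_mono)
      show "integrable M (\<lambda>\<omega>. V 1 (past t 1 \<omega>))" by (rule integrable_past[OF base])
      fix \<omega> assume "\<omega> \<in> space M"
      then have "0 < f (past t 1 \<omega> 1)" using past_S[OF base, of \<omega> 1] by (intro f) auto
      then show "V 1 (past t 1 \<omega>) \<le> 1" by (auto simp: V_def B_def)
    qed simp
    then show ?case by (simp add: prob_space)
  next
    case (step k)
    have tk: "times t k" by (rule times_less[OF step.prems])
    have d: "0 \<le> t (Suc k) - t k" using step.prems by (simp add: times_def)
    define \<Psi> where "\<Psi> p y = (if B k p then \<kappa> else f y / f (p 1))" for p y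
    have pos: "0 < f (past t k \<omega> i)" if "\<omega> \<in> space M" "i \<le> k" for \<omega> i
      using past_S[OF tk that] by (rule f)
    have "expectation (\<lambda>\<omega>. V (Suc k) (past t (Suc k) \<omega>))
        \<le> expectation (\<lambda>\<omega>. \<Psi> (past t k \<omega>) (Z (t (Suc k)) \<omega>))"
    proof (rule integral_mono)
      show "integrable M (\<lambda>\<omega>. V (Suc k) (past t (Suc k) \<omega>))" by (rule integrable_past[OF step.prems])
      have "integrable M (\<lambda>\<omega>. (\<lambda>p. \<Psi> (restrict p {..k}) (p (Suc k))) (past t (Suc k) \<omega>))"
        by (rule integrable_past[OF step.prems])
      moreover have "restrict (past t (Suc k) \<omega>) {..k} = past t k \<omega>" for \<omega>
        by (auto simp: past_def restrict_def)
      ultimately show "integrable M (\<lambda>\<omega>. \<Psi> (past t k \<omega>) (Z (t (Suc k)) \<omega>))" by simp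
      fix \<omega> assume \<omega>: "\<omega> \<in> space M"
      have "0 < f (Z (t 1) \<omega>)" using pos[OF \<omega>, of 1] step.hyps by simp
      then show "V (Suc k) (past t (Suc k) \<omega>) \<le> \<Psi> (past t k \<omega>) (Z (t (Suc k)) \<omega>)"
        using step.hyps \<kappa> by (auto simp: V_def \<Psi>_def B_def pos_le_divide_eq le_Suc_eq Ball_def)
    qed
    also have "\<dots> = expectation (\<lambda>\<omega>. semigroup_of L (t (Suc k) - t k) (\<Psi> (past t k \<omega>)) (Z (t k) \<omega>))"
      by (rule markov_property[OF step.prems])
    also have "\<dots> \<le> expectation (\<lambda>\<omega>. exp (c * (t (Suc k) - t k)) * V k (past t k \<omega>))"
    proof (rule integral_mono)
      have "integrable M (\<lambda>\<omega>. (\<lambda>p. semigroup_of L (t (Suc k) - t k) (\<Psi> p) (p k)) (past t k \<omega>))"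
        by (rule integrable_past[OF tk])
      then show "integrable M (\<lambda>\<omega>. semigroup_of L (t (Suc k) - t k) (\<Psi> (past t k \<omega>)) (Z (t k) \<omega>))"
        by simp
      show "integrable M (\<lambda>\<omega>. exp (c * (t (Suc k) - t k)) * V k (past t k \<omega>))"
        by (rule integrable_mult_right integrable_past[OF tk])+
      fix \<omega> assume \<omega>: "\<omega> \<in> space M"
      let ?p = "past t k \<omega>"
      have x: "Z (t k) \<omega> \<in> S" using Z_in[OF times_in[OF tk] \<omega>] by simp
      have "semigroup_of L (t (Suc k) - t k) (\<Psi> ?p) (Z (t k) \<omega>)
          \<le> exp (c * (t (Suc k) - t k)) * \<Psi> ?p (Z (t k) \<omega>)"
      proof (rule semigroup_le_exp[OF _ _ c x d])
        fix y assume y: "y \<in> S"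
        have p1: "0 < f (?p 1)" using pos[OF \<omega>, of 1] step.hyps by simp
        show "0 \<le> \<Psi> ?p y" using p1 f[OF y] \<kappa> by (auto simp: \<Psi>_def)
        show "L (\<Psi> ?p) y \<le> c * \<Psi> ?p y"
        proof (cases "B k ?p")
          case True
          then show ?thesis using c \<kappa> by (simp add: L_eq[OF y] \<Psi>_def)
        next
          case False
          then have "L (\<Psi> ?p) y = L f y / f (?p 1)"
            by (simp add: L_eq[OF y] \<Psi>_def sum_divide_distrib diff_divide_distrib[symmetric])
          then show ?thesis using False Lf[OF y] p1 by (simp add: \<Psi>_def divide_right_mono)
        qed
      qed
      then show "semigroup_of L (t (Suc k) - t k) (\<Psi> ?p) (Z (t k) \<omega>)
          \<le> exp (c * (t (Suc k) - t k)) * V k ?p"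
        by (simp only: V_def \<Psi>_def past_apply[OF order_refl])
    qed
    also have "\<dots> = exp (c * (t (Suc k) - t k)) * expectation (\<lambda>\<omega>. V k (past t k \<omega>))" by simp
    also have "\<dots> \<le> exp (c * (t (Suc k) - t k)) * exp (c * (t k - t 1))"
      using step.IH[OF tk] by (intro mult_left_mono) auto
    also have "\<dots> = exp (c * (t (Suc k) - t 1))" by (simp add: mult_exp_exp algebra_simps)
    finally show ?case .
  qed
  have "{\<omega> \<in> space M. B k (past t k \<omega>)} \<in> events"
    by (rule event_past_pred[OF t])
  then have "\<kappa> * prob {\<omega> \<in> space M. B k (past t k \<omega>)}
      = expectation (\<lambda>\<omega>. \<kappa> * indicator {\<omega> \<in> space M. B k (past t k \<omega>)} \<omega>)" by simp
  also have "\<dots> \<le> expectation (\<lambda>\<omega>. V k (past t k \<omega>))"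
  proof (rule integral_mono)
    show "integrable M (\<lambda>\<omega>. \<kappa> * indicator {\<omega> \<in> space M. B k (past t k \<omega>)} \<omega>)"
      using \<open>{\<omega> \<in> space M. B k (past t k \<omega>)} \<in> events\<close>
      by (intro integrable_mult_right integrable_real_indicator) (auto simp: emeasure_eq_measure)
    show "integrable M (\<lambda>\<omega>. V k (past t k \<omega>))" by (rule integrable_past[OF t])
    fix \<omega> assume \<omega>: "\<omega> \<in> space M"
    have "0 < f (past t k \<omega> k)" "0 < f (past t k \<omega> 1)" using past_S[OF t \<omega>] k by (auto intro!: f simp del: past_apply)
    then show "\<kappa> * indicator {\<omega> \<in> space M. B k (past t k \<omega>)} \<omega> \<le> V k (past t k \<omega>)"
      using \<kappa> by (auto simp: V_def indicator_def)
  qed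
  finally have "\<kappa> * prob {\<omega> \<in> space M. B k (past t k \<omega>)} \<le> exp (c * (t k - t 1))" using main by linarith
  moreover have "B k (past t k \<omega>) \<longleftrightarrow> (\<exists>i\<in>{1..k}. \<kappa> * f (Z (t 1) \<omega>) \<le> f (Z (t i) \<omega>))" for \<omega>
    using k by (auto simp: B_def)
  ultimately show ?thesis using \<kappa> by (simp add: pos_le_divide_eq mult.commute)
qed

text \<open>The events on dyadic grids increase to the event in continuous time: a value taken at
  \<open>r < u\<close> persists on a right neighbourhood of \<open>r\<close> and is seen at a nearby
  dyadic point, while \<open>u\<close> belongs to every grid. Hence the event is measurable and the
  discrete bound survives the limit.\<close>

lemma maximal_inequality:
  assumes s: "0 \<le> s" "s < u" "u \<le> T" and f: "\<And>x. x \<in> S \<Longrightarrow> 0 < f x"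
    and Lf: "\<And>x. x \<in> S \<Longrightarrow> L f x \<le> c * f x" and c: "0 \<le> c" and \<kappa>: "0 < \<kappa>"
  shows "{\<omega> \<in> space M. \<exists>r\<in>{s..u}. \<kappa> * f (Z s \<omega>) \<le> f (Z r \<omega>)} \<in> events" (is "?E \<in> _")
    and "prob {\<omega> \<in> space M. \<exists>r\<in>{s..u}. \<kappa> * f (Z s \<omega>) \<le> f (Z r \<omega>)} \<le> exp (c * (u - s)) / \<kappa>"
proof -
  define d where "d n = (u - s) / 2 ^ n" for n :: nat
  define g where "g n j = s + real j * d n" for n j :: nat
  define A where "A n = {\<omega> \<in> space M. \<exists>j\<le>2 ^ n. \<kappa> * f (Z s \<omega>) \<le> f (Z (g n j) \<omega>)}" for n :: nat
  \<comment> \<open>\<open>times\<close> demands that index 0 be time 0, so the grid on the window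
    from \<open>s\<close> to \<open>u\<close> starts at index 1. This is why the discrete inequality
    compares with \<open>t 1\<close>.\<close>
  define t where "t n i = (if i = 0 then 0 else g n (i - 1))" for n i :: nat
  have d: "0 < d n" for n using s by (simp add: d_def)
  have g_end: "g n (2 ^ n) = u" for n by (simp add: g_def d_def)
  have g_le: "g n i \<le> g n j" if "i \<le> j" for n i j
    using that d[of n] by (simp add: g_def mult_right_mono)
  have g0: "g n 0 = s" for n by (simp add: g_def)
  have t: "times (t n) (Suc (2 ^ n))" for n
  proof -
    have "t n i \<le> t n (Suc i)" for i
      using g_le[of 0 i n] g_le[of "i - 1" i n] s g0[of n] by (auto simp: t_def)
    then show ?thesis using s g_end by (auto simp: times_def t_def)
  qed
  have A_alt: "A n = {\<omega> \<in> space M. \<exists>i\<in>{1..Suc (2 ^ n)}. \<kappa> * f (Z (t n 1) \<omega>) \<le> f (Z (t n i) \<omega>)}" for n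
  proof -
    have "(\<exists>j\<le>2 ^ n. P j) \<longleftrightarrow> (\<exists>i\<in>{1..Suc (2 ^ n)}. P (i - 1))" for P :: "nat \<Rightarrow> bool"
    proof safe
      fix j :: nat assume "j \<le> 2 ^ n" "P j"
      then show "\<exists>i\<in>{1..Suc (2 ^ n)}. P (i - 1)" by (intro bexI[of _ "Suc j"]) auto
    next
      fix i :: nat assume "i \<in> {1..Suc (2 ^ n)}" "P (i - 1)"
      then show "\<exists>j\<le>2 ^ n. P j" by (intro exI[of _ "i - 1"]) auto
    qed
    from this[of "\<lambda>j. \<kappa> * f (Z s _) \<le> f (Z (g n j) _)"] show ?thesis
      unfolding A_def t_def by (auto simp: g0)
  qed
  have A_ev: "A n \<in> events" for n
  proof -
    define D where "D p \<longleftrightarrow> (\<exists>i\<in>{1..Suc (2 ^ n)}. \<kappa> * f (p 1) \<le> f (p i))" for p :: "nat \<Rightarrow> 's"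
    have "A n = {\<omega> \<in> space M. D (past (t n) (Suc (2 ^ n)) \<omega>)}"
      unfolding A_alt D_def by (intro Collect_cong conj_cong refl bex_cong) simp_all
    then show ?thesis by (simp only: event_past_pred[OF t])
  qed
  have A_prob: "prob (A n) \<le> exp (c * (u - s)) / \<kappa>" for n
    using maximal_inequality_discrete[OF t _ f Lf c \<kappa>, of n] g_end[of n] g0[of n]
    by (simp add: A_alt t_def)
  have inc: "incseq A"
  proof (rule incseq_SucI, rule subsetI)
    fix n \<omega> assume "\<omega> \<in> A n"
    then obtain j where j: "\<omega> \<in> space M" "j \<le> 2 ^ n" "\<kappa> * f (Z s \<omega>) \<le> f (Z (g n j) \<omega>)" by (auto simp: A_def)
    have "g n j = g (Suc n) (2 * j)" by (simp add: g_def d_def)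
    then show "\<omega> \<in> A (Suc n)" using j unfolding A_def by (auto intro!: exI[of _ "2 * j"])
  qed
  have E: "?E = (\<Union>n. A n)"
  proof (intro equalityI subsetI)
    fix \<omega> assume "\<omega> \<in> (\<Union>n. A n)"
    then obtain n j where j: "\<omega> \<in> space M" "j \<le> 2 ^ n" "\<kappa> * f (Z s \<omega>) \<le> f (Z (g n j) \<omega>)" by (auto simp: A_def)
    have "g n j \<in> {s..u}" using g_le[of 0 j n] g_le[OF j(2), of n] g0[of n] g_end[of n] by auto
    then show "\<omega> \<in> ?E" using j by blast
  next
    fix \<omega> assume "\<omega> \<in> ?E"
    then obtain r where r: "\<omega> \<in> space M" "r \<in> {s..u}" "\<kappa> * f (Z s \<omega>) \<le> f (Z r \<omega>)" by blast
    show "\<omega> \<in> (\<Union>n. A n)"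
    proof (cases "r = u")
      case True
      then have "\<omega> \<in> A 0" using r g_end[of 0] by (auto simp: A_def intro!: exI[of _ 1])
      then show ?thesis by blast
    next
      case False
      then have "r \<in> {0..<T}" using r s by auto
      from right_constant[OF r(1) this] obtain b where b: "b > r" "\<And>y. r < y \<Longrightarrow> y < b \<Longrightarrow> Z y \<omega> = Z r \<omega>"
        by (auto simp: eventually_at_right_field)
      define e where "e = min b u - r"
      have e: "0 < e" using b False r by (auto simp: e_def)
      have "(\<lambda>n. (u - s) * inverse (2 ^ n)) \<longlonglongrightarrow> (u - s) * 0"
        by (intro tendsto_mult tendsto_const LIMSEQ_inverse_realpow_zero) auto
      then have "\<forall>\<^sub>F n in sequentially. d n < e"
        using order_tendstoD(2)[of d 0 sequentially e] e by (simp add: d_def[abs_def] divide_inverse)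
      then obtain n where n: "d n < e" by (auto simp: eventually_sequentially)
      define j where "j = nat \<lfloor>(r - s) / d n\<rfloor> + 1"
      have jl: "(r - s) / d n < real j" "real j \<le> (r - s) / d n + 1"
        using r(2) d[of n] unfolding j_def by (auto simp: of_nat_nat floor_correct) linarith+
      have "r < g n j" "g n j \<le> r + d n"
        using jl d[of n] by (auto simp: g_def field_simps)
      then have rg: "r < g n j" "g n j < b" "g n j < u" using n by (auto simp: e_def)
      have "j \<le> 2 ^ n"
      proof (rule ccontr)
        assume "\<not> j \<le> 2 ^ n"
        then have "g n (2 ^ n) \<le> g n j" by (intro g_le) auto
        then show False using rg(3) g_end by simp
      qed
      then have "\<omega> \<in> A n" using b(2)[OF rg(1,2)] r by (auto simp: A_def)
      then show ?thesis by blast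
    qed
  qed
  show "?E \<in> events" unfolding E using A_ev by blast
  have "(\<lambda>n. prob (A n)) \<longlonglongrightarrow> prob (\<Union>n. A n)"
    using A_ev by (intro finite_Lim_measure_incseq inc) auto
  then show "prob ?E \<le> exp (c * (u - s)) / \<kappa>"
    unfolding E using A_prob by (intro LIMSEQ_le_const2) auto
qed

end

section \<open>First-order compensation of the semigroup\<close>

context jump_generator
begin

lemma semigroup_mono:
  assumes "\<And>y. y \<in> S \<Longrightarrow> f y \<le> g y" "x \<in> S" "0 \<le> t"
  shows "semigroup_of L t f x \<le> semigroup_of L t g x"
  unfolding semigroup_eq_sum[OF assms(2,3), symmetric]
  using assms by (intro sum_mono mult_left_mono transition_prob_nonneg) auto

lemma semigroup_cmult: "x \<in> S \<Longrightarrow> 0 \<le> t \<Longrightarrow> semigroup_of L t (\<lambda>y. c * f y) x = c * semigroup_of L t f x"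
  by (simp add: semigroup_eq_sum[symmetric] sum_distrib_left mult_ac)

lemma semigroup_diff:
  "x \<in> S \<Longrightarrow> 0 \<le> t \<Longrightarrow> semigroup_of L t (\<lambda>y. f y - g y) x = semigroup_of L t f x - semigroup_of L t g x"
  by (simp add: semigroup_eq_sum[symmetric] algebra_simps sum_subtractf)

lemma semigroup_const_le:
  assumes "x \<in> S" "0 \<le> t" "0 \<le> c"
  shows "semigroup_of L t (\<lambda>_. c) x \<le> c"
  using semigroup_le_exp[of "\<lambda>_. c" 0 x t] assms by (simp add: L_eq)

lemma semigroup_abs_le:
  assumes f: "\<And>y. y \<in> S \<Longrightarrow> \<bar>f y\<bar> \<le> c" and x: "x \<in> S" and t: "0 \<le> t"
  shows "\<bar>semigroup_of L t f x\<bar> \<le> c"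
proof -
  have c: "0 \<le> c" using f[OF x] by linarith
  have "semigroup_of L t f x \<le> semigroup_of L t (\<lambda>_. c) x"
    using f by (intro semigroup_mono x t) (auto simp: abs_le_iff)
  moreover have "semigroup_of L t (\<lambda>y. - f y) x \<le> semigroup_of L t (\<lambda>_. c) x"
    using f by (intro semigroup_mono x t) (auto simp: abs_le_iff)
  moreover have "semigroup_of L t (\<lambda>y. - f y) x = - semigroup_of L t f x"
    using semigroup_cmult[OF x t, of "-1" f] by simp
  ultimately show ?thesis using semigroup_const_le[OF x t c] by linarith
qed

text \<open>To first order, multiplying \<open>exp F\<close> by \<open>exp (- t W)\<close> with \<open>W = exp (- F) L (exp F)\<close>
  compensates for the action of the semigroup.\<close>

lemma semigroup_compensated:
  assumes K: "0 \<le> K"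
  obtains C where "0 \<le> C" "\<And>t F W x. 0 \<le> t \<Longrightarrow> t \<le> 1 \<Longrightarrow> x \<in> S \<Longrightarrow>
      (\<And>y. y \<in> S \<Longrightarrow> \<bar>F y\<bar> \<le> K) \<Longrightarrow> (\<And>y. y \<in> S \<Longrightarrow> \<bar>W y\<bar> \<le> K) \<Longrightarrow>
      (\<And>y. y \<in> S \<Longrightarrow> W y = exp (- F y) * L (\<lambda>z. exp (F z)) y) \<Longrightarrow>
      \<bar>semigroup_of L t (\<lambda>y. exp (F y - t * W y)) x - exp (F x)\<bar> \<le> C * t\<^sup>2 * exp (F x)"
proof
  let ?r = "2 * rate_bound" and ?E = "exp K"
  let ?B = "?E + ?r * ?E"
  let ?C0 = "?E * (K\<^sup>2 * ?E) + ?B * exp ?r + ?r * (?r * ?E)"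
  have r: "0 \<le> ?r" using rate_bound_nonneg by simp
  show "0 \<le> ?C0 * ?E" using r K by (intro mult_nonneg_nonneg add_nonneg_nonneg) auto
  fix t :: real and F W :: "'s \<Rightarrow> real" and x
  assume t: "0 \<le> t" "t \<le> 1" and x: "x \<in> S" and F: "\<And>y. y \<in> S \<Longrightarrow> \<bar>F y\<bar> \<le> K"
    and WK: "\<And>y. y \<in> S \<Longrightarrow> \<bar>W y\<bar> \<le> K" and W: "\<And>y. y \<in> S \<Longrightarrow> W y = exp (- F y) * L (\<lambda>z. exp (F z)) y"
  define g where "g y = exp (F y)" for y
  have gE: "\<bar>g y\<bar> \<le> ?E" if "y \<in> S" for y using F[OF that] by (auto simp: g_def)
  have Lg: "\<bar>L g y\<bar> \<le> ?r * ?E" if "y \<in> S" for y by (rule L_abs_le[OF gE that])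
  have gW: "g y * W y = L g y" if "y \<in> S" for y
    using W[OF that] by (simp add: g_def[abs_def] exp_minus field_simps)
  define v1 where "v1 y = g y - t * L g y" for y
  have v1: "\<bar>v1 y\<bar> \<le> ?B" if y: "y \<in> S" for y
  proof -
    have "\<bar>v1 y\<bar> \<le> \<bar>g y\<bar> + \<bar>t * L g y\<bar>" unfolding v1_def by (rule abs_triangle_ineq4)
    also have "\<bar>t * L g y\<bar> \<le> 1 * (?r * ?E)"
      unfolding abs_mult using t Lg[OF y] by (intro mult_mono) auto
    finally show ?thesis using gE[OF y] by simp
  qed
  have d1: "\<bar>exp (F y - t * W y) - v1 y\<bar> \<le> ?E * (K\<^sup>2 * ?E) * t\<^sup>2" if y: "y \<in> S" for y
  proof -
    have "exp (F y - t * W y) = g y * exp (- t * W y)" by (simp add: g_def exp_diff exp_minus divide_inverse)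
    moreover have "v1 y = g y * (1 + (- t * W y))" using gW[OF y] by (simp add: v1_def algebra_simps)
    ultimately have "\<bar>exp (F y - t * W y) - v1 y\<bar> = \<bar>g y\<bar> * \<bar>exp (- t * W y) - 1 - (- t * W y)\<bar>"
      by (simp add: abs_mult[symmetric] algebra_simps)
    also have "\<dots> \<le> ?E * ((- t * W y)\<^sup>2 * exp \<bar>- t * W y\<bar>)"
      by (intro mult_mono gE y abs_exp_taylor) auto
    also have "\<dots> \<le> ?E * (t\<^sup>2 * K\<^sup>2 * ?E)"
    proof -
      have "(W y)\<^sup>2 \<le> K\<^sup>2" using WK[OF y] K by (simp add: abs_le_square_iff[symmetric])
      moreover have "\<bar>- t * W y\<bar> \<le> 1 * K" unfolding abs_mult using t WK[OF y] by (intro mult_mono) auto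
      ultimately show ?thesis
        by (intro mult_left_mono mult_mono) (auto simp: power_mult_distrib intro!: mult_left_mono)
    qed
    finally show ?thesis by (simp add: mult_ac)
  qed
  have e1: "\<bar>semigroup_of L t (\<lambda>y. exp (F y - t * W y)) x - semigroup_of L t v1 x\<bar> \<le> ?E * (K\<^sup>2 * ?E) * t\<^sup>2"
    unfolding semigroup_diff[OF x t(1), symmetric] by (rule semigroup_abs_le[OF d1 x t(1)])
  have e2: "\<bar>semigroup_of L t v1 x - (v1 x + t * L v1 x)\<bar> \<le> ?B * exp ?r * t\<^sup>2"
    by (rule semigroup_taylor[OF v1 x t])
  have Lv1: "L v1 x = L g x - t * L (L g) x"
    unfolding L_eq[OF x] v1_def
    by (simp add: sum_subtractf[symmetric] sum_distrib_left algebra_simps)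
  have "v1 x + t * L v1 x - g x = - (t\<^sup>2 * L (L g) x)"
    unfolding Lv1 v1_def by (simp add: power2_eq_square algebra_simps)
  then have e3: "\<bar>v1 x + t * L v1 x - g x\<bar> \<le> ?r * (?r * ?E) * t\<^sup>2"
    using L_abs_le[OF Lg x] by (simp add: abs_mult mult.commute[of "t\<^sup>2"] mult_right_mono)
  have "\<bar>semigroup_of L t (\<lambda>y. exp (F y - t * W y)) x - g x\<bar> \<le> ?C0 * t\<^sup>2"
    using e1 e2 e3 by (simp add: algebra_simps)
  \<comment> \<open>The absolute error is made relative to \<open>exp (F x)\<close>, which is at
    least \<open>exp (- K)\<close>. Relative errors can be multiplied along a time grid.\<close>
  also have "\<dots> \<le> ?C0 * t\<^sup>2 * (?E * exp (F x))"
  proof -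
    have "exp (K + F x) \<ge> 1" using F[OF x] by simp
    then have "1 \<le> ?E * exp (F x)" by (simp add: exp_add)
    moreover have "0 \<le> ?C0 * t\<^sup>2" using r K by (intro mult_nonneg_nonneg add_nonneg_nonneg) auto
    ultimately show ?thesis using mult_left_mono[of 1 "?E * exp (F x)" "?C0 * t\<^sup>2"] by simp
  qed
  finally show "\<bar>semigroup_of L t (\<lambda>y. exp (F y - t * W y)) x - exp (F x)\<bar> \<le> ?C0 * ?E * t\<^sup>2 * exp (F x)"
    by (simp add: g_def mult_ac)
qed

end

section \<open>Exponential martingales of time-dependent observables\<close>

locale exponential_martingale = markov_chain S L J rate target T \<mu> M Z
  for S :: "'s::topological_space set" and L J and rate :: "'j \<Rightarrow> 's \<Rightarrow> real" and target T \<mu>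
    and M :: "'w measure" and Z +
  fixes F D :: "real \<Rightarrow> 's \<Rightarrow> real"
  assumes F_deriv: "\<And>s x. x \<in> S \<Longrightarrow> s \<in> {0..T} \<Longrightarrow>
      ((\<lambda>s. F s x) has_real_derivative D s x) (at s within {0..T})"
    and D_cont: "\<And>x. x \<in> S \<Longrightarrow> continuous_on {0..T} (\<lambda>s. D s x)"
begin

text \<open>The nonlinear generator of Hamilton-Jacobi type, obtained by conjugating
  \<open>L\<close> with \<open>exp F\<close>.\<close>

definition W :: "real \<Rightarrow> 's \<Rightarrow> real" where
  "W s x = exp (- F s x) * L (\<lambda>y. exp (F s y)) x"

lemma F_cont: "x \<in> S \<Longrightarrow> continuous_on {0..T} (\<lambda>s. F s x)"
  by (rule DERIV_continuous_on) (rule F_deriv)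

lemma W_cont: assumes x: "x \<in> S" shows "continuous_on {0..T} (\<lambda>s. W s x)"
  unfolding W_def L_eq[OF x]
  by (intro continuous_intros F_cont x target_in)

text \<open>The density of the compensator: subtracting its time integral from \<open>F\<close>
  inside the exponential offsets both the explicit time dependence of \<open>F\<close> and the
  action of the generator.\<close>

definition dens :: "real \<Rightarrow> 's \<Rightarrow> real" where "dens s x = D s x + W s x"

lemma dens_cont: "x \<in> S \<Longrightarrow> continuous_on {0..T} (\<lambda>s. dens s x)"
  unfolding dens_def by (intro continuous_intros D_cont W_cont)

text \<open>The density is frozen at the right end of the step, to agree with the Riemann sums of
  right-continuous functions. The tolerated relative error \<open>exp (h / T)\<close> multiplies to
  \<open>exp 1\<close> over a grid covering the whole time interval.\<close>

lemma one_step: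
  obtains \<delta> where "0 < \<delta>" "\<And>t h x. 0 \<le> t \<Longrightarrow> 0 < h \<Longrightarrow> t + h \<le> T \<Longrightarrow> h < \<delta> \<Longrightarrow> x \<in> S \<Longrightarrow>
    exp (- (h / T)) * exp (F t x) \<le>
      semigroup_of L h (\<lambda>y. exp (- (h * dens (t + h) y)) * exp (F (t + h) y)) x \<and>
    semigroup_of L h (\<lambda>y. exp (- (h * dens (t + h) y)) * exp (F (t + h) y)) x
      \<le> exp (h / T) * exp (F t x)"
proof -
  \<comment> \<open>An error \<open>2 * e * h\<close> comes from the variation of \<open>D\<close>
    and \<open>W\<close> over the step and another \<open>e * h\<close> from the semigroup
    expansion. Together they make \<open>3 * e * h\<close>, which is half of
    \<open>h / T\<close>.\<close>
  define e where "e = 1 / (6 * T)"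
  have e: "0 < e" using T_pos by (simp add: e_def)
  obtain KF where KF: "0 \<le> KF" "\<And>s x. s \<in> {0..T} \<Longrightarrow> x \<in> S \<Longrightarrow> \<bar>F s x\<bar> \<le> KF"
    by (rule uniform_bound_finite[of S T F, OF finite_S F_cont], assumption, blast)
  obtain KW where KW: "0 \<le> KW" "\<And>s x. s \<in> {0..T} \<Longrightarrow> x \<in> S \<Longrightarrow> \<bar>W s x\<bar> \<le> KW"
    by (rule uniform_bound_finite[of S T W, OF finite_S W_cont], assumption, blast)
  define K where "K = max KF KW"
  have K: "0 \<le> K" "\<And>s x. s \<in> {0..T} \<Longrightarrow> x \<in> S \<Longrightarrow> \<bar>F s x\<bar> \<le> K"
     "\<And>s x. s \<in> {0..T} \<Longrightarrow> x \<in> S \<Longrightarrow> \<bar>W s x\<bar> \<le> K"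
    using KF KW unfolding K_def le_max_iff_disj by blast+
  obtain C where C: "0 \<le> C" "\<And>t F W x. 0 \<le> t \<Longrightarrow> t \<le> 1 \<Longrightarrow> x \<in> S \<Longrightarrow>
      (\<And>y. y \<in> S \<Longrightarrow> \<bar>F y\<bar> \<le> K) \<Longrightarrow> (\<And>y. y \<in> S \<Longrightarrow> \<bar>W y\<bar> \<le> K) \<Longrightarrow>
      (\<And>y. y \<in> S \<Longrightarrow> W y = exp (- F y) * L (\<lambda>z. exp (F z)) y) \<Longrightarrow>
      \<bar>semigroup_of L t (\<lambda>y. exp (F y - t * W y)) x - exp (F x)\<bar> \<le> C * t\<^sup>2 * exp (F x)"
  proof (rule semigroup_compensated[OF K(1)])
    fix C assume 1: "0 \<le> C" and 2: "\<And>t F W x. 0 \<le> t \<Longrightarrow> t \<le> 1 \<Longrightarrow> x \<in> S \<Longrightarrow>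
      (\<And>y. y \<in> S \<Longrightarrow> \<bar>F y\<bar> \<le> K) \<Longrightarrow> (\<And>y. y \<in> S \<Longrightarrow> \<bar>W y\<bar> \<le> K) \<Longrightarrow>
      (\<And>y. y \<in> S \<Longrightarrow> W y = exp (- F y) * L (\<lambda>z. exp (F z)) y) \<Longrightarrow>
      \<bar>semigroup_of L t (\<lambda>y. exp (F y - t * W y)) x - exp (F x)\<bar> \<le> C * t\<^sup>2 * exp (F x)"
    show thesis by (rule that[OF 1]) (rule 2)
  qed
  obtain dD where dD: "0 < dD" "\<And>s u x. s \<in> {0..T} \<Longrightarrow> u \<in> {0..T} \<Longrightarrow> x \<in> S \<Longrightarrow> \<bar>s - u\<bar> < dD \<Longrightarrow> \<bar>D s x - D u x\<bar> < e"
    by (rule uniform_continuity_finite[of S T D, OF finite_S D_cont e], assumption, blast)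
  obtain dW where dW: "0 < dW" "\<And>s u x. s \<in> {0..T} \<Longrightarrow> u \<in> {0..T} \<Longrightarrow> x \<in> S \<Longrightarrow> \<bar>s - u\<bar> < dW \<Longrightarrow> \<bar>W s x - W u x\<bar> < e"
    by (rule uniform_continuity_finite[of S T W, OF finite_S W_cont e], assumption, blast)
  \<comment> \<open>Beyond uniform continuity, the entry \<open>e / (2 * C + 1)\<close> turns the
    quadratic error \<open>C * h^2\<close> into at most \<open>e * h / 2\<close>, and
    \<open>1 / (2 * C + 1)\<close> keeps it below one half, which the lower bound \<open>g2\<close>
    uses.\<close>
  define \<delta> where "\<delta> = Min {1, dD, dW, e / (2 * C + 1), 1 / (2 * C + 1)}"
  have C2: "0 < 2 * C + 1" using C(1) by linarith
  have \<delta>: "0 < \<delta>" "\<delta> \<le> 1" "\<delta> \<le> dD" "\<delta> \<le> dW" "\<delta> \<le> e / (2 * C + 1)" "\<delta> \<le> 1 / (2 * C + 1)"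
    using dD dW e C2 by (auto simp: \<delta>_def)
  show thesis
  proof (rule that[OF \<delta>(1)])
    fix t h x assume t: "0 \<le> t" and h: "0 < h" "t + h \<le> T" "h < \<delta>" and x: "x \<in> S"
    have tT: "t \<in> {0..T}" "t + h \<in> {0..T}" using t h by auto
    define u where "u y = exp (- (h * dens (t + h) y)) * exp (F (t + h) y)" for y
    define v where "v y = exp (F t y - h * W t y)" for y
    define X where "X y = F (t + h) y - F t y - h * dens (t + h) y + h * W t y" for y
    have X: "\<bar>X y\<bar> \<le> 2 * e * h" if y: "y \<in> S" for y
    proof -
      have "\<exists>z\<in>{t<..<t + h}. F (t + h) y - F t y = D z y * (t + h - t)"
      proof (rule mvt_simple)
        fix z assume z: "t \<le> z" "z \<le> t + h"
        have zT: "z \<in> {0..T}" "{t..t + h} \<subseteq> {0..T}" using z t h(2) by auto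
        have "((\<lambda>s. F s y) has_real_derivative D z y) (at z within {t..t + h})"
          by (rule DERIV_subset[OF F_deriv[OF y zT(1)] zT(2)])
        then show "((\<lambda>s. F s y) has_derivative (*) (D z y)) (at z within {t..t + h})"
          by (simp add: has_field_derivative_def)
      qed (use h in auto)
      then obtain z where z: "z \<in> {t<..<t + h}" "F (t + h) y - F t y = D z y * h" by auto
      have "\<bar>D z y - D (t + h) y\<bar> < e"
        using z t h \<delta> y by (intro dD(2)) auto
      moreover have "\<bar>W t y - W (t + h) y\<bar> < e"
        using t h \<delta> y by (intro dW(2)) auto
      ultimately have "\<bar>(D z y - D (t + h) y) + (W t y - W (t + h) y)\<bar> \<le> 2 * e" by linarith
      moreover have "X y = ((D z y - D (t + h) y) + (W t y - W (t + h) y)) * h"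
        using z(2) by (simp add: X_def dens_def algebra_simps)
      ultimately show ?thesis using h(1) by (simp add: abs_mult mult_right_mono)
    qed
    have u: "u y = exp (X y) * v y" for y
      by (simp add: u_def v_def X_def mult_exp_exp)
    have "semigroup_of L h u x \<le> semigroup_of L h (\<lambda>y. exp (2 * e * h) * v y) x"
      unfolding u using X h by (intro semigroup_mono x) (auto simp: v_def abs_le_iff)
    then have up: "semigroup_of L h u x \<le> exp (2 * e * h) * semigroup_of L h v x"
      using semigroup_cmult[OF x, of h] h by simp
    have "semigroup_of L h (\<lambda>y. exp (- (2 * e * h)) * v y) x \<le> semigroup_of L h u x"
      unfolding u using X h by (intro semigroup_mono x) (auto simp: v_def abs_le_iff minus_le_iff)
    then have lo: "exp (- (2 * e * h)) * semigroup_of L h v x \<le> semigroup_of L h u x"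
      using semigroup_cmult[OF x, of h] h by simp
    have v: "\<bar>semigroup_of L h v x - exp (F t x)\<bar> \<le> C * h\<^sup>2 * exp (F t x)"
      unfolding v_def
    proof (rule C(2)[OF _ _ x])
      show "\<And>y. y \<in> S \<Longrightarrow> W t y = exp (- F t y) * L (\<lambda>z. exp (F t z)) y" by (simp add: W_def)
    qed (use h \<delta> K tT in auto)
    have hC: "2 * C * h \<le> e" "2 * C * h \<le> 1"
    proof -
      have "(2 * C + 1) * h \<le> (2 * C + 1) * \<delta>" using h C2 by (intro mult_left_mono) auto
      moreover have "(2 * C + 1) * \<delta> \<le> e" "(2 * C + 1) * \<delta> \<le> 1"
        using \<delta>(5,6) C2 by (auto simp: field_simps)
      ultimately show "2 * C * h \<le> e" "2 * C * h \<le> 1" using h(1) by (auto simp: algebra_simps)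
    qed
    have Ch: "2 * (C * h\<^sup>2) \<le> e * h" "2 * (C * h\<^sup>2) \<le> 1" "0 \<le> C * h\<^sup>2"
    proof -
      have "2 * C * h * h \<le> e * h" using hC(1) h(1) by (intro mult_right_mono) auto
      moreover have "2 * C * h * h \<le> 1 * 1"
        using hC(2) h \<delta>(2) C(1) by (intro mult_mono) auto
      ultimately show "2 * (C * h\<^sup>2) \<le> e * h" "2 * (C * h\<^sup>2) \<le> 1" "0 \<le> C * h\<^sup>2"
        using C(1) by (auto simp: power2_eq_square mult_ac)
    qed
    have eh: "0 \<le> e * h" using e h by simp
    have g1: "1 + C * h\<^sup>2 \<le> exp (e * h)"
      using exp_ge_add_one_self[of "C * h\<^sup>2"] Ch eh by (smt (verit) exp_le_cancel_iff)
    \<comment> \<open>The elementary inequality behind it is that \<open>(1 - a) (1 + 2 a)\<close>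
      is at least 1 for \<open>a\<close> between 0 and one half.\<close>
    have g2: "exp (- (e * h)) \<le> 1 - C * h\<^sup>2"
    proof -
      let ?a = "C * h\<^sup>2"
      have "0 \<le> ?a * (1 - 2 * ?a)" by (rule mult_nonneg_nonneg) (use Ch in linarith)+
      then have "1 \<le> (1 - ?a) * (1 + 2 * ?a)" by (simp add: algebra_simps)
      also have "1 + 2 * ?a \<le> exp (e * h)" using exp_ge_add_one_self[of "e * h"] Ch(1) by linarith
      then have "(1 - ?a) * (1 + 2 * ?a) \<le> (1 - ?a) * exp (e * h)"
        using Ch by (intro mult_left_mono) auto
      finally show ?thesis by (simp add: exp_minus field_simps)
    qed
    have v_up: "semigroup_of L h v x \<le> exp (e * h) * exp (F t x)"
    proof -
      have "semigroup_of L h v x \<le> (1 + C * h\<^sup>2) * exp (F t x)"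
        using v by (auto simp: abs_le_iff algebra_simps)
      also have "\<dots> \<le> exp (e * h) * exp (F t x)" using g1 by (intro mult_right_mono) auto
      finally show ?thesis .
    qed
    have v_lo: "exp (- (e * h)) * exp (F t x) \<le> semigroup_of L h v x"
    proof -
      have "exp (- (e * h)) * exp (F t x) \<le> (1 - C * h\<^sup>2) * exp (F t x)" using g2 by (intro mult_right_mono) auto
      also have "\<dots> \<le> semigroup_of L h v x" using v by (auto simp: abs_le_iff algebra_simps)
      finally show ?thesis .
    qed
    have eT: "3 * (e * h) \<le> h / T" using T_pos h by (simp add: e_def field_simps)
    have "semigroup_of L h u x \<le> exp (2 * e * h) * (exp (e * h) * exp (F t x))"
      using up v_up by (meson exp_ge_zero mult_left_mono order_trans)
    also have "\<dots> = exp (3 * (e * h)) * exp (F t x)" by (simp add: mult_exp_exp algebra_simps)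
    also have "\<dots> \<le> exp (h / T) * exp (F t x)" using eT by (intro mult_right_mono) auto
    finally have 1: "semigroup_of L h u x \<le> exp (h / T) * exp (F t x)" .
    have "exp (- (h / T)) * exp (F t x) \<le> exp (- (3 * (e * h))) * exp (F t x)"
      using eT by (intro mult_right_mono) auto
    also have "\<dots> = exp (- (2 * e * h)) * (exp (- (e * h)) * exp (F t x))" by (simp add: mult_exp_exp algebra_simps)
    also have "\<dots> \<le> semigroup_of L h u x"
      using lo v_lo by (meson exp_ge_zero mult_left_mono order_trans)
    finally have 2: "exp (- (h / T)) * exp (F t x) \<le> semigroup_of L h u x" .
    show "exp (- (h / T)) * exp (F t x) \<le>
        semigroup_of L h (\<lambda>y. exp (- (h * dens (t + h) y)) * exp (F (t + h) y)) x \<and>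
      semigroup_of L h (\<lambda>y. exp (- (h * dens (t + h) y)) * exp (F (t + h) y)) x
        \<le> exp (h / T) * exp (F t x)"
      using 1 2 unfolding u_def by simp
  qed
qed

end

context markov_chain
begin

lemma time_integral:
  fixes g :: "real \<Rightarrow> 's \<Rightarrow> real"
  assumes g: "\<And>x. x \<in> S \<Longrightarrow> continuous_on {0..T} (\<lambda>s. g s x)" and \<omega>: "\<omega> \<in> space M"
  shows time_integrable: "(\<lambda>s. g s (Z s \<omega>)) integrable_on {0..T}"
    and time_integral_riemann: "(\<lambda>n. \<Sum>i<Suc n. T / Suc n * g (Suc i * (T / Suc n)) (Z (Suc i * (T / Suc n)) \<omega>))
      \<longlonglongrightarrow> integral {0..T} (\<lambda>s. g s (Z s \<omega>))"
proof -
  obtain K where K: "\<And>s x. s \<in> {0..T} \<Longrightarrow> x \<in> S \<Longrightarrow> \<bar>g s x\<bar> \<le> K"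
    by (rule uniform_bound_finite[of S T g, OF finite_S g], assumption, blast)
  have bd: "\<bar>g s (Z s \<omega>)\<bar> \<le> K" if "s \<in> {0..T}" for s using K that Z_in[OF that \<omega>] by blast
  have rc: "((\<lambda>s. g s (Z s \<omega>)) \<longlongrightarrow> g s (Z s \<omega>)) (at_right s)" if s: "s \<in> {0..<T}" for s
  proof -
    have x: "Z s \<omega> \<in> S" using s Z_in[OF _ \<omega>] by auto
    have "((\<lambda>r. g r (Z s \<omega>)) \<longlongrightarrow> g s (Z s \<omega>)) (at s within {0..T})"
      using g[OF x] s by (auto simp: continuous_on_def)
    then have "((\<lambda>r. g r (Z s \<omega>)) \<longlongrightarrow> g s (Z s \<omega>)) (at s within {s..T})"
      by (rule tendsto_within_subset) (use s in auto)
    then have "((\<lambda>r. g r (Z s \<omega>)) \<longlongrightarrow> g s (Z s \<omega>)) (at_right s)"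
      using s by (simp add: at_within_Icc_at_right)
    moreover have "\<forall>\<^sub>F r in at_right s. g r (Z s \<omega>) = g r (Z r \<omega>)"
      using right_constant[OF \<omega> s] by eventually_elim simp
    ultimately show ?thesis by (rule Lim_transform_eventually)
  qed
  show "(\<lambda>s. g s (Z s \<omega>)) integrable_on {0..T}"
    by (rule right_continuous_integrable[OF T_pos bd rc])
  show "(\<lambda>n. \<Sum>i<Suc n. T / Suc n * g (Suc i * (T / Suc n)) (Z (Suc i * (T / Suc n)) \<omega>))
      \<longlonglongrightarrow> integral {0..T} (\<lambda>s. g s (Z s \<omega>))"
    by (rule right_continuous_riemann(2)[OF T_pos bd rc])
qed

lemma times_grid: "times (\<lambda>i. real i * (T / Suc n)) (Suc n)"
proof -
  have "real i * (T / Suc n) \<le> real (Suc i) * (T / Suc n)" for i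
    using T_pos by (intro mult_right_mono) auto
  then show ?thesis using T_pos by (auto simp: times_def simp del: of_nat_Suc)
qed

lemma measurable_Z_real [measurable]:
  assumes "t \<in> {0..T}"
  shows "(\<lambda>\<omega>. f (Z t \<omega>) :: real) \<in> borel_measurable M"
  by (rule measurable_compose[OF measurable_Z[OF assms]]) simp

lemma measurable_time_integral:
  fixes g :: "real \<Rightarrow> 's \<Rightarrow> real"
  assumes g: "\<And>x. x \<in> S \<Longrightarrow> continuous_on {0..T} (\<lambda>s. g s x)"
  shows "(\<lambda>\<omega>. integral {0..T} (\<lambda>s. g s (Z s \<omega>))) \<in> borel_measurable M"
proof (rule borel_measurable_LIMSEQ_metric[of "\<lambda>n \<omega>. \<Sum>i<Suc n. T / Suc n * g (real (Suc i) * (T / Suc n)) (Z (real (Suc i) * (T / Suc n)) \<omega>)"])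
  show "\<And>\<omega>. \<omega> \<in> space M \<Longrightarrow> (\<lambda>n. \<Sum>i<Suc n. T / Suc n * g (Suc i * (T / Suc n)) (Z (Suc i * (T / Suc n)) \<omega>))
      \<longlonglongrightarrow> integral {0..T} (\<lambda>s. g s (Z s \<omega>))"
    by (rule time_integral_riemann[OF g])
  fix n
  have "real (Suc i) * (T / Suc n) \<in> {0..T}" if "i \<in> {..<Suc n}" for i
    using times_in[OF times_grid[of n], of "Suc i"] that by (simp only: lessThan_iff Suc_le_eq)
  then show "(\<lambda>\<omega>. \<Sum>i<Suc n. T / Suc n * g (Suc i * (T / Suc n)) (Z (Suc i * (T / Suc n)) \<omega>)) \<in> borel_measurable M"
    by (intro borel_measurable_sum borel_measurable_times measurable_const measurable_Z_real)
qed

end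

context exponential_martingale
begin

text \<open>The logarithm of the terminal value without the initial term; the exponential of
  \<open>F 0 (Z 0)\<close> appears on the other side of the moment bounds.\<close>

definition X :: "'w \<Rightarrow> real" where
  "X \<omega> = F T (Z T \<omega>) - integral {0..T} (\<lambda>s. dens s (Z s \<omega>))"

lemma measurable_X: "X \<in> borel_measurable M"
  unfolding X_def[abs_def] using T_pos
  by (intro borel_measurable_diff measurable_Z_real measurable_time_integral dens_cont) auto

text \<open>On the grid with \<open>n + 1\<close> steps the one-step bounds multiply to the factors
  \<open>exp 1\<close> and \<open>exp (- 1)\<close>, whatever \<open>n\<close> is. The discretised
  exponentials are bounded uniformly and converge pointwise, so the bounds pass to the limit by
  dominated convergence.\<close>

lemma expectation_exp_X:
  shows integrable_exp_X: "integrable M (\<lambda>\<omega>. exp (X \<omega>))"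
    and expectation_exp_X_le: "expectation (\<lambda>\<omega>. exp (X \<omega>)) \<le> exp 1 * expectation (\<lambda>\<omega>. exp (F 0 (Z 0 \<omega>)))"
    and expectation_exp_X_ge: "exp (- 1) * expectation (\<lambda>\<omega>. exp (F 0 (Z 0 \<omega>))) \<le> expectation (\<lambda>\<omega>. exp (X \<omega>))"
proof -
  define h where "h n = T / Suc n" for n
  define t where "t n i = real i * h n" for n i
  define Y where "Y n \<omega> = exp (F T (Z T \<omega>) - (\<Sum>i<Suc n. h n * dens (t n (Suc i)) (Z (t n (Suc i)) \<omega>)))" for n \<omega>
  have h: "0 < h n" "real (Suc n) * h n = T" for n using T_pos by (auto simp: h_def)
  have t: "times (t n) (Suc n)" for n
    using times_grid[of n] by (simp add: t_def[abs_def] h_def)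
  obtain KF where KF: "0 \<le> KF" "\<And>s x. s \<in> {0..T} \<Longrightarrow> x \<in> S \<Longrightarrow> \<bar>F s x\<bar> \<le> KF"
    by (rule uniform_bound_finite[of S T F, OF finite_S F_cont], assumption, blast)
  obtain KD where KD: "0 \<le> KD" "\<And>s x. s \<in> {0..T} \<Longrightarrow> x \<in> S \<Longrightarrow> \<bar>dens s x\<bar> \<le> KD"
    by (rule uniform_bound_finite[of S T dens, OF finite_S dens_cont], assumption, blast)
  have lim: "(\<lambda>n. Y n \<omega>) \<longlonglongrightarrow> exp (X \<omega>)" if "\<omega> \<in> space M" for \<omega>
    unfolding Y_def X_def t_def h_def
    by (intro tendsto_intros time_integral_riemann dens_cont that)
  have meas: "Y n \<in> borel_measurable M" for n
    unfolding Y_def using times_in[OF t] T_pos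
    by (intro measurable_compose[OF _ borel_measurable_exp] borel_measurable_diff borel_measurable_sum
      borel_measurable_times measurable_const measurable_Z_real) auto
  have bound: "norm (Y n \<omega>) \<le> exp (KF + T * KD)" if "\<omega> \<in> space M" for n \<omega>
  proof -
    have "\<bar>F T (Z T \<omega>)\<bar> \<le> KF" using KF T_pos Z_in[OF _ that] by simp
    moreover have "\<bar>\<Sum>i<Suc n. h n * dens (t n (Suc i)) (Z (t n (Suc i)) \<omega>)\<bar> \<le> (\<Sum>i<Suc n. h n * KD)"
    proof (rule order_trans[OF sum_abs sum_mono])
      fix i assume "i \<in> {..<Suc n}"
      then have "t n (Suc i) \<in> {0..T}" by (intro times_in[OF t]) auto
      then show "\<bar>h n * dens (t n (Suc i)) (Z (t n (Suc i)) \<omega>)\<bar> \<le> h n * KD"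
        using KD Z_in[OF _ that] h(1)[of n] by (simp add: abs_mult)
    qed
    moreover have "(\<Sum>i<Suc n. h n * KD) = T * KD" using h(2)[of n] by (simp flip: mult.assoc)
    ultimately have "F T (Z T \<omega>) - (\<Sum>i<Suc n. h n * dens (t n (Suc i)) (Z (t n (Suc i)) \<omega>)) \<le> KF + T * KD"
      by linarith
    then show ?thesis by (simp only: Y_def real_norm_def abs_exp_cancel exp_le_cancel_iff)
  qed
  have "integrable M (\<lambda>\<omega>. exp (X \<omega>)) \<and> (\<lambda>n. expectation (Y n)) \<longlonglongrightarrow> expectation (\<lambda>\<omega>. exp (X \<omega>))"
    using integrable_dominated_convergence[of "\<lambda>\<omega>. exp (X \<omega>)" M Y "\<lambda>_. exp (KF + T * KD)"]
      integral_dominated_convergence[of "\<lambda>\<omega>. exp (X \<omega>)" M Y "\<lambda>_. exp (KF + T * KD)"]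
      measurable_X lim meas bound by auto
  then have int: "integrable M (\<lambda>\<omega>. exp (X \<omega>))"
    and conv: "(\<lambda>n. expectation (Y n)) \<longlonglongrightarrow> expectation (\<lambda>\<omega>. exp (X \<omega>))" by auto
  obtain \<delta> where \<delta>: "0 < \<delta>" and step: "\<And>t h x. 0 \<le> t \<Longrightarrow> 0 < h \<Longrightarrow> t + h \<le> T \<Longrightarrow> h < \<delta> \<Longrightarrow> x \<in> S \<Longrightarrow>
    exp (- (h / T)) * exp (F t x) \<le>
      semigroup_of L h (\<lambda>y. exp (- (h * dens (t + h) y)) * exp (F (t + h) y)) x \<and>
    semigroup_of L h (\<lambda>y. exp (- (h * dens (t + h) y)) * exp (F (t + h) y)) x
      \<le> exp (h / T) * exp (F t x)"
    by (rule one_step) blast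
  have hl: "h \<longlonglongrightarrow> 0" unfolding h_def by (intro LIMSEQ_Suc lim_const_over_n)
  have ev: "\<forall>\<^sub>F n in sequentially. h n < \<delta>" by (rule order_tendstoD(2)[OF hl \<delta>])
  have Y_prod: "Y n \<omega> = (\<Prod>i=1..Suc n. exp (- (h n * dens (t n i) (Z (t n i) \<omega>)))) * exp (F (t n (Suc n)) (Z (t n (Suc n)) \<omega>))" for n \<omega>
  proof -
    have "t n (Suc n) = T" using h(2) by (simp add: t_def)
    moreover have "(\<Prod>i=1..Suc n. exp (- (h n * dens (t n i) (Z (t n i) \<omega>))))
        = exp (- (\<Sum>i<Suc n. h n * dens (t n (Suc i)) (Z (t n (Suc i)) \<omega>)))"
      unfolding One_nat_def prod.atLeast1_atMost_eq by (simp add: exp_sum sum_negf[symmetric] del: sum.lessThan_Suc prod.lessThan_Suc)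
    ultimately show ?thesis unfolding Y_def by (simp add: mult_exp_exp)
  qed
  have ts: "t n (Suc i) = t n i + h n" "0 \<le> t n i" for n i using h(1)[of n] by (auto simp: t_def algebra_simps)
  have tT: "t n i + h n \<le> T" if "i < Suc n" for n i
    using times_in[OF t[of n], of "Suc i"] that ts(1)[of n i] by simp
  have t0: "t n 0 = 0" for n by (simp add: t_def)
  have bounds: "expectation (Y n) \<le> exp 1 * expectation (\<lambda>\<omega>. exp (F 0 (Z 0 \<omega>)))"
    "exp (- 1) * expectation (\<lambda>\<omega>. exp (F 0 (Z 0 \<omega>))) \<le> expectation (Y n)" if n: "h n < \<delta>" for n
  proof -
    have "exp (h n / T) ^ Suc n = exp (real (Suc n) * (h n / T))" by (rule exp_of_nat_mult[symmetric])
    also have "real (Suc n) * (h n / T) = real (Suc n) * h n / T" by (rule times_divide_eq_right)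
    also have "\<dots> = 1" using h(2)[of n] T_pos by (simp only: divide_self)
    finally have c1: "exp (h n / T) ^ Suc n = exp 1" .
    have c2: "exp (- (h n / T)) ^ Suc n = exp (- 1)"
      unfolding exp_minus power_inverse c1 by simp
    have "expectation (Y n) \<le> exp (h n / T) ^ Suc n * expectation (\<lambda>\<omega>. exp (F (t n 0) (Z 0 \<omega>)))"
      unfolding Y_prod
    proof (rule expectation_prod_bounds[OF t])
      fix i x assume "i < Suc n" "x \<in> S"
      then show "semigroup_of L (t n (Suc i) - t n i) (\<lambda>y. exp (- (h n * dens (t n (Suc i)) y)) * exp (F (t n (Suc i)) y)) x
          \<le> exp (h n / T) * exp (F (t n i) x)"
        using step[OF ts(2)[of n i] h(1)[of n] tT[OF \<open>i < Suc n\<close>] n \<open>x \<in> S\<close>] ts(1)[of n i] by simp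
    qed auto
    then show "expectation (Y n) \<le> exp 1 * expectation (\<lambda>\<omega>. exp (F 0 (Z 0 \<omega>)))" unfolding c1 t0 .
    \<comment> \<open>The lower bound is the same product estimate for the negated terminal
      function, with step factor \<open>exp (- (h n / T))\<close>.\<close>
    have "expectation (\<lambda>\<omega>. (\<Prod>i=1..Suc n. exp (- (h n * dens (t n i) (Z (t n i) \<omega>)))) * - exp (F (t n (Suc n)) (Z (t n (Suc n)) \<omega>)))
        \<le> exp (- (h n / T)) ^ Suc n * expectation (\<lambda>\<omega>. - exp (F (t n 0) (Z 0 \<omega>)))"
    proof (rule expectation_prod_bounds[OF t])
      fix i x assume i: "i < Suc n" "x \<in> S"
      have "semigroup_of L (t n (Suc i) - t n i) (\<lambda>y. exp (- (h n * dens (t n (Suc i)) y)) * - exp (F (t n (Suc i)) y)) x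
        = - semigroup_of L (t n (Suc i) - t n i) (\<lambda>y. exp (- (h n * dens (t n (Suc i)) y)) * exp (F (t n (Suc i)) y)) x"
        using semigroup_cmult[OF i(2), of "h n" "-1"] h(1)[of n] ts(1)[of n i] by simp
      then show "semigroup_of L (t n (Suc i) - t n i) (\<lambda>y. exp (- (h n * dens (t n (Suc i)) y)) * - exp (F (t n (Suc i)) y)) x
          \<le> exp (- (h n / T)) * - exp (F (t n i) x)"
        using step[OF ts(2)[of n i] h(1)[of n] tT[OF i(1)] n i(2)] ts(1)[of n i] by simp
    qed auto
    then show "exp (- 1) * expectation (\<lambda>\<omega>. exp (F 0 (Z 0 \<omega>))) \<le> expectation (Y n)"
      unfolding Y_prod c2 t0 by simp
  qed
  show "integrable M (\<lambda>\<omega>. exp (X \<omega>))" by (rule int)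
  show "expectation (\<lambda>\<omega>. exp (X \<omega>)) \<le> exp 1 * expectation (\<lambda>\<omega>. exp (F 0 (Z 0 \<omega>)))"
    by (rule tendsto_upperbound[OF conv]) (use ev in eventually_elim, auto simp: bounds)
  show "exp (- 1) * expectation (\<lambda>\<omega>. exp (F 0 (Z 0 \<omega>))) \<le> expectation (\<lambda>\<omega>. exp (X \<omega>))"
    by (rule tendsto_lowerbound[OF conv]) (use ev in eventually_elim, auto simp: bounds)
qed

end

section \<open>The exclusion process\<close>

definition mass :: "nat \<Rightarrow> (nat \<Rightarrow> nat) \<Rightarrow> real" where
  "mass N \<eta> = (\<Sum>x = 1..N - 1. real (\<eta> x)) / real N"

lemma mass_path_apply: "t \<in> {0..T} \<Longrightarrow> mass_path T N \<zeta> t = mass N (\<zeta> t)"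
  by (simp add: mass_path_def total_mass_empirical_measure mass_def)

lemma configs_val: "\<eta> \<in> configs N \<Longrightarrow> x \<in> {1..N - 1} \<Longrightarrow> \<eta> x = 0 \<or> \<eta> x = 1"
  by (auto simp: configs_def PiE_def Pi_def)

lemma configs_le_one: "\<eta> \<in> configs N \<Longrightarrow> x \<in> {1..N - 1} \<Longrightarrow> real (\<eta> x) \<le> 1"
  using configs_val[of \<eta> N x] by auto

lemma mass_bounds:
  assumes "\<eta> \<in> configs N"
  shows "0 \<le> mass N \<eta>" "mass N \<eta> \<le> 1"
proof -
  have "(\<Sum>x = 1..N - 1. real (\<eta> x)) \<le> (\<Sum>x = 1..N - 1. 1)"
    by (intro sum_mono configs_le_one[OF assms])
  also have "\<dots> \<le> real N" by simp
  finally show "0 \<le> mass N \<eta>" "mass N \<eta> \<le> 1"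
    by (auto simp: mass_def divide_le_eq sum_nonneg)
qed

lemma finite_configs: "finite (configs N)"
  unfolding configs_def by (intro finite_PiE) auto

lemma configs_discrete:
  assumes "\<eta> \<in> configs N"
  shows "\<exists>U. open U \<and> \<eta> \<in> U \<and> U \<inter> configs N = {\<eta>}"
proof (intro exI conjI)
  let ?U = "\<Inter>x\<in>{1..N - 1}. (\<lambda>f. f x) -` {\<eta> x}"
  show "open ?U"
  proof (intro open_INT ballI)
    fix x
    have "continuous_on UNIV (\<lambda>f :: nat \<Rightarrow> nat. f x)" by (rule continuous_on_product_coordinates)
    then show "open ((\<lambda>f. f x) -` {\<eta> x})"
      by (intro open_vimage discrete_topology_class.open_discrete)
  qed simp
  show "\<eta> \<in> ?U" by simp
  have "\<xi> = \<eta>" if "\<xi> \<in> ?U" "\<xi> \<in> configs N" for \<xi>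
  proof (rule PiE_ext[of \<xi> "{1..N - 1}" "\<lambda>_. {0, 1}"])
    show "\<xi> \<in> {1..N - 1} \<rightarrow>\<^sub>E {0, 1}" "\<eta> \<in> {1..N - 1} \<rightarrow>\<^sub>E {0, 1}"
      using that assms by (auto simp: configs_def)
  qed (use that in auto)
  then show "?U \<inter> configs N = {\<eta>}" using assms by auto
qed

lemma swap_in_configs: "\<eta> \<in> configs N \<Longrightarrow> x \<in> {1..N - 2} \<Longrightarrow> swap x (x + 1) \<eta> \<in> configs N"
proof -
  assume \<eta>: "\<eta> \<in> configs N" and x: "x \<in> {1..N - 2}"
  have "x \<in> {1..N - 1}" "x + 1 \<in> {1..N - 1}" using x by auto
  then show ?thesis
    using \<eta> unfolding configs_def swap_def by (intro PiE_I) (auto simp: PiE_iff extensional_def)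
qed

lemma flip_in_configs: "\<eta> \<in> configs N \<Longrightarrow> x \<in> {1..N - 1} \<Longrightarrow> flip x \<eta> \<in> configs N"
  unfolding configs_def flip_def by (auto simp: PiE_def extensional_def Pi_def)

definition jump_index :: "nat \<Rightarrow> (nat + nat) set" where
  "jump_index N = {1..N - 2} <+> {1, N - 1}"

definition flip_rate :: "real \<Rightarrow> real \<Rightarrow> nat \<Rightarrow> (nat \<Rightarrow> nat) \<Rightarrow> real" where
  "flip_rate \<alpha> \<beta> x \<eta> =
     boundary_rate \<alpha> \<beta> x * (1 - real (\<eta> x)) + (1 - boundary_rate \<alpha> \<beta> x) * real (\<eta> x)"

definition jump_rate :: "real \<Rightarrow> real \<Rightarrow> nat \<Rightarrow> nat + nat \<Rightarrow> (nat \<Rightarrow> nat) \<Rightarrow> real" where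
  "jump_rate \<alpha> \<beta> N j \<eta> = (case j of Inl x \<Rightarrow> real N ^ 3 | Inr x \<Rightarrow> real N * flip_rate \<alpha> \<beta> x \<eta>)"

definition jump_target :: "nat + nat \<Rightarrow> (nat \<Rightarrow> nat) \<Rightarrow> nat \<Rightarrow> nat" where
  "jump_target j = (case j of Inl x \<Rightarrow> swap x (x + 1) | Inr x \<Rightarrow> flip x)"

definition linear_obs :: "nat \<Rightarrow> (nat \<Rightarrow> real) \<Rightarrow> (nat \<Rightarrow> nat) \<Rightarrow> real" where
  "linear_obs N a \<eta> = (\<Sum>x = 1..N - 1. a x * real (\<eta> x))"

lemma linear_obs_swap:
  assumes x: "x \<in> {1..N - 2}"
  shows "linear_obs N a (swap x (x + 1) \<eta>) =
    linear_obs N a \<eta> + (a (x + 1) - a x) * (real (\<eta> x) - real (\<eta> (x + 1)))"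
proof -
  have split: "linear_obs N a \<xi> = a x * real (\<xi> x) + (a (x + 1) * real (\<xi> (x + 1))
      + (\<Sum>y\<in>{1..N - 1} - {x} - {x + 1}. a y * real (\<xi> y)))" for \<xi>
    unfolding linear_obs_def using x
    by (subst sum.remove[of _ x]; (subst sum.remove[of _ "x + 1"])?) auto
  have "(\<Sum>y\<in>{1..N - 1} - {x} - {x + 1}. a y * real (swap x (x + 1) \<eta> y))
      = (\<Sum>y\<in>{1..N - 1} - {x} - {x + 1}. a y * real (\<eta> y))"
    by (intro sum.cong refl) (auto simp: swap_def)
  then show ?thesis unfolding split by (simp add: swap_def algebra_simps)
qed

lemma linear_obs_flip:
  assumes x: "x \<in> {1..N - 1}" and \<eta>: "\<eta> \<in> configs N"
  shows "linear_obs N a (flip x \<eta>) = linear_obs N a \<eta> + a x * (1 - 2 * real (\<eta> x))"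
proof -
  have split: "linear_obs N a \<xi> = a x * real (\<xi> x) + (\<Sum>y\<in>{1..N - 1} - {x}. a y * real (\<xi> y))" for \<xi>
    unfolding linear_obs_def using x by (subst sum.remove[of _ x]) auto
  have "(\<Sum>y\<in>{1..N - 1} - {x}. a y * real (flip x \<eta> y)) = (\<Sum>y\<in>{1..N - 1} - {x}. a y * real (\<eta> y))"
    by (intro sum.cong refl) (auto simp: flip_def)
  moreover have "real (flip x \<eta> x) = 1 - real (\<eta> x)"
    using configs_val[OF \<eta> x] by (auto simp: flip_def)
  ultimately show ?thesis unfolding split by (simp add: right_diff_distrib)
qed

lemma bulk_summation:
  "(\<Sum>x = 1..n. real x * (f x - f (x + 1))) = (\<Sum>x = 1..n. f x) - real n * f (n + 1)" for f :: "nat \<Rightarrow> real"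
  by (induction n) (auto simp: algebra_simps)

lemma bulk_telescope: "(\<Sum>x = 1..n. f x - f (x + 1)) = f 1 - f (n + 1)" for f :: "nat \<Rightarrow> real"
  by (induction n) auto

text \<open>The slope in the occupation number: the boundary rate times the exponential increment
  equals \<open>r (exp p - 1)\<close> plus the occupation times \<open>bdry r p\<close>. These
  slopes are what the correction has to transfer from the boundary sites to the mean.\<close>

definition bdry :: "real \<Rightarrow> real \<Rightarrow> real" where
  "bdry r p = - r * (exp p - 1) + (1 - r) * (exp (- p) - 1)"

definition bdry' :: "real \<Rightarrow> real \<Rightarrow> real" where
  "bdry' r p = - r * exp p - (1 - r) * exp (- p)"

lemma bdry_deriv: "(bdry r has_real_derivative bdry' r p) (at p)"
  unfolding bdry_def bdry'_def by (auto intro!: derivative_eq_intros)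

lemma bdry_abs_le:
  assumes r: "0 < r" "r < 1" and p: "\<bar>p\<bar> \<le> K"
  shows "\<bar>bdry r p\<bar> \<le> exp K" "\<bar>bdry' r p\<bar> \<le> exp K"
proof -
  have e: "0 < exp p" "exp p \<le> exp K" "0 < exp (- p)" "exp (- p) \<le> exp K" and K: "1 \<le> exp K"
    using p by auto
  have "r * \<bar>exp p - 1\<bar> + (1 - r) * \<bar>exp (- p) - 1\<bar> \<le> r * exp K + (1 - r) * exp K"
    using r by (intro add_mono mult_left_mono) (use e K in linarith)+
  moreover have "\<bar>bdry r p\<bar> \<le> r * \<bar>exp p - 1\<bar> + (1 - r) * \<bar>exp (- p) - 1\<bar>"
    unfolding bdry_def using abs_triangle_ineq[of "- r * (exp p - 1)" "(1 - r) * (exp (- p) - 1)"] r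
    by (simp add: abs_mult)
  ultimately show "\<bar>bdry r p\<bar> \<le> exp K" by (simp add: algebra_simps)
  have "r * exp p + (1 - r) * exp (- p) \<le> r * exp K + (1 - r) * exp K"
    using e r by (intro add_mono mult_left_mono) auto
  moreover have "0 \<le> r * exp p + (1 - r) * exp (- p)" using r by simp
  ultimately show "\<bar>bdry' r p\<bar> \<le> exp K" by (simp add: bdry'_def algebra_simps)
qed

text \<open>The integrand in \<open>J_functional\<close>: the Hamiltonian of a birth and death
  dynamics with birth rate \<open>2 \<gamma> (1 - a)\<close> and death rate
  \<open>2 (1 - \<gamma>) a\<close>.\<close>

definition hamiltonian :: "real \<Rightarrow> real \<Rightarrow> real \<Rightarrow> real" where
  "hamiltonian \<gamma> a p = 2 * \<gamma> * (1 - a) * (exp p - 1) + 2 * (1 - \<gamma>) * a * (exp (- p) - 1)"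

text \<open>The profile \<open>corr N\<close> has discrete gradient \<open>x / (N - 1)\<close>, and \<open>corr N x - (x - 1)\<close> has
  gradient \<open>x / (N - 1) - 1\<close>. The bulk generator maps the corresponding linear observables to
  the mean occupation minus the occupation at \<open>N - 1\<close> and at \<open>1\<close>, so that they replace
  the boundary occupations by the mean occupation.\<close>

definition corr :: "nat \<Rightarrow> nat \<Rightarrow> real" where
  "corr N x = real x * (real x - 1) / (2 * real (N - 1))"

text \<open>This is \<open>a\<close> times the profile that replaces the occupation at 1, plus
  \<open>b\<close> times the one that replaces the occupation at \<open>N - 1\<close>. The two have
  been combined so that the discrete gradient is visibly affine in \<open>x\<close>.\<close>

definition corr_coeff :: "nat \<Rightarrow> real \<Rightarrow> real \<Rightarrow> nat \<Rightarrow> real" where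
  "corr_coeff N a b x = (a + b) * corr N x - a * (real x - 1)"

lemma corr_coeff_diff:
  assumes "2 \<le> N"
  shows "corr_coeff N a b (x + 1) - corr_coeff N a b x = (a + b) * (real x / real (N - 1)) - a"
proof -
  have "corr N (x + 1) - corr N x = real x / real (N - 1)"
    unfolding corr_def diff_divide_distrib[symmetric] using assms by (simp add: field_simps)
  moreover have "corr_coeff N a b (x + 1) - corr_coeff N a b x = (a + b) * (corr N (x + 1) - corr N x) - a"
    by (simp add: corr_coeff_def algebra_simps)
  ultimately show ?thesis by simp
qed

lemma corr_coeff_diff_le:
  assumes "2 \<le> N" "x \<in> {1..N - 1}" and a: "\<bar>a\<bar> \<le> R" and b: "\<bar>b\<bar> \<le> R"
  shows "\<bar>corr_coeff N a b (x + 1) - corr_coeff N a b x\<bar> \<le> 3 * R"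
proof -
  have "0 \<le> real x / real (N - 1)" "real x / real (N - 1) \<le> 1" using assms by (auto simp: divide_le_eq)
  then have "\<bar>a + b\<bar> * \<bar>real x / real (N - 1)\<bar> \<le> (2 * R) * 1" using a b by (intro mult_mono) auto
  then show ?thesis
    unfolding corr_coeff_diff[OF assms(1)] abs_mult[symmetric] using a
      abs_triangle_ineq4[of "(a + b) * (real x / real (N - 1))" a] by linarith
qed

lemma corr_coeff_le:
  assumes "2 \<le> N" "x \<in> {1..N - 1}" and a: "\<bar>a\<bar> \<le> R" and b: "\<bar>b\<bar> \<le> R"
  shows "\<bar>corr_coeff N a b x\<bar> \<le> 3 * R * N"
proof -
  have x: "1 \<le> real x" "real x \<le> real (N - 1)" "real (N - 1) \<le> N" using assms by auto
  have R: "0 \<le> R" using a by linarith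
  have "0 \<le> corr N x" using x by (simp add: corr_def)
  moreover have "corr N x \<le> N"
  proof -
    have "real x * (real x - 1) \<le> real (N - 1) * real N" using x by (intro mult_mono) auto
    also have "\<dots> \<le> real N * (2 * real (N - 1))" by simp
    finally show ?thesis using x by (simp add: corr_def divide_le_eq)
  qed
  ultimately have "\<bar>a + b\<bar> * \<bar>corr N x\<bar> \<le> (2 * R) * N" using a b by (intro mult_mono) auto
  moreover have "\<bar>a\<bar> * \<bar>real x - 1\<bar> \<le> R * N" using a x R by (intro mult_mono) auto
  moreover have "\<bar>corr_coeff N a b x\<bar> \<le> \<bar>a + b\<bar> * \<bar>corr N x\<bar> + \<bar>a\<bar> * \<bar>real x - 1\<bar>"
    unfolding corr_coeff_def abs_mult[symmetric] by (rule abs_triangle_ineq4)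
  ultimately show ?thesis by linarith
qed

lemma abs_sum_configs_le:
  assumes \<eta>: "\<eta> \<in> configs N" and N: "1 \<le> N" and c: "\<And>x. x \<in> {1..N - 1} \<Longrightarrow> \<bar>c x\<bar> \<le> R * N" and R: "0 \<le> R"
  shows "\<bar>\<Sum>x = 1..N - 1. c x / (real N)\<^sup>2 * real (\<eta> x)\<bar> \<le> R"
proof -
  have "\<bar>\<Sum>x = 1..N - 1. c x / (real N)\<^sup>2 * real (\<eta> x)\<bar> \<le> (\<Sum>x = 1..N - 1. R / N)"
  proof (rule order_trans[OF sum_abs sum_mono])
    fix x assume x: "x \<in> {1..N - 1}"
    have "\<bar>c x\<bar> / (real N)\<^sup>2 * real (\<eta> x) \<le> (R * N) / (real N)\<^sup>2 * 1"
      using c[OF x] configs_le_one[OF \<eta> x] R by (intro mult_mono divide_right_mono) auto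
    also have "\<dots> = R / N" using N by (simp add: power2_eq_square)
    finally show "\<bar>c x / (real N)\<^sup>2 * real (\<eta> x)\<bar> \<le> R / N" by (simp add: abs_mult)
  qed
  also have "\<dots> = real (N - 1) / real N * R" by simp
  also have "\<dots> \<le> 1 * R" using R by (intro mult_right_mono) (auto simp: divide_le_eq)
  finally show ?thesis by simp
qed

lemma linear_obs_corrected:
  assumes "1 \<le> N"
  shows "linear_obs N (\<lambda>x. p + c x / (real N)\<^sup>2) \<eta> = real N * mass N \<eta> * p + (\<Sum>x = 1..N - 1. c x / (real N)\<^sup>2 * real (\<eta> x))"
proof -
  have "real N * mass N \<eta> * p = (\<Sum>x = 1..N - 1. p * real (\<eta> x))"
    using assms by (simp add: mass_def sum_distrib_left[symmetric])
  then show ?thesis by (simp add: linear_obs_def distrib_right sum.distrib)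
qed

locale exclusion_generator =
  fixes \<alpha> \<beta> :: real and N :: nat
  assumes \<alpha>: "0 < \<alpha>" "\<alpha> < 1" and \<beta>: "0 < \<beta>" "\<beta> < 1" and N: "3 \<le> N"
begin

lemma boundary_rate_bounds: "0 < boundary_rate \<alpha> \<beta> x" "boundary_rate \<alpha> \<beta> x < 1"
  using \<alpha> \<beta> by (auto simp: boundary_rate_def)

lemma flip_rate_bounds:
  assumes "\<eta> \<in> configs N" "x \<in> {1..N - 1}"
  shows "0 \<le> flip_rate \<alpha> \<beta> x \<eta>" "flip_rate \<alpha> \<beta> x \<eta> \<le> 1"
  using configs_val[OF assms] boundary_rate_bounds[of x] by (auto simp: flip_rate_def)

sublocale jump_generator "configs N" "accelerated_gen \<alpha> \<beta> N" "jump_index N" "jump_rate \<alpha> \<beta> N" jump_target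
proof
  show "finite (configs N)" by (rule finite_configs)
  fix j \<eta> assume j: "j \<in> jump_index N" and \<eta>: "\<eta> \<in> configs N"
  show "0 \<le> jump_rate \<alpha> \<beta> N j \<eta>"
    using j flip_rate_bounds[OF \<eta>] N by (auto simp: jump_index_def jump_rate_def)
  show "jump_target j \<eta> \<in> configs N"
    using j swap_in_configs[OF \<eta>] flip_in_configs[OF \<eta>] N by (auto simp: jump_index_def jump_target_def)
next
  fix f \<eta> assume "\<eta> \<in> configs N"
  show "accelerated_gen \<alpha> \<beta> N f \<eta> =
      (\<Sum>j\<in>jump_index N. jump_rate \<alpha> \<beta> N j \<eta> * (f (jump_target j \<eta>) - f \<eta>))"
    unfolding jump_index_def
    by (subst sum.Plus) (simp_all add: accelerated_gen_def bulk_gen_def boundary_gen_def jump_rate_def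
      jump_target_def flip_rate_def sum_distrib_left o_def mult_ac)
qed

lemma gen_exp_linear:
  assumes \<eta>: "\<eta> \<in> configs N"
  shows "exp (- linear_obs N a \<eta>) * accelerated_gen \<alpha> \<beta> N (\<lambda>\<xi>. exp (linear_obs N a \<xi>)) \<eta> =
    real N ^ 3 * (\<Sum>x = 1..N - 2. exp ((a (x + 1) - a x) * (real (\<eta> x) - real (\<eta> (x + 1)))) - 1)
    + real N * (\<Sum>x\<in>{1, N - 1}. flip_rate \<alpha> \<beta> x \<eta> * (exp (a x * (1 - 2 * real (\<eta> x))) - 1))"
proof -
  let ?F = "linear_obs N a"
  have e: "exp (- ?F \<eta>) * (exp (?F \<eta> + z) - exp (?F \<eta>)) = exp z - 1" for z
    by (simp add: algebra_simps mult_exp_exp)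
  have 1: "exp (- ?F \<eta>) * bulk_gen N (\<lambda>\<xi>. exp (?F \<xi>)) \<eta> =
      (\<Sum>x = 1..N - 2. exp ((a (x + 1) - a x) * (real (\<eta> x) - real (\<eta> (x + 1)))) - 1)"
    unfolding bulk_gen_def sum_distrib_left
    by (intro sum.cong refl) (simp only: linear_obs_swap e)
  have 2: "exp (- ?F \<eta>) * boundary_gen \<alpha> \<beta> N (\<lambda>\<xi>. exp (?F \<xi>)) \<eta> =
      (\<Sum>x\<in>{1, N - 1}. flip_rate \<alpha> \<beta> x \<eta> * (exp (a x * (1 - 2 * real (\<eta> x))) - 1))"
    unfolding boundary_gen_def sum_distrib_left flip_rate_def[symmetric]
  proof (intro sum.cong refl)
    fix x assume "x \<in> {1, N - 1}"
    then have x: "x \<in> {1..N - 1}" using N by auto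
    show "exp (- ?F \<eta>) * (flip_rate \<alpha> \<beta> x \<eta> * (exp (?F (flip x \<eta>)) - exp (?F \<eta>)))
        = flip_rate \<alpha> \<beta> x \<eta> * (exp (a x * (1 - 2 * real (\<eta> x))) - 1)"
      unfolding linear_obs_flip[OF x \<eta>] e[symmetric] by (simp only: mult_ac)
  qed
  show ?thesis unfolding accelerated_gen_def 1[symmetric] 2[symmetric] by (simp add: algebra_simps)
qed

text \<open>To first order the bulk contribution of the correction cancels the boundary occupations
  exactly. Three errors remain, all bounded in \<open>N\<close>: the second-order bulk term, which
  gives \<open>9 R^2 exp (3 R)\<close>; the change of the boundary exponentials by a correction of
  size \<open>3 R / N\<close>, which gives \<open>3 R^2 exp (3 R)\<close> at each of two sites with
  rate of order \<open>N\<close>; and the passage from the average over \<open>N - 1\<close> sites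
  to the mass, normalised by \<open>N\<close>, which gives \<open>2 R\<close>.\<close>

lemma gen_exp_corrected:
  assumes \<eta>: "\<eta> \<in> configs N" and p: "\<bar>p\<bar> \<le> K" and \<gamma>: "\<gamma> = (\<alpha> + \<beta>) / 2"
    and a: "a = bdry \<alpha> p" and b: "b = bdry \<beta> p" and R: "R = exp K"
    and f: "f = (\<lambda>x. p + corr_coeff N a b x / (real N)\<^sup>2)"
  shows "\<bar>exp (- linear_obs N f \<eta>) * accelerated_gen \<alpha> \<beta> N (\<lambda>\<xi>. exp (linear_obs N f \<xi>)) \<eta>
      - real N * hamiltonian \<gamma> (mass N \<eta>) p\<bar> \<le> 9 * R\<^sup>2 * exp (3 * R) + 6 * R\<^sup>2 * exp (3 * R) + 2 * R"
proof -
  define n where "n = N - 1"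
  have n: "2 \<le> n" "N = n + 1" "real N = real n + 1" using N by (auto simp: n_def)
  have N2: "2 \<le> N" "0 < real N" "1 \<le> real N" using N by auto
  have R1: "1 \<le> R" "0 \<le> R" using p R by auto
  have ab: "\<bar>a\<bar> \<le> R" "\<bar>b\<bar> \<le> R" unfolding a b R using \<alpha> \<beta> p by (auto intro: bdry_abs_le)
  define d where "d x = corr_coeff N a b (x + 1) - corr_coeff N a b x" for x
  define z where "z x = d x * (real (\<eta> x) - real (\<eta> (x + 1))) / (real N)\<^sup>2" for x
  define mh where "mh = (\<Sum>x = 1..n. real (\<eta> x)) / real n"
  have z_eq: "(f (x + 1) - f x) * (real (\<eta> x) - real (\<eta> (x + 1))) = z x" for x
    unfolding f z_def d_def by (simp add: diff_divide_distrib left_diff_distrib)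
  have bulk: "\<bar>real N ^ 3 * (\<Sum>x = 1..N - 2. exp (z x) - 1) - real N ^ 3 * (\<Sum>x = 1..N - 2. z x)\<bar> \<le> 9 * R\<^sup>2 * exp (3 * R)"
  proof -
    have z1: "\<bar>z x\<bar> \<le> 3 * R / (real N)\<^sup>2" if x: "x \<in> {1..N - 2}" for x
    proof -
      have x': "x \<in> {1..N - 1}" "x + 1 \<in> {1..N - 1}" using x N by auto
      have "\<bar>real (\<eta> x) - real (\<eta> (x + 1))\<bar> \<le> 1"
        using configs_val[OF \<eta> x'(1)] configs_val[OF \<eta> x'(2)] by auto
      then have "\<bar>d x\<bar> * \<bar>real (\<eta> x) - real (\<eta> (x + 1))\<bar> \<le> 3 * R * 1"
        unfolding d_def by (intro mult_mono corr_coeff_diff_le N2 x' ab) (use R1 in auto)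
      then show ?thesis unfolding z_def by (simp add: abs_mult divide_right_mono)
    qed
    have "\<bar>real N ^ 3 * (\<Sum>x = 1..N - 2. exp (z x) - 1) - real N ^ 3 * (\<Sum>x = 1..N - 2. z x)\<bar>
        = real N ^ 3 * \<bar>\<Sum>x = 1..N - 2. exp (z x) - 1 - z x\<bar>"
      by (simp add: right_diff_distrib[symmetric] sum_subtractf[symmetric] abs_mult)
    also have "\<dots> \<le> real N ^ 3 * (\<Sum>x = 1..N - 2. 9 * R\<^sup>2 * exp (3 * R) / real N ^ 4)"
    proof (intro mult_left_mono order_trans[OF sum_abs sum_mono])
      fix x assume x: "x \<in> {1..N - 2}"
      have "(3 * R / (real N)\<^sup>2)\<^sup>2 = 9 * R\<^sup>2 / real N ^ 4"
        by (simp add: power_divide power_mult_distrib flip: power_mult)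
      moreover have "(z x)\<^sup>2 \<le> (3 * R / (real N)\<^sup>2)\<^sup>2" using z1[OF x] by (metis power2_abs power_mono abs_ge_zero)
      ultimately have z2: "(z x)\<^sup>2 \<le> 9 * R\<^sup>2 / real N ^ 4" by simp
      have "3 * R / (real N)\<^sup>2 \<le> 3 * R / 1"
        using R1 N2 by (intro divide_left_mono) (auto simp: one_le_power)
      then have "\<bar>z x\<bar> \<le> 3 * R" using z1[OF x] by simp
      then have "(z x)\<^sup>2 * exp \<bar>z x\<bar> \<le> 9 * R\<^sup>2 / real N ^ 4 * exp (3 * R)"
        using z2 by (intro mult_mono) auto
      then show "\<bar>exp (z x) - 1 - z x\<bar> \<le> 9 * R\<^sup>2 * exp (3 * R) / real N ^ 4"
        using abs_exp_taylor[of "z x"] by simp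
    qed simp
    also have "\<dots> = real (N - 2) / real N * (9 * R\<^sup>2 * exp (3 * R))"
      using N2 by (simp add: power_numeral_reduce field_simps)
    also have "\<dots> \<le> 1 * (9 * R\<^sup>2 * exp (3 * R))" by (intro mult_right_mono) (auto simp: divide_le_eq)
    finally show ?thesis by simp
  qed
  \<comment> \<open>The gradient is affine in \<open>x\<close>, so summation by parts and
    telescoping leave only the mean and the two boundary occupations. The speed \<open>N^3\<close>
    against the size \<open>N^(-2)\<close> gives order \<open>N\<close>, the same as the accelerated
    boundary dynamics.\<close>
  have zsum: "real N ^ 3 * (\<Sum>x = 1..N - 2. z x) = real N * ((a + b) * mh - a * real (\<eta> 1) - b * real (\<eta> n))"
  proof -
    have Nn: "N - 2 = n - 1" by (simp add: n_def)
    have "(\<Sum>x = 1..N - 2. z x) * (real N)\<^sup>2 = (\<Sum>x = 1..n - 1. d x * (real (\<eta> x) - real (\<eta> (x + 1))))"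
      unfolding sum_distrib_right Nn using N2 by (intro sum.cong refl) (simp add: z_def)
    also have "\<dots> = (\<Sum>x = 1..n - 1. (a + b) / real n * (real x * (real (\<eta> x) - real (\<eta> (x + 1))))
        - a * (real (\<eta> x) - real (\<eta> (x + 1))))"
      unfolding d_def corr_coeff_diff[OF N2(1)] n_def[symmetric]
      by (intro sum.cong refl) (simp add: left_diff_distrib)
    also have "\<dots> = (a + b) / real n * ((\<Sum>x = 1..n - 1. real (\<eta> x)) - real (n - 1) * real (\<eta> n))
        - a * (real (\<eta> 1) - real (\<eta> n))"
      using bulk_summation[of "\<lambda>x. real (\<eta> x)" "n - 1"] bulk_telescope[of "\<lambda>x. real (\<eta> x)" "n - 1"] n(1)
        sum_subtractf[of "\<lambda>x. (a + b) / real n * (real x * (real (\<eta> x) - real (\<eta> (x + 1))))"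
          "\<lambda>x. a * (real (\<eta> x) - real (\<eta> (x + 1)))" "{1..n - 1}"]
      by (simp only: sum_distrib_left[symmetric]) simp
    also have "(\<Sum>x = 1..n - 1. real (\<eta> x)) - real (n - 1) * real (\<eta> n) = real n * mh - real n * real (\<eta> n)"
    proof -
      have "(\<Sum>x = 1..n. real (\<eta> x)) = (\<Sum>x = 1..n - 1. real (\<eta> x)) + real (\<eta> n)"
        using n(1) sum.nat_ivl_Suc'[of 1 "n - 1" "\<lambda>x. real (\<eta> x)"] by simp
      moreover have "real n * mh = (\<Sum>x = 1..n. real (\<eta> x))" using n(1) by (simp add: mh_def)
      ultimately show ?thesis using n(1) by (simp add: of_nat_diff algebra_simps)
    qed
    also have "(a + b) / real n * (real n * mh - real n * real (\<eta> n)) = (a + b) * (mh - real (\<eta> n))"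
      using n(1) by (simp add: field_simps)
    finally have "(\<Sum>x = 1..N - 2. z x) * (real N)\<^sup>2 = (a + b) * mh - a * real (\<eta> 1) - b * real (\<eta> n)"
      by (simp add: algebra_simps)
    then show ?thesis by (simp add: power3_eq_cube power2_eq_square mult_ac)
  qed
  have bd: "\<bar>real N * (flip_rate \<alpha> \<beta> x \<eta> * (exp (f x * (1 - 2 * real (\<eta> x))) - 1))
      - real N * (r * (exp p - 1) + real (\<eta> x) * bdry r p)\<bar> \<le> 3 * R\<^sup>2 * exp (3 * R)"
    if x: "x \<in> {1..N - 1}" and r: "r = boundary_rate \<alpha> \<beta> x" for x r
  proof -
    define s where "s = 1 - 2 * real (\<eta> x)"
    define e where "e = corr_coeff N a b x / (real N)\<^sup>2"
    have s: "s = 1 \<or> s = -1" using configs_val[OF \<eta> x] by (auto simp: s_def)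
    have e1: "flip_rate \<alpha> \<beta> x \<eta> * (exp (p * s) - 1) = r * (exp p - 1) + real (\<eta> x) * bdry r p"
      using configs_val[OF \<eta> x] unfolding flip_rate_def r[symmetric] s_def bdry_def
      by (auto simp: algebra_simps)
    have e2: "f x * (1 - 2 * real (\<eta> x)) = p * s + e * s"
      by (simp add: f s_def e_def algebra_simps)
    have "real N * (flip_rate \<alpha> \<beta> x \<eta> * (exp (f x * (1 - 2 * real (\<eta> x))) - 1))
      - real N * (r * (exp p - 1) + real (\<eta> x) * bdry r p)
      = real N * (flip_rate \<alpha> \<beta> x \<eta> * (exp (p * s) * (exp (e * s) - 1)))"
      unfolding e2 e1[symmetric] exp_add by (simp add: algebra_simps)
    moreover have "\<bar>real N * (flip_rate \<alpha> \<beta> x \<eta> * (exp (p * s) * (exp (e * s) - 1)))\<bar>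
        \<le> real N * (1 * (R * (3 * R / N * exp (3 * R))))"
    proof -
      have ps: "\<bar>p * s\<bar> \<le> K" using s p by auto
      have es: "\<bar>e * s\<bar> \<le> 3 * R / N"
      proof -
        have "\<bar>e * s\<bar> = \<bar>corr_coeff N a b x\<bar> / (real N)\<^sup>2" using s by (auto simp: e_def)
        also have "\<dots> \<le> 3 * R * N / (real N)\<^sup>2"
          by (intro divide_right_mono corr_coeff_le N2 x ab) auto
        also have "\<dots> = 3 * R / N" using N2 by (simp add: power2_eq_square)
        finally show ?thesis .
      qed
      also have "3 * R / N \<le> 3 * R / 1" using N2 R1 by (intro divide_left_mono) auto
      finally have es': "\<bar>e * s\<bar> \<le> 3 * R" by simp
      have "\<bar>exp (e * s) - 1\<bar> \<le> \<bar>e * s\<bar> * exp \<bar>e * s\<bar>"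
      proof -
        have "1 - y \<le> exp (- y)" "1 + y \<le> exp y" for y :: real using exp_ge_add_one_self by (metis add_uminus_conv_diff, blast)
        from this(1)[of "e * s"] this(2)[of "e * s"] have "exp (e * s) - 1 \<le> e * s * exp (e * s)" "e * s \<le> exp (e * s) - 1"
          by (simp_all add: exp_minus field_simps)
        moreover have "e * s * exp (e * s) \<le> \<bar>e * s\<bar> * exp \<bar>e * s\<bar>" by (intro mult_mono) auto
        moreover have "\<bar>e * s\<bar> * 1 \<le> \<bar>e * s\<bar> * exp \<bar>e * s\<bar>" by (intro mult_left_mono) auto
        ultimately show ?thesis by (auto simp: abs_le_iff)
      qed
      also have "\<dots> \<le> 3 * R / N * exp (3 * R)"
        using es es' R1 N2 by (intro mult_mono) auto
      finally have "\<bar>exp (e * s) - 1\<bar> \<le> 3 * R / N * exp (3 * R)" .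
      moreover have "exp (p * s) \<le> R" unfolding R using ps by auto
      ultimately show ?thesis unfolding abs_mult using flip_rate_bounds[OF \<eta> x] R1
        by (intro mult_mono) auto
    qed
    moreover have "real N * (1 * (R * (3 * R / N * exp (3 * R)))) = 3 * R\<^sup>2 * exp (3 * R)"
      using N2 by (simp add: power2_eq_square field_simps)
    ultimately show ?thesis by simp
  qed
  have ne: "1 \<noteq> N - 1" using N by simp
  have b1: "\<bar>real N * (flip_rate \<alpha> \<beta> 1 \<eta> * (exp (f 1 * (1 - 2 * real (\<eta> 1))) - 1))
      - real N * (\<alpha> * (exp p - 1) + real (\<eta> 1) * a)\<bar> \<le> 3 * R\<^sup>2 * exp (3 * R)"
    unfolding a using N by (intro bd) (auto simp: boundary_rate_def)
  have b2: "\<bar>real N * (flip_rate \<alpha> \<beta> n \<eta> * (exp (f n * (1 - 2 * real (\<eta> n))) - 1))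
      - real N * (\<beta> * (exp p - 1) + real (\<eta> n) * b)\<bar> \<le> 3 * R\<^sup>2 * exp (3 * R)"
    unfolding b using N by (intro bd) (auto simp: boundary_rate_def n_def)
  have ham: "\<bar>real N * ((a + b) * mh + 2 * \<gamma> * (exp p - 1)) - real N * hamiltonian \<gamma> (mass N \<eta>) p\<bar> \<le> 2 * R"
  proof -
    have h: "hamiltonian \<gamma> (mass N \<eta>) p = 2 * \<gamma> * (exp p - 1) + mass N \<eta> * (a + b)"
    proof -
      have g: "2 * \<gamma> = \<alpha> + \<beta>" using \<gamma> by simp
      have "hamiltonian \<gamma> (mass N \<eta>) p = 2 * \<gamma> * (1 - mass N \<eta>) * (exp p - 1) + (2 - 2 * \<gamma>) * mass N \<eta> * (exp (- p) - 1)"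
        by (simp add: hamiltonian_def algebra_simps)
      then show ?thesis unfolding a b bdry_def g by (simp add: algebra_simps)
    qed
    have m: "real N * mass N \<eta> = real n * mh" using n(1) by (simp add: mass_def mh_def n_def)
    have "real N * ((a + b) * mh + 2 * \<gamma> * (exp p - 1)) - real N * hamiltonian \<gamma> (mass N \<eta>) p
        = (a + b) * (real N * mh - real N * mass N \<eta>)"
      unfolding h by (simp add: algebra_simps)
    also have "real N * mh - real N * mass N \<eta> = mh" unfolding m unfolding n(3) by (simp add: distrib_right)
    finally have e: "real N * ((a + b) * mh + 2 * \<gamma> * (exp p - 1)) - real N * hamiltonian \<gamma> (mass N \<eta>) p = (a + b) * mh" .
    have "(\<Sum>x = 1..n. real (\<eta> x)) \<le> (\<Sum>x = 1..n. 1)"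
      unfolding n_def by (intro sum_mono configs_le_one[OF \<eta>])
    then have "mh \<le> 1" "0 \<le> mh" using n(1) by (auto simp: mh_def divide_le_eq sum_nonneg)
    then have "\<bar>a + b\<bar> * \<bar>mh\<bar> \<le> (2 * R) * 1" using ab by (intro mult_mono) auto
    then show ?thesis unfolding e abs_mult by simp
  qed
  have "exp (- linear_obs N f \<eta>) * accelerated_gen \<alpha> \<beta> N (\<lambda>\<xi>. exp (linear_obs N f \<xi>)) \<eta>
      = real N ^ 3 * (\<Sum>x = 1..N - 2. exp (z x) - 1)
        + (real N * (flip_rate \<alpha> \<beta> 1 \<eta> * (exp (f 1 * (1 - 2 * real (\<eta> 1))) - 1))
        + real N * (flip_rate \<alpha> \<beta> n \<eta> * (exp (f n * (1 - 2 * real (\<eta> n))) - 1)))"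
    unfolding gen_exp_linear[OF \<eta>] z_eq n_def using ne by (simp add: algebra_simps)
  moreover have "real N ^ 3 * (\<Sum>x = 1..N - 2. z x) + (real N * (\<alpha> * (exp p - 1) + real (\<eta> 1) * a)
      + real N * (\<beta> * (exp p - 1) + real (\<eta> n) * b)) = real N * ((a + b) * mh + 2 * \<gamma> * (exp p - 1))"
  proof -
    have g: "2 * \<gamma> = \<alpha> + \<beta>" using \<gamma> by simp
    show ?thesis unfolding zsum g by (simp add: algebra_simps)
  qed
  ultimately show ?thesis using bulk b1 b2 ham by linarith
qed

end

lemma C1_on_derivative:
  assumes "G \<in> C1_on T" "0 < T"
  obtains G' where "continuous_on {0..T} G'"
    "\<And>s. s \<in> {0..T} \<Longrightarrow> (G has_real_derivative G' s) (at s within {0..T})"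
    "\<And>s. s \<in> {0..T} \<Longrightarrow> vector_derivative G (at s within {0..T}) = G' s"
proof -
  obtain G' where c: "continuous_on {0..T} G'"
    and d: "\<And>s. s \<in> {0..T} \<Longrightarrow> (G has_vector_derivative G' s) (at s within {0..T})"
    using assms(1) by (auto simp: C1_on_def)
  show thesis
  proof (rule that[OF c])
    fix s assume s: "s \<in> {0..T}"
    show "(G has_real_derivative G' s) (at s within {0..T})"
      using d[OF s] by (simp add: has_real_derivative_iff_has_vector_derivative)
    show "vector_derivative G (at s within {0..T}) = G' s"
      using vector_derivative_within_cbox[of 0 T s G "G' s"] assms(2) s d[OF s] by simp
  qed
qed

lemma C1_onI:
  assumes "continuous_on {0..T} G'"
    "\<And>s. s \<in> {0..T} \<Longrightarrow> (G has_real_derivative G' s) (at s within {0..T})"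
  shows "G \<in> C1_on T"
  using assms by (auto simp: C1_on_def has_real_derivative_iff_has_vector_derivative)

lemma J_functional_eq:
  assumes d: "\<And>s. s \<in> {0..T} \<Longrightarrow> vector_derivative G (at s within {0..T}) = G' s"
  shows "J_functional T \<gamma> G a = a T * G T - a 0 * G 0 - integral {0..T} (\<lambda>s. a s * G' s)
    - integral {0..T} (\<lambda>s. hamiltonian \<gamma> (a s) (G s))"
proof -
  have "integral {0..T} (\<lambda>s. a s * vector_derivative G (at s within {0..T})) = integral {0..T} (\<lambda>s. a s * G' s)"
    by (rule Henstock_Kurzweil_Integration.integral_cong) (simp add: d)
  then show ?thesis by (simp add: J_functional_def hamiltonian_def)
qed

lemma continuous_abs_le:
  fixes g :: "real \<Rightarrow> real"
  assumes "continuous_on {0..T} g"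
  obtains K where "0 \<le> K" "\<And>s. s \<in> {0..T} \<Longrightarrow> \<bar>g s\<bar> \<le> K"
proof -
  have "bounded (g ` {0..T})"
    using assms by (intro compact_imp_bounded compact_continuous_image) auto
  then obtain K where "\<forall>x\<in>g ` {0..T}. norm x \<le> K" by (auto simp: bounded_iff)
  then show thesis by (intro that[of "max 0 K"]) (auto simp: le_max_iff_disj)
qed

section \<open>Exponential moments along the mass path\<close>

locale exclusion_process = exclusion_generator \<alpha> \<beta> N for \<alpha> \<beta> N +
  fixes T :: real and \<eta>0 :: "nat \<Rightarrow> nat" and M :: "'w measure" and Z :: "real \<Rightarrow> 'w \<Rightarrow> nat \<Rightarrow> nat"
  assumes T0: "0 < T" and \<eta>0: "\<eta>0 \<in> configs N"
    and process: "markov_process T (configs N) (accelerated_gen \<alpha> \<beta> N) (return_pmf \<eta>0) M Z"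
begin

sublocale markov_chain "configs N" "accelerated_gen \<alpha> \<beta> N" "jump_index N" "jump_rate \<alpha> \<beta> N" jump_target
    T "return_pmf \<eta>0" M Z
  by unfold_locales (auto simp: T0 process intro: configs_discrete)

abbreviation path :: "'w \<Rightarrow> real \<Rightarrow> real" where
  "path \<omega> \<equiv> mass_path T N (\<lambda>t. Z t \<omega>)"

lemma path_apply: "t \<in> {0..T} \<Longrightarrow> path \<omega> t = mass N (Z t \<omega>)"
  by (rule mass_path_apply)

lemma AE_initial: "AE \<omega> in M. Z 0 \<omega> = \<eta>0"
proof -
  have "prob {\<omega> \<in> space M. Z 0 \<omega> = \<eta>0} = 1"
    using \<eta>0 T0 fdd[of "\<lambda>_. 0" 0 "\<lambda>_. \<eta>0"] by simp
  then show ?thesis by (rule prob_Collect_eq_1[THEN iffD1, rotated])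
     (use event_past[of "\<lambda>_. 0" 0 "\<lambda>_. \<eta>0"] T0 in \<open>auto simp: times_def\<close>)
qed

lemma J_path_eq:
  assumes G: "continuous_on {0..T} G" "continuous_on {0..T} G'"
    "\<And>s. s \<in> {0..T} \<Longrightarrow> vector_derivative G (at s within {0..T}) = G' s" and \<omega>: "\<omega> \<in> space M"
  shows "J_functional T \<gamma> G (path \<omega>) = mass N (Z T \<omega>) * G T - mass N (Z 0 \<omega>) * G 0
    - integral {0..T} (\<lambda>s. mass N (Z s \<omega>) * G' s + hamiltonian \<gamma> (mass N (Z s \<omega>)) (G s))"
proof -
  have i1: "(\<lambda>s. mass N (Z s \<omega>) * G' s) integrable_on {0..T}"
    by (rule time_integrable[of "\<lambda>s x. mass N x * G' s"]) (intro continuous_intros G \<omega>)+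
  have i2: "(\<lambda>s. hamiltonian \<gamma> (mass N (Z s \<omega>)) (G s)) integrable_on {0..T}"
    unfolding hamiltonian_def
    by (rule time_integrable[of "\<lambda>s x. 2 * \<gamma> * (1 - mass N x) * (exp (G s) - 1)
      + 2 * (1 - \<gamma>) * mass N x * (exp (- G s) - 1)"]) (intro continuous_intros G \<omega>)+
  have e: "integral {0..T} (\<lambda>s. path \<omega> s * G' s) = integral {0..T} (\<lambda>s. mass N (Z s \<omega>) * G' s)"
    "integral {0..T} (\<lambda>s. hamiltonian \<gamma> (path \<omega> s) (G s)) = integral {0..T} (\<lambda>s. hamiltonian \<gamma> (mass N (Z s \<omega>)) (G s))"
    by (auto intro!: Henstock_Kurzweil_Integration.integral_cong simp: path_apply)
  have "J_functional T \<gamma> G (path \<omega>) = path \<omega> T * G T - path \<omega> 0 * G 0 - integral {0..T} (\<lambda>s. path \<omega> s * G' s)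
    - integral {0..T} (\<lambda>s. hamiltonian \<gamma> (path \<omega> s) (G s))"
    by (rule J_functional_eq) (rule G(3))
  then show ?thesis
    unfolding e Henstock_Kurzweil_Integration.integral_add[OF i1 i2]
    using T0 by (simp add: path_apply)
qed

lemma measurable_J:
  assumes "G \<in> C1_on T"
  shows "(\<lambda>\<omega>. J_functional T \<gamma> G (path \<omega>)) \<in> borel_measurable M"
proof -
  obtain G' where G': "continuous_on {0..T} G'"
    "\<And>s. s \<in> {0..T} \<Longrightarrow> (G has_real_derivative G' s) (at s within {0..T})"
    "\<And>s. s \<in> {0..T} \<Longrightarrow> vector_derivative G (at s within {0..T}) = G' s"
    using C1_on_derivative[OF assms T0] by blast
  have Gc: "continuous_on {0..T} G" using G'(2) by (rule DERIV_continuous_on)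
  define h where "h s x = mass N x * G' s + hamiltonian \<gamma> (mass N x) (G s)" for s x
  have "continuous_on {0..T} (\<lambda>s. h s x)" for x
    unfolding h_def hamiltonian_def by (intro continuous_intros G'(1) Gc)
  then have "(\<lambda>\<omega>. integral {0..T} (\<lambda>s. h s (Z s \<omega>))) \<in> borel_measurable M"
    by (rule measurable_time_integral)
  moreover have "(\<lambda>\<omega>. mass N (Z T \<omega>)) \<in> borel_measurable M" "(\<lambda>\<omega>. mass N (Z 0 \<omega>)) \<in> borel_measurable M"
    using T0 by (auto intro!: measurable_Z_real)
  ultimately have "(\<lambda>\<omega>. mass N (Z T \<omega>) * G T - mass N (Z 0 \<omega>) * G 0
    - integral {0..T} (\<lambda>s. h s (Z s \<omega>))) \<in> borel_measurable M"
    by (intro borel_measurable_diff borel_measurable_times) auto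
  moreover have "J_functional T \<gamma> G (path \<omega>) = mass N (Z T \<omega>) * G T - mass N (Z 0 \<omega>) * G 0
    - integral {0..T} (\<lambda>s. h s (Z s \<omega>))" if "\<omega> \<in> space M" for \<omega>
    unfolding h_def by (rule J_path_eq[OF Gc G'(1) _ that]) (rule G'(3))
  ultimately show ?thesis by (subst measurable_cong) auto
qed

text \<open>The constant \<open>C\<close> collects 1 from the approximate martingale,
  \<open>3 R\<close> for the correction at each of the two end times, and \<open>T\<close> times the
  error of the density. In the last, \<open>3 R K'\<close> stems from the time derivative of the
  correction and the rest from \<open>gen_exp_corrected\<close>. No term depends on
  \<open>N\<close>, and the initial value factors out because the process starts from a fixed
  configuration.\<close>

lemma exp_J_bounds:
  assumes \<gamma>: "\<gamma> = (\<alpha> + \<beta>) / 2"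
    and G': "continuous_on {0..T} G'"
    "\<And>s. s \<in> {0..T} \<Longrightarrow> (G has_real_derivative G' s) (at s within {0..T})"
    "\<And>s. s \<in> {0..T} \<Longrightarrow> vector_derivative G (at s within {0..T}) = G' s"
    and K: "\<And>s. s \<in> {0..T} \<Longrightarrow> \<bar>G s\<bar> \<le> K" and K': "0 \<le> K'" "\<And>s. s \<in> {0..T} \<Longrightarrow> \<bar>G' s\<bar> \<le> K'"
    and R: "R = exp K" and C: "C = 1 + 6 * R + T * (3 * R * K' + 9 * R\<^sup>2 * exp (3 * R) + 6 * R\<^sup>2 * exp (3 * R) + 2 * R)"
  shows "integrable M (\<lambda>\<omega>. exp (real N * J_functional T \<gamma> G (path \<omega>)))"
    and "expectation (\<lambda>\<omega>. exp (real N * J_functional T \<gamma> G (path \<omega>))) \<le> exp C"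
    and "exp (- C) \<le> expectation (\<lambda>\<omega>. exp (real N * J_functional T \<gamma> G (path \<omega>)))"
proof -
  have Gc: "continuous_on {0..T} G" using G'(2) by (rule DERIV_continuous_on)
  have T0': "0 \<in> {0..T}" "T \<in> {0..T}" using T0 by auto
  have R0: "0 \<le> R" by (simp add: R)
  have N1: "1 \<le> N" "2 \<le> N" using N by auto
  define c where "c s x = corr_coeff N (bdry \<alpha> (G s)) (bdry \<beta> (G s)) x" for s x
  define c' where "c' s x = corr_coeff N (bdry' \<alpha> (G s) * G' s) (bdry' \<beta> (G s) * G' s) x" for s x
  define F where "F s \<eta> = linear_obs N (\<lambda>x. G s + c s x / (real N)\<^sup>2) \<eta>" for s \<eta>
  define D where "D s \<eta> = linear_obs N (\<lambda>x. G' s + c' s x / (real N)\<^sup>2) \<eta>" for s \<eta>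
  have bdry_G: "((\<lambda>s. bdry r (G s)) has_real_derivative bdry' r (G s) * G' s) (at s within {0..T})"
    if "s \<in> {0..T}" for s r
    using DERIV_chain2[OF bdry_deriv G'(2)[OF that]] .
  have c_deriv: "((\<lambda>s. c s x) has_real_derivative c' s x) (at s within {0..T})" if "s \<in> {0..T}" for s x
    unfolding c_def c'_def corr_coeff_def
    by (intro DERIV_diff DERIV_cmult_right DERIV_add bdry_G that)
  interpret E: exponential_martingale "configs N" "accelerated_gen \<alpha> \<beta> N" "jump_index N" "jump_rate \<alpha> \<beta> N"
    jump_target T "return_pmf \<eta>0" M Z F D
  proof
    fix s \<eta> assume s: "s \<in> {0..T}"
    show "((\<lambda>s. F s \<eta>) has_real_derivative D s \<eta>) (at s within {0..T})"
      unfolding F_def D_def linear_obs_def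
      by (intro DERIV_sum DERIV_cmult_right DERIV_add DERIV_cdivide c_deriv G'(2) s)
  next
    fix \<eta>
    show "continuous_on {0..T} (\<lambda>s. D s \<eta>)"
      unfolding D_def linear_obs_def c'_def corr_coeff_def bdry'_def
      by (intro continuous_intros G' Gc) (use N1 in auto)
  qed
  have F_eq: "\<bar>F s \<eta> - real N * mass N \<eta> * G s\<bar> \<le> 3 * R" if s: "s \<in> {0..T}" and \<eta>: "\<eta> \<in> configs N" for s \<eta>
    unfolding F_def linear_obs_corrected[OF N1(1)] add_diff_cancel_left'
  proof (rule abs_sum_configs_le[OF \<eta> N1(1)])
    show "\<bar>c s x\<bar> \<le> 3 * R * real N" if "x \<in> {1..N - 1}" for x
      unfolding c_def R by (rule corr_coeff_le[OF N1(2) that]) (intro bdry_abs_le \<alpha> \<beta> K s)+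
  qed (use R0 in simp)
  have D_eq: "\<bar>D s \<eta> - real N * mass N \<eta> * G' s\<bar> \<le> 3 * R * K'" if s: "s \<in> {0..T}" and \<eta>: "\<eta> \<in> configs N" for s \<eta>
    unfolding D_def linear_obs_corrected[OF N1(1)] add_diff_cancel_left'
  proof (rule abs_sum_configs_le[OF \<eta> N1(1)])
    have "\<bar>bdry' r (G s) * G' s\<bar> \<le> R * K'" if "0 < r" "r < 1" for r
      unfolding R abs_mult using K[OF s] K' s that by (intro mult_mono bdry_abs_le) auto
    then have "\<bar>c' s x\<bar> \<le> 3 * (R * K') * real N" if "x \<in> {1..N - 1}" for x
      unfolding c'_def by (intro corr_coeff_le[OF N1(2) that]) (use \<alpha> \<beta> in auto)
    then show "\<bar>c' s x\<bar> \<le> 3 * R * K' * real N" if "x \<in> {1..N - 1}" for x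
      using that by (simp add: mult.assoc)
  qed (use R0 K' in simp)
  define B where "B = 9 * R\<^sup>2 * exp (3 * R) + 6 * R\<^sup>2 * exp (3 * R) + 2 * R"
  have W_eq: "\<bar>E.W s \<eta> - real N * hamiltonian \<gamma> (mass N \<eta>) (G s)\<bar> \<le> B"
    if s: "s \<in> {0..T}" and \<eta>: "\<eta> \<in> configs N" for s \<eta>
    unfolding E.W_def F_def B_def
    by (rule gen_exp_corrected[OF \<eta> K[OF s] \<gamma> refl refl R]) (simp add: c_def)
  define h where "h s \<eta> = mass N \<eta> * G' s + hamiltonian \<gamma> (mass N \<eta>) (G s)" for s \<eta>
  have h_cont: "continuous_on {0..T} (\<lambda>s. h s \<eta>)" for \<eta>
    unfolding h_def hamiltonian_def by (intro continuous_intros G' Gc)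
  have close: "\<bar>real N * J_functional T \<gamma> G (path \<omega>) - (E.X \<omega> - F 0 (Z 0 \<omega>))\<bar> \<le> C - 1" if \<omega>: "\<omega> \<in> space M" for \<omega>
  proof -
    have i1: "(\<lambda>s. h s (Z s \<omega>)) integrable_on {0..T}" by (rule time_integrable[OF h_cont \<omega>])
    have i1': "(\<lambda>s. real N * h s (Z s \<omega>)) integrable_on {0..T}"
      using integrable_cmul[OF i1, of "real N"] by simp
    have i2: "(\<lambda>s. E.dens s (Z s \<omega>)) integrable_on {0..T}" by (rule time_integrable[OF E.dens_cont \<omega>])
    have J: "J_functional T \<gamma> G (path \<omega>) = mass N (Z T \<omega>) * G T - mass N (Z 0 \<omega>) * G 0 - integral {0..T} (\<lambda>s. h s (Z s \<omega>))"
      unfolding h_def by (rule J_path_eq[OF Gc G'(1) _ \<omega>]) (rule G'(3))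
    have "norm (integral {0..T} (\<lambda>s. real N * h s (Z s \<omega>) - E.dens s (Z s \<omega>))) \<le> (3 * R * K' + B) * measure lborel (cbox 0 T)"
      unfolding cbox_interval[symmetric]
    proof (rule integrable_bound)
      show "0 \<le> 3 * R * K' + B" using R0 K' by (simp add: B_def)
      show "(\<lambda>s. real N * h s (Z s \<omega>) - E.dens s (Z s \<omega>)) integrable_on cbox 0 T"
        unfolding cbox_interval by (intro integrable_diff i1' i2)
      fix s assume "s \<in> cbox 0 T"
      then have s: "s \<in> {0..T}" by simp
      show "norm (real N * h s (Z s \<omega>) - E.dens s (Z s \<omega>)) \<le> 3 * R * K' + B"
        using D_eq[OF s Z_in[OF s \<omega>]] W_eq[OF s Z_in[OF s \<omega>]]
        by (simp add: E.dens_def h_def algebra_simps abs_le_iff)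
    qed
    also have "integral {0..T} (\<lambda>s. real N * h s (Z s \<omega>) - E.dens s (Z s \<omega>))
        = real N * integral {0..T} (\<lambda>s. h s (Z s \<omega>)) - integral {0..T} (\<lambda>s. E.dens s (Z s \<omega>))"
      using Henstock_Kurzweil_Integration.integral_diff[OF i1' i2] by simp
    finally have "\<bar>real N * integral {0..T} (\<lambda>s. h s (Z s \<omega>)) - integral {0..T} (\<lambda>s. E.dens s (Z s \<omega>))\<bar> \<le> T * (3 * R * K' + B)"
      using T0 by (simp add: mult.commute)
    moreover have "C - 1 = 3 * R + 3 * R + T * (3 * R * K' + B)" unfolding C B_def by (simp add: algebra_simps)
    moreover have "real N * J_functional T \<gamma> G (path \<omega>) = real N * mass N (Z T \<omega>) * G T - real N * mass N (Z 0 \<omega>) * G 0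
        - real N * integral {0..T} (\<lambda>s. h s (Z s \<omega>))"
      unfolding J by (simp add: algebra_simps)
    ultimately show ?thesis
      using F_eq[OF T0'(1) Z_in[OF T0'(1) \<omega>]] F_eq[OF T0'(2) Z_in[OF T0'(2) \<omega>]]
      unfolding E.X_def by linarith
  qed
  define J where "J \<omega> = exp (real N * J_functional T \<gamma> G (path \<omega>))" for \<omega>
  have "G \<in> C1_on T" by (rule C1_onI[OF G'(1)]) (rule G'(2))
  from measurable_J[OF this, of \<gamma>] have Jm: "J \<in> borel_measurable M"
    unfolding J_def[abs_def] by (intro measurable_compose[OF _ borel_measurable_exp] borel_measurable_times) auto
  have F0: "AE \<omega> in M. F 0 (Z 0 \<omega>) = F 0 \<eta>0" using AE_initial by eventually_elim simp
  have bounds: "AE \<omega> in M. J \<omega> \<le> exp (C - 1 - F 0 \<eta>0) * exp (E.X \<omega>) \<and> exp (- (C - 1) - F 0 \<eta>0) * exp (E.X \<omega>) \<le> J \<omega>"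
    using F0 AE_space
  proof eventually_elim
    case (elim \<omega>)
    then show ?case using close[of \<omega>] by (auto simp: J_def mult_exp_exp abs_le_iff)
  qed
  have iX: "integrable M (\<lambda>\<omega>. c * exp (E.X \<omega>))" for c by (intro integrable_mult_right E.integrable_exp_X)
  have iJ: "integrable M J"
    by (rule Bochner_Integration.integrable_bound[OF iX[of "exp (C - 1 - F 0 \<eta>0)"] Jm])
       (use bounds in eventually_elim, auto simp: J_def)
  have EF: "expectation (\<lambda>\<omega>. exp (F 0 (Z 0 \<omega>))) = exp (F 0 \<eta>0)"
  proof -
    have "expectation (\<lambda>\<omega>. exp (F 0 (Z 0 \<omega>))) = expectation (\<lambda>\<omega>. exp (F 0 \<eta>0))"
    proof (rule integral_cong_AE)
      show "(\<lambda>\<omega>. exp (F 0 (Z 0 \<omega>))) \<in> borel_measurable M"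
        by (rule measurable_Z_real[OF T0'(1), of "\<lambda>x. exp (F 0 x)"])
      show "AE \<omega> in M. exp (F 0 (Z 0 \<omega>)) = exp (F 0 \<eta>0)" using F0 by eventually_elim simp
    qed simp
    then show ?thesis by (simp add: prob_space)
  qed
  show "integrable M (\<lambda>\<omega>. exp (real N * J_functional T \<gamma> G (path \<omega>)))" using iJ by (simp add: J_def[abs_def])
  have "expectation J \<le> expectation (\<lambda>\<omega>. exp (C - 1 - F 0 \<eta>0) * exp (E.X \<omega>))"
    by (intro integral_mono_AE iJ iX) (use bounds in eventually_elim, auto)
  also have "\<dots> = exp (C - 1 - F 0 \<eta>0) * expectation (\<lambda>\<omega>. exp (E.X \<omega>))" by simp
  also have "\<dots> \<le> exp (C - 1 - F 0 \<eta>0) * (exp 1 * exp (F 0 \<eta>0))"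
    using E.expectation_exp_X_le unfolding EF by (intro mult_left_mono) auto
  also have "\<dots> = exp C" by (simp add: mult_exp_exp)
  finally show "expectation (\<lambda>\<omega>. exp (real N * J_functional T \<gamma> G (path \<omega>))) \<le> exp C" by (simp add: J_def[abs_def])
  have "exp (- C) = exp (- (C - 1) - F 0 \<eta>0) * (exp (- 1) * exp (F 0 \<eta>0))" by (simp add: mult_exp_exp)
  also have "\<dots> \<le> exp (- (C - 1) - F 0 \<eta>0) * expectation (\<lambda>\<omega>. exp (E.X \<omega>))"
    using E.expectation_exp_X_ge unfolding EF by (intro mult_left_mono) auto
  also have "\<dots> = expectation (\<lambda>\<omega>. exp (- (C - 1) - F 0 \<eta>0) * exp (E.X \<omega>))" by simp
  also have "\<dots> \<le> expectation J"
    by (intro integral_mono_AE iJ iX) (use bounds in eventually_elim, auto)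
  finally show "exp (- C) \<le> expectation (\<lambda>\<omega>. exp (real N * J_functional T \<gamma> G (path \<omega>)))" by (simp add: J_def[abs_def])
qed

text \<open>Exchanges conserve the mass, so for a constant profile the term of speed
  \<open>N^3\<close> vanishes. Only the two boundary sites contribute, each with rate at most
  \<open>N\<close> and an exponential factor at most \<open>exp \<bar>p\<bar>\<close>.\<close>

lemma gen_exp_mass_le:
  assumes \<eta>: "\<eta> \<in> configs N"
  shows "accelerated_gen \<alpha> \<beta> N (\<lambda>\<xi>. exp (linear_obs N (\<lambda>_. p) \<xi>)) \<eta> \<le> 2 * real N * exp \<bar>p\<bar> * exp (linear_obs N (\<lambda>_. p) \<eta>)"
proof -
  have "exp (- linear_obs N (\<lambda>_. p) \<eta>) * accelerated_gen \<alpha> \<beta> N (\<lambda>\<xi>. exp (linear_obs N (\<lambda>_. p) \<xi>)) \<eta>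
      = real N * (\<Sum>x\<in>{1, N - 1}. flip_rate \<alpha> \<beta> x \<eta> * (exp (p * (1 - 2 * real (\<eta> x))) - 1))"
    unfolding gen_exp_linear[OF \<eta>] by simp
  also have "\<dots> \<le> real N * (\<Sum>x\<in>{1, N - 1}. exp \<bar>p\<bar>)"
  proof (intro mult_left_mono sum_mono)
    fix x assume "x \<in> {1, N - 1}"
    then have x: "x \<in> {1..N - 1}" using N by auto
    have e: "exp (p * (1 - 2 * real (\<eta> x))) \<le> exp \<bar>p\<bar>" using configs_val[OF \<eta> x] by auto
    have "flip_rate \<alpha> \<beta> x \<eta> * (exp (p * (1 - 2 * real (\<eta> x))) - 1) \<le> flip_rate \<alpha> \<beta> x \<eta> * exp \<bar>p\<bar>"
      by (intro mult_left_mono flip_rate_bounds(1)[OF \<eta> x]) (use e in linarith)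
    also have "\<dots> \<le> 1 * exp \<bar>p\<bar>" using flip_rate_bounds[OF \<eta> x] by (intro mult_right_mono) auto
    finally show "flip_rate \<alpha> \<beta> x \<eta> * (exp (p * (1 - 2 * real (\<eta> x))) - 1) \<le> exp \<bar>p\<bar>" by simp
  qed simp
  also have "\<dots> \<le> 2 * real N * exp \<bar>p\<bar>" using N by (simp add: sum.insert_if)
  finally have "exp (linear_obs N (\<lambda>_. p) \<eta>) * (exp (- linear_obs N (\<lambda>_. p) \<eta>) * accelerated_gen \<alpha> \<beta> N (\<lambda>\<xi>. exp (linear_obs N (\<lambda>_. p) \<xi>)) \<eta>)
      \<le> exp (linear_obs N (\<lambda>_. p) \<eta>) * (2 * real N * exp \<bar>p\<bar>)" by (intro mult_left_mono) auto
  moreover have "exp y * (exp (- y) * z) = z" for y z :: real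
    by (simp add: exp_minus_inverse flip: mult.assoc)
  ultimately show ?thesis by (simp only: mult.commute)
qed

lemma linear_obs_const: "linear_obs N (\<lambda>_. p) \<eta> = real N * p * mass N \<eta>"
  using N by (simp add: linear_obs_def mass_def sum_distrib_left[symmetric])

text \<open>The maximal inequality is applied to the exponentials of \<open>p\<close> and
  \<open>- p\<close> times \<open>N\<close> times the mass: a rise or a fall by
  \<open>\<epsilon>\<close> multiplies one of them by \<open>exp (N p \<epsilon>)\<close>, while
  both grow in mean at rate at most \<open>2 N exp p\<close>.\<close>

lemma window_oscillation:
  assumes s: "0 \<le> s" "s < u" "u \<le> T" and p: "0 < p"
  shows "{\<omega> \<in> space M. \<exists>r\<in>{s..u}. \<epsilon> \<le> \<bar>path \<omega> r - path \<omega> s\<bar>} \<in> events"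
    and "prob {\<omega> \<in> space M. \<exists>r\<in>{s..u}. \<epsilon> \<le> \<bar>path \<omega> r - path \<omega> s\<bar>} \<le> 2 * exp (real N * (2 * exp p * (u - s) - p * \<epsilon>))"
proof -
  define A where "A q = {\<omega> \<in> space M. \<exists>r\<in>{s..u}. exp (real N * p * \<epsilon>) * exp (linear_obs N (\<lambda>_. q) (Z s \<omega>)) \<le> exp (linear_obs N (\<lambda>_. q) (Z r \<omega>))}" for q
  have A: "A q \<in> events" "prob (A q) \<le> exp (real N * (2 * exp p * (u - s) - p * \<epsilon>))" if "\<bar>q\<bar> = p" for q
  proof -
    note m = maximal_inequality[OF s, of "\<lambda>\<eta>. exp (linear_obs N (\<lambda>_. q) \<eta>)" "2 * real N * exp p" "exp (real N * p * \<epsilon>)"]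
    show "A q \<in> events" unfolding A_def by (rule m(1)) (use gen_exp_mass_le[of _ q] that in auto)
    have "prob (A q) \<le> exp (2 * real N * exp p * (u - s)) / exp (real N * p * \<epsilon>)"
      unfolding A_def by (rule m(2)) (use gen_exp_mass_le[of _ q] that in auto)
    then show "prob (A q) \<le> exp (real N * (2 * exp p * (u - s) - p * \<epsilon>))"
      by (simp add: exp_diff[symmetric] algebra_simps)
  qed
  have E: "{\<omega> \<in> space M. \<exists>r\<in>{s..u}. \<epsilon> \<le> \<bar>path \<omega> r - path \<omega> s\<bar>} = A p \<union> A (- p)"
  proof -
    have iff: "\<epsilon> \<le> \<bar>path \<omega> r - path \<omega> s\<bar> \<longleftrightarrow>
        exp (real N * p * \<epsilon>) * exp (linear_obs N (\<lambda>_. p) (Z s \<omega>)) \<le> exp (linear_obs N (\<lambda>_. p) (Z r \<omega>)) \<or>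
        exp (real N * p * \<epsilon>) * exp (linear_obs N (\<lambda>_. - p) (Z s \<omega>)) \<le> exp (linear_obs N (\<lambda>_. - p) (Z r \<omega>))"
      if "r \<in> {s..u}" for r \<omega>
    proof -
      have Np: "0 < real N * p" using N p by simp
      have pr: "path \<omega> r = mass N (Z r \<omega>)" "path \<omega> s = mass N (Z s \<omega>)" using that s by (auto simp: path_apply)
      have 1: "real N * p * \<epsilon> + real N * p * x \<le> real N * p * y \<longleftrightarrow> \<epsilon> + x \<le> y" for x y
        unfolding distrib_left[symmetric] using Np by (simp only: mult_le_cancel_left_pos)
      have 2: "real N * p * \<epsilon> + real N * (- p) * x \<le> real N * (- p) * y \<longleftrightarrow> \<epsilon> + y \<le> x" for x y
        using 1[of y x] by (simp add: algebra_simps)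
      show ?thesis unfolding pr linear_obs_const mult_exp_exp exp_le_cancel_iff 1 2 by linarith
    qed
    show ?thesis unfolding A_def using iff by blast
  qed
  show "{\<omega> \<in> space M. \<exists>r\<in>{s..u}. \<epsilon> \<le> \<bar>path \<omega> r - path \<omega> s\<bar>} \<in> events"
    unfolding E using A p by (intro sets.Un) auto
  have "prob (A p \<union> A (- p)) \<le> prob (A p) + prob (A (- p))"
    using A p by (intro measure_Un_le) auto
  then show "prob {\<omega> \<in> space M. \<exists>r\<in>{s..u}. \<epsilon> \<le> \<bar>path \<omega> r - path \<omega> s\<bar>} \<le> 2 * exp (real N * (2 * exp p * (u - s) - p * \<epsilon>))"
    unfolding E using A(2)[of p] A(2)[of "- p"] p by simp
qed

end

text \<open>Increments are measured from the left end of each window, in accordance with the maximal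
  inequality, which compares with the starting time.\<close>

definition osc_bad :: "real \<Rightarrow> nat \<Rightarrow> real \<Rightarrow> (real \<Rightarrow> real) \<Rightarrow> bool" where
  "osc_bad T n \<epsilon> a \<longleftrightarrow> (\<exists>k<n. \<exists>r\<in>{k * (T / n)..Suc k * (T / n)}. \<epsilon> \<le> \<bar>a r - a (k * (T / n))\<bar>)"

lemma exponential_tightness:
  fixes T \<epsilon> L :: real
  assumes T: "0 < T" and \<epsilon>: "0 < \<epsilon>" and L: "0 \<le> L"
  obtains n C where "0 < n" "0 < C"
    "\<And>\<alpha> \<beta> N \<eta>0 (M :: 'w measure) Z. exclusion_process \<alpha> \<beta> N T \<eta>0 M Z \<Longrightarrow>
      {\<omega> \<in> space M. osc_bad T n \<epsilon> (mass_path T N (\<lambda>t. Z t \<omega>))} \<in> sets M \<and>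
      measure M {\<omega> \<in> space M. osc_bad T n \<epsilon> (mass_path T N (\<lambda>t. Z t \<omega>))} \<le> C * exp (- L * real N)"
proof -
  \<comment> \<open>The gain \<open>p * \<epsilon>\<close> in the exponent is made
    \<open>L + 2\<close>. Windows so short that \<open>2 exp p\<close> times their length is at most
    2 then leave a decay rate of at least \<open>L\<close>.\<close>
  define p where "p = (L + 2) / \<epsilon>"
  have p: "0 < p" "p * \<epsilon> = L + 2" using L \<epsilon> by (auto simp: p_def)
  obtain n where n: "T * exp p < real n" using reals_Archimedean2 by blast
  have n0: "0 < real n" using n T by (smt (verit) exp_gt_zero mult_pos_pos)
  have "2 * exp p * (T / n) \<le> 2"
  proof -
    have "2 * exp p * (T / n) = 2 * (T * exp p / n)" by simp
    also have "T * exp p / n \<le> 1" using n n0 by (simp add: divide_le_eq)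
    finally show ?thesis by simp
  qed
  show thesis
  proof (rule that[of n "2 * real n"])
    fix \<alpha> \<beta> N \<eta>0 and M :: "'w measure" and Z
    assume "exclusion_process \<alpha> \<beta> N T \<eta>0 M Z"
    then interpret exclusion_process \<alpha> \<beta> N T \<eta>0 M Z .
    define A where "A k = {\<omega> \<in> space M. \<exists>r\<in>{k * (T / n)..Suc k * (T / n)}. \<epsilon> \<le> \<bar>path \<omega> r - path \<omega> (k * (T / n))\<bar>}" for k :: nat
    have A: "A k \<in> events" "prob (A k) \<le> 2 * exp (- L * real N)" if k: "k < n" for k
    proof -
      have s: "0 \<le> k * (T / n)" "k * (T / n) < Suc k * (T / n)" "Suc k * (T / n) \<le> T"
      proof -
        have h: "0 < T / n" using T n0 by simp
        show "0 \<le> k * (T / n)" using h by (intro mult_nonneg_nonneg) auto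
        show "k * (T / n) < Suc k * (T / n)" using h by (intro mult_strict_right_mono) auto
        have "real (Suc k) * (T / n) \<le> real n * (T / n)" using h k by (intro mult_right_mono) auto
        then show "Suc k * (T / n) \<le> T" using n0 by simp
      qed
      show "A k \<in> events" unfolding A_def by (rule window_oscillation[OF s p(1)])
      have "prob (A k) \<le> 2 * exp (real N * (2 * exp p * (Suc k * (T / n) - k * (T / n)) - p * \<epsilon>))"
        unfolding A_def by (rule window_oscillation[OF s p(1)])
      also have "real (Suc k) * (T / n) - k * (T / n) = T / n"
        by (simp add: distrib_right add_divide_distrib)
      also have "real N * (2 * exp p * (T / n) - p * \<epsilon>) \<le> real N * (- L)"
        using \<open>2 * exp p * (T / n) \<le> 2\<close> p(2) by (intro mult_left_mono) auto
      finally show "prob (A k) \<le> 2 * exp (- L * real N)" by (simp add: mult.commute)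
    qed
    have E: "{\<omega> \<in> space M. osc_bad T n \<epsilon> (path \<omega>)} = (\<Union>k<n. A k)"
      unfolding osc_bad_def A_def by blast
    have "prob (\<Union>k<n. A k) \<le> (\<Sum>k<n. prob (A k))"
      using A by (intro measure_UNION_le) auto
    also have "\<dots> \<le> (\<Sum>k<n. 2 * exp (- L * real N))" using A by (intro sum_mono) auto
    finally show "{\<omega> \<in> space M. osc_bad T n \<epsilon> (path \<omega>)} \<in> events \<and>
      prob {\<omega> \<in> space M. osc_bad T n \<epsilon> (path \<omega>)} \<le> 2 * real n * exp (- L * real N)"
      unfolding E using A by auto
  qed (use n0 in auto)
qed

text \<open>Bounds on \<open>G\<close> and its derivative determine the constant, so one
  \<open>C\<close> serves all \<open>N\<close>, all initial configurations and all realisations of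
  the process.\<close>

lemma exponential_moments:
  fixes T \<alpha> \<beta> \<gamma> :: real
  assumes T: "0 < T" and \<gamma>: "\<gamma> = (\<alpha> + \<beta>) / 2" and G: "G \<in> C1_on T"
  obtains C where "\<And>N \<eta>0 (M :: 'w measure) Z. exclusion_process \<alpha> \<beta> N T \<eta>0 M Z \<Longrightarrow>
      integrable M (\<lambda>\<omega>. exp (real N * J_functional T \<gamma> G (mass_path T N (\<lambda>t. Z t \<omega>)))) \<and>
      integral\<^sup>L M (\<lambda>\<omega>. exp (real N * J_functional T \<gamma> G (mass_path T N (\<lambda>t. Z t \<omega>)))) \<le> exp C \<and>
      exp (- C) \<le> integral\<^sup>L M (\<lambda>\<omega>. exp (real N * J_functional T \<gamma> G (mass_path T N (\<lambda>t. Z t \<omega>))))"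
proof -
  obtain G' where G': "continuous_on {0..T} G'"
    "\<And>s. s \<in> {0..T} \<Longrightarrow> (G has_real_derivative G' s) (at s within {0..T})"
    "\<And>s. s \<in> {0..T} \<Longrightarrow> vector_derivative G (at s within {0..T}) = G' s"
    using C1_on_derivative[OF G T] by blast
  have Gc: "continuous_on {0..T} G" using G'(2) by (rule DERIV_continuous_on)
  obtain K where K: "0 \<le> K" "\<And>s. s \<in> {0..T} \<Longrightarrow> \<bar>G s\<bar> \<le> K" using continuous_abs_le[OF Gc] by blast
  obtain K' where K': "0 \<le> K'" "\<And>s. s \<in> {0..T} \<Longrightarrow> \<bar>G' s\<bar> \<le> K'" using continuous_abs_le[OF G'(1)] by blast
  show thesis
  proof (rule that, intro conjI)
    fix N \<eta>0 and M :: "'w measure" and Z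
    assume "exclusion_process \<alpha> \<beta> N T \<eta>0 M Z"
    then interpret exclusion_process \<alpha> \<beta> N T \<eta>0 M Z .
    note b = exp_J_bounds[OF \<gamma> G' K(2) K' refl refl]
    show "integrable M (\<lambda>\<omega>. exp (real N * J_functional T \<gamma> G (path \<omega>)))" by (rule b(1))
    show "expectation (\<lambda>\<omega>. exp (real N * J_functional T \<gamma> G (path \<omega>))) \<le> exp (1 + 6 * exp K + T * (3 * exp K * K' + 9 * (exp K)\<^sup>2 * exp (3 * exp K) + 6 * (exp K)\<^sup>2 * exp (3 * exp K) + 2 * exp K))"
      by (rule b(2))
    show "exp (- (1 + 6 * exp K + T * (3 * exp K * K' + 9 * (exp K)\<^sup>2 * exp (3 * exp K) + 6 * (exp K)\<^sup>2 * exp (3 * exp K) + 2 * exp K))) \<le> expectation (\<lambda>\<omega>. exp (real N * J_functional T \<gamma> G (path \<omega>)))"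
      by (rule b(3))
  qed
qed

section \<open>Discretisation of step paths\<close>

lemma tendsto_finite_range_eventually:
  fixes a :: "'a \<Rightarrow> real"
  assumes A: "finite A" and ev: "\<forall>\<^sub>F s in F. a s \<in> A" and lim: "(a \<longlongrightarrow> l) F"
  shows "\<forall>\<^sub>F s in F. a s = l"
proof -
  have "open (- (A - {l}))" using A by (intro open_Compl finite_imp_closed finite_Diff)
  then have "\<forall>\<^sub>F s in F. a s \<in> - (A - {l})" using lim by (intro topological_tendstoD) auto
  then show ?thesis using ev by eventually_elim auto
qed

text \<open>This serves measurability. Mass paths take finitely many values, and such a path is the
  Skorohod limit of its samplings on finite grids, so membership in an open set is decided by
  countably many finite-dimensional events.\<close>

locale step_path =
  fixes T :: real and a :: "real \<Rightarrow> real"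
  assumes T: "0 < T" and a: "a \<in> skorohod_paths T" and fin: "finite (a ` {0..T})"
begin

definition jumps :: "real set" where
  "jumps = {t \<in> {0<..T}. \<not> (\<forall>\<^sub>F s in at_left t. a s = a t)}"

lemma right_const:
  assumes t: "t \<in> {0..<T}"
  obtains b where "t < b" "b \<le> T" "\<And>s. t \<le> s \<Longrightarrow> s < b \<Longrightarrow> a s = a t"
proof -
  have "(a \<longlongrightarrow> a t) (at_right t)" using a t by (auto simp: skorohod_paths_def cadlag_on_def)
  moreover have "\<forall>\<^sub>F s in at_right t. a s \<in> a ` {0..T}"
    using eventually_at_right_real[of t T] t by (auto elim!: eventually_mono)
  ultimately have "\<forall>\<^sub>F s in at_right t. a s = a t" using fin by (intro tendsto_finite_range_eventually)
  then obtain b where b: "b > t" "\<And>s. t < s \<Longrightarrow> s < b \<Longrightarrow> a s = a t"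
    by (auto simp: eventually_at_right_field)
  show thesis
  proof (rule that[of "min b T"])
    show "a s = a t" if "t \<le> s" "s < min b T" for s using b(2)[of s] that by (cases "s = t") auto
  qed (use b t in auto)
qed

lemma left_const:
  assumes t: "t \<in> {0<..T}"
  obtains b l where "0 \<le> b" "b < t" "\<And>s. b < s \<Longrightarrow> s < t \<Longrightarrow> a s = l"
proof -
  have "\<exists>l. (a \<longlongrightarrow> l) (at_left t)" using a t unfolding skorohod_paths_def cadlag_on_def by blast
  then obtain l where "(a \<longlongrightarrow> l) (at_left t)" by blast
  moreover have "\<forall>\<^sub>F s in at_left t. a s \<in> a ` {0..T}"
    using eventually_at_left_real[of 0 t] t by (auto elim!: eventually_mono)
  ultimately have "\<forall>\<^sub>F s in at_left t. a s = l" using fin by (intro tendsto_finite_range_eventually)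
  then obtain b where b: "b < t" "\<And>s. b < s \<Longrightarrow> s < t \<Longrightarrow> a s = l"
    by (auto simp: eventually_at_left_field)
  show thesis by (rule that[of "max b 0"]) (use b t in auto)
qed

text \<open>Infinitely many jumps would accumulate at some time. A cadlag path with finite range is
  constant on a punctured one-sided neighbourhood of each time, on either side, which excludes
  this.\<close>

lemma finite_jumps: "finite jumps"
proof (rule ccontr)
  assume inf: "infinite jumps"
  have "jumps \<subseteq> {0..T}" by (auto simp: jumps_def)
  then obtain t where t: "t \<in> {0..T}" "t islimpt jumps"
    using inf Heine_Borel_imp_Bolzano_Weierstrass[of "{0..T}" jumps] by auto
  have "\<forall>\<^sub>F s in at_right t. s \<notin> jumps"
  proof (cases "t = T")
    case True
    show ?thesis using eventually_at_right_real[of t "t + 1"] by (auto elim!: eventually_mono simp: jumps_def True)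
  next
    case False
    then obtain b where b: "t < b" "b \<le> T" "\<And>s. t \<le> s \<Longrightarrow> s < b \<Longrightarrow> a s = a t" using t right_const[of t] by auto
    have "s \<notin> jumps" if s: "t < s" "s < b" for s
    proof -
      have "\<forall>\<^sub>F r in at_left s. r \<in> {t<..<s}" using s by (intro eventually_at_left_real)
      then have "\<forall>\<^sub>F r in at_left s. a r = a s"
      proof eventually_elim
        case (elim r)
        have "a r = a t" "a s = a t" by (intro b(3); use elim s in simp)+
        then show ?case by simp
      qed
      then show ?thesis by (simp add: jumps_def)
    qed
    then show ?thesis using b(1) by (auto simp: eventually_at_right_field)
  qed
  moreover have "\<forall>\<^sub>F s in at_left t. s \<notin> jumps"
  proof (cases "t = 0")
    case True
    show ?thesis using eventually_at_left_real[of "t - 1" t] by (auto elim!: eventually_mono simp: jumps_def True)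
  next
    case False
    then obtain b l where b: "0 \<le> b" "b < t" "\<And>s. b < s \<Longrightarrow> s < t \<Longrightarrow> a s = l" using t left_const[of t] by auto
    have "s \<notin> jumps" if s: "b < s" "s < t" for s
    proof -
      have "\<forall>\<^sub>F r in at_left s. r \<in> {b<..<s}" using s by (intro eventually_at_left_real)
      then have "\<forall>\<^sub>F r in at_left s. a r = a s" using b(3) s by (auto elim!: eventually_mono)
      then show ?thesis by (simp add: jumps_def)
    qed
    then show ?thesis using b(2) by (auto simp: eventually_at_left_field)
  qed
  ultimately have "\<forall>\<^sub>F s in at t. s \<notin> jumps" by (simp add: eventually_at_split)
  then show False using t(2) by (simp add: islimpt_iff_eventually)
qed

text \<open>Away from jumps the path is continuous, and a continuous function with finite range on a
  connected set is constant. A jump at the left end \<open>u\<close> does no harm, since only values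
  to its right are compared with it.\<close>

lemma constant_between_jumps:
  assumes uv: "0 \<le> u" "u \<le> v" "v \<le> T" and J: "jumps \<inter> {u<..v} = {}"
  shows "a u = a v"
proof -
  have "continuous_on {u..v} a"
    unfolding continuous_on_def
  proof
    fix t assume t: "t \<in> {u..v}"
    have R: "\<forall>\<^sub>F s in at_right t. s \<in> {u..v} \<longrightarrow> a s = a t"
    proof (cases "t < T")
      case True
      then obtain b where b: "t < b" "b \<le> T" "\<And>s. t \<le> s \<Longrightarrow> s < b \<Longrightarrow> a s = a t"
        using right_const[of t] t uv by auto
      then show ?thesis unfolding eventually_at_right_field using less_imp_le by blast
    next
      case False
      then show ?thesis using t uv by (auto simp: eventually_at_right_field intro!: exI[of _ "t + 1"])
    qed
    have L: "\<forall>\<^sub>F s in at_left t. s \<in> {u..v} \<longrightarrow> a s = a t"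
    proof (cases "u < t")
      case True
      then have "t \<in> {0<..T}" "t \<notin> jumps" using J t uv by auto
      then have "\<forall>\<^sub>F s in at_left t. a s = a t" by (simp add: jumps_def)
      then show ?thesis by (rule eventually_mono) simp
    next
      case False
      then show ?thesis using t by (auto simp: eventually_at_left_field intro!: exI[of _ "t - 1"])
    qed
    have "\<forall>\<^sub>F s in at t. s \<in> {u..v} \<longrightarrow> a s = a t" using R L by (simp add: eventually_at_split)
    then have "\<forall>\<^sub>F s in at t within {u..v}. a s = a t"
      by (auto simp: eventually_at_filter elim!: eventually_mono)
    then show "(a \<longlongrightarrow> a t) (at t within {u..v})" by (rule tendsto_eventually)
  qed
  moreover have "finite (a ` {u..v})" using uv by (intro finite_subset[OF _ fin]) auto
  ultimately have "a constant_on {u..v}"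
    by (intro continuous_finite_range_constant connected_Icc)
  then show ?thesis using uv by (auto simp: constant_on_def)
qed

lemma same_jumps_eq:
  assumes "s \<in> {0..T}" "t \<in> {0..T}" and "\<And>\<tau>. \<tau> \<in> jumps \<Longrightarrow> \<tau> \<le> s \<longleftrightarrow> \<tau> \<le> t"
  shows "a s = a t"
proof (cases "s \<le> t")
  case True
  then show ?thesis using assms by (intro constant_between_jumps) force+
next
  case False
  then show ?thesis using assms by (intro constant_between_jumps[symmetric]) force+
qed

definition disc :: "nat \<Rightarrow> real \<Rightarrow> real" where
  "disc n = (\<lambda>t\<in>{0..T}. a (of_int \<lfloor>t / (T / Suc n)\<rfloor> * (T / Suc n)))"

lemma floor_grid:
  assumes h: "0 < h"
  shows "of_int \<lfloor>t / h\<rfloor> * h \<le> t" "t < of_int \<lfloor>t / h\<rfloor> * h + h"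
proof -
  have 1: "of_int \<lfloor>t / h\<rfloor> \<le> t / h" and 2: "t / h < of_int \<lfloor>t / h\<rfloor> + 1" by linarith+
  show "of_int \<lfloor>t / h\<rfloor> * h \<le> t" using 1 h by (simp only: pos_le_divide_eq)
  have "t < (of_int \<lfloor>t / h\<rfloor> + 1) * h" using 2 h by (simp only: pos_divide_less_eq)
  then show "t < of_int \<lfloor>t / h\<rfloor> * h + h" by (simp add: distrib_right)
qed

lemma grid_in: "t \<in> {0..T} \<Longrightarrow> 0 < h \<Longrightarrow> of_int \<lfloor>t / h\<rfloor> * h \<in> {0..T}"
  using floor_grid[of h t] by auto

lemma disc_in_paths: "disc n \<in> skorohod_paths T"
proof -
  define h where "h = T / Suc n"
  have h: "0 < h" using T by (simp add: h_def)
  have d: "disc n t = a (of_int \<lfloor>t / h\<rfloor> * h)" if "t \<in> {0..T}" for t using that by (simp add: disc_def h_def)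
  have "disc n \<in> {0..T} \<rightarrow>\<^sub>E {0..1}"
    using a grid_in[OF _ h] unfolding disc_def h_def[symmetric] skorohod_paths_def
    by (intro restrict_PiE_iff[THEN iffD2] ballI) blast
  moreover have "cadlag_on T (disc n)"
    unfolding cadlag_on_def
  proof (intro conjI ballI)
    fix t assume t: "t \<in> {0..<T}"
    have "t < of_int \<lfloor>t / h\<rfloor> * h + h" by (rule floor_grid(2)[OF h])
    then have "\<forall>\<^sub>F s in at_right t. s \<in> {t<..<min T (of_int \<lfloor>t / h\<rfloor> * h + h)}"
      using t by (intro eventually_at_right_real) auto
    then have "\<forall>\<^sub>F s in at_right t. disc n s = disc n t"
    proof eventually_elim
      case (elim s)
      have "of_int \<lfloor>t / h\<rfloor> \<le> s / h" "s / h < of_int \<lfloor>t / h\<rfloor> + 1"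
        using elim floor_grid[OF h, of t] h by (auto simp: field_simps)
      then have "\<lfloor>s / h\<rfloor> = \<lfloor>t / h\<rfloor>" by linarith
      then show ?case using d[of s] d[of t] elim t by auto
    qed
    then show "(disc n \<longlongrightarrow> disc n t) (at_right t)" by (rule tendsto_eventually)
  next
    fix t assume t: "t \<in> {0<..T}"
    \<comment> \<open>The ceiling minus one, and not the floor: if \<open>t\<close> is itself a grid
      point, the left limit sees the preceding cell.\<close>
    define c where "c = \<lceil>t / h\<rceil> - 1"
    have c: "of_int c * h < t" "t \<le> of_int c * h + h" "0 \<le> c"
    proof -
      have "of_int c < t / h" "t / h \<le> of_int c + 1" unfolding c_def by linarith+
      then show "of_int c * h < t" "t \<le> of_int c * h + h" using h by (auto simp: field_simps)
      have "0 < t / h" using t h by simp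
      then show "0 \<le> c" unfolding c_def by linarith
    qed
    have "\<forall>\<^sub>F s in at_left t. s \<in> {of_int c * h<..<t}" using c by (intro eventually_at_left_real)
    then have "\<forall>\<^sub>F s in at_left t. disc n s = a (of_int c * h)"
    proof eventually_elim
      case (elim s)
      have "of_int c < s / h" "s / h < of_int c + 1" using elim c h by (auto simp: field_simps)
      then have "\<lfloor>s / h\<rfloor> = c" by linarith
      moreover have "0 \<le> of_int c * h" using c h by simp
      ultimately show ?case using d[of s] elim t by auto
    qed
    then have "(disc n \<longlongrightarrow> a (of_int c * h)) (at_left t)" by (rule tendsto_eventually)
    then show "\<exists>l. (disc n \<longlongrightarrow> l) (at_left t)" by blast
  qed
  ultimately show ?thesis by (simp add: skorohod_paths_def)
qed

text \<open>Tents around the jump times move each jump to the next grid point.\<close>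

lemma disc_close:
  obtains c n0 where "\<And>n. n0 \<le> n \<Longrightarrow> skorohod_close T a (disc n) (c / Suc n)"
proof -
  define k where "k = real (card jumps)"
  \<comment> \<open>With 0 and \<open>T\<close> included among the points kept apart, each tent of
    half-width \<open>\<delta>\<close> vanishes at every other jump and at the end points of the
    interval different from its centre.\<close>
  obtain \<delta> where \<delta>: "0 < \<delta>" and gap: "\<And>x y. x \<in> insert 0 (insert T jumps) \<Longrightarrow> y \<in> insert 0 (insert T jumps) \<Longrightarrow> x \<noteq> y \<Longrightarrow> \<delta> \<le> \<bar>x - y\<bar>"
  proof -
    let ?D = "insert 0 (insert T jumps)"
    let ?P = "(\<lambda>(x, y). \<bar>x - y\<bar>) ` {(x, y) \<in> ?D \<times> ?D. x \<noteq> y}"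
    have "finite {(x, y) \<in> ?D \<times> ?D. x \<noteq> y}"
      by (rule finite_subset[of _ "?D \<times> ?D"]) (use finite_jumps in \<open>auto intro!: finite_cartesian_product\<close>)
    then have f: "finite ?P" by (rule finite_imageI)
    have "(0, T) \<in> {(x, y) \<in> ?D \<times> ?D. x \<noteq> y}" using T by simp
    then have ne: "?P \<noteq> {}" by blast
    have "0 < Min ?P" using f ne by (subst Min_gr_iff) auto
    moreover have "Min ?P \<le> \<bar>x - y\<bar>" if "x \<in> ?D" "y \<in> ?D" "x \<noteq> y" for x y
      using f that by (intro Min_le) auto
    ultimately show ?thesis by (rule that)
  qed
  \<comment> \<open>For such \<open>n\<close> the number of jumps times the mesh is below
    \<open>\<delta>\<close>. Then the tents together have Lipschitz constant less than 1, and the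
    perturbed identity \<open>l\<close> remains strictly increasing.\<close>
  obtain n0 where n0: "k * T / \<delta> < real n0" using reals_Archimedean2 by blast
  show thesis
  proof (rule that[of n0 "k * T"])
    fix n assume n: "n0 \<le> n"
    define h where "h = T / Suc n"
    have h: "0 < h" "real (Suc n) * h = T" using T by (auto simp: h_def)
    have kh: "k * h < \<delta>"
    proof -
      have "k * T / \<delta> < real (Suc n)" using n0 n by linarith
      then show ?thesis using \<delta> by (simp add: h_def field_simps del: of_nat_Suc)
    qed
    define \<sigma> where "\<sigma> \<tau> = of_int \<lceil>\<tau> / h\<rceil> * h" for \<tau>
    define tent where "tent \<tau> t = max 0 (1 - \<bar>t - \<tau>\<bar> / \<delta>)" for \<tau> t
    define l where "l t = t + (\<Sum>\<tau>\<in>jumps. (\<sigma> \<tau> - \<tau>) * tent \<tau> t)" for t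
    have \<sigma>: "0 \<le> \<sigma> \<tau> - \<tau>" "\<sigma> \<tau> - \<tau> \<le> h" for \<tau>
    proof -
      have 1: "\<tau> / h \<le> of_int \<lceil>\<tau> / h\<rceil>" and 2: "of_int \<lceil>\<tau> / h\<rceil> - 1 \<le> \<tau> / h" by linarith+
      show "0 \<le> \<sigma> \<tau> - \<tau>" using 1 h(1) unfolding \<sigma>_def by (simp only: pos_divide_le_eq diff_ge_0_iff_ge)
      have "(of_int \<lceil>\<tau> / h\<rceil> - 1) * h \<le> \<tau>" using 2 h(1) by (simp only: pos_le_divide_eq)
      then show "\<sigma> \<tau> - \<tau> \<le> h" unfolding \<sigma>_def by (simp add: left_diff_distrib)
    qed
    \<comment> \<open>A jump at \<open>T\<close> is already on the grid and is not moved, so that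
      \<open>l\<close> maps \<open>T\<close> to itself.\<close>
    have \<sigma>T: "\<sigma> T = T"
    proof -
      have "T / h = of_int (int (Suc n))" using h by (simp add: field_simps)
      then have "\<lceil>T / h\<rceil> = int (Suc n)" by linarith
      then show ?thesis using h by (simp add: \<sigma>_def)
    qed
    have tent01: "0 \<le> tent \<tau> t" "tent \<tau> t \<le> 1" for \<tau> t using \<delta> by (auto simp: tent_def)
    have tent0: "tent \<tau> t = 0" if "\<delta> \<le> \<bar>t - \<tau>\<bar>" for \<tau> t using that \<delta> by (simp add: tent_def)
    have tent_lip: "\<bar>tent \<tau> t - tent \<tau> s\<bar> \<le> \<bar>t - s\<bar> / \<delta>" for \<tau> s t
    proof -
      have "\<bar>(1 - \<bar>t - \<tau>\<bar> / \<delta>) - (1 - \<bar>s - \<tau>\<bar> / \<delta>)\<bar> = \<bar>\<bar>s - \<tau>\<bar> - \<bar>t - \<tau>\<bar>\<bar> / \<delta>"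
        using \<delta> by (simp add: diff_divide_distrib[symmetric])
      also have "\<dots> \<le> \<bar>t - s\<bar> / \<delta>" using \<delta> by (intro divide_right_mono) auto
      finally show ?thesis unfolding tent_def by linarith
    qed
    have mono: "l s < l t" if st: "s < t" for s t
    proof -
      have "\<bar>\<Sum>\<tau>\<in>jumps. (\<sigma> \<tau> - \<tau>) * (tent \<tau> t - tent \<tau> s)\<bar> \<le> (\<Sum>\<tau>\<in>jumps. h * (\<bar>t - s\<bar> / \<delta>))"
      proof (rule order_trans[OF sum_abs sum_mono])
        fix \<tau>
        have "\<bar>\<sigma> \<tau> - \<tau>\<bar> \<le> h" using \<sigma>[of \<tau>] by simp
        then show "\<bar>(\<sigma> \<tau> - \<tau>) * (tent \<tau> t - tent \<tau> s)\<bar> \<le> h * (\<bar>t - s\<bar> / \<delta>)"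
          unfolding abs_mult using h(1) by (intro mult_mono tent_lip) auto
      qed
      also have "\<dots> = k * h / \<delta> * (t - s)" using st by (simp add: k_def)
      also have "\<dots> < 1 * (t - s)" using kh \<delta> st by (intro mult_strict_right_mono) auto
      finally show ?thesis unfolding l_def by (simp add: right_diff_distrib sum_subtractf abs_less_iff)
    qed
    have J: "\<tau> \<in> jumps \<Longrightarrow> 0 < \<tau> \<and> \<tau> \<le> T" for \<tau> by (auto simp: jumps_def)
    have l0: "l 0 = 0"
    proof -
      have "tent \<tau> 0 = 0" if "\<tau> \<in> jumps" for \<tau> using gap[of 0 \<tau>] that J[OF that] by (intro tent0) auto
      then show ?thesis by (simp add: l_def)
    qed
    have lT: "l T = T"
    proof -
      have "(\<sigma> \<tau> - \<tau>) * tent \<tau> T = 0" if "\<tau> \<in> jumps" for \<tau>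
      proof (cases "\<tau> = T")
        case False
        then have "\<delta> \<le> \<bar>T - \<tau>\<bar>" using that by (intro gap) auto
        then show ?thesis using tent0 by simp
      qed (use \<sigma>T in simp)
      then have "(\<Sum>\<tau>\<in>jumps. (\<sigma> \<tau> - \<tau>) * tent \<tau> T) = 0" by (intro sum.neutral ballI)
      then show ?thesis by (simp add: l_def)
    qed
    have l\<tau>: "l \<tau> = \<sigma> \<tau>" if \<tau>: "\<tau> \<in> jumps" for \<tau>
    proof -
      have "(\<Sum>\<tau>'\<in>jumps. (\<sigma> \<tau>' - \<tau>') * tent \<tau>' \<tau>) = (\<Sum>\<tau>'\<in>{\<tau>}. (\<sigma> \<tau>' - \<tau>') * tent \<tau>' \<tau>)"
      proof (rule sum.mono_neutral_right[OF finite_jumps])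
        show "\<forall>i\<in>jumps - {\<tau>}. (\<sigma> i - i) * tent i \<tau> = 0"
          using gap \<tau> tent0 by (metis DiffE insertCI mult_zero_right singletonI)
      qed (use \<tau> in auto)
      then show ?thesis by (simp add: l_def tent_def)
    qed
    have cont: "continuous_on {0..T} l"
      unfolding l_def tent_def using \<delta> by (intro continuous_intros) auto
    have bound: "\<bar>l t - t\<bar> \<le> k * h" for t
    proof -
      have "\<bar>\<Sum>\<tau>\<in>jumps. (\<sigma> \<tau> - \<tau>) * tent \<tau> t\<bar> \<le> (\<Sum>\<tau>\<in>jumps. h * 1)"
      proof (rule order_trans[OF sum_abs sum_mono])
        fix \<tau>
        have "\<bar>\<sigma> \<tau> - \<tau>\<bar> \<le> h" "\<bar>tent \<tau> t\<bar> \<le> 1" using \<sigma>[of \<tau>] tent01[of \<tau> t] by auto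
        then show "\<bar>(\<sigma> \<tau> - \<tau>) * tent \<tau> t\<bar> \<le> h * 1"
          unfolding abs_mult using h(1) by (intro mult_mono) auto
      qed
      then show ?thesis by (simp add: l_def k_def)
    qed
    have l_in: "l t \<in> {0..T}" if "t \<in> {0..T}" for t
      using mono[of 0 t] mono[of t T] that l0 lT by (cases "t = 0"; cases "t = T") auto
    have "l ` {0..T} = {0..T}"
    proof
      show "l ` {0..T} \<subseteq> {0..T}" using l_in by blast
      show "{0..T} \<subseteq> l ` {0..T}"
      proof
        fix y assume "y \<in> {0..T}"
        then show "y \<in> l ` {0..T}" using IVT'[of l 0 y T] cont T l0 lT by auto
      qed
    qed
    then have tc: "l \<in> time_changes T" using mono by (auto simp: time_changes_def strict_mono_on_def)
    \<comment> \<open>It suffices that \<open>t\<close> and the grid point below \<open>l t\<close>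
      lie after the same jumps. Since \<open>l\<close> carries the jump \<open>\<tau>\<close> to its
      rounding \<open>\<sigma> \<tau>\<close>, this is the adjunction between ceiling and floor on
      the grid.\<close>
    have eq: "a t = disc n (l t)" if t: "t \<in> {0..T}" for t
    proof -
      have "a t = a (of_int \<lfloor>l t / h\<rfloor> * h)"
      proof (rule same_jumps_eq[OF t grid_in[OF l_in[OF t] h(1)]])
        fix \<tau> assume \<tau>: "\<tau> \<in> jumps"
        have "\<tau> \<le> t \<longleftrightarrow> \<sigma> \<tau> \<le> l t"
          unfolding l\<tau>[OF \<tau>, symmetric] using mono[of t \<tau>] mono[of \<tau> t] by (cases "\<tau> = t") (auto simp: not_le[symmetric])
        also have "\<dots> \<longleftrightarrow> of_int \<lceil>\<tau> / h\<rceil> \<le> l t / h" using h by (simp add: \<sigma>_def field_simps)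
        also have "\<dots> \<longleftrightarrow> \<lceil>\<tau> / h\<rceil> \<le> \<lfloor>l t / h\<rfloor>" by (simp add: le_floor_iff)
        also have "\<dots> \<longleftrightarrow> \<tau> / h \<le> of_int \<lfloor>l t / h\<rfloor>" by (simp add: ceiling_le_iff)
        also have "\<dots> \<longleftrightarrow> \<tau> \<le> of_int \<lfloor>l t / h\<rfloor> * h" using h by (simp add: field_simps)
        finally show "\<tau> \<le> t \<longleftrightarrow> \<tau> \<le> of_int \<lfloor>l t / h\<rfloor> * h" .
      qed
      then show ?thesis using l_in[OF t] by (simp add: disc_def h_def)
    qed
    have "k * T / Suc n = k * h" by (simp add: h_def)
    moreover have "0 \<le> k * h" using h by (simp add: k_def)
    ultimately show "skorohod_close T a (disc n) (k * T / Suc n)"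
      using tc bound eq by (intro skorohod_closeI[of _ l]) auto
  qed
qed

lemma disc_converges: "(\<lambda>n. skorohod_dist T a (disc n)) \<longlonglongrightarrow> 0"
proof -
  obtain c n0 where c: "\<And>n. n0 \<le> n \<Longrightarrow> skorohod_close T a (disc n) (c / Suc n)" by (rule disc_close) blast
  show ?thesis
  proof (rule tendsto_sandwich[of "\<lambda>_. 0" _ _ "\<lambda>n. c / Suc n"])
    show "\<forall>\<^sub>F n in sequentially. skorohod_dist T a (disc n) \<le> c / Suc n"
      using c skorohod_dist_le[OF a disc_in_paths] by (auto simp: eventually_sequentially)
    show "(\<lambda>n. c / real (Suc n)) \<longlonglongrightarrow> 0" by (intro LIMSEQ_Suc lim_const_over_n)
  qed (auto simp: skorohod_dist_nonneg)
qed

end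

lemma openin_skorohod:
  "openin (skorohod_topology T) U \<longleftrightarrow> U \<subseteq> skorohod_paths T \<and>
     (\<forall>a\<in>U. \<exists>r>0. \<forall>b\<in>skorohod_paths T. skorohod_dist T a b < r \<longrightarrow> b \<in> U)"
proof -
  interpret Metric_space "skorohod_paths T" "skorohod_dist T" by (rule Metric_space_skorohod)
  show ?thesis
    unfolding skorohod_topology_def openin_mtopology
  proof (intro conj_cong refl)
    assume U: "U \<subseteq> skorohod_paths T"
    then have "mball a r \<subseteq> U \<longleftrightarrow> (\<forall>b\<in>skorohod_paths T. skorohod_dist T a b < r \<longrightarrow> b \<in> U)" if "a \<in> U" for a r
      using that unfolding subset_iff in_mball by blast
    then show "(\<forall>x. x \<in> U \<longrightarrow> (\<exists>r>0. mball x r \<subseteq> U)) \<longleftrightarrow>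
        (\<forall>a\<in>U. \<exists>r>0. \<forall>b\<in>skorohod_paths T. skorohod_dist T a b < r \<longrightarrow> b \<in> U)"
      unfolding Ball_def by (intro all_cong) auto
  qed
qed

section \<open>Measurability of path events\<close>

context exclusion_process
begin

lemma path_right: "\<omega> \<in> space M \<Longrightarrow> t \<in> {0..<T} \<Longrightarrow> (path \<omega> \<longlongrightarrow> path \<omega> t) (at_right t)"
proof (rule tendsto_eventually)
  assume \<omega>: "\<omega> \<in> space M" and t: "t \<in> {0..<T}"
  have "\<forall>\<^sub>F s in at_right t. s \<in> {t<..<T}" using t by (intro eventually_at_right_real) auto
  then show "\<forall>\<^sub>F s in at_right t. path \<omega> s = path \<omega> t"
    using right_constant[OF \<omega> t]
  proof eventually_elim
    case (elim s)
    then show ?case using t by (simp add: path_apply)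
  qed
qed

lemma path_in: "\<omega> \<in> space M \<Longrightarrow> t \<in> {0..T} \<Longrightarrow> path \<omega> t \<in> {0..1}"
  using mass_bounds[OF Z_in] by (simp add: path_apply)

lemma path_in_paths:
  assumes \<omega>: "\<omega> \<in> space M"
  shows "path \<omega> \<in> skorohod_paths T"
proof -
  have "path \<omega> \<in> {0..T} \<rightarrow>\<^sub>E {0..1}"
    using path_in[OF \<omega>] by (intro PiE_I) (auto simp: mass_path_def)
  moreover have "cadlag_on T (path \<omega>)"
    unfolding cadlag_on_def
  proof (intro conjI ballI path_right[OF \<omega>])
    fix t assume t: "t \<in> {0<..T}"
    have "\<exists>l. ((\<lambda>s. Z s \<omega>) \<longlongrightarrow> l) (at_left t)"
      using cadlag_Z[OF \<omega>] t unfolding cadlag_on_def by blast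
    then obtain l where l: "((\<lambda>s. Z s \<omega>) \<longlongrightarrow> l) (at_left t)" by blast
    have "((\<lambda>s. real (Z s \<omega> x)) \<longlongrightarrow> real (l x)) (at_left t)" for x
    proof -
      have "continuous_on UNIV (\<lambda>f :: nat \<Rightarrow> nat. f x)" by (rule continuous_on_product_coordinates)
      then have "open ((\<lambda>f :: nat \<Rightarrow> nat. f x) -` {l x})"
        by (intro open_vimage discrete_topology_class.open_discrete)
      then have "\<forall>\<^sub>F s in at_left t. Z s \<omega> x = l x"
        using topological_tendstoD[OF l, of "(\<lambda>f. f x) -` {l x}"] by simp
      then show ?thesis by (intro tendsto_eventually) (auto elim: eventually_mono)
    qed
    then have "((\<lambda>s. mass N (Z s \<omega>)) \<longlongrightarrow> mass N l) (at_left t)"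
      unfolding mass_def using N by (intro tendsto_intros) auto
    moreover have "\<forall>\<^sub>F s in at_left t. s \<in> {0<..<t}" using t by (intro eventually_at_left_real) auto
    then have "\<forall>\<^sub>F s in at_left t. mass N (Z s \<omega>) = path \<omega> s"
      by eventually_elim (use t in \<open>simp add: path_apply\<close>)
    ultimately show "\<exists>l. (path \<omega> \<longlongrightarrow> l) (at_left t)" using Lim_transform_eventually by blast
  qed
  ultimately show ?thesis by (simp add: skorohod_paths_def)
qed

lemma step_path_path: "\<omega> \<in> space M \<Longrightarrow> step_path T (path \<omega>)"
proof
  assume \<omega>: "\<omega> \<in> space M"
  show "path \<omega> \<in> skorohod_paths T" by (rule path_in_paths[OF \<omega>])
  have "path \<omega> ` {0..T} \<subseteq> mass N ` configs N" using Z_in[OF _ \<omega>] by (auto simp: path_apply)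
  then show "finite (path \<omega> ` {0..T})" using finite_configs by (rule finite_subset[OF _ finite_imageI])
qed (rule T0)

text \<open>The path lies in the open set exactly if, for some \<open>k\<close>, the balls of radius
  \<open>1 / (k + 1)\<close> around its samplings are eventually contained in the set. Each of these
  conditions depends on the process at finitely many times, and only countable unions and
  intersections occur.\<close>

lemma event_path_open:
  assumes U: "openin (skorohod_topology T) U"
  shows "{\<omega> \<in> space M. path \<omega> \<in> U} \<in> events"
proof -
  define D where "D n p = (\<lambda>t\<in>{0..T}. mass N (p (nat \<lfloor>t / (T / Suc n)\<rfloor>)))" for n :: nat and p :: "nat \<Rightarrow> nat \<Rightarrow> nat"
  define B where "B k n p \<longleftrightarrow> (\<forall>b\<in>skorohod_paths T. skorohod_dist T (D n p) b < 1 / real (Suc k) \<longrightarrow> b \<in> U)" for k n p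
  define t where "t n i = real i * (T / Suc n)" for n i :: nat
  have t: "times (t n) (Suc n)" for n using times_grid[of n] by (simp add: t_def[abs_def])
  have disc: "step_path.disc T (path \<omega>) n = D n (past (t n) (Suc n) \<omega>)" if \<omega>: "\<omega> \<in> space M" for n \<omega>
  proof -
    interpret step_path T "path \<omega>" by (rule step_path_path[OF \<omega>])
    have h: "0 < T / Suc n" using T0 by simp
    show ?thesis unfolding disc_def D_def
    proof (rule restrict_ext)
      fix s assume s: "s \<in> {0..T}"
      let ?m = "nat \<lfloor>s / (T / Suc n)\<rfloor>"
      have "s / (T / Suc n) \<le> T / (T / Suc n)" using s h by (intro divide_right_mono) auto
      also have "\<dots> = real (Suc n)" using T0 by simp
      finally have "0 \<le> s / (T / Suc n)" "s / (T / Suc n) \<le> real (Suc n)" using s h by auto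
      then have m: "real ?m = of_int \<lfloor>s / (T / Suc n)\<rfloor>" "?m \<le> Suc n" by (auto simp: nat_le_iff) linarith+
      have "past (t n) (Suc n) \<omega> ?m = Z (of_int \<lfloor>s / (T / Suc n)\<rfloor> * (T / Suc n)) \<omega>"
        using m by (simp only: past_apply t_def)
      then show "path \<omega> (of_int \<lfloor>s / (T / Suc n)\<rfloor> * (T / Suc n)) = mass N (past (t n) (Suc n) \<omega> ?m)"
        using path_apply[OF grid_in[OF s h]] by simp
    qed
  qed
  have iff: "path \<omega> \<in> U \<longleftrightarrow> (\<exists>k. \<exists>n0. \<forall>n\<ge>n0. B k n (past (t n) (Suc n) \<omega>))" if \<omega>: "\<omega> \<in> space M" for \<omega>
  proof
    interpret step_path T "path \<omega>" by (rule step_path_path[OF \<omega>])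
    interpret S: Metric_space "skorohod_paths T" "skorohod_dist T" by (rule Metric_space_skorohod)
    {
      assume "path \<omega> \<in> U"
      then obtain r where r: "r > 0" "\<And>b. b \<in> skorohod_paths T \<Longrightarrow> skorohod_dist T (path \<omega>) b < r \<Longrightarrow> b \<in> U"
        using U unfolding openin_skorohod by blast
      obtain k where k: "1 / real (Suc k) < r / 2" using r(1) reals_Archimedean[of "r / 2"] by (auto simp: inverse_eq_divide)
      have "\<forall>\<^sub>F n in sequentially. skorohod_dist T (path \<omega>) (disc n) < r / 2"
        using order_tendstoD(2)[OF disc_converges, of "r / 2"] r(1) by simp
      then obtain n0 where n0: "\<And>n. n \<ge> n0 \<Longrightarrow> skorohod_dist T (path \<omega>) (disc n) < r / 2"
        by (auto simp: eventually_sequentially)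
      have "B k n (past (t n) (Suc n) \<omega>)" if n: "n \<ge> n0" for n
        unfolding B_def disc[OF \<omega>, symmetric]
      proof (intro ballI impI)
        fix b assume b: "b \<in> skorohod_paths T" "skorohod_dist T (disc n) b < 1 / real (Suc k)"
        have "skorohod_dist T (path \<omega>) b \<le> skorohod_dist T (path \<omega>) (disc n) + skorohod_dist T (disc n) b"
          by (rule S.triangle[OF a disc_in_paths b(1)])
        then show "b \<in> U" using n0[OF n] b k by (intro r(2)) auto
      qed
      then show "\<exists>k. \<exists>n0. \<forall>n\<ge>n0. B k n (past (t n) (Suc n) \<omega>)" by blast
    next
      assume "\<exists>k. \<exists>n0. \<forall>n\<ge>n0. B k n (past (t n) (Suc n) \<omega>)"
      then obtain k n0 where B: "\<And>n. n \<ge> n0 \<Longrightarrow> B k n (past (t n) (Suc n) \<omega>)" by blast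
      have "\<forall>\<^sub>F n in sequentially. skorohod_dist T (path \<omega>) (disc n) < 1 / real (Suc k)"
        using order_tendstoD(2)[OF disc_converges, of "1 / real (Suc k)"] by simp
      then obtain n1 where n1: "\<And>n. n \<ge> n1 \<Longrightarrow> skorohod_dist T (path \<omega>) (disc n) < 1 / real (Suc k)"
        by (auto simp: eventually_sequentially)
      show "path \<omega> \<in> U"
        using B[of "max n0 n1"] n1[of "max n0 n1"] a unfolding B_def disc[OF \<omega>, symmetric]
        by (auto simp: S.commute)
    }
  qed
  have ev: "{\<omega> \<in> space M. B k n (past (t n) (Suc n) \<omega>)} \<in> events" for k n
    by (rule event_past_pred[OF t])
  have "{\<omega> \<in> space M. path \<omega> \<in> U} = (\<Union>k. \<Union>n0. \<Inter>n\<in>{n0..}. {\<omega> \<in> space M. B k n (past (t n) (Suc n) \<omega>)})"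
  proof (intro set_eqI iffI)
    fix \<omega> assume "\<omega> \<in> {\<omega> \<in> space M. path \<omega> \<in> U}"
    then have \<omega>: "\<omega> \<in> space M" "path \<omega> \<in> U" by auto
    then obtain k n0 where "\<forall>n\<ge>n0. B k n (past (t n) (Suc n) \<omega>)" using iff by blast
    then show "\<omega> \<in> (\<Union>k. \<Union>n0. \<Inter>n\<in>{n0..}. {\<omega> \<in> space M. B k n (past (t n) (Suc n) \<omega>)})"
      using \<omega> by blast
  next
    fix \<omega> assume "\<omega> \<in> (\<Union>k. \<Union>n0. \<Inter>n\<in>{n0..}. {\<omega> \<in> space M. B k n (past (t n) (Suc n) \<omega>)})"
    then obtain k n0 where *: "\<forall>n\<ge>n0. \<omega> \<in> space M \<and> B k n (past (t n) (Suc n) \<omega>)" by blast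
    then have "\<omega> \<in> space M" by blast
    then show "\<omega> \<in> {\<omega> \<in> space M. path \<omega> \<in> U}" using iff * by blast
  qed
  also have "\<dots> \<in> events" using ev by (intro sets.countable_UN sets.countable_INT') auto
  finally show ?thesis .
qed

end

section \<open>The rate functional\<close>

text \<open>Affinity in \<open>a\<close> makes \<open>J_functional\<close> affine in the path for
  each test function, so the rate, a supremum of such functionals, is convex.\<close>

lemma hamiltonian_affine: "hamiltonian \<gamma> a p = 2 * \<gamma> * (exp p - 1) + a * (2 * bdry \<gamma> p)"
  by (simp add: hamiltonian_def bdry_def algebra_simps)

text \<open>The lower bound is uniform in \<open>p\<close>: it comes from the total jump rate being
  at most 2. This uniformity controls the cost of rescaling time, where the field is
  arbitrary.\<close>

lemma hamiltonian_bounds: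
  assumes \<gamma>: "0 < \<gamma>" "\<gamma> < 1" and a: "a \<in> {0..1}"
  shows hamiltonian_ge: "- 2 \<le> hamiltonian \<gamma> a p" and hamiltonian_le: "hamiltonian \<gamma> a p \<le> 2 * exp \<bar>p\<bar>"
proof -
  have w: "0 \<le> \<gamma> * (1 - a)" "0 \<le> (1 - \<gamma>) * a" using \<gamma> a by auto
  have s: "\<gamma> * (1 - a) + (1 - \<gamma>) * a \<le> 1"
  proof -
    have "\<gamma> * (1 - a) \<le> 1 * (1 - a)" "(1 - \<gamma>) * a \<le> 1 * a" using \<gamma> a by (intro mult_right_mono; auto)+
    then show ?thesis by simp
  qed
  have h: "hamiltonian \<gamma> a p = 2 * (\<gamma> * (1 - a) * (exp p - 1) + (1 - \<gamma>) * a * (exp (- p) - 1))"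
    by (simp add: hamiltonian_def algebra_simps)
  define A B where "A = \<gamma> * (1 - a)" and "B = (1 - \<gamma>) * a"
  have "A * (- 1) \<le> A * (exp p - 1)" "B * (- 1) \<le> B * (exp (- p) - 1)"
    using w unfolding A_def B_def by (intro mult_left_mono; auto)+
  then have "- A \<le> A * (exp p - 1)" "- B \<le> B * (exp (- p) - 1)" by simp_all
  moreover have "A + B \<le> 1" using s by (simp add: A_def B_def)
  ultimately have "- 1 \<le> A * (exp p - 1) + B * (exp (- p) - 1)" by linarith
  then have "- 2 \<le> 2 * (A * (exp p - 1) + B * (exp (- p) - 1))" by argo
  then show "- 2 \<le> hamiltonian \<gamma> a p" unfolding h A_def B_def .
  have "exp p - 1 \<le> exp \<bar>p\<bar>" "exp (- p) - 1 \<le> exp \<bar>p\<bar>"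
    using exp_le_cancel_iff[of p "\<bar>p\<bar>"] exp_le_cancel_iff[of "- p" "\<bar>p\<bar>"] by linarith+
  then have "\<gamma> * (1 - a) * (exp p - 1) \<le> \<gamma> * (1 - a) * exp \<bar>p\<bar>" "(1 - \<gamma>) * a * (exp (- p) - 1) \<le> (1 - \<gamma>) * a * exp \<bar>p\<bar>"
    using w by (intro mult_left_mono; auto)+
  moreover have "(\<gamma> * (1 - a) + (1 - \<gamma>) * a) * exp \<bar>p\<bar> \<le> 1 * exp \<bar>p\<bar>" using s by (intro mult_right_mono) auto
  ultimately show "hamiltonian \<gamma> a p \<le> 2 * exp \<bar>p\<bar>" unfolding h by (simp add: distrib_right)
qed

lemma path_bounds: "a \<in> skorohod_paths T \<Longrightarrow> t \<in> {0..T} \<Longrightarrow> a t \<in> {0..1}"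
  by (auto simp: skorohod_paths_def)

lemma path_right_continuous: "a \<in> skorohod_paths T \<Longrightarrow> t \<in> {0..<T} \<Longrightarrow> (a \<longlongrightarrow> a t) (at_right t)"
  unfolding skorohod_paths_def cadlag_on_def by blast

lemma continuous_at_right_interval:
  assumes "continuous_on {0..T} g" "t \<in> {0..<T}"
  shows "(g \<longlongrightarrow> (g t :: real)) (at_right t)"
proof -
  have "(g \<longlongrightarrow> g t) (at t within {0..T})" using assms by (auto simp: continuous_on_def)
  then have "(g \<longlongrightarrow> g t) (at t within {t..T})" by (rule tendsto_within_subset) (use assms in auto)
  then show ?thesis using assms(2) by (simp add: at_within_Icc_at_right)
qed

lemma path_mult_integrable:
  assumes T: "0 < T" and a: "a \<in> skorohod_paths T" and g: "continuous_on {0..T} g"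
  shows "(\<lambda>s. a s * g s) integrable_on {0..T}"
proof -
  obtain K where K: "\<And>s. s \<in> {0..T} \<Longrightarrow> \<bar>g s\<bar> \<le> K" using continuous_abs_le[OF g] by blast
  show ?thesis
  proof (rule right_continuous_integrable[OF T])
    fix s assume s: "s \<in> {0..T}"
    have "\<bar>a s\<bar> * \<bar>g s\<bar> \<le> 1 * K" using K[OF s] path_bounds[OF a s] by (intro mult_mono) auto
    then show "\<bar>a s * g s\<bar> \<le> K" by (simp add: abs_mult)
  next
    fix s assume "s \<in> {0..<T}"
    then show "((\<lambda>s. a s * g s) \<longlongrightarrow> a s * g s) (at_right s)"
      by (intro tendsto_mult path_right_continuous[OF a] continuous_at_right_interval[OF g])
  qed
qed

text \<open>All dependence on the path is gathered into end-point values and one integral against a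
  continuous kernel, from which the Lipschitz bound, pointwise limits and convex combinations can be
  read off.\<close>

lemma J_affine_form:
  assumes T: "0 < T" and G: "G \<in> C1_on T"
  obtains q c where "continuous_on {0..T} q"
    "\<And>a. a \<in> skorohod_paths T \<Longrightarrow> J_functional T \<gamma> G a = a T * G T - a 0 * G 0 - integral {0..T} (\<lambda>s. a s * q s) - c"
proof -
  obtain G' where G': "continuous_on {0..T} G'"
    "\<And>s. s \<in> {0..T} \<Longrightarrow> (G has_real_derivative G' s) (at s within {0..T})"
    "\<And>s. s \<in> {0..T} \<Longrightarrow> vector_derivative G (at s within {0..T}) = G' s"
    using C1_on_derivative[OF G T] by blast
  have Gc: "continuous_on {0..T} G" using G'(2) by (rule DERIV_continuous_on)
  have bc: "continuous_on {0..T} (\<lambda>s. 2 * bdry \<gamma> (G s))"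
    unfolding bdry_def by (intro continuous_intros Gc)
  have ec: "continuous_on {0..T} (\<lambda>s. 2 * \<gamma> * (exp (G s) - 1))" by (intro continuous_intros Gc)
  show thesis
  proof (rule that)
    show "continuous_on {0..T} (\<lambda>s. G' s + 2 * bdry \<gamma> (G s))" by (intro continuous_on_add G' bc)
    fix a assume a: "a \<in> skorohod_paths T"
    note i = path_mult_integrable[OF T a G'(1)] path_mult_integrable[OF T a bc] integrable_continuous_interval[OF ec]
    have J: "J_functional T \<gamma> G a = a T * G T - a 0 * G 0 - integral {0..T} (\<lambda>s. a s * G' s)
      - integral {0..T} (\<lambda>s. hamiltonian \<gamma> (a s) (G s))"
      by (rule J_functional_eq) (rule G'(3))
    show "J_functional T \<gamma> G a = a T * G T - a 0 * G 0 - integral {0..T} (\<lambda>s. a s * (G' s + 2 * bdry \<gamma> (G s)))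
        - integral {0..T} (\<lambda>s. 2 * \<gamma> * (exp (G s) - 1))"
      unfolding J hamiltonian_affine distrib_left[of "a _"]
      using Henstock_Kurzweil_Integration.integral_add[OF i(1,2)] Henstock_Kurzweil_Integration.integral_add[OF i(3,2)]
      by simp
  qed
qed

lemma J_lipschitz:
  assumes T: "0 < T" and G: "G \<in> C1_on T"
  obtains C where "0 < C" "\<And>a b d. a \<in> skorohod_paths T \<Longrightarrow> b \<in> skorohod_paths T \<Longrightarrow>
    (\<And>t. t \<in> {0..T} \<Longrightarrow> \<bar>a t - b t\<bar> \<le> d) \<Longrightarrow> \<bar>J_functional T \<gamma> G a - J_functional T \<gamma> G b\<bar> \<le> C * d"
proof -
  obtain q c where q: "continuous_on {0..T} q" and J: "\<And>a. a \<in> skorohod_paths T \<Longrightarrow>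
    J_functional T \<gamma> G a = a T * G T - a 0 * G 0 - integral {0..T} (\<lambda>s. a s * q s) - c"
    using J_affine_form[OF T G] by blast
  obtain K where K: "0 \<le> K" "\<And>s. s \<in> {0..T} \<Longrightarrow> \<bar>q s\<bar> \<le> K" using continuous_abs_le[OF q] by blast
  show thesis
  proof (rule that[of "\<bar>G T\<bar> + \<bar>G 0\<bar> + T * K + 1"])
    show "0 < \<bar>G T\<bar> + \<bar>G 0\<bar> + T * K + 1" using K T by (intro add_nonneg_pos add_nonneg_nonneg) auto
    fix a b d assume a: "a \<in> skorohod_paths T" and b: "b \<in> skorohod_paths T"
      and d: "\<And>t. t \<in> {0..T} \<Longrightarrow> \<bar>a t - b t\<bar> \<le> d"
    have dT: "\<bar>a T - b T\<bar> \<le> d" "\<bar>a 0 - b 0\<bar> \<le> d" using d T by auto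
    have d0: "0 \<le> d" using dT by linarith
    note i = path_mult_integrable[OF T a q] path_mult_integrable[OF T b q]
    have "norm (integral {0..T} (\<lambda>s. a s * q s - b s * q s)) \<le> (d * K) * measure lborel (cbox 0 T)"
      unfolding cbox_interval[symmetric]
    proof (rule integrable_bound)
      show "0 \<le> d * K" using d0 K by simp
      show "(\<lambda>s. a s * q s - b s * q s) integrable_on cbox 0 T"
        unfolding cbox_interval by (intro integrable_diff i)
      fix s assume "s \<in> cbox 0 T"
      then have s: "s \<in> {0..T}" by simp
      have "\<bar>a s - b s\<bar> * \<bar>q s\<bar> \<le> d * K" using d[OF s] K(2)[OF s] d0 by (intro mult_mono) auto
      then show "norm (a s * q s - b s * q s) \<le> d * K" by (simp add: abs_mult[symmetric] left_diff_distrib)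
    qed
    then have I: "\<bar>integral {0..T} (\<lambda>s. a s * q s) - integral {0..T} (\<lambda>s. b s * q s)\<bar> \<le> T * K * d"
      using T unfolding Henstock_Kurzweil_Integration.integral_diff[OF i] by (simp add: mult_ac)
    have "\<bar>(a T - b T) * G T\<bar> \<le> d * \<bar>G T\<bar>" "\<bar>(a 0 - b 0) * G 0\<bar> \<le> d * \<bar>G 0\<bar>"
      unfolding abs_mult using dT by (intro mult_right_mono; simp)+
    then have "\<bar>J_functional T \<gamma> G a - J_functional T \<gamma> G b\<bar> \<le> d * \<bar>G T\<bar> + d * \<bar>G 0\<bar> + T * K * d"
      unfolding J[OF a] J[OF b] left_diff_distrib using I by linarith
    also have "\<dots> \<le> (\<bar>G T\<bar> + \<bar>G 0\<bar> + T * K + 1) * d" using d0 by (simp add: algebra_simps)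
    finally show "\<bar>J_functional T \<gamma> G a - J_functional T \<gamma> G b\<bar> \<le> (\<bar>G T\<bar> + \<bar>G 0\<bar> + T * K + 1) * d" .
  qed
qed

lemma J_pointwise_limit:
  assumes T: "0 < T" and G: "G \<in> C1_on T" and a: "\<And>n. a n \<in> skorohod_paths T" and b: "b \<in> skorohod_paths T"
    and lim: "\<And>t. t \<in> {0..T} \<Longrightarrow> (\<lambda>n. a n t) \<longlonglongrightarrow> b t"
  shows "(\<lambda>n. J_functional T \<gamma> G (a n)) \<longlonglongrightarrow> J_functional T \<gamma> G b"
proof -
  obtain q c where q: "continuous_on {0..T} q" and J: "\<And>a. a \<in> skorohod_paths T \<Longrightarrow>
    J_functional T \<gamma> G a = a T * G T - a 0 * G 0 - integral {0..T} (\<lambda>s. a s * q s) - c"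
    using J_affine_form[OF T G] by blast
  obtain K where K: "0 \<le> K" "\<And>s. s \<in> {0..T} \<Longrightarrow> \<bar>q s\<bar> \<le> K" using continuous_abs_le[OF q] by blast
  have "(\<lambda>n. integral {0..T} (\<lambda>s. a n s * q s)) \<longlonglongrightarrow> integral {0..T} (\<lambda>s. b s * q s)"
  proof (rule dominated_convergence(2))
    show "(\<lambda>s. a n s * q s) integrable_on {0..T}" for n by (rule path_mult_integrable[OF T a q])
    show "(\<lambda>s. K) integrable_on {0..T}" by (rule integrable_const_ivl)
    fix n s assume s: "s \<in> {0..T}"
    have "\<bar>a n s\<bar> * \<bar>q s\<bar> \<le> 1 * K" using K(2)[OF s] path_bounds[OF a s, of n] by (intro mult_mono) auto
    then show "norm (a n s * q s) \<le> K" by (simp add: abs_mult)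
  next
    fix s assume "s \<in> {0..T}"
    then show "(\<lambda>n. a n s * q s) \<longlonglongrightarrow> b s * q s" by (intro tendsto_intros lim)
  qed
  then show ?thesis unfolding J[OF a] J[OF b] using T by (intro tendsto_intros lim) auto
qed

lemma path_convex_comb:
  assumes a: "a \<in> skorohod_paths T" and b: "b \<in> skorohod_paths T" and u: "0 \<le> u" "u \<le> 1"
  shows "(\<lambda>t\<in>{0..T}. (1 - u) * a t + u * b t) \<in> skorohod_paths T"
proof -
  let ?c = "\<lambda>t\<in>{0..T}. (1 - u) * a t + u * b t"
  have "(1 - u) * a t + u * b t \<in> {0..1}" if t: "t \<in> {0..T}" for t
  proof -
    have "(1 - u) * a t \<le> (1 - u) * 1" "u * b t \<le> u * 1"
      using path_bounds[OF a t] path_bounds[OF b t] u by (intro mult_left_mono; auto)+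
    then show ?thesis using path_bounds[OF a t] path_bounds[OF b t] u by auto
  qed
  then have "?c \<in> {0..T} \<rightarrow>\<^sub>E {0..1}" by (intro PiE_I) auto
  moreover have "cadlag_on T ?c"
    unfolding cadlag_on_def
  proof (intro conjI ballI)
    fix t assume t: "t \<in> {0..<T}"
    have "((\<lambda>t. (1 - u) * a t + u * b t) \<longlongrightarrow> (1 - u) * a t + u * b t) (at_right t)"
      by (intro tendsto_intros path_right_continuous[OF a t] path_right_continuous[OF b t])
    moreover have "\<forall>\<^sub>F s in at_right t. (1 - u) * a s + u * b s = ?c s"
      using eventually_at_right_real[of t T] t by (auto elim!: eventually_mono)
    ultimately show "(?c \<longlongrightarrow> ?c t) (at_right t)" using t by (auto intro: Lim_transform_eventually)
  next
    fix t assume t: "t \<in> {0<..T}"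
    have "\<exists>l. (a \<longlongrightarrow> l) (at_left t)" "\<exists>m. (b \<longlongrightarrow> m) (at_left t)"
      using a b t unfolding skorohod_paths_def cadlag_on_def by blast+
    then obtain l m where "(a \<longlongrightarrow> l) (at_left t)" "(b \<longlongrightarrow> m) (at_left t)" by blast
    then have "((\<lambda>t. (1 - u) * a t + u * b t) \<longlongrightarrow> (1 - u) * l + u * m) (at_left t)"
      by (intro tendsto_intros)
    moreover have "\<forall>\<^sub>F s in at_left t. (1 - u) * a s + u * b s = ?c s"
      using eventually_at_left_real[of 0 t] t by (auto elim!: eventually_mono)
    ultimately show "\<exists>l. (?c \<longlongrightarrow> l) (at_left t)" using Lim_transform_eventually by blast
  qed
  ultimately show ?thesis by (simp add: skorohod_paths_def)
qed

lemma J_convex_comb: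
  assumes T: "0 < T" and G: "G \<in> C1_on T" and a: "a \<in> skorohod_paths T" and b: "b \<in> skorohod_paths T"
    and u: "0 \<le> u" "u \<le> 1"
  shows "J_functional T \<gamma> G (\<lambda>t\<in>{0..T}. (1 - u) * a t + u * b t) = (1 - u) * J_functional T \<gamma> G a + u * J_functional T \<gamma> G b"
proof -
  obtain q c where q: "continuous_on {0..T} q" and J: "\<And>a. a \<in> skorohod_paths T \<Longrightarrow>
    J_functional T \<gamma> G a = a T * G T - a 0 * G 0 - integral {0..T} (\<lambda>s. a s * q s) - c"
    using J_affine_form[OF T G] by blast
  let ?c = "\<lambda>t\<in>{0..T}. (1 - u) * a t + u * b t"
  note i = path_mult_integrable[OF T a q] path_mult_integrable[OF T b q]
  have "integral {0..T} (\<lambda>s. ?c s * q s) = integral {0..T} (\<lambda>s. (1 - u) *\<^sub>R (a s * q s) + u *\<^sub>R (b s * q s))"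
    by (intro Henstock_Kurzweil_Integration.integral_cong) (simp add: algebra_simps)
  also have "\<dots> = (1 - u) * integral {0..T} (\<lambda>s. a s * q s) + u * integral {0..T} (\<lambda>s. b s * q s)"
    using Henstock_Kurzweil_Integration.integral_add[OF integrable_cmul[OF i(1), of "1 - u"] integrable_cmul[OF i(2), of u]]
    by simp
  finally show ?thesis
    unfolding J[OF a] J[OF b] J[OF path_convex_comb[OF a b u]] using T by (simp add: algebra_simps)
qed

lemma continuous_path:
  assumes "continuous_on {0..T} a" "\<And>t. t \<in> {0..T} \<Longrightarrow> a t \<in> {0..1}" "\<And>t. t \<notin> {0..T} \<Longrightarrow> a t = undefined"
  shows "a \<in> skorohod_paths T"
proof -
  have "cadlag_on T a" unfolding cadlag_on_def
  proof (intro conjI ballI)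
    show "t \<in> {0..<T} \<Longrightarrow> (a \<longlongrightarrow> a t) (at_right t)" for t by (rule continuous_at_right_interval[OF assms(1)])
    fix t assume t: "t \<in> {0<..T}"
    have "(a \<longlongrightarrow> a t) (at t within {0..T})" using assms t by (auto simp: continuous_on_def)
    then have "(a \<longlongrightarrow> a t) (at t within {0..t})" by (rule tendsto_within_subset) (use t in auto)
    then show "\<exists>l. (a \<longlongrightarrow> l) (at_left t)" using t by (auto simp: at_within_Icc_at_left)
  qed
  then show ?thesis using assms by (auto simp: skorohod_paths_def PiE_iff extensional_def)
qed

section \<open>Localisation to subintervals and continuity of paths of finite rate\<close>

definition J_between :: "real \<Rightarrow> (real \<Rightarrow> real) \<Rightarrow> (real \<Rightarrow> real) \<Rightarrow> (real \<Rightarrow> real) \<Rightarrow> real \<Rightarrow> real \<Rightarrow> real" where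
  "J_between \<gamma> G G' a s t = a t * G t - a s * G s - integral {s..t} (\<lambda>r. a r * G' r + hamiltonian \<gamma> (a r) (G r))"

text \<open>The cubic Hermite step, clamped to the unit interval. Its derivative vanishes at both
  ends of the transition, so products of a test function with such steps remain
  \<open>C^1\<close>.\<close>

definition smoothstep :: "real \<Rightarrow> real" where
  "smoothstep u = (let v = max 0 (min 1 u) in v\<^sup>2 * (3 - 2 * v))"

definition smoothstep' :: "real \<Rightarrow> real" where
  "smoothstep' u = (let v = max 0 (min 1 u) in 6 * v * (1 - v))"

lemma smoothstep_simps [simp]:
  "u \<le> 0 \<Longrightarrow> smoothstep u = 0" "1 \<le> u \<Longrightarrow> smoothstep u = 1"
  "u \<le> 0 \<Longrightarrow> smoothstep' u = 0" "1 \<le> u \<Longrightarrow> smoothstep' u = 0"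
  by (auto simp: smoothstep_def smoothstep'_def Let_def)

lemma smoothstep_bounds: "0 \<le> smoothstep u" "smoothstep u \<le> 1"
proof -
  define v where "v = max 0 (min 1 u)"
  have v: "0 \<le> v" "v \<le> 1" by (auto simp: v_def)
  have s: "smoothstep u = v\<^sup>2 * (3 - 2 * v)" by (simp add: smoothstep_def v_def Let_def)
  show "0 \<le> smoothstep u" unfolding s using v by simp
  have "1 - v\<^sup>2 * (3 - 2 * v) = (1 - v)\<^sup>2 * (1 + 2 * v)" by (simp add: power2_eq_square algebra_simps)
  moreover have "0 \<le> (1 - v)\<^sup>2 * (1 + 2 * v)" using v by simp
  ultimately show "smoothstep u \<le> 1" unfolding s by linarith
qed

lemma smoothstep'_nonneg: "0 \<le> smoothstep' u"
  by (simp add: smoothstep'_def Let_def)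

lemma smoothstep'_continuous: "continuous_on A smoothstep'"
  unfolding smoothstep'_def Let_def by (intro continuous_intros)

lemma smoothstep_deriv: "(smoothstep has_real_derivative smoothstep' u) (at u)"
proof -
  consider "u < 0" | "u = 0" | "0 < u" "u < 1" | "u = 1" | "1 < u" by linarith
  then show ?thesis
  proof cases
    case 1
    then have "(smoothstep has_real_derivative 0) (at u)"
      by (intro has_field_derivative_transform_within_open[OF DERIV_const[of 0], of "{..<0}"]) auto
    then show ?thesis using 1 by simp
  next
    case 5
    then have "(smoothstep has_real_derivative 0) (at u)"
      by (intro has_field_derivative_transform_within_open[OF DERIV_const[of 1], of "{1<..}"]) auto
    then show ?thesis using 5 by simp
  next
    case 3
    have "((\<lambda>v. v\<^sup>2 * (3 - 2 * v)) has_real_derivative 6 * u * (1 - u)) (at u)"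
      by (auto intro!: derivative_eq_intros simp: power2_eq_square algebra_simps)
    then have "(smoothstep has_real_derivative 6 * u * (1 - u)) (at u)"
      using 3 by (elim has_field_derivative_transform_within_open[of _ _ _ "{0<..<1}"]) (auto simp: smoothstep_def Let_def)
    then show ?thesis using 3 by (simp add: smoothstep'_def Let_def)
  next
    case 2
    have "((\<lambda>h. (smoothstep h - 0) / h) \<longlongrightarrow> 0) (at 0)"
    proof (rule Lim_null_comparison)
      show "\<forall>\<^sub>F h in at 0. norm ((smoothstep h - 0) / h) \<le> 3 * \<bar>h\<bar>"
      proof (rule always_eventually, rule allI)
        fix h :: real
        consider "h \<le> 0" | "0 < h" "h < 1" | "1 \<le> h" by linarith
        then show "norm ((smoothstep h - 0) / h) \<le> 3 * \<bar>h\<bar>"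
        proof cases
          case 2
          then have "smoothstep h / h = h * (3 - 2 * h)" by (simp add: smoothstep_def Let_def power2_eq_square)
          also have "\<dots> \<le> h * 3" using 2 by (intro mult_left_mono) auto
          finally show ?thesis using 2 smoothstep_bounds[of h] by simp
        next
          case 3
          then have "1 / h \<le> 1" "1 \<le> 3 * h" by auto
          then have "1 / h \<le> 3 * h" by linarith
          then show ?thesis using 3 by simp
        qed auto
      qed
      show "((\<lambda>h. 3 * \<bar>h\<bar>) \<longlongrightarrow> 0) (at (0::real))" by (auto intro!: tendsto_eq_intros)
    qed
    then show ?thesis using 2 by (simp add: has_field_derivative_iff)
  next
    case 4
    have "((\<lambda>h. (smoothstep (1 + h) - 1) / h) \<longlongrightarrow> 0) (at 0)"
    proof (rule Lim_null_comparison)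
      show "\<forall>\<^sub>F h in at 0. norm ((smoothstep (1 + h) - 1) / h) \<le> 3 * \<bar>h\<bar>"
      proof (rule always_eventually, rule allI)
        fix h :: real
        consider "h \<ge> 0" | "-1 < h" "h < 0" | "h \<le> -1" by linarith
        then show "norm ((smoothstep (1 + h) - 1) / h) \<le> 3 * \<bar>h\<bar>"
        proof cases
          case 2
          then have "(smoothstep (1 + h) - 1) / h = - (h * (3 + 2 * h))"
            by (simp add: smoothstep_def Let_def power2_eq_square field_simps)
          moreover have "\<bar>h\<bar> * \<bar>3 + 2 * h\<bar> \<le> \<bar>h\<bar> * 3" using 2 by (intro mult_left_mono) auto
          ultimately show ?thesis by (simp add: abs_mult)
        next
          case 3
          have k: "1 / k \<le> 1" if "1 \<le> k" for k :: real using that by simp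
          have "1 / \<bar>h\<bar> \<le> 1" by (rule k) (use 3 in simp)
          moreover have "1 \<le> 3 * \<bar>h\<bar>" using 3 by simp
          ultimately have "1 / \<bar>h\<bar> \<le> 3 * \<bar>h\<bar>" by linarith
          moreover have "norm ((smoothstep (1 + h) - 1) / h) = 1 / \<bar>h\<bar>" using 3 by (simp add: abs_divide)
          ultimately show ?thesis by linarith
        qed auto
      qed
      show "((\<lambda>h. 3 * \<bar>h\<bar>) \<longlongrightarrow> 0) (at (0::real))" by (auto intro!: tendsto_eq_intros)
    qed
    then show ?thesis using 4 by (simp add: DERIV_def)
  qed
qed

lemma real_derivative_vector_derivative:
  assumes "0 < T" "s \<in> {0..T}" "(G has_real_derivative d) (at s within {0..T})"
  shows "vector_derivative G (at s within {0..T}) = d"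
  using vector_derivative_within_cbox[of 0 T s G d] assms
  by (simp add: has_real_derivative_iff_has_vector_derivative)

text \<open>The bumps have integral 1 and live on shrinking intervals to the right of
  \<open>s\<close>; right continuity of the path at \<open>s\<close> is therefore all that the limit
  asks for.\<close>

lemma approx_identity:
  assumes T: "0 < T" and a: "a \<in> skorohod_paths T" and c: "continuous_on {0..T} c" and s: "s \<in> {0..<T}"
  shows "(\<lambda>n. integral {0..T} (\<lambda>r. a r * (c r * (smoothstep' ((r - s) * real (Suc n)) * real (Suc n))))) \<longlonglongrightarrow> a s * c s"
proof (rule LIMSEQ_I)
  fix e :: real assume e: "0 < e"
  define \<psi> where "\<psi> n r = smoothstep' ((r - s) * real (Suc n)) * real (Suc n)" for n r
  have "((\<lambda>r. a r * c r) \<longlongrightarrow> a s * c s) (at_right s)"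
    using s by (intro tendsto_mult path_right_continuous[OF a] continuous_at_right_interval[OF c])
  then have "\<forall>\<^sub>F r in at_right s. dist (a r * c r) (a s * c s) < e / 2" using e by (intro tendstoD) auto
  then obtain b where b: "s < b" "\<And>r. s < r \<Longrightarrow> r < b \<Longrightarrow> \<bar>a r * c r - a s * c s\<bar> < e / 2"
    by (auto simp: eventually_at_right_field dist_real_def)
  obtain n0 where n0: "inverse (real (Suc n0)) < min b T - s" using reals_Archimedean[of "min b T - s"] b s by auto
  show "\<exists>no. \<forall>n\<ge>no. norm (integral {0..T} (\<lambda>r. a r * (c r * (smoothstep' ((r - s) * real (Suc n)) * real (Suc n)))) - a s * c s) < e"
  proof (intro exI[of _ n0] allI impI)
    fix n assume n: "n0 \<le> n"
    define m where "m = real (Suc n)"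
    have m: "0 < m" "1 / m < min b T - s"
    proof -
      show "0 < m" by (simp add: m_def)
      have "1 / m \<le> 1 / real (Suc n0)" using n by (simp add: m_def field_simps)
      then show "1 / m < min b T - s" using n0 by (simp add: inverse_eq_divide)
    qed
    have \<psi>c: "continuous_on {0..T} (\<psi> n)"
      unfolding \<psi>_def
      by (intro continuous_intros continuous_on_compose2[OF smoothstep'_continuous[of UNIV]]) auto
    have \<psi>0: "0 \<le> \<psi> n r" for r by (simp add: \<psi>_def smoothstep'_nonneg)
    have \<psi>_out: "\<psi> n r = 0" if "r \<le> s \<or> s + 1 / m \<le> r" for r
    proof (cases "r \<le> s")
      case True
      then have "(r - s) * m \<le> 0" using m by (intro mult_nonpos_nonneg) auto
      then show ?thesis by (simp add: \<psi>_def m_def)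
    next
      case False
      then have "1 / m \<le> r - s" using that by auto
      then have "1 \<le> (r - s) * m" using m by (simp add: divide_le_eq)
      then show ?thesis by (simp add: \<psi>_def m_def)
    qed
    have i\<psi>: "(\<psi> n has_integral 1) {0..T}"
    proof -
      have "(\<psi> n has_integral (smoothstep ((T - s) * m) - smoothstep ((0 - s) * m))) {0..T}"
      proof (rule fundamental_theorem_of_calculus)
        show "0 \<le> T" using T by simp
        fix r assume "r \<in> {0..T}"
        have "((\<lambda>r. smoothstep ((r - s) * m)) has_real_derivative smoothstep' ((r - s) * m) * m) (at r)"
          by (rule DERIV_chain2[OF smoothstep_deriv]) (auto intro!: derivative_eq_intros)
        then show "((\<lambda>r. smoothstep ((r - s) * m)) has_vector_derivative \<psi> n r) (at r within {0..T})"
          unfolding \<psi>_def m_def has_real_derivative_iff_has_vector_derivative[symmetric]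
          by (rule has_field_derivative_at_within)
      qed
      moreover have "smoothstep ((0 - s) * m) = 0"
        using m s by (intro smoothstep_simps) (auto intro: mult_nonpos_nonneg)
      moreover have "smoothstep ((T - s) * m) = 1"
      proof -
        have "1 / m \<le> T - s" using m by linarith
        then show ?thesis using m by (intro smoothstep_simps) (simp add: divide_le_eq)
      qed
      ultimately show ?thesis by simp
    qed
    have i1: "(\<lambda>r. a r * (c r * \<psi> n r)) integrable_on {0..T}"
      by (intro path_mult_integrable[OF T a] continuous_on_mult c \<psi>c)
    have i2: "(\<lambda>r. a s * c s * \<psi> n r) integrable_on {0..T}"
      using integrable_cmul[OF has_integral_integrable[OF i\<psi>], of "a s * c s"] by simp
    have i3: "(\<lambda>r. e / 2 * \<psi> n r) integrable_on {0..T}"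
      using integrable_cmul[OF has_integral_integrable[OF i\<psi>], of "e / 2"] by simp
    have "norm (integral {0..T} (\<lambda>r. a r * (c r * \<psi> n r) - a s * c s * \<psi> n r)) \<le> integral {0..T} (\<lambda>r. e / 2 * \<psi> n r)"
    proof (rule integral_norm_bound_integral[OF integrable_diff[OF i1 i2] i3])
      fix r assume "r \<in> {0..T}"
      show "norm (a r * (c r * \<psi> n r) - a s * c s * \<psi> n r) \<le> e / 2 * \<psi> n r"
      proof (cases "r \<le> s \<or> s + 1 / m \<le> r")
        case False
        then have "s < r" "r < b" using m(2) by auto
        then have "\<bar>a r * c r - a s * c s\<bar> * \<bar>\<psi> n r\<bar> \<le> e / 2 * \<psi> n r"
          using less_imp_le[OF b(2)[of r]] \<psi>0[of r] e by (intro mult_mono) auto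
        then show ?thesis by (simp add: abs_mult[symmetric] left_diff_distrib mult.assoc)
      qed (simp add: \<psi>_out)
    qed
    moreover have "integral {0..T} (\<lambda>r. a r * (c r * \<psi> n r) - a s * c s * \<psi> n r)
        = integral {0..T} (\<lambda>r. a r * (c r * \<psi> n r)) - a s * c s"
      using Henstock_Kurzweil_Integration.integral_diff[OF i1 i2] integral_unique[OF i\<psi>] by simp
    moreover have "integral {0..T} (\<lambda>r. e / 2 * \<psi> n r) = e / 2" using integral_unique[OF i\<psi>] by simp
    ultimately show "norm (integral {0..T} (\<lambda>r. a r * (c r * (smoothstep' ((r - s) * real (Suc n)) * real (Suc n)))) - a s * c s) < e"
      using e by (simp add: \<psi>_def)
  qed
qed

lemma J_zero: assumes "0 < T" shows "(\<lambda>_. 0) \<in> C1_on T" "J_functional T \<gamma> (\<lambda>_. 0) a = 0"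
proof -
  show "(\<lambda>_. 0) \<in> C1_on T" by (rule C1_onI[of T "\<lambda>_. 0"]) auto
  have "J_functional T \<gamma> (\<lambda>_. 0) a = a T * 0 - a 0 * 0 - integral {0..T} (\<lambda>s. a s * 0) - integral {0..T} (\<lambda>s. hamiltonian \<gamma> (a s) 0)"
    by (rule J_functional_eq[of T "\<lambda>_. 0" "\<lambda>_. 0"]) (rule real_derivative_vector_derivative[OF assms], auto)
  then show "J_functional T \<gamma> (\<lambda>_. 0) a = 0" by (simp add: hamiltonian_def)
qed

lemma tendsto_zero_fast: "0 < x \<Longrightarrow> \<forall>\<^sub>F n in sequentially. 1 \<le> x * real (Suc n)" for x :: real
proof -
  assume x: "0 < x"
  obtain n0 where n0: "1 / x < real n0" using reals_Archimedean2 by blast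
  have "1 \<le> x * real (Suc n)" if "n0 \<le> n" for n
  proof -
    have "1 / x \<le> real (Suc n)" using n0 that by linarith
    then show ?thesis using x by (simp add: divide_le_eq mult.commute)
  qed
  then show ?thesis by (auto simp: eventually_sequentially)
qed

text \<open>Cutting off a test function by steeper and steeper smooth steps localises the bound to
  subintervals. Both steps lie to the right of the end points, where paths are continuous.\<close>

lemma J_between_le:
  assumes T: "0 < T" and \<gamma>: "0 < \<gamma>" "\<gamma> < 1" and a: "a \<in> skorohod_paths T"
    and K: "\<And>H. H \<in> C1_on T \<Longrightarrow> J_functional T \<gamma> H a \<le> K"
    and st: "0 \<le> s" "s \<le> t" "t \<le> T" and G'c: "continuous_on {0..T} G'"
    and G': "\<And>r. r \<in> {0..T} \<Longrightarrow> (G has_real_derivative G' r) (at r within {0..T})"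
  shows "J_between \<gamma> G G' a s t \<le> K"
proof (cases "s = t")
  case True
  then show ?thesis using K[OF J_zero(1)[OF T]] J_zero(2)[OF T] by (simp add: J_between_def)
next
  case False
  then have lt: "s < t" using st by simp
  have Gc: "continuous_on {0..T} G" using G' by (rule DERIV_continuous_on)
  define \<psi> where "\<psi> u n r = smoothstep' ((r - u) * real (Suc n)) * real (Suc n)" for u n r
  define cut where "cut n r = smoothstep ((r - s) * real (Suc n)) - smoothstep ((r - t) * real (Suc n))" for n r
  have step_deriv: "((\<lambda>r. smoothstep ((r - u) * real (Suc n))) has_real_derivative \<psi> u n r) (at r within A)" for u n r A
    unfolding \<psi>_def
    by (rule has_field_derivative_at_within, rule DERIV_chain2[OF smoothstep_deriv])
       (auto intro!: derivative_eq_intros)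
  have cut_deriv: "(cut n has_real_derivative \<psi> s n r - \<psi> t n r) (at r within {0..T})" for n r
    unfolding cut_def by (intro DERIV_diff step_deriv)
  have cutc: "continuous_on {0..T} (cut n)" for n by (rule DERIV_continuous_on) (rule cut_deriv)
  have \<psi>c: "continuous_on {0..T} (\<psi> u n)" for u n
    unfolding \<psi>_def
    by (intro continuous_intros continuous_on_compose2[OF smoothstep'_continuous[of UNIV]]) auto
  have cut_bound: "\<bar>cut n r\<bar> \<le> 1" for n r
    unfolding cut_def using smoothstep_bounds[of "(r - s) * real (Suc n)"] smoothstep_bounds[of "(r - t) * real (Suc n)"]
    by linarith
  have step0: "smoothstep ((r - u) * real (Suc n)) = 0" if "r \<le> u" for r u n
    using that by (intro smoothstep_simps(1) mult_nonpos_nonneg) auto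
  have step1: "\<forall>\<^sub>F n in sequentially. smoothstep ((r - u) * real (Suc n)) = 1" if "u < r" for r u
    using tendsto_zero_fast[of "r - u"] that by (auto elim!: eventually_mono)
  \<comment> \<open>Both steps begin at their nominal time and rise afterwards, so the limiting
    indicator is that of the half-open interval without \<open>s\<close> and with
    \<open>t\<close>.\<close>
  have cut_lim: "(\<lambda>n. cut n r) \<longlonglongrightarrow> (if r \<in> {s<..t} then 1 else 0)" for r
  proof -
    consider "r \<le> s" | "s < r" "r \<le> t" | "t < r" by linarith
    then have "\<forall>\<^sub>F n in sequentially. cut n r = (if r \<in> {s<..t} then 1 else 0)"
    proof cases
      case 1
      then show ?thesis using lt step0 by (simp add: cut_def)
    next
      case 2
      show ?thesis using step1[OF 2(1)] by eventually_elim (use 2 step0 in \<open>simp add: cut_def\<close>)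
    next
      case 3
      then have "s < r" using lt by simp
      show ?thesis using step1[OF \<open>s < r\<close>] step1[OF 3] by eventually_elim (use 3 in \<open>simp add: cut_def\<close>)
    qed
    then show ?thesis by (rule tendsto_eventually)
  qed
  define H where "H n r = G r * cut n r" for n r
  define H' where "H' n r = G' r * cut n r + G r * (\<psi> s n r - \<psi> t n r)" for n r
  have H'c: "continuous_on {0..T} (H' n)" for n
    unfolding H'_def by (intro continuous_intros G'c Gc cutc \<psi>c)
  have H_deriv: "(H n has_real_derivative H' n r) (at r within {0..T})" if "r \<in> {0..T}" for n r
    unfolding H_def H'_def using DERIV_mult[OF G'[OF that] cut_deriv[of n r]] by (simp add: mult.commute add.commute)
  have H_in: "H n \<in> C1_on T" for n by (rule C1_onI[OF H'c]) (rule H_deriv)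
  define f where "f n r = a r * (G' r * cut n r) + hamiltonian \<gamma> (a r) (G r * cut n r)" for n r
  define g where "g r = a r * G' r + hamiltonian \<gamma> (a r) (G r)" for r
  have ic: "(\<lambda>r. a r * (G' r * cut n r)) integrable_on {0..T}" for n
    by (intro path_mult_integrable[OF T a] continuous_intros G'c cutc)
  have ih: "(\<lambda>r. hamiltonian \<gamma> (a r) (G r * cut n r)) integrable_on {0..T}" for n
  proof -
    have "(\<lambda>r. 2 * \<gamma> * (exp (G r * cut n r) - 1) + a r * (2 * bdry \<gamma> (G r * cut n r))) integrable_on {0..T}"
      unfolding bdry_def
      by (intro integrable_add integrable_continuous_interval path_mult_integrable[OF T a] continuous_intros Gc cutc)
    then show ?thesis unfolding hamiltonian_affine .
  qed
  have fi: "f n integrable_on {0..T}" for n unfolding f_def by (intro integrable_add ic ih)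
  have i\<psi>: "(\<lambda>r. a r * (G r * \<psi> u n r)) integrable_on {0..T}" for u n
    by (intro path_mult_integrable[OF T a] continuous_intros Gc \<psi>c)
  have J: "J_functional T \<gamma> (H n) a = (a T * G T * cut n T + integral {0..T} (\<lambda>r. a r * (G r * \<psi> t n r)))
      - integral {0..T} (\<lambda>r. a r * (G r * \<psi> s n r)) - integral {0..T} (f n)" for n
  proof -
    have "J_functional T \<gamma> (H n) a = a T * H n T - a 0 * H n 0 - integral {0..T} (\<lambda>r. a r * H' n r)
        - integral {0..T} (\<lambda>r. hamiltonian \<gamma> (a r) (H n r))"
      by (rule J_functional_eq) (rule real_derivative_vector_derivative[OF T _ H_deriv])
    moreover have "H n 0 = 0" using step0[of 0 s n] step0[of 0 t n] st by (simp add: H_def cut_def)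
    moreover have "integral {0..T} (\<lambda>r. a r * H' n r) = integral {0..T} (\<lambda>r. a r * (G' r * cut n r))
        + (integral {0..T} (\<lambda>r. a r * (G r * \<psi> s n r)) - integral {0..T} (\<lambda>r. a r * (G r * \<psi> t n r)))"
      unfolding Henstock_Kurzweil_Integration.integral_diff[OF i\<psi> i\<psi>, symmetric]
        Henstock_Kurzweil_Integration.integral_add[OF ic integrable_diff[OF i\<psi> i\<psi>], symmetric]
      by (intro Henstock_Kurzweil_Integration.integral_cong) (simp add: H'_def algebra_simps)
    moreover have "integral {0..T} (f n) = integral {0..T} (\<lambda>r. a r * (G' r * cut n r))
        + integral {0..T} (\<lambda>r. hamiltonian \<gamma> (a r) (H n r))"
      unfolding f_def H_def by (rule Henstock_Kurzweil_Integration.integral_add[OF ic ih])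
    ultimately show ?thesis by (simp add: H_def)
  qed
  have lim_s: "(\<lambda>n. integral {0..T} (\<lambda>r. a r * (G r * \<psi> s n r))) \<longlonglongrightarrow> a s * G s"
    unfolding \<psi>_def using lt st by (intro approx_identity[OF T a Gc]) auto
  \<comment> \<open>For \<open>t < T\<close> the end-point term dies out and the second bump
    supplies \<open>a t * G t\<close>. For \<open>t = T\<close> the bump would sit beyond the
    interval and vanishes on it, while the cut-off tends to 1 at \<open>T\<close>, so the value
    comes from the end-point term.\<close>
  have lim_t: "(\<lambda>n. a T * G T * cut n T + integral {0..T} (\<lambda>r. a r * (G r * \<psi> t n r))) \<longlonglongrightarrow> a t * G t"
  proof (cases "t = T")
    case True
    have "\<psi> T n r = 0" if "r \<in> {0..T}" for n r
    proof -
      have "(r - T) * real (Suc n) \<le> 0" using that by (intro mult_nonpos_nonneg) auto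
      then show ?thesis by (simp add: \<psi>_def)
    qed
    then have "integral {0..T} (\<lambda>r. a r * (G r * \<psi> t n r)) = 0" for n
      unfolding True using Henstock_Kurzweil_Integration.integral_cong[of "{0..T}" "\<lambda>r. a r * (G r * \<psi> T n r)" "\<lambda>_. 0"] by simp
    then show ?thesis using tendsto_mult[OF tendsto_const[of "a T * G T"] cut_lim[of T]] lt True by simp
  next
    case False
    then have "(\<lambda>n. integral {0..T} (\<lambda>r. a r * (G r * \<psi> t n r))) \<longlonglongrightarrow> a t * G t"
      unfolding \<psi>_def using lt st by (intro approx_identity[OF T a Gc]) auto
    moreover have "(\<lambda>n. a T * G T * cut n T) \<longlonglongrightarrow> a T * G T * 0"
      using cut_lim[of T] False st by (intro tendsto_mult tendsto_const) auto
    ultimately show ?thesis using tendsto_add by fastforce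
  qed
  have lim_f: "(\<lambda>n. integral {0..T} (f n)) \<longlonglongrightarrow> integral {s..t} g"
  proof -
    obtain K0 where K0: "0 \<le> K0" "\<And>r. r \<in> {0..T} \<Longrightarrow> \<bar>G r\<bar> \<le> K0" using continuous_abs_le[OF Gc] by blast
    obtain K1 where K1: "0 \<le> K1" "\<And>r. r \<in> {0..T} \<Longrightarrow> \<bar>G' r\<bar> \<le> K1" using continuous_abs_le[OF G'c] by blast
    have "(\<lambda>n. integral {0..T} (f n)) \<longlonglongrightarrow> integral {0..T} (\<lambda>r. if r \<in> {s<..t} then g r else 0)"
    proof (rule dominated_convergence(2)[OF fi])
      show "(\<lambda>r. K1 + 2 * exp K0) integrable_on {0..T}" by (rule integrable_const_ivl)
      fix n r assume r: "r \<in> {0..T}"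
      have "\<bar>a r\<bar> * (\<bar>G' r\<bar> * \<bar>cut n r\<bar>) \<le> 1 * (K1 * 1)"
        using path_bounds[OF a r] K1(2)[OF r] cut_bound K1(1) by (intro mult_mono) auto
      then have 1: "\<bar>a r * (G' r * cut n r)\<bar> \<le> K1" by (simp add: abs_mult)
      have "\<bar>G r\<bar> * \<bar>cut n r\<bar> \<le> K0 * 1" using K0(2)[OF r] cut_bound K0(1) by (intro mult_mono) auto
      then have e: "exp \<bar>G r * cut n r\<bar> \<le> exp K0" by (simp add: abs_mult)
      have "1 \<le> exp K0" using K0 by simp
      then have "\<bar>hamiltonian \<gamma> (a r) (G r * cut n r)\<bar> \<le> 2 * exp K0"
        using hamiltonian_bounds[OF \<gamma> path_bounds[OF a r], of "G r * cut n r"] e by linarith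
      then show "norm (f n r) \<le> K1 + 2 * exp K0"
        unfolding f_def real_norm_def using 1 by linarith
    next
      fix r assume r: "r \<in> {0..T}"
      have "(\<lambda>n. f n r) \<longlonglongrightarrow> a r * (G' r * (if r \<in> {s<..t} then 1 else 0)) + hamiltonian \<gamma> (a r) (G r * (if r \<in> {s<..t} then 1 else 0))"
        unfolding f_def hamiltonian_def by (intro tendsto_intros cut_lim)
      moreover have "a r * (G' r * (if r \<in> {s<..t} then 1 else 0)) + hamiltonian \<gamma> (a r) (G r * (if r \<in> {s<..t} then 1 else 0))
          = (if r \<in> {s<..t} then g r else 0)"
        by (simp add: g_def hamiltonian_def)
      ultimately show "(\<lambda>n. f n r) \<longlonglongrightarrow> (if r \<in> {s<..t} then g r else 0)" by simp
    qed
    also have "integral {0..T} (\<lambda>r. if r \<in> {s<..t} then g r else 0) = integral ({0..T} \<inter> {s<..t}) g"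
      using integral_restrict_Int[of "{0..T}" "{s<..t}" g] by (simp add: Int_commute)
    also have "\<dots> = integral {s..t} g"
    proof (rule integral_spike_set)
      show "negligible {x \<in> {0..T} \<inter> {s<..t} - {s..t}. g x \<noteq> 0}"
        by (rule negligible_subset[of "{s}"]) auto
      show "negligible {x \<in> {s..t} - {0..T} \<inter> {s<..t}. g x \<noteq> 0}"
        by (rule negligible_subset[of "{s}"]) (use st in auto)
    qed
    finally show ?thesis .
  qed
  have "(\<lambda>n. J_functional T \<gamma> (H n) a) \<longlonglongrightarrow> a t * G t - a s * G s - integral {s..t} g"
    unfolding J by (intro tendsto_diff lim_t lim_s lim_f)
  then have "a t * G t - a s * G s - integral {s..t} g \<le> K"
    by (rule LIMSEQ_le_const2) (use K[OF H_in] in auto)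
  then show ?thesis by (simp add: J_between_def g_def[abs_def])
qed

text \<open>Constant test functions \<open>p\<close> and \<open>- p\<close> on a subinterval give
  that the increment times \<open>p\<close> is at most \<open>K + 2 exp p (t - s)\<close>. A large
  \<open>p\<close> absorbs \<open>K\<close>; a short interval then absorbs the exponential.\<close>

lemma finite_rate_continuous:
  assumes T: "0 < T" and \<gamma>: "0 < \<gamma>" "\<gamma> < 1" and a: "a \<in> skorohod_paths T"
    and K: "\<And>H. H \<in> C1_on T \<Longrightarrow> J_functional T \<gamma> H a \<le> K"
  shows "continuous_on {0..T} a"
proof -
  have K0: "0 \<le> K" using K[OF J_zero(1)[OF T]] J_zero(2)[OF T] by simp
  have inc: "\<bar>a t - a s\<bar> * p \<le> K + 2 * exp p * (t - s)" if st: "0 \<le> s" "s \<le> t" "t \<le> T" and p: "0 < p" for s t p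
  proof -
    have b: "q * (a t - a s) \<le> K + 2 * exp p * (t - s)" if q: "\<bar>q\<bar> = p" for q
    proof -
      have "J_between \<gamma> (\<lambda>_. q) (\<lambda>_. 0) a s t \<le> K" by (rule J_between_le[OF T \<gamma> a K st]) auto
      moreover have "integral {s..t} (\<lambda>r. a r * 0 + hamiltonian \<gamma> (a r) q) \<le> integral {s..t} (\<lambda>r. 2 * exp p)"
      proof (rule integral_le)
        have "(\<lambda>r. a r * (2 * bdry \<gamma> q)) integrable_on {s..t}"
          by (rule integrable_subinterval_real[OF path_mult_integrable[OF T a]]) (use st in auto)
        then have "(\<lambda>r. 2 * \<gamma> * (exp q - 1) + a r * (2 * bdry \<gamma> q)) integrable_on {s..t}"
          by (intro integrable_add integrable_const_ivl)
        then show "(\<lambda>r. a r * 0 + hamiltonian \<gamma> (a r) q) integrable_on {s..t}" by (simp add: hamiltonian_affine)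
        show "(\<lambda>r. 2 * exp p) integrable_on {s..t}" by (rule integrable_const_ivl)
        fix r assume "r \<in> {s..t}"
        then have "a r \<in> {0..1}" using st by (intro path_bounds[OF a]) auto
        then show "a r * 0 + hamiltonian \<gamma> (a r) q \<le> 2 * exp p" using hamiltonian_le[OF \<gamma>, of "a r" q] q by simp
      qed
      ultimately show ?thesis using st by (simp add: J_between_def algebra_simps)
    qed
    have "p * (a t - a s) \<le> K + 2 * exp p * (t - s)" "- (p * (a t - a s)) \<le> K + 2 * exp p * (t - s)"
      using b[of p] b[of "- p"] p by auto
    then have "\<bar>p * (a t - a s)\<bar> \<le> K + 2 * exp p * (t - s)" by linarith
    then show ?thesis using p by (simp add: abs_mult mult.commute)
  qed
  have "\<exists>d>0. \<forall>t\<in>{0..T}. \<bar>t - s\<bar> < d \<longrightarrow> \<bar>a t - a s\<bar> < e" if s: "s \<in> {0..T}" and e: "0 < e" for s e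
  proof -
    \<comment> \<open>With this \<open>p\<close> the target \<open>e * p\<close> exceeds
      \<open>K\<close> by exactly 1, and the choice of \<open>d\<close> keeps the exponential term
      below 1.\<close>
    define p where "p = (K + 1) / e"
    have p: "0 < p" "e * p = K + 1" using K0 e by (auto simp: p_def)
    define d where "d = 1 / (2 * exp p)"
    have d: "0 < d" by (simp add: d_def)
    have "\<bar>a t - a s\<bar> < e" if t: "t \<in> {0..T}" "\<bar>t - s\<bar> < d" for t
    proof -
      have "\<bar>a t - a s\<bar> * p \<le> K + 2 * exp p * \<bar>t - s\<bar>"
        using inc[of s t p] inc[of t s p] s t p by (cases "s \<le> t") (auto simp: abs_minus_commute)
      also have "2 * exp p * \<bar>t - s\<bar> < 2 * exp p * d" using t by (intro mult_strict_left_mono) auto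
      also have "2 * exp p * d = 1" by (simp add: d_def)
      finally have "\<bar>a t - a s\<bar> * p < e * p" using p(2) by simp
      then show ?thesis using p(1) by simp
    qed
    then show ?thesis using d by blast
  qed
  then show ?thesis unfolding continuous_on_iff dist_real_def by blast
qed

section \<open>Rescaling and averaging of paths in time\<close>

lemma DERIV_transform_on:
  "x \<in> S \<Longrightarrow> (\<And>y. y \<in> S \<Longrightarrow> f y = g y) \<Longrightarrow> (f has_field_derivative d) (at x within S) \<Longrightarrow>
    (g has_field_derivative d) (at x within S)"
  by (rule has_field_derivative_transform_within[of f d x S 1]) auto

text \<open>The rescaled test function in \<open>J_shift_le\<close> is evaluated outside the
  original interval. Freezing the derivative at its end-point values and integrating gives a
  \<open>C^1\<close> extension.\<close>

lemma C1_on_extend: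
  assumes T: "0 < T" and G: "G \<in> C1_on T" and R: "T \<le> R"
  obtains f F where "continuous_on UNIV f"
    "\<And>x. x \<in> {- R..R} \<Longrightarrow> (F has_real_derivative f x) (at x within {- R..R})"
    "\<And>x. x \<in> {0..T} \<Longrightarrow> F x = G x" "\<And>x. x \<in> {0..T} \<Longrightarrow> vector_derivative G (at x within {0..T}) = f x"
proof -
  obtain G' where G': "continuous_on {0..T} G'"
    "\<And>s. s \<in> {0..T} \<Longrightarrow> (G has_real_derivative G' s) (at s within {0..T})"
    "\<And>s. s \<in> {0..T} \<Longrightarrow> vector_derivative G (at s within {0..T}) = G' s"
    using C1_on_derivative[OF G T] by blast
  define f where "f x = G' (max 0 (min T x))" for x
  have fc: "continuous_on A f" for A
    unfolding f_def using T by (intro continuous_on_compose2[OF G'(1)] continuous_intros) auto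
  define F where "F x = G 0 + (integral {- R..x} f - integral {- R..0} f)" for x
  have F: "(F has_real_derivative f x) (at x within {- R..R})" if "x \<in> {- R..R}" for x
    unfolding F_def using integral_has_real_derivative[OF fc that] by (auto intro!: derivative_eq_intros)
  have f_eq: "f x = G' x" if "x \<in> {0..T}" for x using that by (simp add: f_def)
  have "((\<lambda>x. F x - G x) has_real_derivative 0) (at x within {0..T})" if x: "x \<in> {0..T}" for x
  proof -
    have "(F has_real_derivative f x) (at x within {0..T})"
      by (rule DERIV_subset[OF F]) (use x R T in auto)
    from DERIV_diff[OF this G'(2)[OF x]] show ?thesis by (simp add: f_eq[OF x])
  qed
  then obtain c where c: "\<And>x. x \<in> {0..T} \<Longrightarrow> F x - G x = c"
    using has_field_derivative_zero_constant[of "{0..T}" "\<lambda>x. F x - G x"] by auto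
  have "c = 0" using c[of 0] T by (simp add: F_def)
  then have F_eq: "F x = G x" if "x \<in> {0..T}" for x using c[OF that] by simp
  show thesis by (rule that[OF fc F F_eq]) (simp_all add: G'(3) f_eq)
qed

text \<open>Substitution turns the functional of the rescaled path into that of \<open>a\<close> on
  a subinterval, with a rescaled field; the boundary terms and the \<open>G'\<close> integral are
  invariant, but the Hamiltonian integral acquires a factor \<open>1 / \<kappa>\<close>. As the
  Hamiltonian is at least -2, the excess is at most
  \<open>(1 / \<kappa> - 1) 2 \<kappa> T\<close>.\<close>

lemma J_shift_le:
  assumes T: "0 < T" and \<gamma>: "0 < \<gamma>" "\<gamma> < 1" and a: "a \<in> skorohod_paths T" and ac: "continuous_on {0..T} a"
    and K: "\<And>H. H \<in> C1_on T \<Longrightarrow> J_functional T \<gamma> H a \<le> K"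
    and \<kappa>: "0 < \<kappa>" "\<kappa> \<le> 1" and \<sigma>: "0 \<le> \<sigma>" "\<kappa> * T + \<sigma> \<le> T" and G: "G \<in> C1_on T"
  shows "J_functional T \<gamma> G (\<lambda>t\<in>{0..T}. a (\<kappa> * t + \<sigma>)) \<le> K + 2 * (1 - \<kappa>) * T"
proof -
  \<comment> \<open>For \<open>r\<close> in \<open>{0..T}\<close> the rescaled time
    \<open>(r - \<sigma>) / \<kappa>\<close> has modulus at most
    \<open>T / \<kappa>\<close>.\<close>
  define R where "R = T / \<kappa> + T"
  have "0 \<le> \<kappa> * T" using \<kappa> T by simp
  then have sT: "\<sigma> \<le> T" using \<sigma> by linarith
  have R: "T \<le> R" using T \<kappa> by (simp add: R_def)
  obtain f F where fc: "continuous_on UNIV f"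
    and F: "\<And>x. x \<in> {- R..R} \<Longrightarrow> (F has_real_derivative f x) (at x within {- R..R})"
    and FG: "\<And>x. x \<in> {0..T} \<Longrightarrow> F x = G x"
    and fG: "\<And>x. x \<in> {0..T} \<Longrightarrow> vector_derivative G (at x within {0..T}) = f x"
  proof (rule C1_on_extend[OF T G R])
    fix f F assume 1: "continuous_on UNIV f"
      and 2: "\<And>x. x \<in> {- R..R} \<Longrightarrow> (F has_real_derivative f x) (at x within {- R..R})"
      and 3: "\<And>x. x \<in> {0..T} \<Longrightarrow> F x = G x" and 4: "\<And>x. x \<in> {0..T} \<Longrightarrow> vector_derivative G (at x within {0..T}) = f x"
    show thesis by (rule that[OF 1 2 3 4])
  qed
  define g where "g r = F ((r - \<sigma>) / \<kappa>)" for r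
  define g' where "g' r = f ((r - \<sigma>) / \<kappa>) / \<kappa>" for r
  have rng: "(r - \<sigma>) / \<kappa> \<in> {- R..R}" if "r \<in> {0..T}" for r
  proof -
    have "\<bar>(r - \<sigma>) / \<kappa>\<bar> \<le> T / \<kappa>" using that \<sigma> sT \<kappa> by (auto simp: abs_divide intro!: divide_right_mono)
    then show ?thesis unfolding atLeastAtMost_iff R_def using T by linarith
  qed
  have g: "(g has_real_derivative g' r) (at r within {0..T})" if r: "r \<in> {0..T}" for r
  proof -
    have "((\<lambda>r. (r - \<sigma>) / \<kappa>) has_real_derivative 1 / \<kappa>) (at r within {0..T})"
      using \<kappa> by (auto intro!: derivative_eq_intros)
    moreover have "(F has_real_derivative f ((r - \<sigma>) / \<kappa>)) (at ((r - \<sigma>) / \<kappa>) within (\<lambda>r. (r - \<sigma>) / \<kappa>) ` {0..T})"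
      by (rule DERIV_subset[OF F[OF rng[OF r]]]) (use rng in blast)
    ultimately show ?thesis
      using DERIV_image_chain[of F "f ((r - \<sigma>) / \<kappa>)" "\<lambda>r. (r - \<sigma>) / \<kappa>" r "{0..T}" "1 / \<kappa>"]
      by (simp add: g_def[abs_def] g'_def o_def)
  qed
  have g'c: "continuous_on A g'" for A
    unfolding g'_def using \<kappa> by (intro continuous_intros continuous_on_compose2[OF fc]) auto
  have gc: "continuous_on {0..T} g" using g by (rule DERIV_continuous_on)
  have sub: "{\<sigma>..\<kappa> * T + \<sigma>} \<subseteq> {0..T}" using \<sigma> by auto
  have st: "\<sigma> \<le> \<kappa> * T + \<sigma>" using \<kappa> T by simp
  have subst: "((\<lambda>t. \<kappa> * h (\<kappa> * t + \<sigma>)) has_integral integral {\<sigma>..\<kappa> * T + \<sigma>} h) {0..T}"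
    if h: "continuous_on {\<sigma>..\<kappa> * T + \<sigma>} h" for h :: "real \<Rightarrow> real"
  proof -
    have "((\<lambda>t. \<kappa> *\<^sub>R h (\<kappa> * t + \<sigma>)) has_integral integral {\<kappa> * 0 + \<sigma>..\<kappa> * T + \<sigma>} h) {0..T}"
    proof (rule has_integral_substitution[where c = \<sigma> and d = "\<kappa> * T + \<sigma>"])
      show "(\<lambda>t. \<kappa> * t + \<sigma>) ` {0..T} \<subseteq> {\<sigma>..\<kappa> * T + \<sigma>}" using \<kappa> by (auto intro!: mult_left_mono)
    qed (use T \<kappa> h in \<open>auto intro!: derivative_eq_intros\<close>)
    then show ?thesis by simp
  qed
  define I1 where "I1 = integral {\<sigma>..\<kappa> * T + \<sigma>} (\<lambda>r. a r * g' r)"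
  define I2 where "I2 = integral {\<sigma>..\<kappa> * T + \<sigma>} (\<lambda>r. hamiltonian \<gamma> (a r) (g r))"
  have ac': "continuous_on {\<sigma>..\<kappa> * T + \<sigma>} a" and gc': "continuous_on {\<sigma>..\<kappa> * T + \<sigma>} g"
    using ac gc sub by (auto intro: continuous_on_subset)
  have c1: "continuous_on {\<sigma>..\<kappa> * T + \<sigma>} (\<lambda>r. a r * g' r)"
    and c2: "continuous_on {\<sigma>..\<kappa> * T + \<sigma>} (\<lambda>r. hamiltonian \<gamma> (a r) (g r))"
    unfolding hamiltonian_def by (intro continuous_intros ac' gc' g'c)+
  have g_at: "g (\<kappa> * t + \<sigma>) = F t" "g' (\<kappa> * t + \<sigma>) = f t / \<kappa>" for t using \<kappa> by (auto simp: g_def g'_def)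
  let ?b = "\<lambda>t\<in>{0..T}. a (\<kappa> * t + \<sigma>)"
  have J: "J_functional T \<gamma> G ?b = ?b T * G T - ?b 0 * G 0 - integral {0..T} (\<lambda>t. ?b t * f t)
      - integral {0..T} (\<lambda>t. hamiltonian \<gamma> (?b t) (G t))"
    by (rule J_functional_eq) (rule fG)
  have e1: "integral {0..T} (\<lambda>t. ?b t * f t) = I1"
  proof -
    have "integral {0..T} (\<lambda>t. ?b t * f t) = integral {0..T} (\<lambda>t. \<kappa> * (a (\<kappa> * t + \<sigma>) * g' (\<kappa> * t + \<sigma>)))"
      using \<kappa> by (intro Henstock_Kurzweil_Integration.integral_cong) (simp add: g_at)
    then show ?thesis unfolding I1_def using integral_unique[OF subst[OF c1]] by simp
  qed
  have e2: "\<kappa> * integral {0..T} (\<lambda>t. hamiltonian \<gamma> (?b t) (G t)) = I2"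
  proof -
    have "integral {0..T} (\<lambda>t. hamiltonian \<gamma> (?b t) (G t)) = integral {0..T} (\<lambda>t. hamiltonian \<gamma> (a (\<kappa> * t + \<sigma>)) (g (\<kappa> * t + \<sigma>)))"
      by (intro Henstock_Kurzweil_Integration.integral_cong) (simp add: g_at FG)
    then show ?thesis unfolding I2_def using integral_unique[OF subst[OF c2]] by simp
  qed
  have "J_between \<gamma> g g' a \<sigma> (\<kappa> * T + \<sigma>) \<le> K"
    by (rule J_between_le[OF T \<gamma> a K \<sigma>(1) st \<sigma>(2) g'c g])
  then have B: "a (\<kappa> * T + \<sigma>) * G T - a \<sigma> * G 0 - (I1 + I2) \<le> K"
    using Henstock_Kurzweil_Integration.integral_add[OF integrable_continuous_interval[OF c1] integrable_continuous_interval[OF c2]]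
      g_at(1)[of T] g_at(1)[of 0] FG[of T] FG[of 0] T by (simp add: J_between_def I1_def I2_def)
  have I2: "- 2 * (\<kappa> * T) \<le> I2"
  proof -
    have "integral {\<sigma>..\<kappa> * T + \<sigma>} (\<lambda>r. - 2) \<le> I2"
      unfolding I2_def
    proof (rule integral_le[OF integrable_const_ivl integrable_continuous_interval[OF c2]])
      fix r assume "r \<in> {\<sigma>..\<kappa> * T + \<sigma>}"
      then show "- 2 \<le> hamiltonian \<gamma> (a r) (g r)" using sub by (intro hamiltonian_ge \<gamma> path_bounds[OF a]) auto
    qed
    then show ?thesis using st by simp
  qed
  have "integral {0..T} (\<lambda>t. hamiltonian \<gamma> (?b t) (G t)) = I2 / \<kappa>" using e2 \<kappa> by (simp add: field_simps)
  then have "J_functional T \<gamma> G ?b = (a (\<kappa> * T + \<sigma>) * G T - a \<sigma> * G 0 - (I1 + I2)) - (1 / \<kappa> - 1) * I2"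
    unfolding J e1 using T by (simp add: algebra_simps)
  moreover have "(1 / \<kappa> - 1) * (- 2 * (\<kappa> * T)) \<le> (1 / \<kappa> - 1) * I2"
    using I2 \<kappa> by (intro mult_left_mono) auto
  moreover have "(1 / \<kappa> - 1) * (- 2 * (\<kappa> * T)) = - (2 * (1 - \<kappa>) * T)" using \<kappa> by (simp add: field_simps)
  ultimately show ?thesis using B by linarith
qed

lemma J_average_le:
  assumes T: "0 < T" and G: "G \<in> C1_on T"
    and a: "\<And>i. i \<le> n \<Longrightarrow> a i \<in> skorohod_paths T" and C: "\<And>i. i \<le> n \<Longrightarrow> J_functional T \<gamma> G (a i) \<le> C"
  shows "(\<lambda>t\<in>{0..T}. (\<Sum>i<Suc n. 1 / Suc n * a i t)) \<in> skorohod_paths T \<and>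
    J_functional T \<gamma> G (\<lambda>t\<in>{0..T}. (\<Sum>i<Suc n. 1 / Suc n * a i t)) \<le> C"
  using a C
proof (induction n)
  case 0
  have "(\<lambda>t\<in>{0..T}. (\<Sum>i<Suc 0. 1 / Suc 0 * a i t)) = a 0"
    using 0(1)[of 0] by (auto simp: skorohod_paths_def PiE_iff extensional_def)
  then show ?case using 0 by simp
next
  case (Suc n)
  let ?A = "\<lambda>t\<in>{0..T}. (\<Sum>i<Suc n. 1 / Suc n * a i t)"
  define u where "u = 1 / real (Suc (Suc n))"
  have u: "0 \<le> u" "u \<le> 1" by (auto simp: u_def)
  have "?A \<in> skorohod_paths T \<and> J_functional T \<gamma> G ?A \<le> C"
    by (rule Suc.IH) (simp_all add: Suc.prems)
  then have IH: "?A \<in> skorohod_paths T" "J_functional T \<gamma> G ?A \<le> C" by blast+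
  have aS: "a (Suc n) \<in> skorohod_paths T" "J_functional T \<gamma> G (a (Suc n)) \<le> C" using Suc.prems by auto
  have eq: "(\<lambda>t\<in>{0..T}. (\<Sum>i<Suc (Suc n). 1 / Suc (Suc n) * a i t)) = (\<lambda>t\<in>{0..T}. (1 - u) * ?A t + u * a (Suc n) t)"
  proof (rule restrict_ext)
    fix t assume t: "t \<in> {0..T}"
    have "(1 - u) * (1 / Suc n) = u" by (simp add: u_def field_simps)
    then have "(1 - u) * (\<Sum>i<Suc n. 1 / Suc n * a i t) = (\<Sum>i<Suc n. u * a i t)"
      unfolding sum_distrib_left mult.assoc[symmetric] by simp
    then show "(\<Sum>i<Suc (Suc n). 1 / Suc (Suc n) * a i t) = (1 - u) * ?A t + u * a (Suc n) t"
      using t by (simp add: u_def del: sum.lessThan_Suc) (simp add: sum.lessThan_Suc)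
  qed
  have "(1 - u) * J_functional T \<gamma> G ?A + u * J_functional T \<gamma> G (a (Suc n)) \<le> (1 - u) * C + u * C"
    using IH aS u by (intro add_mono mult_left_mono) auto
  then have "J_functional T \<gamma> G (\<lambda>t\<in>{0..T}. (1 - u) * ?A t + u * a (Suc n) t) \<le> C"
    unfolding J_convex_comb[OF T G IH(1) aS(1) u] by (simp add: algebra_simps)
  then show ?case unfolding eq using path_convex_comb[OF IH(1) aS(1) u] by blast
qed

text \<open>An average of the shifted paths from \<open>J_shift_le\<close> with
  \<open>\<kappa> = 1 - \<delta>\<close>. The contraction of time leaves room for shifts up to
  \<open>\<delta> T\<close>, so the path is never evaluated outside its interval, as it would be
  under ordinary convolution.\<close>

definition smoothing :: "real \<Rightarrow> real \<Rightarrow> (real \<Rightarrow> real) \<Rightarrow> real \<Rightarrow> real" where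
  "smoothing T \<delta> a = (\<lambda>t\<in>{0..T}. integral {0..1} (\<lambda>u. a ((1 - \<delta>) * t + \<delta> * T * u)))"

locale smoothed =
  fixes T \<delta> :: real and a :: "real \<Rightarrow> real"
  assumes T: "0 < T" and \<delta>: "0 < \<delta>" "\<delta> < 1" and a: "a \<in> skorohod_paths T" and ac: "continuous_on {0..T} a"
begin

lemma arg_in:
  assumes "t \<in> {0..T}" "u \<in> {0..1}"
  shows "(1 - \<delta>) * t + \<delta> * T * u \<in> {0..T}"
proof -
  have "(1 - \<delta>) * t \<le> (1 - \<delta>) * T" "\<delta> * T * u \<le> \<delta> * T * 1" using assms \<delta> T by (intro mult_left_mono; auto)+
  moreover have "0 \<le> (1 - \<delta>) * t" "0 \<le> \<delta> * T * u" using assms \<delta> T by auto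
  ultimately show ?thesis by (simp add: algebra_simps)
qed

lemma arg_continuous: "t \<in> {0..T} \<Longrightarrow> continuous_on {0..1} (\<lambda>u. a ((1 - \<delta>) * t + \<delta> * T * u))"
  by (intro continuous_on_compose2[OF ac] continuous_intros) (use arg_in in auto)

lemma smoothing_integrable: "t \<in> {0..T} \<Longrightarrow> (\<lambda>u. a ((1 - \<delta>) * t + \<delta> * T * u)) integrable_on {0..1}"
  by (intro integrable_continuous_interval arg_continuous)

lemma smoothing_close:
  assumes t: "t \<in> {0..T}" and e: "\<And>s r. s \<in> {0..T} \<Longrightarrow> r \<in> {0..T} \<Longrightarrow> \<bar>s - r\<bar> \<le> \<delta> * T \<Longrightarrow> \<bar>a s - a r\<bar> \<le> e"
  shows "\<bar>smoothing T \<delta> a t - a t\<bar> \<le> e"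
proof -
  have e0: "0 \<le> e" using e[OF t t] \<delta> T by simp
  have "norm (integral {0..1} (\<lambda>u. a ((1 - \<delta>) * t + \<delta> * T * u) - a t)) \<le> e * measure lborel (cbox 0 (1::real))"
    unfolding cbox_interval[symmetric]
  proof (rule integrable_bound[OF e0])
    show "(\<lambda>u. a ((1 - \<delta>) * t + \<delta> * T * u) - a t) integrable_on cbox 0 1"
      unfolding cbox_interval by (intro integrable_diff smoothing_integrable t integrable_const_ivl)
    fix u :: real assume "u \<in> cbox 0 1"
    then have u: "u \<in> {0..1}" by simp
    have "(1 - \<delta>) * t + \<delta> * T * u - t = \<delta> * (T * u - t)" by (simp add: algebra_simps)
    moreover have "\<bar>T * u - t\<bar> \<le> T"
    proof -
      have "0 \<le> T * u" "T * u \<le> T * 1" using u T by (auto intro!: mult_left_mono)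
      then show ?thesis using t by auto
    qed
    ultimately have "\<bar>(1 - \<delta>) * t + \<delta> * T * u - t\<bar> \<le> \<delta> * T" using \<delta> by (simp add: abs_mult)
    then show "norm (a ((1 - \<delta>) * t + \<delta> * T * u) - a t) \<le> e"
      unfolding real_norm_def by (intro e arg_in t u)
  qed
  then show ?thesis
    using t Henstock_Kurzweil_Integration.integral_diff[OF smoothing_integrable[OF t] integrable_const_ivl[of "a t" 0 1]]
    by (simp add: smoothing_def)
qed

lemma smoothing_in_unit: "t \<in> {0..T} \<Longrightarrow> smoothing T \<delta> a t \<in> {0..1}"
proof -
  assume t: "t \<in> {0..T}"
  have b: "a ((1 - \<delta>) * t + \<delta> * T * u) \<in> {0..1}" if "u \<in> {0..1}" for u by (intro path_bounds[OF a] arg_in t that)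
  have "integral {0..1::real} (\<lambda>u. 0 :: real) \<le> integral {0..1} (\<lambda>u. a ((1 - \<delta>) * t + \<delta> * T * u))"
    by (rule integral_le[OF integrable_const_ivl smoothing_integrable[OF t]]) (use b in auto)
  moreover have "integral {0..1} (\<lambda>u. a ((1 - \<delta>) * t + \<delta> * T * u)) \<le> integral {0..1::real} (\<lambda>u. 1 :: real)"
    by (rule integral_le[OF smoothing_integrable[OF t] integrable_const_ivl]) (use b in auto)
  ultimately show ?thesis using t by (simp add: smoothing_def)
qed

text \<open>The average is a difference quotient of a primitive of \<open>a\<close>, so one
  averaging gains one derivative, which is again made of values of \<open>a\<close>. Two averagings
  therefore give a twice continuously differentiable path.\<close>

lemma smoothing_deriv:
  assumes t: "t \<in> {0..T}"
  shows "(smoothing T \<delta> a has_real_derivative (1 - \<delta>) / (\<delta> * T) * (a ((1 - \<delta>) * t + \<delta> * T) - a ((1 - \<delta>) * t)))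
    (at t within {0..T})"
proof -
  define A where "A x = integral {0..x} a" for x
  have A: "(A has_real_derivative a x) (at x within {0..T})" if "x \<in> {0..T}" for x
    unfolding A_def by (rule integral_has_real_derivative[OF ac that])
  have comp: "((\<lambda>t. A ((1 - \<delta>) * t + \<sigma>)) has_real_derivative a ((1 - \<delta>) * t + \<sigma>) * (1 - \<delta>)) (at t within {0..T})"
    if \<sigma>: "\<sigma> = 0 \<or> \<sigma> = \<delta> * T" for \<sigma>
  proof -
    have r: "(1 - \<delta>) * t + \<sigma> \<in> {0..T}" if "t \<in> {0..T}" for t
      using arg_in[OF that, of 0] arg_in[OF that, of 1] \<sigma> by auto
    have "((\<lambda>t. (1 - \<delta>) * t + \<sigma>) has_real_derivative (1 - \<delta>)) (at t within {0..T})"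
      by (auto intro!: derivative_eq_intros)
    moreover have "(A has_real_derivative a ((1 - \<delta>) * t + \<sigma>)) (at ((1 - \<delta>) * t + \<sigma>) within (\<lambda>t. (1 - \<delta>) * t + \<sigma>) ` {0..T})"
      by (rule DERIV_subset[OF A[OF r[OF t]]]) (use r in blast)
    ultimately show ?thesis
      using DERIV_image_chain[of A "a ((1 - \<delta>) * t + \<sigma>)" "\<lambda>t. (1 - \<delta>) * t + \<sigma>" t "{0..T}" "1 - \<delta>"]
      by (simp add: o_def)
  qed
  have eq: "smoothing T \<delta> a t = (A ((1 - \<delta>) * t + \<delta> * T) - A ((1 - \<delta>) * t)) / (\<delta> * T)" if t: "t \<in> {0..T}" for t
  proof -
    let ?s = "(1 - \<delta>) * t"
    have s: "0 \<le> ?s" "?s + \<delta> * T \<le> T" using arg_in[OF t, of 0] arg_in[OF t, of 1] by auto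
    have dT: "0 < \<delta> * T" using \<delta> T by simp
    have c: "continuous_on {?s..?s + \<delta> * T} a" by (rule continuous_on_subset[OF ac]) (use s in auto)
    have "((\<lambda>u. (\<delta> * T) *\<^sub>R a (?s + \<delta> * T * u)) has_integral integral {?s + \<delta> * T * 0..?s + \<delta> * T * 1} a) {0..1}"
    proof (rule has_integral_substitution[where c = ?s and d = "?s + \<delta> * T"])
      show "(\<lambda>u. ?s + \<delta> * T * u) ` {0..1} \<subseteq> {?s..?s + \<delta> * T}"
        using dT mult_left_mono[of _ 1 "\<delta> * T"] by auto
    qed (use dT c in \<open>auto intro!: derivative_eq_intros\<close>)
    then have "\<delta> * T * integral {0..1} (\<lambda>u. a (?s + \<delta> * T * u)) = integral {?s..?s + \<delta> * T} a"
      by (auto dest: integral_unique)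
    moreover have "A ?s + integral {?s..?s + \<delta> * T} a = A (?s + \<delta> * T)"
      unfolding A_def using s dT
      by (intro Henstock_Kurzweil_Integration.integral_combine integrable_continuous_interval continuous_on_subset[OF ac]) auto
    ultimately have "A (?s + \<delta> * T) - A ?s = \<delta> * T * integral {0..1} (\<lambda>u. a (?s + \<delta> * T * u))" by linarith
    then show ?thesis using t dT T \<delta> by (simp add: smoothing_def)
  qed
  have "((\<lambda>t. (A ((1 - \<delta>) * t + \<delta> * T) - A ((1 - \<delta>) * t)) / (\<delta> * T)) has_real_derivative
      (1 - \<delta>) / (\<delta> * T) * (a ((1 - \<delta>) * t + \<delta> * T) - a ((1 - \<delta>) * t))) (at t within {0..T})"
  proof -
    have e: "(x * (1 - \<delta>) - y * (1 - \<delta>)) / (\<delta> * T) = (1 - \<delta>) / (\<delta> * T) * (x - y)" for x y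
      unfolding left_diff_distrib[symmetric] by (simp add: mult.commute)
    have "((\<lambda>t. (A ((1 - \<delta>) * t + \<delta> * T) - A ((1 - \<delta>) * t + 0)) / (\<delta> * T)) has_real_derivative
      (a ((1 - \<delta>) * t + \<delta> * T) * (1 - \<delta>) - a ((1 - \<delta>) * t + 0) * (1 - \<delta>)) / (\<delta> * T)) (at t within {0..T})"
      by (intro DERIV_cdivide DERIV_diff comp) auto
    then show ?thesis unfolding e add_0_right .
  qed
  then show ?thesis by (rule DERIV_transform_on[OF t, rotated]) (simp add: eq)
qed

lemma smoothing_continuous: "continuous_on {0..T} (smoothing T \<delta> a)"
  by (rule DERIV_continuous_on) (rule smoothing_deriv)

lemma smoothing_in_paths: "smoothing T \<delta> a \<in> skorohod_paths T"
  by (rule continuous_path[OF smoothing_continuous smoothing_in_unit]) (auto simp: smoothing_def)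

text \<open>Jensen's inequality through Riemann sums: finite averages of shifted paths satisfy the
  bound by convexity, they converge pointwise to the smoothed path, and \<open>J_functional\<close>
  passes to the limit.\<close>

lemma J_smoothing_le:
  assumes \<gamma>: "0 < \<gamma>" "\<gamma> < 1" and K: "\<And>H. H \<in> C1_on T \<Longrightarrow> J_functional T \<gamma> H a \<le> K" and G: "G \<in> C1_on T"
  shows "J_functional T \<gamma> G (smoothing T \<delta> a) \<le> K + 2 * \<delta> * T"
proof -
  define s where "s n i = (\<lambda>t\<in>{0..T}. a ((1 - \<delta>) * t + \<delta> * T * (Suc i * (1 / Suc n))))" for n i :: nat
  define A where "A n = (\<lambda>t\<in>{0..T}. (\<Sum>i<Suc n. 1 / Suc n * s n i t))" for n
  have frac: "real (Suc i) * (1 / Suc n) \<in> {0..1}" if "i \<le> n" for i n using that by (auto simp: field_simps)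
  have s_in: "s n i \<in> skorohod_paths T" if "i \<le> n" for n i
  proof (rule continuous_path)
    have "continuous_on {0..T} (\<lambda>t. a ((1 - \<delta>) * t + \<delta> * T * (Suc i * (1 / Suc n))))"
    proof (rule continuous_on_compose2[OF ac])
      show "(\<lambda>t. (1 - \<delta>) * t + \<delta> * T * (Suc i * (1 / Suc n))) ` {0..T} \<subseteq> {0..T}"
        using arg_in[OF _ frac[OF that]] by blast
    qed (intro continuous_intros)
    then show "continuous_on {0..T} (s n i)" by (rule continuous_on_eq) (simp add: s_def)
    show "s n i t \<in> {0..1}" if "t \<in> {0..T}" for t
      using path_bounds[OF a arg_in[OF that frac[OF \<open>i \<le> n\<close>]]] that by (simp add: s_def)
  qed (auto simp: s_def)
  have s_J: "J_functional T \<gamma> G (s n i) \<le> K + 2 * \<delta> * T" if "i \<le> n" for n i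
  proof -
    have "\<delta> * T * (Suc i * (1 / Suc n)) \<le> \<delta> * T * 1" using frac[OF that] \<delta> T by (intro mult_left_mono) auto
    then have "J_functional T \<gamma> G (s n i) \<le> K + 2 * (1 - (1 - \<delta>)) * T"
      unfolding s_def using \<delta> T frac[OF that]
      by (intro J_shift_le[OF T \<gamma> a ac K _ _ _ _ G]) (auto simp: algebra_simps)
    then show ?thesis by simp
  qed
  have "A n \<in> skorohod_paths T \<and> J_functional T \<gamma> G (A n) \<le> K + 2 * \<delta> * T" for n
    unfolding A_def by (rule J_average_le[OF T G]) (use s_in s_J in auto)
  then have A: "A n \<in> skorohod_paths T" "J_functional T \<gamma> G (A n) \<le> K + 2 * \<delta> * T" for n by blast+
  have "(\<lambda>n. J_functional T \<gamma> G (A n)) \<longlonglongrightarrow> J_functional T \<gamma> G (smoothing T \<delta> a)"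
  proof (rule J_pointwise_limit[OF T G A(1) smoothing_in_paths])
    fix t assume t: "t \<in> {0..T}"
    have "(\<lambda>n. \<Sum>i<Suc n. 1 / Suc n * a ((1 - \<delta>) * t + \<delta> * T * (Suc i * (1 / Suc n))))
        \<longlonglongrightarrow> integral {0..1} (\<lambda>u. a ((1 - \<delta>) * t + \<delta> * T * u))"
    proof (rule right_continuous_riemann(2))
      fix u :: real assume "u \<in> {0..1}"
      then have "a ((1 - \<delta>) * t + \<delta> * T * u) \<in> {0..1}" by (intro path_bounds[OF a] arg_in t)
      then show "\<bar>a ((1 - \<delta>) * t + \<delta> * T * u)\<bar> \<le> 1" by auto
    next
      fix u :: real assume "u \<in> {0..<1}"
      then show "((\<lambda>u. a ((1 - \<delta>) * t + \<delta> * T * u)) \<longlongrightarrow> a ((1 - \<delta>) * t + \<delta> * T * u)) (at_right u)"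
        by (rule continuous_at_right_interval[OF arg_continuous[OF t]])
    qed simp
    then show "(\<lambda>n. A n t) \<longlonglongrightarrow> smoothing T \<delta> a t"
      using t by (simp add: A_def s_def smoothing_def del: sum.lessThan_Suc of_nat_Suc)
  qed
  then show ?thesis by (rule LIMSEQ_le_const2) (use A in auto)
qed

end

section \<open>Driven paths and their fields\<close>

lemma C1_on_continuous: "G \<in> C1_on T \<Longrightarrow> 0 < T \<Longrightarrow> continuous_on {0..T} G"
  by (erule C1_on_derivative, assumption) (rule DERIV_continuous_on)

text \<open>Integration by parts moves the derivative to the path and absorbs the end-point terms,
  so that bounds can be checked pointwise in time.\<close>

lemma J_differentiable_path:
  assumes T: "0 < T" and a: "a \<in> skorohod_paths T" and a'c: "continuous_on {0..T} a'"
    and a': "\<And>t. t \<in> {0..T} \<Longrightarrow> (a has_real_derivative a' t) (at t within {0..T})" and G: "G \<in> C1_on T"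
  shows "J_functional T \<gamma> G a = integral {0..T} (\<lambda>t. a' t * G t - hamiltonian \<gamma> (a t) (G t))"
proof -
  obtain G' where G': "continuous_on {0..T} G'"
    "\<And>s. s \<in> {0..T} \<Longrightarrow> (G has_real_derivative G' s) (at s within {0..T})"
    "\<And>s. s \<in> {0..T} \<Longrightarrow> vector_derivative G (at s within {0..T}) = G' s"
    using C1_on_derivative[OF G T] by blast
  have Gc: "continuous_on {0..T} G" using G'(2) by (rule DERIV_continuous_on)
  have ac: "continuous_on {0..T} a" using a' by (rule DERIV_continuous_on)
  have J: "J_functional T \<gamma> G a = a T * G T - a 0 * G 0 - integral {0..T} (\<lambda>s. a s * G' s)
      - integral {0..T} (\<lambda>s. hamiltonian \<gamma> (a s) (G s))"
    by (rule J_functional_eq) (rule G'(3))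
  have i1: "(\<lambda>s. a s * G' s) integrable_on {0..T}" and i2: "(\<lambda>s. a' s * G s) integrable_on {0..T}"
    and i3: "(\<lambda>s. hamiltonian \<gamma> (a s) (G s)) integrable_on {0..T}"
    unfolding hamiltonian_def
    by (intro integrable_continuous_interval continuous_intros ac a'c Gc G')+
  have "((\<lambda>s. a s * G' s + a' s * G s) has_integral (a T * G T - a 0 * G 0)) {0..T}"
  proof (rule fundamental_theorem_of_calculus)
    fix s assume s: "s \<in> {0..T}"
    show "((\<lambda>s. a s * G s) has_vector_derivative a s * G' s + a' s * G s) (at s within {0..T})"
      unfolding has_real_derivative_iff_has_vector_derivative[symmetric]
      using DERIV_mult[OF a'[OF s] G'(2)[OF s]] by (simp add: algebra_simps)
  qed (use T in simp)
  then have "a T * G T - a 0 * G 0 = integral {0..T} (\<lambda>s. a s * G' s) + integral {0..T} (\<lambda>s. a' s * G s)"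
    unfolding Henstock_Kurzweil_Integration.integral_add[OF i1 i2, symmetric] by (rule integral_unique[symmetric])
  then show ?thesis
    unfolding J Henstock_Kurzweil_Integration.integral_diff[OF i2 i3] by simp
qed

text \<open>The law of large numbers path started from \<open>m\<close>, which solves the equation with zero field.\<close>

definition relaxation :: "real \<Rightarrow> real \<Rightarrow> real \<Rightarrow> real \<Rightarrow> real" where
  "relaxation T \<gamma> m = (\<lambda>t\<in>{0..T}. \<gamma> + (m - \<gamma>) * exp (- 2 * t))"

lemma relaxation_between:
  assumes "0 < lo" "lo \<le> m" "m \<le> hi" "lo \<le> \<gamma>" "\<gamma> \<le> hi" "t \<in> {0..T}"
  shows "lo \<le> relaxation T \<gamma> m t" "relaxation T \<gamma> m t \<le> hi"
proof -
  define w where "w = exp (- 2 * t)"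
  have w: "0 \<le> w" "w \<le> 1" using assms by (auto simp: w_def)
  have e: "relaxation T \<gamma> m t = (1 - w) * \<gamma> + w * m" using assms by (simp add: relaxation_def w_def algebra_simps)
  have "(1 - w) * lo + w * lo \<le> (1 - w) * \<gamma> + w * m" "(1 - w) * \<gamma> + w * m \<le> (1 - w) * hi + w * hi"
    using w assms by (intro add_mono mult_left_mono; simp)+
  then show "lo \<le> relaxation T \<gamma> m t" "relaxation T \<gamma> m t \<le> hi" unfolding e by (simp_all add: algebra_simps)
qed

lemma relaxation_deriv:
  assumes t: "t \<in> {0..T}"
  shows "(relaxation T \<gamma> m has_real_derivative - 2 * (m - \<gamma>) * exp (- 2 * t)) (at t within {0..T})"
proof -
  have "((\<lambda>t. \<gamma> + (m - \<gamma>) * exp (- 2 * t)) has_real_derivative - 2 * (m - \<gamma>) * exp (- 2 * t)) (at t within {0..T})"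
    by (auto intro!: derivative_eq_intros simp: algebra_simps)
  then show ?thesis by (rule DERIV_transform_on[OF t, rotated]) (simp add: relaxation_def)
qed

lemma relaxation_in_paths:
  assumes "0 < \<gamma>" "\<gamma> < 1" "0 < m" "m < 1"
  shows "relaxation T \<gamma> m \<in> skorohod_paths T"
proof (rule continuous_path)
  show "continuous_on {0..T} (relaxation T \<gamma> m)" by (rule DERIV_continuous_on) (rule relaxation_deriv)
  fix t assume t: "t \<in> {0..T}"
  show "relaxation T \<gamma> m t \<in> {0..1}"
    using relaxation_between[of "min m \<gamma>" m 1 \<gamma> t T] assms t by auto
qed (auto simp: relaxation_def)

text \<open>The velocity of the relaxation path is birth rate minus death rate. Hence the integrand
  is nonpositive for every value of the field, by \<open>p \<le> exp p - 1\<close> applied to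
  \<open>G t\<close> and \<open>- G t\<close>.\<close>

lemma J_relaxation_le:
  assumes T: "0 < T" and \<gamma>: "0 < \<gamma>" "\<gamma> < 1" and m: "0 < m" "m < 1" and G: "G \<in> C1_on T"
  shows "J_functional T \<gamma> G (relaxation T \<gamma> m) \<le> 0"
proof -
  define b where "b = relaxation T \<gamma> m"
  define b' where "b' t = - 2 * (m - \<gamma>) * exp (- 2 * t)" for t
  have b: "b \<in> skorohod_paths T" unfolding b_def by (rule relaxation_in_paths[OF \<gamma> m])
  have b'c: "continuous_on {0..T} b'" unfolding b'_def by (intro continuous_intros)
  have b'd: "(b has_real_derivative b' t) (at t within {0..T})" if "t \<in> {0..T}" for t
    unfolding b_def b'_def by (rule relaxation_deriv[OF that])
  have bc: "continuous_on {0..T} b" using b'd by (rule DERIV_continuous_on)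
  have Gc: "continuous_on {0..T} G"
    using G T by (rule C1_on_continuous)
  have J: "J_functional T \<gamma> G b = integral {0..T} (\<lambda>t. b' t * G t - hamiltonian \<gamma> (b t) (G t))"
    by (rule J_differentiable_path[OF T b b'c b'd G])
  also have "\<dots> \<le> integral {0..T} (\<lambda>t. 0)"
  proof (rule integral_le)
    show "(\<lambda>t. b' t * G t - hamiltonian \<gamma> (b t) (G t)) integrable_on {0..T}"
      unfolding hamiltonian_def by (intro integrable_continuous_interval continuous_intros b'c Gc bc)
    show "(\<lambda>t. 0 :: real) integrable_on {0..T}" by (rule integrable_const_ivl)
    fix t assume t: "t \<in> {0..T}"
    have e: "b' t = 2 * (\<gamma> * (1 - b t)) - 2 * ((1 - \<gamma>) * b t)"
      using t by (simp add: b_def b'_def relaxation_def algebra_simps)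
    have le: "p \<le> exp p - 1" for p :: real using exp_ge_add_one_self[of p] by linarith
    have "\<gamma> * (1 - b t) * G t \<le> \<gamma> * (1 - b t) * (exp (G t) - 1)"
      using path_bounds[OF b t] \<gamma> by (intro mult_left_mono le) auto
    have "(1 - \<gamma>) * b t * (- G t) \<le> (1 - \<gamma>) * b t * (exp (- G t) - 1)"
      using path_bounds[OF b t] \<gamma> by (intro mult_left_mono le) auto
    then have "2 * (\<gamma> * (1 - b t) * G t) + 2 * ((1 - \<gamma>) * b t * (- G t)) \<le> hamiltonian \<gamma> (b t) (G t)"
    proof -
      have h: "hamiltonian \<gamma> (b t) (G t) = 2 * (\<gamma> * (1 - b t) * (exp (G t) - 1)) + 2 * ((1 - \<gamma>) * b t * (exp (- G t) - 1))"
        by (simp add: hamiltonian_def algebra_simps)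
      have "2 * x + 2 * y \<le> 2 * x' + 2 * y'" if "x \<le> x'" "y \<le> y'" for x x' y y' :: real using that by simp
      from this[of "\<gamma> * (1 - b t) * G t" _ "(1 - \<gamma>) * b t * (- G t)"] show ?thesis
        using \<open>\<gamma> * (1 - b t) * G t \<le> \<gamma> * (1 - b t) * (exp (G t) - 1)\<close>
          \<open>(1 - \<gamma>) * b t * (- G t) \<le> (1 - \<gamma>) * b t * (exp (- G t) - 1)\<close> unfolding h by blast
    qed
    then show "b' t * G t - hamiltonian \<gamma> (b t) (G t) \<le> 0" unfolding e by (simp add: algebra_simps)
  qed
  finally show ?thesis by (simp add: b_def)
qed

text \<open>The quadratic equation \<open>A q\<^sup>2 - v q - B = 0\<close> for \<open>q = exp G\<close> expresses that \<open>G\<close> is the optimal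
  field for velocity \<open>v\<close>.\<close>

lemma optimal_field:
  assumes T: "0 < T" and \<gamma>: "0 < \<gamma>" "\<gamma> < 1"
    and a: "\<And>t. t \<in> {0..T} \<Longrightarrow> 0 < a t \<and> a t < 1"
    and a': "\<And>t. t \<in> {0..T} \<Longrightarrow> (a has_real_derivative a' t) (at t within {0..T})"
    and a'': "\<And>t. t \<in> {0..T} \<Longrightarrow> (a' has_real_derivative a'' t) (at t within {0..T})"
    and a''c: "continuous_on {0..T} a''"
  obtains G where "G \<in> C1_on T"
    "\<And>t. t \<in> {0..T} \<Longrightarrow> a' t = 2 * \<gamma> * (1 - a t) * exp (G t) - 2 * (1 - \<gamma>) * a t * exp (- G t)"
proof -
  define A where "A t = 2 * \<gamma> * (1 - a t)" for t
  define B where "B t = 2 * (1 - \<gamma>) * a t" for t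
  define D where "D t = (a' t)\<^sup>2 + 4 * A t * B t" for t
  \<comment> \<open>The positive root of the quadratic. As \<open>a\<close> stays strictly inside
    the unit interval, \<open>A\<close> and \<open>B\<close> are positive, so the discriminant
    exceeds the square of \<open>a'\<close> and the root is positive and differentiable. Its
    derivative involves \<open>a''\<close>, which is why paths are averaged twice
    beforehand.\<close>
  define q where "q t = (a' t + sqrt (D t)) / (2 * A t)" for t
  have A: "0 < A t" and B: "0 < B t" if "t \<in> {0..T}" for t using a[OF that] \<gamma> by (auto simp: A_def B_def)
  have D: "0 < D t" "\<bar>a' t\<bar> < sqrt (D t)" if t: "t \<in> {0..T}" for t
  proof -
    have AB: "0 < A t * B t" using A[OF t] B[OF t] by simp
    then show "0 < D t" unfolding D_def by (simp add: add_nonneg_pos mult.assoc)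
    have "sqrt ((a' t)\<^sup>2) < sqrt (D t)" unfolding D_def using AB by (intro real_sqrt_less_mono) (simp add: mult.assoc)
    then show "\<bar>a' t\<bar> < sqrt (D t)" by simp
  qed
  have q: "0 < q t" if t: "t \<in> {0..T}" for t
  proof -
    have "0 < a' t + sqrt (D t)" using D(2)[OF t] by linarith
    then show ?thesis using A[OF t] by (simp add: q_def)
  qed
  have q_eq: "a' t = A t * q t - B t / q t" if t: "t \<in> {0..T}" for t
  proof -
    have s2: "(sqrt (D t))\<^sup>2 = (a' t)\<^sup>2 + 4 * A t * B t" using D(1)[OF t] by (simp add: D_def)
    define r where "r = sqrt (D t)"
    have Aq: "2 * A t * q t = a' t + r" using A[OF t] by (simp add: q_def r_def)
    have "4 * A t * (A t * (q t)\<^sup>2 - a' t * q t - B t) = (2 * A t * q t)\<^sup>2 - 2 * a' t * (2 * A t * q t) - 4 * A t * B t"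
      by (simp add: power2_eq_square algebra_simps)
    also have "\<dots> = r\<^sup>2 - (a' t)\<^sup>2 - 4 * A t * B t" unfolding Aq by (simp add: power2_eq_square algebra_simps)
    also have "\<dots> = 0" using s2 by (simp add: r_def)
    finally have "A t * (q t)\<^sup>2 - a' t * q t - B t = 0" using A[OF t] by simp
    then show ?thesis using q[OF t] by (simp add: field_simps power2_eq_square)
  qed
  define D' where "D' t = 2 * a' t * a'' t + 4 * (- 2 * \<gamma> * a' t * B t + A t * (2 * (1 - \<gamma>) * a' t))" for t
  define q' where "q' t = ((a'' t + D' t / (2 * sqrt (D t))) * (2 * A t) - (a' t + sqrt (D t)) * (2 * (- 2 * \<gamma> * a' t))) / (2 * A t)\<^sup>2" for t
  have ac: "continuous_on {0..T} a" using a' by (rule DERIV_continuous_on)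
  have a'c: "continuous_on {0..T} a'" using a'' by (rule DERIV_continuous_on)
  have dA: "(A has_real_derivative - 2 * \<gamma> * a' t) (at t within {0..T})" if "t \<in> {0..T}" for t
    unfolding A_def[abs_def] using a'[OF that] by (auto intro!: derivative_eq_intros)
  have dB: "(B has_real_derivative 2 * (1 - \<gamma>) * a' t) (at t within {0..T})" if "t \<in> {0..T}" for t
    unfolding B_def[abs_def] using a'[OF that] by (auto intro!: derivative_eq_intros)
  have dD: "(D has_real_derivative D' t) (at t within {0..T})" if t: "t \<in> {0..T}" for t
    unfolding D_def[abs_def] D'_def using a''[OF t] dA[OF t] dB[OF t]
    by (auto intro!: derivative_eq_intros simp: algebra_simps)
  have dS: "((\<lambda>t. sqrt (D t)) has_real_derivative D' t / (2 * sqrt (D t))) (at t within {0..T})" if t: "t \<in> {0..T}" for t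
  proof -
    have e: "inverse s / 2 * x = x / (2 * s)" for s x :: real by (cases "s = 0") (auto simp: field_simps)
    show ?thesis using DERIV_chain2[OF DERIV_real_sqrt[OF D(1)[OF t]] dD[OF t]] unfolding e .
  qed
  have dq: "(q has_real_derivative q' t) (at t within {0..T})" if t: "t \<in> {0..T}" for t
    unfolding q_def[abs_def] q'_def power2_eq_square
    using DERIV_divide[OF DERIV_add[OF a''[OF t] dS[OF t]] DERIV_cmult[OF dA[OF t], of 2]] A[OF t] by simp
  have Ac: "continuous_on {0..T} A" and Bc: "continuous_on {0..T} B" and Dc: "continuous_on {0..T} D" and qc: "continuous_on {0..T} q"
    by (rule DERIV_continuous_on, erule dA dB dD dq)+
  have sc: "continuous_on {0..T} (\<lambda>t. sqrt (D t))" by (intro continuous_intros Dc)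
  have D'c: "continuous_on {0..T} D'" unfolding D'_def by (intro continuous_intros a'c a''c Ac Bc)
  have nz: "2 * sqrt (D t) \<noteq> 0" "(2 * A t)\<^sup>2 \<noteq> 0" "q t \<noteq> 0" if "t \<in> {0..T}" for t
    using D(1)[OF that] A[OF that] q[OF that] by auto
  have q'c: "continuous_on {0..T} q'"
    unfolding q'_def by (intro continuous_intros D'c sc Ac a'c a''c) (use nz in auto)
  show thesis
  proof (rule that[of "\<lambda>t. ln (q t)"])
    show "(\<lambda>t. ln (q t)) \<in> C1_on T"
    proof (rule C1_onI)
      show "continuous_on {0..T} (\<lambda>t. inverse (q t) * q' t)"
        by (intro continuous_intros qc q'c) (use nz in auto)
      show "((\<lambda>t. ln (q t)) has_real_derivative inverse (q t) * q' t) (at t within {0..T})" if t: "t \<in> {0..T}" for t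
        using DERIV_chain2[OF DERIV_ln[OF q[OF t]] dq[OF t]] .
    qed
    fix t assume t: "t \<in> {0..T}"
    show "a' t = 2 * \<gamma> * (1 - a t) * exp (ln (q t)) - 2 * (1 - \<gamma>) * a t * exp (- ln (q t))"
      using q_eq[OF t] q[OF t] by (simp add: A_def B_def exp_minus divide_inverse)
  qed
qed

text \<open>Two averagings make the path twice differentiable but may leave it touching 0 or 1 and
  displace its starting point. Mixing in a small multiple \<open>\<theta>\<close> of a relaxation
  path, which costs nothing, moves it into the open interval, and the starting point of that path is
  chosen so as to restore the initial value exactly.\<close>

lemma smooth_approximation:
  assumes T: "0 < T" and \<gamma>: "0 < \<gamma>" "\<gamma> < 1" and a: "a \<in> skorohod_paths T" and m: "a 0 = m" "0 < m" "m < 1"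
    and K: "\<And>H. H \<in> C1_on T \<Longrightarrow> J_functional T \<gamma> H a \<le> K" and e: "0 < e"
  obtains c G where "c \<in> skorohod_paths T" "continuous_on {0..T} c" "c 0 = m" "\<And>t. t \<in> {0..T} \<Longrightarrow> \<bar>c t - a t\<bar> \<le> e"
    "\<And>H. H \<in> C1_on T \<Longrightarrow> J_functional T \<gamma> H c \<le> K + e" "G \<in> C1_on T"
    "\<And>t. t \<in> {0..T} \<Longrightarrow> (c has_real_derivative 2 * \<gamma> * (1 - c t) * exp (G t) - 2 * (1 - \<gamma>) * c t * exp (- G t)) (at t within {0..T})"
proof -
  have K0: "0 \<le> K" using K[OF J_zero(1)[OF T]] J_zero(2)[OF T] by simp
  have ac: "continuous_on {0..T} a" by (rule finite_rate_continuous[OF T \<gamma> a K])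
  define \<theta> where "\<theta> = min (e / 4) (1 / 2)"
  have \<theta>: "0 < \<theta>" "\<theta> \<le> e / 4" "\<theta> \<le> 1 / 2" using e by (auto simp: \<theta>_def)
  define d where "d = Min {m, 1 - m, 1}"
  have d: "0 < d" "d \<le> m" "d \<le> 1 - m" "d \<le> 1" using m by (auto simp: d_def)
  \<comment> \<open>Each averaging moves the path by at most \<open>e1\<close>. The first bound
    leaves room for the mixing in the total error \<open>e\<close>; the second keeps the
    displacement of the starting point, once divided by \<open>\<theta>\<close>, within half the
    distance \<open>d\<close> from the ends of the unit interval.\<close>
  define e1 where "e1 = min (e / 8) (\<theta> * d / 4)"
  have e1: "0 < e1" "2 * e1 \<le> e / 4" "2 * e1 \<le> \<theta> * d / 2" using e \<theta> d by (auto simp: e1_def)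
  have "uniformly_continuous_on {0..T} a" using ac by (intro compact_uniformly_continuous) auto
  then obtain \<rho> where \<rho>: "0 < \<rho>" "\<And>s r. s \<in> {0..T} \<Longrightarrow> r \<in> {0..T} \<Longrightarrow> \<bar>s - r\<bar> < \<rho> \<Longrightarrow> \<bar>a s - a r\<bar> < e1"
    using e1(1) unfolding uniformly_continuous_on_def dist_real_def by (metis abs_minus_commute)
  \<comment> \<open>The first entry keeps the averaging window below the modulus of continuity
    \<open>\<rho>\<close>; the second bounds by \<open>e\<close> the increase
    \<open>4 \<delta> T\<close> of the rate caused by two averagings.\<close>
  define \<delta> where "\<delta> = Min {\<rho> / (2 * T), e / (4 * T), 1 / 2}"
  have \<delta>: "0 < \<delta>" "\<delta> < 1" "\<delta> \<le> \<rho> / (2 * T)" "\<delta> \<le> e / (4 * T)" using \<rho> T e by (auto simp: \<delta>_def min_less_iff_disj)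
  have \<delta>T: "\<delta> * T < \<rho>" "4 * \<delta> * T \<le> e" using \<delta>(3,4) T \<rho>(1) by (auto simp: field_simps)
  interpret s1: smoothed T \<delta> a using T \<delta> a ac by unfold_locales auto
  define a1 where "a1 = smoothing T \<delta> a"
  have a1: "a1 \<in> skorohod_paths T" "continuous_on {0..T} a1"
    unfolding a1_def by (rule s1.smoothing_in_paths s1.smoothing_continuous)+
  have osc: "\<bar>a s - a r\<bar> \<le> e1" if "s \<in> {0..T}" "r \<in> {0..T}" "\<bar>s - r\<bar> \<le> \<delta> * T" for s r
    using \<rho>(2)[OF that(1,2)] that(3) \<delta>T(1) by auto
  have a1_close: "\<bar>a1 t - a t\<bar> \<le> e1" if "t \<in> {0..T}" for t
    unfolding a1_def by (rule s1.smoothing_close[OF that osc])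
  interpret s2: smoothed T \<delta> a1 using T \<delta> a1 by unfold_locales auto
  define a2 where "a2 = smoothing T \<delta> a1"
  \<comment> \<open>Averaging does not enlarge the oscillation over lags up to the window length, so
    the second averaging moves the path by at most \<open>e1\<close> once more.\<close>
  have osc1: "\<bar>a1 s - a1 r\<bar> \<le> e1" if s: "s \<in> {0..T}" and r: "r \<in> {0..T}" and sr: "\<bar>s - r\<bar> \<le> \<delta> * T" for s r
  proof -
    have "norm (integral {0..1} (\<lambda>u. a ((1 - \<delta>) * s + \<delta> * T * u) - a ((1 - \<delta>) * r + \<delta> * T * u))) \<le> e1 * measure lborel (cbox 0 (1::real))"
      unfolding cbox_interval[symmetric]
    proof (rule integrable_bound)
      show "0 \<le> e1" using e1 by simp
      show "(\<lambda>u. a ((1 - \<delta>) * s + \<delta> * T * u) - a ((1 - \<delta>) * r + \<delta> * T * u)) integrable_on cbox 0 1"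
        unfolding cbox_interval by (intro integrable_diff s1.smoothing_integrable s r)
      fix u :: real assume "u \<in> cbox 0 1"
      then have u: "u \<in> {0..1}" by simp
      have "((1 - \<delta>) * s + \<delta> * T * u) - ((1 - \<delta>) * r + \<delta> * T * u) = (1 - \<delta>) * (s - r)" by (simp add: algebra_simps)
      then have "\<bar>((1 - \<delta>) * s + \<delta> * T * u) - ((1 - \<delta>) * r + \<delta> * T * u)\<bar> = (1 - \<delta>) * \<bar>s - r\<bar>"
        using \<delta> by (simp add: abs_mult)
      also have "\<dots> \<le> 1 * \<bar>s - r\<bar>" using \<delta> by (intro mult_right_mono) auto
      finally show "norm (a ((1 - \<delta>) * s + \<delta> * T * u) - a ((1 - \<delta>) * r + \<delta> * T * u)) \<le> e1"
        unfolding real_norm_def using sr by (intro osc s1.arg_in s r u) auto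
    qed
    then show ?thesis
      using s r Henstock_Kurzweil_Integration.integral_diff[OF s1.smoothing_integrable[OF s] s1.smoothing_integrable[OF r]]
      by (simp add: a1_def smoothing_def)
  qed
  have a2_close: "\<bar>a2 t - a t\<bar> \<le> 2 * e1" if t: "t \<in> {0..T}" for t
  proof -
    have "\<bar>a2 t - a1 t\<bar> \<le> e1" unfolding a2_def by (rule s2.smoothing_close[OF t osc1])
    then show ?thesis using a1_close[OF t] by linarith
  qed
  have J1: "J_functional T \<gamma> H a1 \<le> K + 2 * \<delta> * T" if "H \<in> C1_on T" for H
    unfolding a1_def by (rule s1.J_smoothing_le[OF \<gamma> K that])
  have J2: "J_functional T \<gamma> H a2 \<le> K + 2 * \<delta> * T + 2 * \<delta> * T" if "H \<in> C1_on T" for H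
    unfolding a2_def by (rule s2.J_smoothing_le[OF \<gamma> J1 that])
  have a2: "a2 \<in> skorohod_paths T" unfolding a2_def by (rule s2.smoothing_in_paths)
  define \<beta> where "\<beta> = (1 - \<delta>) / (\<delta> * T)"
  define a1' where "a1' t = \<beta> * (a ((1 - \<delta>) * t + \<delta> * T) - a ((1 - \<delta>) * t))" for t
  define a2' where "a2' t = \<beta> * (a1 ((1 - \<delta>) * t + \<delta> * T) - a1 ((1 - \<delta>) * t))" for t
  define a2'' where "a2'' t = \<beta> * (a1' ((1 - \<delta>) * t + \<delta> * T) * (1 - \<delta>) - a1' ((1 - \<delta>) * t) * (1 - \<delta>))" for t
  have arg: "(1 - \<delta>) * t + \<delta> * T \<in> {0..T}" "(1 - \<delta>) * t \<in> {0..T}" if "t \<in> {0..T}" for t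
    using s1.arg_in[OF that, of 1] s1.arg_in[OF that, of 0] by auto
  have d1: "(a1 has_real_derivative a1' t) (at t within {0..T})" if "t \<in> {0..T}" for t
    using s1.smoothing_deriv[OF that] by (simp add: a1_def a1'_def \<beta>_def)
  have d2: "(a2 has_real_derivative a2' t) (at t within {0..T})" if "t \<in> {0..T}" for t
    using s2.smoothing_deriv[OF that] by (simp add: a2_def a2'_def \<beta>_def)
  have chain: "((\<lambda>t. a1 ((1 - \<delta>) * t + \<sigma>)) has_real_derivative a1' ((1 - \<delta>) * t + \<sigma>) * (1 - \<delta>)) (at t within {0..T})"
    if t: "t \<in> {0..T}" and \<sigma>: "\<sigma> = 0 \<or> \<sigma> = \<delta> * T" for t \<sigma>
  proof -
    have r: "(1 - \<delta>) * t + \<sigma> \<in> {0..T}" if "t \<in> {0..T}" for t using arg[OF that] \<sigma> by auto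
    have "((\<lambda>t. (1 - \<delta>) * t + \<sigma>) has_real_derivative (1 - \<delta>)) (at t within {0..T})"
      by (auto intro!: derivative_eq_intros)
    moreover have "(a1 has_real_derivative a1' ((1 - \<delta>) * t + \<sigma>)) (at ((1 - \<delta>) * t + \<sigma>) within (\<lambda>t. (1 - \<delta>) * t + \<sigma>) ` {0..T})"
      by (rule DERIV_subset[OF d1[OF r[OF t]]]) (use r in blast)
    ultimately show ?thesis
      using DERIV_image_chain[of a1 "a1' ((1 - \<delta>) * t + \<sigma>)" "\<lambda>t. (1 - \<delta>) * t + \<sigma>" t "{0..T}" "1 - \<delta>"]
      by (simp add: o_def)
  qed
  have d2': "(a2' has_real_derivative a2'' t) (at t within {0..T})" if "t \<in> {0..T}" for t
    unfolding a2'_def[abs_def] a2''_def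
    using DERIV_cmult[OF DERIV_diff[OF chain[OF that, of "\<delta> * T"] chain[OF that, of 0]], of \<beta>] by simp
  have comp_c: "continuous_on {0..T} (\<lambda>t. g ((1 - \<delta>) * t + \<delta> * T))" "continuous_on {0..T} (\<lambda>t. g ((1 - \<delta>) * t))"
    if g: "continuous_on {0..T} g" for g :: "real \<Rightarrow> real"
    by (rule continuous_on_compose2[OF g]; use arg in \<open>auto intro!: continuous_intros\<close>)+
  have a1'c: "continuous_on {0..T} a1'" unfolding a1'_def by (intro continuous_intros comp_c ac)
  have a2''c: "continuous_on {0..T} a2''" unfolding a2''_def by (intro continuous_intros comp_c a1'c)
  \<comment> \<open>The solution of \<open>(1 - \<theta>) a2(0) + \<theta> b0 = m\<close>.\<close>
  define b0 where "b0 = m + (1 - \<theta>) / \<theta> * (m - a2 0)"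
  have b0: "0 < b0" "b0 < 1"
  proof -
    have "\<bar>m - a2 0\<bar> \<le> \<theta> * d / 2" using a2_close[of 0] m(1) e1(3) T by (simp add: abs_minus_commute)
    then have "(1 - \<theta>) / \<theta> * \<bar>m - a2 0\<bar> \<le> (1 / \<theta>) * (\<theta> * d / 2)"
      using \<theta> by (intro mult_mono divide_right_mono) auto
    also have "\<dots> = d / 2" using \<theta> by simp
    finally have "\<bar>(1 - \<theta>) / \<theta> * (m - a2 0)\<bar> \<le> d / 2" using \<theta> by (simp add: abs_mult)
    then show "0 < b0" "b0 < 1" using d unfolding b0_def by linarith+
  qed
  define b where "b = relaxation T \<gamma> b0"
  have b: "b \<in> skorohod_paths T" unfolding b_def by (rule relaxation_in_paths[OF \<gamma> b0])
  define c where "c = (\<lambda>t\<in>{0..T}. (1 - \<theta>) * a2 t + \<theta> * b t)"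
  have \<theta>01: "0 \<le> \<theta>" "\<theta> \<le> 1" using \<theta> by auto
  have c: "c \<in> skorohod_paths T" unfolding c_def by (rule path_convex_comb[OF a2 b \<theta>01])
  define c' where "c' t = (1 - \<theta>) * a2' t + \<theta> * (- 2 * (b0 - \<gamma>) * exp (- 2 * t))" for t
  define c'' where "c'' t = (1 - \<theta>) * a2'' t + \<theta> * (4 * (b0 - \<gamma>) * exp (- 2 * t))" for t
  have c'd: "(c has_real_derivative c' t) (at t within {0..T})" if t: "t \<in> {0..T}" for t
  proof -
    have "((\<lambda>t. (1 - \<theta>) * a2 t + \<theta> * b t) has_real_derivative c' t) (at t within {0..T})"
      unfolding c'_def b_def by (intro DERIV_add DERIV_cmult d2 relaxation_deriv t)
    then show ?thesis by (rule DERIV_transform_on[OF t, rotated]) (simp add: c_def)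
  qed
  have c''d: "(c' has_real_derivative c'' t) (at t within {0..T})" if t: "t \<in> {0..T}" for t
    unfolding c'_def[abs_def] c''_def using d2'[OF t]
    by (auto intro!: derivative_eq_intros simp: algebra_simps)
  have c''c: "continuous_on {0..T} c''" unfolding c''_def by (intro continuous_intros a2''c)
  \<comment> \<open>The relaxation path stays between \<open>b0\<close> and \<open>\<gamma>\<close>,
    both strictly inside the unit interval, and its positive weight \<open>\<theta>\<close>
    transfers this to the mixture.\<close>
  have cpos: "0 < c t \<and> c t < 1" if t: "t \<in> {0..T}" for t
  proof -
    define lo where "lo = min b0 \<gamma>"
    define hi where "hi = max b0 \<gamma>"
    have lh: "0 < lo" "hi < 1" using b0 \<gamma> by (auto simp: lo_def hi_def)
    have "lo \<le> b t \<and> b t \<le> hi"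
      using relaxation_between[of lo b0 hi \<gamma> t T] b0 \<gamma> t by (auto simp: b_def lo_def hi_def)
    then have "lo \<le> b t" "b t \<le> hi" by blast+
    then have "\<theta> * lo \<le> \<theta> * b t" "\<theta> * b t \<le> \<theta> * hi" "0 < \<theta> * lo" "\<theta> * hi < \<theta>"
      using \<theta> lh by (auto intro: mult_left_mono)
    moreover have "0 \<le> (1 - \<theta>) * a2 t" "(1 - \<theta>) * a2 t \<le> (1 - \<theta>) * 1"
      using path_bounds[OF a2 t] \<theta> by (auto intro!: mult_left_mono mult_nonneg_nonneg)
    ultimately show ?thesis using t by (simp add: c_def)
  qed
  have J: "J_functional T \<gamma> H c \<le> K + e" if H: "H \<in> C1_on T" for H
  proof -
    have "J_functional T \<gamma> H c = (1 - \<theta>) * J_functional T \<gamma> H a2 + \<theta> * J_functional T \<gamma> H b"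
      unfolding c_def by (rule J_convex_comb[OF T H a2 b \<theta>01])
    also have "\<dots> \<le> (1 - \<theta>) * (K + e) + \<theta> * 0"
    proof (intro add_mono mult_left_mono)
      show "J_functional T \<gamma> H a2 \<le> K + e" using J2[OF H] \<delta>T(2) by linarith
      show "J_functional T \<gamma> H b \<le> 0" unfolding b_def by (rule J_relaxation_le[OF T \<gamma> b0 H])
    qed (use \<theta> in auto)
    also have "\<dots> \<le> 1 * (K + e)" using \<theta> K0 e by (simp add: mult_right_mono)
    finally show ?thesis by simp
  qed
  have close: "\<bar>c t - a t\<bar> \<le> e" if t: "t \<in> {0..T}" for t
  proof -
    have "c t - a t = (a2 t - a t) + \<theta> * (b t - a2 t)" using t by (simp add: c_def algebra_simps)
    moreover have "\<bar>\<theta> * (b t - a2 t)\<bar> \<le> \<theta> * 1"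
      unfolding abs_mult using path_bounds[OF a2 t] path_bounds[OF b t] \<theta> by (intro mult_mono) auto
    ultimately show ?thesis using a2_close[OF t] e1(2) \<theta>(2) e by linarith
  qed
  have c0: "c 0 = m"
  proof -
    have "b 0 = b0" using T by (simp add: b_def relaxation_def)
    then have "c 0 = (1 - \<theta>) * a2 0 + \<theta> * b0" using T by (simp add: c_def)
    also have "\<theta> * b0 = \<theta> * m + (1 - \<theta>) * (m - a2 0)" using \<theta> by (simp add: b0_def distrib_left)
    finally show ?thesis by (simp add: algebra_simps)
  qed
  obtain G where G: "G \<in> C1_on T"
    "\<And>t. t \<in> {0..T} \<Longrightarrow> c' t = 2 * \<gamma> * (1 - c t) * exp (G t) - 2 * (1 - \<gamma>) * c t * exp (- G t)"
    using optimal_field[OF T \<gamma> cpos c'd c''d c''c] by blast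
  have cc: "continuous_on {0..T} c" using c'd by (rule DERIV_continuous_on)
  show thesis
    by (rule that[OF c cc c0 close J G(1)]) (use c'd G(2) in auto)
qed

text \<open>First variation in the test function: at a maximiser \<open>G\<close> the path solves a linear equation
  with field \<open>G\<close>, tested here with \<open>\<phi> = exp (\<integral> k) \<psi>\<close> and \<open>\<psi>' = - (a - c) exp (\<integral> k)\<close>.\<close>

lemma optimal_path_unique:
  assumes T: "0 < T" and \<gamma>: "0 < \<gamma>" "\<gamma> < 1" and a: "a \<in> skorohod_paths T" "continuous_on {0..T} a"
    and c: "c \<in> skorohod_paths T" and G: "G \<in> C1_on T"
    and c': "\<And>t. t \<in> {0..T} \<Longrightarrow> (c has_real_derivative 2 * \<gamma> * (1 - c t) * exp (G t) - 2 * (1 - \<gamma>) * c t * exp (- G t)) (at t within {0..T})"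
    and init: "a 0 = c 0" and max: "\<And>H. H \<in> C1_on T \<Longrightarrow> J_functional T \<gamma> H a \<le> J_functional T \<gamma> G a"
  shows "a = c"
proof -
  obtain G' where G': "continuous_on {0..T} G'"
    "\<And>s. s \<in> {0..T} \<Longrightarrow> (G has_real_derivative G' s) (at s within {0..T})"
    "\<And>s. s \<in> {0..T} \<Longrightarrow> vector_derivative G (at s within {0..T}) = G' s"
    using C1_on_derivative[OF G T] by blast
  have Gc: "continuous_on {0..T} G" by (rule C1_on_continuous[OF G T])
  have cc: "continuous_on {0..T} c" using c' by (rule DERIV_continuous_on)
  define drift where "drift x s = 2 * \<gamma> * (1 - x) * exp (G s) - 2 * (1 - \<gamma>) * x * exp (- G s)" for x s
  define k where "k s = 2 * \<gamma> * exp (G s) + 2 * (1 - \<gamma>) * exp (- G s)" for s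
  have kc: "continuous_on {0..T} k" unfolding k_def by (intro continuous_intros Gc)
  have drc: "continuous_on {0..T} (\<lambda>s. drift (x s) s)" if "continuous_on {0..T} x" for x
    unfolding drift_def by (intro continuous_intros Gc that)
  have drift_diff: "drift x s - drift y s = - (k s * (x - y))" for x y s
    by (simp add: drift_def k_def algebra_simps)
  obtain K where K: "0 \<le> K" "\<And>s. s \<in> {0..T} \<Longrightarrow> \<bar>G s\<bar> \<le> K" using continuous_abs_le[OF Gc] by blast
  have weak: "a T * \<phi> T - a 0 * \<phi> 0 - integral {0..T} (\<lambda>s. a s * \<phi>' s) - integral {0..T} (\<lambda>s. drift (a s) s * \<phi> s) = 0"
    (is "?l = 0") if \<phi>'c: "continuous_on {0..T} \<phi>'"
      and \<phi>': "\<And>s. s \<in> {0..T} \<Longrightarrow> (\<phi> has_real_derivative \<phi>' s) (at s within {0..T})" for \<phi> \<phi>'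
  proof -
    have \<phi>c: "continuous_on {0..T} \<phi>" using \<phi>' by (rule DERIV_continuous_on)
    obtain B where B: "0 \<le> B" "\<And>s. s \<in> {0..T} \<Longrightarrow> \<bar>\<phi> s\<bar> \<le> B" using continuous_abs_le[OF \<phi>c] by blast
    \<comment> \<open>A bound, per unit of \<open>u^2\<close>, on the second-order Taylor remainder
      of the Hamiltonian when the field changes from \<open>G\<close> to
      \<open>G + u \<phi>\<close>.\<close>
    define Q where "Q = 2 * exp K * (B\<^sup>2 * exp B)"
    have Q0: "0 \<le> Q" by (simp add: Q_def)
    \<comment> \<open>Perturbing the field by \<open>u \<phi>\<close> changes the functional by
      \<open>u\<close> times the first variation, up to a quadratic error; maximality of
      \<open>G\<close> leaves only this error on the right.\<close>
    have var: "u * ?l \<le> Q * T * u\<^sup>2" if u: "\<bar>u\<bar> \<le> 1" for u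
    proof -
      define H where "H s = G s + u * \<phi> s" for s
      define H' where "H' s = G' s + u * \<phi>' s" for s
      have H'c: "continuous_on {0..T} H'" unfolding H'_def by (intro continuous_intros G' \<phi>'c)
      have Hd: "(H has_real_derivative H' s) (at s within {0..T})" if "s \<in> {0..T}" for s
        unfolding H_def[abs_def] H'_def by (intro DERIV_add DERIV_cmult G' \<phi>' that)
      have H: "H \<in> C1_on T" by (rule C1_onI[OF H'c Hd])
      have Hc: "continuous_on {0..T} H" by (rule C1_on_continuous[OF H T])
      have JH: "J_functional T \<gamma> H a = a T * H T - a 0 * H 0 - integral {0..T} (\<lambda>s. a s * H' s) - integral {0..T} (\<lambda>s. hamiltonian \<gamma> (a s) (H s))"
        by (rule J_functional_eq) (rule real_derivative_vector_derivative[OF T _ Hd])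
      have JG: "J_functional T \<gamma> G a = a T * G T - a 0 * G 0 - integral {0..T} (\<lambda>s. a s * G' s) - integral {0..T} (\<lambda>s. hamiltonian \<gamma> (a s) (G s))"
        by (rule J_functional_eq) (rule G'(3))
      have i1: "(\<lambda>s. a s * G' s) integrable_on {0..T}" "(\<lambda>s. a s * \<phi>' s) integrable_on {0..T}"
        by (intro integrable_continuous_interval continuous_intros a G' \<phi>'c)+
      have e1: "integral {0..T} (\<lambda>s. a s * H' s) = integral {0..T} (\<lambda>s. a s * G' s) + u * integral {0..T} (\<lambda>s. a s * \<phi>' s)"
        using Henstock_Kurzweil_Integration.integral_add[OF i1(1) integrable_cmul[OF i1(2), of u]]
        by (simp add: H'_def algebra_simps)
      have i2: "(\<lambda>s. hamiltonian \<gamma> (a s) (G s)) integrable_on {0..T}" "(\<lambda>s. drift (a s) s * \<phi> s) integrable_on {0..T}"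
        "(\<lambda>s. hamiltonian \<gamma> (a s) (H s)) integrable_on {0..T}"
        unfolding hamiltonian_def by (intro integrable_continuous_interval continuous_intros a Gc \<phi>c Hc drc)+
      have i3: "(\<lambda>s. hamiltonian \<gamma> (a s) (G s) + u * (drift (a s) s * \<phi> s) + Q * u\<^sup>2) integrable_on {0..T}"
        using integrable_add[OF integrable_add[OF i2(1) integrable_cmul[OF i2(2), of u]] integrable_const_ivl[of "Q * u\<^sup>2"]] by simp
      have "integral {0..T} (\<lambda>s. hamiltonian \<gamma> (a s) (H s)) \<le> integral {0..T} (\<lambda>s. hamiltonian \<gamma> (a s) (G s) + u * (drift (a s) s * \<phi> s) + Q * u\<^sup>2)"
      proof (rule integral_le[OF i2(3) i3])
        fix s assume s: "s \<in> {0..T}"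
        define x where "x = u * \<phi> s"
        have "\<bar>u\<bar> * \<bar>\<phi> s\<bar> \<le> 1 * B" using u B(2)[OF s] by (intro mult_mono) auto
        then have xB: "\<bar>x\<bar> \<le> B" by (simp add: x_def abs_mult)
        have x2: "x\<^sup>2 * exp \<bar>x\<bar> \<le> u\<^sup>2 * (B\<^sup>2 * exp B)"
        proof -
          have "(\<phi> s)\<^sup>2 \<le> B\<^sup>2" using B(2)[OF s] B(1) by (simp add: abs_le_square_iff[symmetric])
          then have "x\<^sup>2 \<le> u\<^sup>2 * B\<^sup>2" by (simp add: x_def power_mult_distrib mult_left_mono)
          then have "x\<^sup>2 * exp \<bar>x\<bar> \<le> (u\<^sup>2 * B\<^sup>2) * exp B" using xB by (intro mult_mono) auto
          then show ?thesis by (simp add: mult.assoc)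
        qed
        have t1: "exp y - 1 - y \<le> u\<^sup>2 * (B\<^sup>2 * exp B)" if "y = x \<or> y = - x" for y
          using abs_exp_taylor[of y] x2 that by auto
        have as: "a s \<in> {0..1}" by (rule path_bounds[OF a(1) s])
        have eK: "exp (G s) \<le> exp K" "exp (- G s) \<le> exp K" using K(2)[OF s] by auto
        define w where "w = \<gamma> * (1 - a s)"
        define w' where "w' = (1 - \<gamma>) * a s"
        have w: "0 \<le> w" "0 \<le> w'" using \<gamma> as by (auto simp: w_def w'_def)
        have ww: "w + w' \<le> 1"
        proof -
          have "w \<le> 1 * (1 - a s)" "w' \<le> 1 * a s" unfolding w_def w'_def using \<gamma> as by (intro mult_right_mono; auto)+
          then show ?thesis by simp
        qed
        define b where "b = u\<^sup>2 * (B\<^sup>2 * exp B)"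
        have b0: "0 \<le> b" by (simp add: b_def)
        have p1: "exp (G s) * (exp x - 1 - x) \<le> exp K * b"
        proof -
          have "exp (G s) * (exp x - 1 - x) \<le> exp (G s) * b" using t1[of x] by (intro mult_left_mono) (auto simp: b_def)
          also have "\<dots> \<le> exp K * b" using eK b0 by (intro mult_right_mono) auto
          finally show ?thesis .
        qed
        have p2: "exp (- G s) * (exp (- x) - 1 - (- x)) \<le> exp K * b"
        proof -
          have "exp (- G s) * (exp (- x) - 1 - (- x)) \<le> exp (- G s) * b" using t1[of "- x"] by (intro mult_left_mono) (auto simp: b_def)
          also have "\<dots> \<le> exp K * b" using eK b0 by (intro mult_right_mono) auto
          finally show ?thesis .
        qed
        have "w * (exp (G s) * (exp x - 1 - x)) + w' * (exp (- G s) * (exp (- x) - 1 - (- x))) \<le> w * (exp K * b) + w' * (exp K * b)"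
          by (intro add_mono mult_left_mono p1 p2 w)
        also have "\<dots> = (w + w') * (exp K * b)" by (simp add: distrib_right)
        also have "\<dots> \<le> 1 * (exp K * b)" using ww b0 by (intro mult_right_mono) auto
        finally have le: "2 * (w * (exp (G s) * (exp x - 1 - x)) + w' * (exp (- G s) * (exp (- x) - 1 - (- x)))) \<le> Q * u\<^sup>2"
          by (simp add: Q_def b_def mult_ac)
        have "hamiltonian \<gamma> (a s) (G s + x) = hamiltonian \<gamma> (a s) (G s) + drift (a s) s * x
            + 2 * (w * (exp (G s) * (exp x - 1 - x)) + w' * (exp (- G s) * (exp (- x) - 1 - (- x))))"
          by (simp add: hamiltonian_def drift_def w_def w'_def exp_add algebra_simps exp_diff exp_minus divide_inverse)
        then show "hamiltonian \<gamma> (a s) (H s) \<le> hamiltonian \<gamma> (a s) (G s) + u * (drift (a s) s * \<phi> s) + Q * u\<^sup>2"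
          using le by (simp add: H_def x_def mult_ac)
      qed
      also have "\<dots> = integral {0..T} (\<lambda>s. hamiltonian \<gamma> (a s) (G s)) + u * integral {0..T} (\<lambda>s. drift (a s) s * \<phi> s) + Q * T * u\<^sup>2"
        using Henstock_Kurzweil_Integration.integral_add[OF integrable_add[OF i2(1) integrable_cmul[OF i2(2), of u]] integrable_const_ivl[of "Q * u\<^sup>2"]]
          Henstock_Kurzweil_Integration.integral_add[OF i2(1) integrable_cmul[OF i2(2), of u]] T by simp
      finally have "J_functional T \<gamma> H a \<ge> J_functional T \<gamma> G a + u * ?l - Q * T * u\<^sup>2"
        unfolding JH JG e1 H_def by (simp add: algebra_simps)
      then show ?thesis using max[OF H] by linarith
    qed
    show "?l = 0"
    proof (rule ccontr)
      assume nz: "?l \<noteq> 0"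
      \<comment> \<open>A step of size \<open>v\<close>, in the direction of the sign of the first
        variation, would win linearly and lose at most \<open>Q T v^2\<close>. With \<open>v\<close>
        at most the variation divided by \<open>R > Q T\<close>, the win exceeds the loss.\<close>
      define R where "R = Q * T + 1"
      have R: "0 < R" using Q0 T by (simp add: R_def add_nonneg_pos)
      define v where "v = min 1 (\<bar>?l\<bar> / R)"
      have v: "0 < v" "v \<le> 1" "R * v \<le> \<bar>?l\<bar>" using nz R by (auto simp: v_def min_def field_simps)
      have "\<bar>v * sgn ?l\<bar> \<le> 1" using v by (simp add: abs_mult sgn_if)
      from var[OF this] have "v * \<bar>?l\<bar> \<le> Q * T * v\<^sup>2"
        using nz by (simp add: power_mult_distrib mult.assoc abs_sgn[symmetric] mult.commute[of "sgn ?l"] sgn_if split: if_splits)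
      then have "\<bar>?l\<bar> \<le> Q * T * v" using v(1) by (simp add: power2_eq_square mult.left_commute[of v] mult.assoc)
      also have "\<dots> < R * v" using v(1) by (simp add: R_def distrib_right)
      finally show False using v(3) by simp
    qed
  qed
  have weak_c: "c T * \<phi> T - c 0 * \<phi> 0 - integral {0..T} (\<lambda>s. c s * \<phi>' s) - integral {0..T} (\<lambda>s. drift (c s) s * \<phi> s) = 0"
    if \<phi>'c: "continuous_on {0..T} \<phi>'"
      and \<phi>': "\<And>s. s \<in> {0..T} \<Longrightarrow> (\<phi> has_real_derivative \<phi>' s) (at s within {0..T})" for \<phi> \<phi>'
  proof -
    have \<phi>c: "continuous_on {0..T} \<phi>" using \<phi>' by (rule DERIV_continuous_on)
    have i: "(\<lambda>s. c s * \<phi>' s) integrable_on {0..T}" "(\<lambda>s. drift (c s) s * \<phi> s) integrable_on {0..T}"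
      by (intro integrable_continuous_interval continuous_intros cc \<phi>'c \<phi>c drc)+
    have "((\<lambda>s. c s * \<phi>' s + drift (c s) s * \<phi> s) has_integral (c T * \<phi> T - c 0 * \<phi> 0)) {0..T}"
    proof (rule fundamental_theorem_of_calculus)
      fix s assume s: "s \<in> {0..T}"
      show "((\<lambda>s. c s * \<phi> s) has_vector_derivative c s * \<phi>' s + drift (c s) s * \<phi> s) (at s within {0..T})"
        unfolding has_real_derivative_iff_has_vector_derivative[symmetric]
        using DERIV_mult[OF c'[OF s] \<phi>'[OF s]] by (simp add: drift_def algebra_simps)
    qed (use T in simp)
    then show ?thesis using Henstock_Kurzweil_Integration.integral_add[OF i] by (simp add: integral_unique)
  qed
  define d where "d s = a s - c s" for s
  have dc: "continuous_on {0..T} d" unfolding d_def by (intro continuous_intros a cc)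
  define P where "P t = integral {0..t} k" for t
  have P: "(P has_real_derivative k t) (at t within {0..T})" if "t \<in> {0..T}" for t
    unfolding P_def by (rule integral_has_real_derivative[OF kc that])
  have Pc: "continuous_on {0..T} P" using P by (rule DERIV_continuous_on)
  have dPc: "continuous_on {0..T} (\<lambda>s. d s * exp (P s))" by (intro continuous_intros dc Pc)
  \<comment> \<open>Chosen so that \<open>\<phi>\<close> vanishes at \<open>T\<close> and
    \<open>\<phi>' - k \<phi> = - d exp (2 P)\<close>. The initial values agree, so subtracting the
    two weak equations leaves the integral of \<open>d (\<phi>' - k \<phi>)\<close>, which is minus
    the integral of the square of \<open>d exp P\<close>.\<close>
  define \<psi> where "\<psi> t = integral {0..T} (\<lambda>s. d s * exp (P s)) - integral {0..t} (\<lambda>s. d s * exp (P s))" for t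
  have \<psi>: "(\<psi> has_real_derivative - (d t * exp (P t))) (at t within {0..T})" if "t \<in> {0..T}" for t
    unfolding \<psi>_def[abs_def] using integral_has_real_derivative[OF dPc that] by (auto intro!: derivative_eq_intros)
  have \<psi>c: "continuous_on {0..T} \<psi>" using \<psi> by (rule DERIV_continuous_on)
  define \<phi> where "\<phi> t = exp (P t) * \<psi> t" for t
  define \<phi>' where "\<phi>' t = k t * \<phi> t - d t * exp (P t) * exp (P t)" for t
  have \<phi>c: "continuous_on {0..T} \<phi>" unfolding \<phi>_def by (intro continuous_intros Pc \<psi>c)
  have \<phi>'c: "continuous_on {0..T} \<phi>'" unfolding \<phi>'_def by (intro continuous_intros Pc \<phi>c dc kc)
  have \<phi>d: "(\<phi> has_real_derivative \<phi>' t) (at t within {0..T})" if t: "t \<in> {0..T}" for t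
    unfolding \<phi>_def[abs_def] \<phi>'_def using P[OF t] \<psi>[OF t]
    by (auto intro!: derivative_eq_intros simp: \<phi>_def algebra_simps)
  have i: "(\<lambda>s. a s * \<phi>' s) integrable_on {0..T}" "(\<lambda>s. c s * \<phi>' s) integrable_on {0..T}"
    "(\<lambda>s. drift (a s) s * \<phi> s) integrable_on {0..T}" "(\<lambda>s. drift (c s) s * \<phi> s) integrable_on {0..T}"
    by (intro integrable_continuous_interval continuous_intros a cc \<phi>'c \<phi>c drc)+
  have \<phi>T: "\<phi> T = 0" by (simp add: \<phi>_def \<psi>_def)
  have "(integral {0..T} (\<lambda>s. a s * \<phi>' s) - integral {0..T} (\<lambda>s. c s * \<phi>' s))
      + (integral {0..T} (\<lambda>s. drift (a s) s * \<phi> s) - integral {0..T} (\<lambda>s. drift (c s) s * \<phi> s)) = 0"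
    using weak[OF \<phi>'c \<phi>d] weak_c[OF \<phi>'c \<phi>d] init \<phi>T by simp
  then have "integral {0..T} (\<lambda>s. (a s * \<phi>' s - c s * \<phi>' s) + (drift (a s) s * \<phi> s - drift (c s) s * \<phi> s)) = 0"
    using Henstock_Kurzweil_Integration.integral_add[OF integrable_diff[OF i(1,2)] integrable_diff[OF i(3,4)]]
      Henstock_Kurzweil_Integration.integral_diff[OF i(1,2)] Henstock_Kurzweil_Integration.integral_diff[OF i(3,4)] by simp
  also have "(\<lambda>s. (a s * \<phi>' s - c s * \<phi>' s) + (drift (a s) s * \<phi> s - drift (c s) s * \<phi> s)) = (\<lambda>s. - ((d s * exp (P s))\<^sup>2))"
  proof
    fix s
    have "drift (a s) s * \<phi> s - drift (c s) s * \<phi> s = - (k s * d s) * \<phi> s"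
      unfolding left_diff_distrib[symmetric] drift_diff by (simp add: d_def)
    then show "(a s * \<phi>' s - c s * \<phi>' s) + (drift (a s) s * \<phi> s - drift (c s) s * \<phi> s) = - ((d s * exp (P s))\<^sup>2)"
      unfolding left_diff_distrib[symmetric] by (simp add: d_def[symmetric] \<phi>'_def power2_eq_square algebra_simps)
  qed
  finally have "integral {0..T} (\<lambda>s. (d s * exp (P s))\<^sup>2) = 0" by simp
  then have "\<forall>s\<in>{0..T}. (d s * exp (P s))\<^sup>2 = 0"
    using integral_eq_0_iff[of 0 T "\<lambda>s. (d s * exp (P s))\<^sup>2"] T continuous_on_power[OF dPc, of 2] by auto
  then have eq: "a s = c s" if "s \<in> {0..T}" for s using that by (auto simp: d_def)
  show "a = c"
    by (rule PiE_ext[of a "{0..T}" "\<lambda>_. {0..1}" c]) (use a(1) c eq in \<open>auto simp: skorohod_paths_def\<close>)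
qed

section \<open>A countable family of test functions\<close>

text \<open>Coding the coefficients by a list of rationals, with the degree given by its length,
  makes the index type countable, so that the family can be enumerated by
  \<open>from_nat\<close>.\<close>

definition bernstein_comb :: "real \<Rightarrow> rat list \<Rightarrow> real \<Rightarrow> real" where
  "bernstein_comb T qs x = (\<Sum>k\<le>length qs - 1. of_rat (qs ! k) * Bernstein (length qs - 1) k (x / T))"

text \<open>A primitive of a Bernstein polynomial plus a rational constant: the derivative is
  approximated first, and integration then yields approximation of the function together with its
  derivative.\<close>

definition test_family :: "real \<Rightarrow> rat \<times> rat list \<Rightarrow> real \<Rightarrow> real" where
  "test_family T i t = of_rat (fst i) + integral {0..t} (bernstein_comb T (snd i))"

lemma bernstein_comb_continuous: "continuous_on A (bernstein_comb T qs)"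
  unfolding bernstein_comb_def Bernstein_def divide_inverse by (intro continuous_intros)

lemma test_family_deriv:
  "t \<in> {0..T} \<Longrightarrow> (test_family T i has_real_derivative bernstein_comb T (snd i) t) (at t within {0..T})"
  unfolding test_family_def
  using integral_has_real_derivative[OF bernstein_comb_continuous, of t 0 T T "snd i"]
  by (auto intro!: derivative_eq_intros)

lemma test_family_C1: "test_family T i \<in> C1_on T"
  by (rule C1_onI[OF bernstein_comb_continuous test_family_deriv])

text \<open>Rational Bernstein approximation of \<open>G'\<close>, followed by integration, gives
  test functions converging to \<open>G\<close> with derivatives converging to \<open>G'\<close>.
  For a fixed path the functional converges by dominated convergence, so a strict inequality is
  inherited by some member of the family.\<close>

lemma test_family_dense:
  assumes T: "0 < T" and \<gamma>: "0 < \<gamma>" "\<gamma> < 1" and G: "G \<in> C1_on T" and a: "a \<in> skorohod_paths T" and lt: "x < J_functional T \<gamma> G a"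
  obtains i where "x < J_functional T \<gamma> (test_family T i) a"
proof -
  obtain G' where G': "continuous_on {0..T} G'"
    "\<And>s. s \<in> {0..T} \<Longrightarrow> (G has_real_derivative G' s) (at s within {0..T})"
    "\<And>s. s \<in> {0..T} \<Longrightarrow> vector_derivative G (at s within {0..T}) = G' s"
    using C1_on_derivative[OF G T] by blast
  have Gc: "continuous_on {0..T} G" by (rule C1_on_continuous[OF G T])
  obtain K where K: "0 \<le> K" "\<And>s. s \<in> {0..T} \<Longrightarrow> \<bar>G s\<bar> \<le> K" using continuous_abs_le[OF Gc] by blast
  have f: "continuous_on {0..1} (\<lambda>u. G' (T * u))"
    using T by (intro continuous_on_compose2[OF G'(1)] continuous_intros) (auto simp: mult_le_cancel_left1)
  have "\<exists>i. \<forall>s\<in>{0..T}. \<bar>bernstein_comb T (snd i) s - G' s\<bar> \<le> \<eta> \<and> \<bar>test_family T i s - G s\<bar> \<le> \<eta>" if \<eta>: "0 < \<eta>" for \<eta>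
  proof -
    \<comment> \<open>The polynomial and the rounding of its coefficients contribute
      \<open>\<epsilon>\<close> each to the derivative; integrating over a time at most
      \<open>T\<close> and rounding the initial value give the total
      \<open>\<epsilon> + 2 \<epsilon> T\<close>.\<close>
    define \<epsilon> where "\<epsilon> = (\<eta> / 2) / (1 + 2 * T)"
    have "1 + 2 * T \<noteq> 0" using T by simp
    then have "\<epsilon> * (1 + 2 * T) = \<eta> / 2" unfolding \<epsilon>_def by (rule nonzero_eq_divide_eq[THEN iffD1, OF _ refl])
    then have "\<epsilon> + 2 * \<epsilon> * T = \<eta> / 2" by (simp add: distrib_left)
    moreover have "0 < \<epsilon>" using \<eta> T by (simp add: \<epsilon>_def)
    moreover have "0 < 2 * \<epsilon> * T" using \<open>0 < \<epsilon>\<close> T by simp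
    ultimately have \<epsilon>: "0 < \<epsilon>" "2 * \<epsilon> \<le> \<eta>" "\<epsilon> + 2 * \<epsilon> * T \<le> \<eta>" using \<eta> by linarith+
    obtain n where n: "\<And>u. u \<in> {0..1} \<Longrightarrow> \<bar>G' (T * u) - (\<Sum>k\<le>n. G' (T * (k / n)) * Bernstein n k u)\<bar> < \<epsilon>"
      using Bernstein_Weierstrass[OF f \<epsilon>(1)] by blast
    have "\<exists>q. \<bar>of_rat q - y\<bar> \<le> \<epsilon>" for y :: real
    proof -
      obtain q where "y - \<epsilon> < of_rat q" "of_rat q < y + \<epsilon>" using of_rat_dense[of "y - \<epsilon>" "y + \<epsilon>"] \<epsilon> by auto
      then show ?thesis by (intro exI[of _ q]) auto
    qed
    then obtain r where r: "\<And>y :: real. \<bar>of_rat (r y) - y\<bar> \<le> \<epsilon>" by metis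
    define qs where "qs = map (\<lambda>k. r (G' (T * (real k / n)))) [0..<Suc n]"
    define i where "i = (r (G 0), qs)"
    have len: "length qs - 1 = n" by (simp add: qs_def)
    have qk: "qs ! k = r (G' (T * (real k / n)))" if "k \<le> n" for k
      unfolding qs_def using that by (subst nth_map) (auto simp del: upt_Suc)
    have b: "\<bar>bernstein_comb T qs s - G' s\<bar> \<le> 2 * \<epsilon>" if s: "s \<in> {0..T}" for s
    proof -
      define u where "u = s / T"
      have u: "u \<in> {0..1}" "T * u = s" using s T by (auto simp: u_def)
      have "\<bar>bernstein_comb T qs s - (\<Sum>k\<le>n. G' (T * (k / n)) * Bernstein n k u)\<bar>
          = \<bar>\<Sum>k\<le>n. (of_rat (r (G' (T * (k / n)))) - G' (T * (k / n))) * Bernstein n k u\<bar>"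
        unfolding bernstein_comb_def len u_def[symmetric] sum_subtractf[symmetric] left_diff_distrib[symmetric]
        by (intro arg_cong[of _ _ abs] sum.cong refl) (simp add: qk)
      also have "\<dots> \<le> (\<Sum>k\<le>n. \<epsilon> * Bernstein n k u)"
      proof (rule order_trans[OF sum_abs sum_mono])
        fix k
        show "\<bar>(of_rat (r (G' (T * (k / n)))) - G' (T * (k / n))) * Bernstein n k u\<bar> \<le> \<epsilon> * Bernstein n k u"
          unfolding abs_mult using r[of "G' (T * (k / n))"] Bernstein_nonneg[of u n k] u(1) by (intro mult_mono) auto
      qed
      also have "\<dots> = \<epsilon>" by (simp add: sum_distrib_left[symmetric])
      finally show ?thesis using n[OF u(1)] unfolding u(2) by linarith
    qed
    have "\<bar>test_family T i s - G s\<bar> \<le> \<eta>" if s: "s \<in> {0..T}" for s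
    proof -
      have sub: "{0..s} \<subseteq> {0..T}" using s by auto
      have G_eq: "G s = G 0 + integral {0..s} G'"
      proof -
        have "(G' has_integral (G s - G 0)) {0..s}"
        proof (rule fundamental_theorem_of_calculus)
          fix r assume "r \<in> {0..s}"
          then have "r \<in> {0..T}" using sub by blast
          then show "(G has_vector_derivative G' r) (at r within {0..s})"
            unfolding has_real_derivative_iff_has_vector_derivative[symmetric]
            by (rule DERIV_subset[OF G'(2) sub])
        qed (use s in auto)
        then show ?thesis by (simp add: integral_unique)
      qed
      have ib: "bernstein_comb T qs integrable_on {0..s}" by (intro integrable_continuous_interval bernstein_comb_continuous)
      have ig: "G' integrable_on {0..s}" by (rule integrable_continuous_interval[OF continuous_on_subset[OF G'(1) sub]])
      have "norm (integral {0..s} (\<lambda>x. bernstein_comb T qs x - G' x)) \<le> (2 * \<epsilon>) * measure lborel (cbox 0 s)"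
        unfolding cbox_interval[symmetric]
      proof (rule integrable_bound)
        show "0 \<le> 2 * \<epsilon>" using \<epsilon> by simp
        show "(\<lambda>x. bernstein_comb T qs x - G' x) integrable_on cbox 0 s" unfolding cbox_interval by (rule integrable_diff[OF ib ig])
        fix x assume "x \<in> cbox 0 s"
        then have "x \<in> {0..T}" using sub by auto
        then show "norm (bernstein_comb T qs x - G' x) \<le> 2 * \<epsilon>" using b by simp
      qed
      also have "\<dots> \<le> (2 * \<epsilon>) * T" using s \<epsilon> by (intro mult_left_mono) auto
      finally have "\<bar>integral {0..s} (bernstein_comb T qs) - integral {0..s} G'\<bar> \<le> 2 * \<epsilon> * T"
        unfolding Henstock_Kurzweil_Integration.integral_diff[OF ib ig] by simp
      moreover have "test_family T i s - G s = (of_rat (r (G 0)) - G 0) + (integral {0..s} (bernstein_comb T qs) - integral {0..s} G')"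
        unfolding G_eq by (simp add: test_family_def i_def)
      ultimately show ?thesis using r[of "G 0"] \<epsilon>(3) by linarith
    qed
    moreover have "\<bar>bernstein_comb T (snd i) s - G' s\<bar> \<le> \<eta>" if "s \<in> {0..T}" for s using b[OF that] \<epsilon>(2) by (simp add: i_def)
    ultimately show ?thesis by blast
  qed
  then have "\<exists>i. \<forall>s\<in>{0..T}. \<bar>bernstein_comb T (snd i) s - G' s\<bar> \<le> 1 / Suc n \<and> \<bar>test_family T i s - G s\<bar> \<le> 1 / Suc n" for n
    by simp
  then obtain i where i: "\<And>n s. s \<in> {0..T} \<Longrightarrow> \<bar>bernstein_comb T (snd (i n)) s - G' s\<bar> \<le> 1 / Suc n \<and> \<bar>test_family T (i n) s - G s\<bar> \<le> 1 / Suc n"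
    by metis
  define P where "P n = test_family T (i n)" for n
  define P' where "P' n = bernstein_comb T (snd (i n))" for n
  have null: "(\<lambda>n. 1 / real (Suc n)) \<longlonglongrightarrow> 0" by (intro LIMSEQ_Suc lim_const_over_n)
  have P'lim: "(\<lambda>n. P' n s) \<longlonglongrightarrow> G' s" and Plim: "(\<lambda>n. P n s) \<longlonglongrightarrow> G s" if s: "s \<in> {0..T}" for s
  proof -
    have "(\<lambda>n. P' n s - G' s) \<longlonglongrightarrow> 0" "(\<lambda>n. P n s - G s) \<longlonglongrightarrow> 0"
      by (rule Lim_null_comparison[OF _ null]; use i[OF s] in \<open>simp add: P_def P'_def\<close>)+
    then show "(\<lambda>n. P' n s) \<longlonglongrightarrow> G' s" "(\<lambda>n. P n s) \<longlonglongrightarrow> G s" by (simp_all add: LIM_zero_iff)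
  qed
  obtain K' where K': "0 \<le> K'" "\<And>s. s \<in> {0..T} \<Longrightarrow> \<bar>G' s\<bar> \<le> K'" using continuous_abs_le[OF G'(1)] by blast
  have le1: "1 / real (Suc n) \<le> 1" for n by simp
  have P'b: "\<bar>P' n s\<bar> \<le> K' + 1" and Pb: "\<bar>P n s\<bar> \<le> K + 1" if s: "s \<in> {0..T}" for n s
    using i[OF s, of n] K'(2)[OF s] K(2)[OF s] le1[of n] unfolding P_def P'_def by linarith+
  have P'c: "continuous_on {0..T} (P' n)" for n unfolding P'_def by (rule bernstein_comb_continuous)
  have Pc: "continuous_on {0..T} (P n)" for n unfolding P_def by (rule C1_on_continuous[OF test_family_C1 T])
  have JP: "J_functional T \<gamma> (P n) a = a T * P n T - a 0 * P n 0 - integral {0..T} (\<lambda>s. a s * P' n s) - integral {0..T} (\<lambda>s. hamiltonian \<gamma> (a s) (P n s))" for n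
    unfolding P_def P'_def by (rule J_functional_eq) (rule real_derivative_vector_derivative[OF T _ test_family_deriv])
  have JG: "J_functional T \<gamma> G a = a T * G T - a 0 * G 0 - integral {0..T} (\<lambda>s. a s * G' s) - integral {0..T} (\<lambda>s. hamiltonian \<gamma> (a s) (G s))"
    by (rule J_functional_eq) (rule G'(3))
  have l1: "(\<lambda>n. integral {0..T} (\<lambda>s. a s * P' n s)) \<longlonglongrightarrow> integral {0..T} (\<lambda>s. a s * G' s)"
  proof (rule dominated_convergence(2))
    show "(\<lambda>s. a s * P' n s) integrable_on {0..T}" for n by (rule path_mult_integrable[OF T a P'c])
    show "(\<lambda>s. K' + 1) integrable_on {0..T}" by (rule integrable_const_ivl)
    fix n s assume s: "s \<in> {0..T}"
    have "\<bar>a s\<bar> * \<bar>P' n s\<bar> \<le> 1 * (K' + 1)" using path_bounds[OF a s] P'b[OF s] K' by (intro mult_mono) auto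
    then show "norm (a s * P' n s) \<le> K' + 1" by (simp add: abs_mult)
  next
    fix s assume "s \<in> {0..T}"
    then show "(\<lambda>n. a s * P' n s) \<longlonglongrightarrow> a s * G' s" by (intro tendsto_intros P'lim)
  qed
  have l2: "(\<lambda>n. integral {0..T} (\<lambda>s. hamiltonian \<gamma> (a s) (P n s))) \<longlonglongrightarrow> integral {0..T} (\<lambda>s. hamiltonian \<gamma> (a s) (G s))"
  proof (rule dominated_convergence(2))
    show "(\<lambda>s. hamiltonian \<gamma> (a s) (P n s)) integrable_on {0..T}" for n
      unfolding hamiltonian_affine bdry_def
      by (intro integrable_add integrable_continuous_interval path_mult_integrable[OF T a] continuous_intros Pc)
    show "(\<lambda>s. 2 * exp (K + 1)) integrable_on {0..T}" by (rule integrable_const_ivl)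
    fix n s assume s: "s \<in> {0..T}"
    have "exp \<bar>P n s\<bar> \<le> exp (K + 1)" "1 \<le> exp (K + 1)" using Pb[OF s] K by auto
    then show "norm (hamiltonian \<gamma> (a s) (P n s)) \<le> 2 * exp (K + 1)"
      using hamiltonian_bounds[OF \<gamma> path_bounds[OF a s], of "P n s"] unfolding real_norm_def by linarith
  next
    fix s assume "s \<in> {0..T}"
    then show "(\<lambda>n. hamiltonian \<gamma> (a s) (P n s)) \<longlonglongrightarrow> hamiltonian \<gamma> (a s) (G s)"
      unfolding hamiltonian_def by (intro tendsto_intros Plim)
  qed
  have "(\<lambda>n. J_functional T \<gamma> (P n) a) \<longlonglongrightarrow> J_functional T \<gamma> G a"
    unfolding JP JG using T by (intro tendsto_diff tendsto_mult tendsto_const l1 l2 Plim) auto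
  then have "\<forall>\<^sub>F n in sequentially. x < J_functional T \<gamma> (P n) a" using lt by (rule order_tendstoD(1))
  then obtain n where "x < J_functional T \<gamma> (P n) a" by (auto simp: eventually_sequentially)
  then show thesis unfolding P_def by (rule that)
qed

section \<open>Compactness\<close>

lemma window_exists:
  fixes n :: nat
  assumes T: "0 < T" and n: "0 < n" and t: "t \<in> {0..T}"
  obtains k where "k < n" "t \<in> {k * (T / n)..Suc k * (T / n)}"
proof -
  define h where "h = T / n"
  have h: "0 < h" "n * h = T" using T n by (auto simp: h_def)
  show thesis
  proof (cases "t = T")
    case True
    have "real (n - 1) * h \<le> T" using h n by (simp add: of_nat_diff left_diff_distrib)
    moreover have "Suc (n - 1) * h = T" using h n by simp
    ultimately show ?thesis using n True by (intro that[of "n - 1"]) (auto simp: h_def)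
  next
    case False
    define k where "k = nat \<lfloor>t / h\<rfloor>"
    have "0 \<le> t / h" using t h by simp
    then have k: "real k = of_int \<lfloor>t / h\<rfloor>" by (simp add: k_def)
    have "real k \<le> t / h" "t / h < real k + 1" unfolding k by linarith+
    then have kh: "real k * h \<le> t" "t < (real k + 1) * h" using h(1) by (simp_all only: pos_le_divide_eq pos_divide_less_eq)
    have "k < n"
    proof (rule ccontr)
      assume "\<not> k < n"
      then have "real n * h \<le> real k * h" using h by (intro mult_right_mono) auto
      then show False using kh h t False by auto
    qed
    then show ?thesis using kh by (intro that[of k]) (auto simp: h_def add.commute)
  qed
qed

lemma not_osc_bad:
  "\<not> osc_bad T n \<epsilon> a \<longleftrightarrow> (\<forall>k<n. \<forall>r\<in>{k * (T / n)..Suc k * (T / n)}. \<bar>a r - a (k * (T / n))\<bar> < \<epsilon>)"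
  unfolding osc_bad_def by (auto simp: not_le)

text \<open>Two times closer than the window length lie in the same or in adjacent windows. In the
  second case the chain from \<open>s\<close> to the left end of its window, to the left end of the
  next, and on to \<open>t\<close> makes the factor 3.\<close>

lemma small_oscillation_increment:
  fixes n :: nat and \<epsilon> :: real
  assumes T: "0 < T" and n: "0 < n" and a: "\<And>k r. k < n \<Longrightarrow> r \<in> {k * (T / n)..Suc k * (T / n)} \<Longrightarrow> \<bar>a r - a (k * (T / n))\<bar> \<le> \<epsilon>"
    and s: "s \<in> {0..T}" and t: "t \<in> {0..T}" and st: "s \<le> t" "t - s < T / n"
  shows "\<bar>a t - a s\<bar> \<le> 3 * \<epsilon>"
proof -
  obtain k where k: "k < n" "s \<in> {k * (T / n)..Suc k * (T / n)}" by (rule window_exists[OF T n s])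
  have h: "0 < T / n" "n * (T / n) = T" using T n by auto
  have e0: "0 \<le> \<epsilon>" using a[OF k] by linarith
  note 1 = a[OF k]
  show ?thesis
  proof (cases "t \<le> Suc k * (T / n)")
    case True
    then have "\<bar>a t - a (k * (T / n))\<bar> \<le> \<epsilon>" using k st by (intro a) auto
    then show ?thesis using 1 e0 by linarith
  next
    case False
    have "Suc k < n"
    proof (rule ccontr)
      assume "\<not> Suc k < n"
      then have "real n * (T / n) \<le> real (Suc k) * (T / n)" using h(1) by (intro mult_right_mono) auto
      then show False using False h t by auto
    qed
    moreover have "t \<le> Suc (Suc k) * (T / n)"
    proof -
      have "real (Suc (Suc k)) * (T / n) = Suc k * (T / n) + T / n" by (simp add: distrib_right add_divide_distrib)
      moreover have "s \<le> Suc k * (T / n)" using k(2) by simp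
      ultimately show ?thesis using st by linarith
    qed
    ultimately have "\<bar>a t - a (Suc k * (T / n))\<bar> \<le> \<epsilon>" using False by (intro a) auto
    moreover have "\<bar>a (Suc k * (T / n)) - a (k * (T / n))\<bar> \<le> \<epsilon>"
      using k h by (intro a) (auto intro: mult_right_mono)
    ultimately show ?thesis using 1 by linarith
  qed
qed

text \<open>An Arzela-Ascoli argument for possibly discontinuous paths. One index \<open>j\<close>
  governs the tolerance at time 0, the number of oscillation levels, the number of test functions
  and the margin over \<open>l0\<close>. If no \<open>j\<close> worked, counterexamples would have a
  uniformly convergent subsequence, whose limit is continuous, lies in \<open>F\<close>, starts at
  \<open>m\<close> and violates the gap.\<close>

lemma compactness_gap:
  assumes T: "0 < T" and \<gamma>: "0 < \<gamma>" "\<gamma> < 1" and G: "G \<in> C1_on T" and n: "\<And>i. 0 < n i"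
    and F: "F \<subseteq> skorohod_paths T"
    and F_closed: "\<And>a b. (\<And>j :: nat. b j \<in> F) \<Longrightarrow> a \<in> skorohod_paths T \<Longrightarrow> uniform_limit {0..T} b a sequentially \<Longrightarrow> a \<in> F"
    and gap: "\<And>a. a \<in> F \<Longrightarrow> continuous_on {0..T} a \<Longrightarrow> a 0 = m \<Longrightarrow> \<exists>H\<in>C1_on T. J_functional T \<gamma> G a + l0 < J_functional T \<gamma> H a"
  obtains j l1 \<H> where "l0 < l1" "finite \<H>" "\<H> \<subseteq> C1_on T"
    "\<And>a. a \<in> F \<Longrightarrow> \<bar>a 0 - m\<bar> \<le> 1 / Suc j \<Longrightarrow> (\<And>i. i \<le> j \<Longrightarrow> \<not> osc_bad T (n i) (1 / Suc i) a) \<Longrightarrow>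
      \<exists>H\<in>\<H>. J_functional T \<gamma> G a + l1 \<le> J_functional T \<gamma> H a"
proof -
  define h where "h i = test_family T (from_nat i)" for i
  have h: "h i \<in> C1_on T" for i unfolding h_def by (rule test_family_C1)
  have "\<exists>j. \<forall>a. a \<in> F \<longrightarrow> \<bar>a 0 - m\<bar> \<le> 1 / Suc j \<longrightarrow> (\<forall>i\<le>j. \<not> osc_bad T (n i) (1 / Suc i) a) \<longrightarrow>
      (\<exists>H\<in>h ` {..j}. J_functional T \<gamma> G a + (l0 + 1 / Suc j) \<le> J_functional T \<gamma> H a)"
  proof (rule ccontr)
    assume neg: "\<not> ?thesis"
    have "\<exists>a. a \<in> F \<and> \<bar>a 0 - m\<bar> \<le> 1 / Suc j \<and> (\<forall>i\<le>j. \<not> osc_bad T (n i) (1 / Suc i) a) \<and>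
      (\<forall>i\<le>j. J_functional T \<gamma> (h i) a < J_functional T \<gamma> G a + (l0 + 1 / Suc j))" for j
    proof -
      from neg obtain a where a: "a \<in> F" "\<bar>a 0 - m\<bar> \<le> 1 / Suc j" "\<forall>i\<le>j. \<not> osc_bad T (n i) (1 / Suc i) a"
        and no: "\<not> (\<exists>H\<in>h ` {..j}. J_functional T \<gamma> G a + (l0 + 1 / Suc j) \<le> J_functional T \<gamma> H a)" by blast
      have "\<forall>i\<le>j. J_functional T \<gamma> (h i) a < J_functional T \<gamma> G a + (l0 + 1 / Suc j)"
        using no by (meson atMost_iff imageI not_le)
      with a show ?thesis by blast
    qed
    then obtain a where aF: "\<And>j. a j \<in> F" and a0: "\<And>j. \<bar>a j 0 - m\<bar> \<le> 1 / Suc j"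
      and osc: "\<And>i j. i \<le> j \<Longrightarrow> \<not> osc_bad T (n i) (1 / Suc i) (a j)"
      and Ja: "\<And>i j. i \<le> j \<Longrightarrow> J_functional T \<gamma> (h i) (a j) < J_functional T \<gamma> G (a j) + (l0 + 1 / Suc j)"
      by metis
    have ap: "a j \<in> skorohod_paths T" for j using aF F by blast
    \<comment> \<open>The left ends of all windows at all levels form a countable set. A diagonal
      subsequence converges on it, and small oscillation extends this to a uniform Cauchy property
      on the whole interval.\<close>
    define D where "D = (\<Union>i. (\<lambda>k. real k * (T / n i)) ` {..<n i})"
    have D: "countable D" "D \<subseteq> {0..T}"
    proof -
      show "countable D" unfolding D_def by (intro countable_UN) (auto intro: countable_finite)
      have "real k * (T / n i) \<in> {0..T}" if "k < n i" for k i
      proof -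
        have "real k * (T / n i) \<le> real (n i) * (T / n i)" using that T by (intro mult_right_mono) auto
        then show ?thesis using T n[of i] by auto
      qed
      then show "D \<subseteq> {0..T}" unfolding D_def by blast
    qed
    have "norm (a j x) \<le> 1" if "x \<in> D" for j x using path_bounds[OF ap, of x j] D(2) that by auto
    then obtain r where r: "strict_mono (r :: nat \<Rightarrow> nat)" "\<And>x. x \<in> D \<Longrightarrow> \<exists>l. (\<lambda>j. a (r j) x) \<longlonglongrightarrow> l"
      using function_convergent_subsequence[OF D(1), of a 1] by blast
    define b where "b j = a (r j)" for j
    have rj: "j \<le> r j" for j using r(1) by (rule seq_suble)
    have b_osc: "\<bar>b j t - b j (k * (T / n i))\<bar> < 1 / Suc i"
      if "i \<le> j" "k < n i" "t \<in> {k * (T / n i)..Suc k * (T / n i)}" for i j k t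
      using osc[of i "r j"] rj[of j] that unfolding not_osc_bad b_def by auto
    have Cauchy: "\<exists>N. \<forall>l j x. N \<le> l \<and> N \<le> j \<and> x \<in> {0..T} \<longrightarrow> dist (b l x) (b j x) < e" if e: "0 < e" for e
    proof -
      obtain i where i: "1 / real (Suc i) < e / 3" using reals_Archimedean[of "e / 3"] e by (auto simp: inverse_eq_divide)
      have "\<exists>N. \<forall>l\<ge>N. \<forall>j\<ge>N. dist (b l (k * (T / n i))) (b j (k * (T / n i))) < e / 3" if "k < n i" for k
      proof -
        have "real k * (T / n i) \<in> D" unfolding D_def using that by blast
        then have "Cauchy (\<lambda>j. b j (k * (T / n i)))"
          using r(2) unfolding b_def by (blast intro: LIMSEQ_imp_Cauchy)
        then show ?thesis using e unfolding Cauchy_def by (metis divide_pos_pos zero_less_numeral)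
      qed
      then obtain N where N: "\<And>k l j. k < n i \<Longrightarrow> N k \<le> l \<Longrightarrow> N k \<le> j \<Longrightarrow> dist (b l (k * (T / n i))) (b j (k * (T / n i))) < e / 3"
        by metis
      define N0 where "N0 = Max (insert i (N ` {..<n i}))"
      have N0: "i \<le> N0" "\<And>k. k < n i \<Longrightarrow> N k \<le> N0" by (auto simp: N0_def)
      show ?thesis
      proof (intro exI[of _ N0] allI impI, elim conjE)
        fix l j x assume l: "N0 \<le> l" and j: "N0 \<le> j" and x: "x \<in> {0..T}"
        obtain k where k: "k < n i" "x \<in> {k * (T / n i)..Suc k * (T / n i)}" by (rule window_exists[OF T n x])
        have "\<bar>b l x - b l (k * (T / n i))\<bar> < 1 / Suc i" "\<bar>b j x - b j (k * (T / n i))\<bar> < 1 / Suc i"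
          using N0 l j by (intro b_osc k; simp)+
        moreover have "\<bar>b l (k * (T / n i)) - b j (k * (T / n i))\<bar> < e / 3"
          using N[OF k(1), of l j] N0(2)[OF k(1)] l j by (simp add: dist_real_def)
        ultimately show "dist (b l x) (b j x) < e" unfolding dist_real_def using i by linarith
      qed
    qed
    then obtain g where g: "\<And>e. 0 < e \<Longrightarrow> \<exists>N. \<forall>j x. N \<le> j \<and> x \<in> {0..T} \<longrightarrow> dist (b j x) (g x) < e"
      using uniformly_convergent_eq_cauchy[of "\<lambda>x. x \<in> {0..T}" b] by auto
    define c where "c = restrict g {0..T}"
    have ul: "uniform_limit {0..T} b c sequentially"
    proof (rule uniform_limitI)
      fix e :: real assume "0 < e"
      then obtain N where "\<forall>j x. N \<le> j \<and> x \<in> {0..T} \<longrightarrow> dist (b j x) (g x) < e" using g by blast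
      then show "\<forall>\<^sub>F j in sequentially. \<forall>x\<in>{0..T}. dist (b j x) (c x) < e"
        unfolding eventually_sequentially c_def by (intro exI[of _ N]) auto
    qed
    have lim: "(\<lambda>j. b j x) \<longlonglongrightarrow> c x" if "x \<in> {0..T}" for x by (rule tendsto_uniform_limitI[OF ul that])
    have bp: "b j \<in> skorohod_paths T" for j unfolding b_def by (rule ap)
    have c01: "c x \<in> {0..1}" if x: "x \<in> {0..T}" for x
      by (rule Lim_in_closed_set[OF closed_real_atLeastAtMost _ _ lim[OF x]]) (use path_bounds[OF bp x] in auto)
    have c_osc: "\<bar>c t - c (k * (T / n i))\<bar> \<le> 1 / Suc i" if k: "k < n i" and t: "t \<in> {k * (T / n i)..Suc k * (T / n i)}" for i k t
    proof -
      have "real (Suc k) * (T / n i) \<le> real (n i) * (T / n i)" using k T by (intro mult_right_mono) auto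
      then have "t \<le> T" using t n[of i] by auto
      moreover have "0 \<le> k * (T / n i)" using T by simp
      ultimately have in_T: "t \<in> {0..T}" "k * (T / n i) \<in> {0..T}" using t by auto
      have "(\<lambda>j. \<bar>b j t - b j (k * (T / n i))\<bar>) \<longlonglongrightarrow> \<bar>c t - c (k * (T / n i))\<bar>"
        by (intro tendsto_intros lim in_T)
      then show ?thesis
        by (rule LIMSEQ_le_const2) (use b_osc[OF _ k t] less_imp_le in blast)
    qed
    have cc: "continuous_on {0..T} c"
      unfolding continuous_on_iff
    proof (intro ballI allI impI)
      fix s and e :: real assume s: "s \<in> {0..T}" and e: "0 < e"
      obtain i where i: "1 / real (Suc i) < e / 3" using reals_Archimedean[of "e / 3"] e by (auto simp: inverse_eq_divide)
      have inc: "\<bar>c u - c v\<bar> \<le> 3 * (1 / Suc i)" if "v \<in> {0..T}" "u \<in> {0..T}" "v \<le> u" "u - v < T / n i" for u v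
        using small_oscillation_increment[where a = c and \<epsilon> = "1 / Suc i", OF T n _ that] c_osc by blast
      have "\<bar>c t - c s\<bar> \<le> 3 * (1 / Suc i)" if t: "t \<in> {0..T}" "\<bar>t - s\<bar> < T / n i" for t
        using inc[OF s t(1)] inc[OF t(1) s] t(2) unfolding abs_minus_commute[of "c t"] by (cases "s \<le> t") (auto simp: abs_minus_commute)
      moreover have "3 * (1 / real (Suc i)) < e" using i by simp
      ultimately have "\<bar>c t - c s\<bar> < e" if "t \<in> {0..T}" "\<bar>t - s\<bar> < T / n i" for t
        using that by (meson le_less_trans)
      moreover have "0 < T / n i" using T n[of i] by simp
      ultimately show "\<exists>d>0. \<forall>x'\<in>{0..T}. dist x' s < d \<longrightarrow> dist (c x') (c s) < e"
        unfolding dist_real_def by blast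
    qed
    have cp: "c \<in> skorohod_paths T" by (rule continuous_path[OF cc c01]) (auto simp: c_def)
    have cF: "c \<in> F" by (rule F_closed[OF _ cp ul]) (simp add: b_def aF)
    have null: "(\<lambda>j. 1 / real (Suc (r j))) \<longlonglongrightarrow> 0"
      using LIMSEQ_subseq_LIMSEQ[OF LIMSEQ_Suc[OF lim_const_over_n[of 1]] r(1)] by (simp add: o_def)
    have "c 0 = m"
    proof -
      have "(\<lambda>j. b j 0 - m) \<longlonglongrightarrow> 0" by (rule Lim_null_comparison[OF _ null]) (use a0 in \<open>simp add: b_def\<close>)
      moreover have "(\<lambda>j. b j 0 - m) \<longlonglongrightarrow> c 0 - m" using T by (intro tendsto_intros lim) auto
      ultimately show ?thesis using LIMSEQ_unique by fastforce
    qed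
    from gap[OF cF cc this] obtain H where H: "H \<in> C1_on T" "J_functional T \<gamma> G c + l0 < J_functional T \<gamma> H c" by blast
    obtain q where q: "J_functional T \<gamma> G c + l0 < J_functional T \<gamma> (test_family T q) c"
      by (rule test_family_dense[OF T \<gamma> H(1) cp H(2)])
    define i where "i = to_nat q"
    have hi: "h i = test_family T q" by (simp add: h_def i_def)
    \<comment> \<open>For fixed \<open>i\<close> the inequality holds along the subsequence from
      \<open>j = i\<close> on, and the margin \<open>1 / (r j + 1)\<close> tends to 0. The limit
      path thus satisfies it with \<open>l0\<close> itself, against the choice of
      \<open>i\<close>.\<close>
    have "J_functional T \<gamma> (h i) c \<le> J_functional T \<gamma> G c + (l0 + 0)"
    proof (rule LIMSEQ_le)
      show "(\<lambda>j. J_functional T \<gamma> (h i) (b j)) \<longlonglongrightarrow> J_functional T \<gamma> (h i) c"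
        by (rule J_pointwise_limit[OF T h bp cp lim])
      show "(\<lambda>j. J_functional T \<gamma> G (b j) + (l0 + 1 / real (Suc (r j)))) \<longlonglongrightarrow> J_functional T \<gamma> G c + (l0 + 0)"
        by (intro tendsto_add tendsto_const null J_pointwise_limit[OF T G bp cp lim])
      show "\<exists>N. \<forall>j\<ge>N. J_functional T \<gamma> (h i) (b j) \<le> J_functional T \<gamma> G (b j) + (l0 + 1 / real (Suc (r j)))"
        using Ja[of i] rj unfolding b_def by (intro exI[of _ i] allI impI less_imp_le) (meson order_trans)
    qed
    then show False using q unfolding hi by simp
  qed
  then obtain j where j: "\<And>a. a \<in> F \<Longrightarrow> \<bar>a 0 - m\<bar> \<le> 1 / Suc j \<Longrightarrow> (\<forall>i\<le>j. \<not> osc_bad T (n i) (1 / Suc i) a) \<Longrightarrow>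
      \<exists>H\<in>h ` {..j}. J_functional T \<gamma> G a + (l0 + 1 / Suc j) \<le> J_functional T \<gamma> H a" by blast
  show thesis
    by (rule that[of "l0 + 1 / Suc j" "h ` {..j}" j]) (use h j in auto)
qed

section \<open>The large deviation principle\<close>

lemma limsup_ext_log_le:
  assumes p: "\<And>N. N0 \<le> N \<Longrightarrow> 0 \<le> p N \<and> p N \<le> C * exp (- l * real N)" and C: "0 < C"
  shows "limsup (\<lambda>N. ereal (1 / real N) * ext_log (p N)) \<le> ereal (- l)"
proof -
  have "(\<lambda>N. ln C / real N - l) \<longlonglongrightarrow> 0 - l" by (intro tendsto_diff tendsto_const lim_const_over_n)
  then have lim: "(\<lambda>N. ereal (ln C / real N - l)) \<longlonglongrightarrow> ereal (- l)" by simp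
  have "\<forall>\<^sub>F N in sequentially. ereal (1 / real N) * ext_log (p N) \<le> ereal (ln C / real N - l)"
    unfolding eventually_sequentially
  proof (intro exI[of _ "max N0 1"] allI impI)
    fix N assume "max N0 1 \<le> N"
    then have N: "N0 \<le> N" "0 < real N" by auto
    show "ereal (1 / real N) * ext_log (p N) \<le> ereal (ln C / real N - l)"
    proof (cases "p N = 0")
      case True
      then show ?thesis using N by (simp add: ext_log_def)
    next
      case False
      then have "0 < p N" using p[OF N(1)] by simp
      then have "ln (p N) \<le> ln (C * exp (- l * real N))" using p[OF N(1)] by simp
      also have "\<dots> = ln C - l * real N" using C by (simp add: ln_mult)
      finally have "1 / real N * ln (p N) \<le> 1 / real N * (ln C - l * real N)" using N by (intro mult_left_mono) auto
      also have "\<dots> = ln C / real N - l" using N by (simp add: field_simps)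
      finally show ?thesis using False by (simp add: ext_log_def)
    qed
  qed
  then have "limsup (\<lambda>N. ereal (1 / real N) * ext_log (p N)) \<le> limsup (\<lambda>N. ereal (ln C / real N - l))"
    by (rule Limsup_mono)
  also have "\<dots> = ereal (- l)" by (rule lim_imp_Limsup[OF _ lim]) simp
  finally show ?thesis .
qed

lemma liminf_ext_log_ge:
  assumes p: "\<And>N. N0 \<le> N \<Longrightarrow> C * exp (- l * real N) \<le> p N" and C: "0 < C"
  shows "ereal (- l) \<le> liminf (\<lambda>N. ereal (1 / real N) * ext_log (p N))"
proof -
  have "(\<lambda>N. ln C / real N - l) \<longlonglongrightarrow> 0 - l" by (intro tendsto_diff tendsto_const lim_const_over_n)
  then have lim: "(\<lambda>N. ereal (ln C / real N - l)) \<longlonglongrightarrow> ereal (- l)" by simp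
  have "\<forall>\<^sub>F N in sequentially. ereal (ln C / real N - l) \<le> ereal (1 / real N) * ext_log (p N)"
    unfolding eventually_sequentially
  proof (intro exI[of _ "max N0 1"] allI impI)
    fix N assume "max N0 1 \<le> N"
    then have N: "N0 \<le> N" "0 < real N" by auto
    have pos: "0 < C * exp (- l * real N)" using C by simp
    then have pN: "0 < p N" using p[OF N(1)] by linarith
    have "ln C / real N - l = 1 / real N * (ln C - l * real N)" using N by (simp add: field_simps)
    also have "ln C - l * real N = ln (C * exp (- l * real N))" using C by (simp add: ln_mult)
    also have "1 / real N * \<dots> \<le> 1 / real N * ln (p N)"
      using p[OF N(1)] pos pN N by (intro mult_left_mono) auto
    finally show "ereal (ln C / real N - l) \<le> ereal (1 / real N) * ext_log (p N)"
      using pN by (simp add: ext_log_def)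
  qed
  then have "liminf (\<lambda>N. ereal (ln C / real N - l)) \<le> liminf (\<lambda>N. ereal (1 / real N) * ext_log (p N))"
    by (rule Liminf_mono)
  moreover have "liminf (\<lambda>N. ereal (ln C / real N - l)) = ereal (- l)" by (rule lim_imp_Liminf[OF _ lim]) simp
  ultimately show ?thesis by simp
qed

text \<open>All paths take values in the unit interval, so they lie within uniform distance 1 of the
  zero path, and the Lipschitz bound applies.\<close>

lemma J_bounded:
  assumes T: "0 < T" and G: "G \<in> C1_on T"
  obtains B where "0 \<le> B" "\<And>a. a \<in> skorohod_paths T \<Longrightarrow> \<bar>J_functional T \<gamma> G a\<bar> \<le> B"
proof -
  obtain C where C: "0 < C" "\<And>a b d. a \<in> skorohod_paths T \<Longrightarrow> b \<in> skorohod_paths T \<Longrightarrow>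
    (\<And>t. t \<in> {0..T} \<Longrightarrow> \<bar>a t - b t\<bar> \<le> d) \<Longrightarrow> \<bar>J_functional T \<gamma> G a - J_functional T \<gamma> G b\<bar> \<le> C * d"
    using J_lipschitz[OF T G, of \<gamma>] by metis
  define z where "z = (\<lambda>t\<in>{0..T}. 0 :: real)"
  have zc: "continuous_on {0..T} z"
    by (rule continuous_on_eq[of _ "\<lambda>_. 0"]) (auto simp: z_def)
  have z: "z \<in> skorohod_paths T" by (rule continuous_path[OF zc]) (auto simp: z_def)
  show thesis
  proof (rule that[of "\<bar>J_functional T \<gamma> G z\<bar> + C"])
    show "0 \<le> \<bar>J_functional T \<gamma> G z\<bar> + C" using C(1) by simp
    fix a assume a: "a \<in> skorohod_paths T"
    have "\<bar>J_functional T \<gamma> G a - J_functional T \<gamma> G z\<bar> \<le> C * 1"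
      by (rule C(2)[OF a z]) (use path_bounds[OF a] in \<open>auto simp: z_def\<close>)
    then show "\<bar>J_functional T \<gamma> G a\<bar> \<le> \<bar>J_functional T \<gamma> G z\<bar> + C" by linarith
  qed
qed

lemma skorohod_dist_uniform:
  assumes "a \<in> skorohod_paths T" "b \<in> skorohod_paths T" "0 \<le> r" "\<And>t. t \<in> {0..T} \<Longrightarrow> \<bar>a t - b t\<bar> \<le> r"
  shows "skorohod_dist T a b \<le> r"
  by (rule skorohod_dist_le[OF assms(1,2)], rule skorohod_closeI[OF assms(3) id_time_change]) (use assms in auto)

text \<open>With the identity as time change, uniform closeness bounds the Skorohod distance. This
  is the form in which closedness enters the compactness argument.\<close>

lemma closedin_uniform_limit:
  assumes F: "closedin (skorohod_topology T) F" and b: "\<And>j :: nat. b j \<in> F" and a: "a \<in> skorohod_paths T"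
    and lim: "uniform_limit {0..T} b a sequentially"
  shows "a \<in> F"
proof (rule ccontr)
  assume "a \<notin> F"
  have op: "openin (skorohod_topology T) (skorohod_paths T - F)" and sub: "F \<subseteq> skorohod_paths T"
    using F by (auto simp: closedin_def)
  obtain r where r: "0 < r" "\<And>c. c \<in> skorohod_paths T \<Longrightarrow> skorohod_dist T a c < r \<Longrightarrow> c \<in> skorohod_paths T - F"
    using op a \<open>a \<notin> F\<close> unfolding openin_skorohod by blast
  have "\<forall>\<^sub>F j in sequentially. \<forall>x\<in>{0..T}. dist (b j x) (a x) < r / 2" by (rule uniform_limitD[OF lim]) (use r in auto)
  then obtain j where "\<forall>x\<in>{0..T}. dist (b j x) (a x) < r / 2"
    unfolding eventually_sequentially by blast
  then have j: "\<And>x. x \<in> {0..T} \<Longrightarrow> \<bar>b j x - a x\<bar> < r / 2" by (auto simp only: dist_real_def)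
  have bj: "b j \<in> skorohod_paths T" using b sub by blast
  have "skorohod_dist T a (b j) \<le> r / 2"
    by (rule skorohod_dist_uniform[OF a bj]) (use r j in \<open>auto simp: abs_minus_commute intro: less_imp_le\<close>)
  then have "b j \<in> skorohod_paths T - F" using r bj by (intro r(2)) auto
  then show False using b by blast
qed

locale mass_process =
  fixes T \<alpha> \<beta> \<gamma> m0 :: real and \<eta> :: "nat \<Rightarrow> nat \<Rightarrow> nat" and M :: "nat \<Rightarrow> 'w measure"
    and \<zeta> :: "nat \<Rightarrow> real \<Rightarrow> 'w \<Rightarrow> nat \<Rightarrow> nat"
  assumes T: "0 < T" and \<alpha>: "0 < \<alpha>" "\<alpha> < 1" and \<beta>: "0 < \<beta>" "\<beta> < 1" and \<gamma>_def: "\<gamma> = (\<alpha> + \<beta>) / 2"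
    and m0: "0 < m0" "m0 < 1" and \<eta>: "\<And>N. 3 \<le> N \<Longrightarrow> \<eta> N \<in> configs N"
    and \<eta>_lim: "(\<lambda>N. total_mass (empirical_measure N (\<eta> N))) \<longlonglongrightarrow> m0"
    and process: "\<And>N. 3 \<le> N \<Longrightarrow>
      markov_process T (configs N) (accelerated_gen \<alpha> \<beta> N) (return_pmf (\<eta> N)) (M N) (\<zeta> N)"
begin

lemma \<gamma>: "0 < \<gamma>" "\<gamma> < 1" using \<alpha> \<beta> by (auto simp: \<gamma>_def)

lemma exclusion: "3 \<le> N \<Longrightarrow> exclusion_process \<alpha> \<beta> N T (\<eta> N) (M N) (\<zeta> N)"
  using T \<alpha> \<beta> \<eta> process by unfold_locales auto

abbreviation mpath :: "nat \<Rightarrow> 'w \<Rightarrow> real \<Rightarrow> real" where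
  "mpath N \<omega> \<equiv> mass_path T N (\<lambda>t. \<zeta> N t \<omega>)"

text \<open>The density of the tilted measure before normalisation; only the two-sided bound on its
  expectation is used in place of the normalising constant.\<close>

definition weight :: "(real \<Rightarrow> real) \<Rightarrow> nat \<Rightarrow> 'w \<Rightarrow> real" where
  "weight G N \<omega> = exp (real N * J_functional T \<gamma> G (mpath N \<omega>))"

lemma weight_moments:
  assumes G: "G \<in> C1_on T"
  obtains C where "\<And>N. 3 \<le> N \<Longrightarrow> integrable (M N) (weight G N) \<and>
    integral\<^sup>L (M N) (weight G N) \<le> exp C \<and> exp (- C) \<le> integral\<^sup>L (M N) (weight G N)"
proof -
  obtain C where C: "\<And>N \<eta>0 (M :: 'w measure) Z. exclusion_process \<alpha> \<beta> N T \<eta>0 M Z \<Longrightarrow>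
      integrable M (\<lambda>\<omega>. exp (real N * J_functional T \<gamma> G (mass_path T N (\<lambda>t. Z t \<omega>)))) \<and>
      integral\<^sup>L M (\<lambda>\<omega>. exp (real N * J_functional T \<gamma> G (mass_path T N (\<lambda>t. Z t \<omega>)))) \<le> exp C \<and>
      exp (- C) \<le> integral\<^sup>L M (\<lambda>\<omega>. exp (real N * J_functional T \<gamma> G (mass_path T N (\<lambda>t. Z t \<omega>))))"
    by (rule exponential_moments[OF T \<gamma>_def G]) blast
  show thesis
    by (rule that[of C]) (unfold weight_def[abs_def], rule C[OF exclusion])
qed

lemma event_closed:
  assumes N: "3 \<le> N" and F: "closedin (skorohod_topology T) F"
  shows "{\<omega> \<in> space (M N). mpath N \<omega> \<in> F} \<in> sets (M N)"
proof -
  interpret exclusion_process \<alpha> \<beta> N T "\<eta> N" "M N" "\<zeta> N" by (rule exclusion[OF N])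
  have "openin (skorohod_topology T) (skorohod_paths T - F)" using F by (simp add: closedin_def)
  then have "{\<omega> \<in> space (M N). path \<omega> \<in> skorohod_paths T - F} \<in> events" by (rule event_path_open)
  then have "space (M N) - {\<omega> \<in> space (M N). path \<omega> \<in> skorohod_paths T - F} \<in> events" by (rule sets.compl_sets)
  also have "space (M N) - {\<omega> \<in> space (M N). path \<omega> \<in> skorohod_paths T - F} = {\<omega> \<in> space (M N). path \<omega> \<in> F}"
    using path_in_paths by auto
  finally show ?thesis .
qed

text \<open>The common source of both bounds. With \<open>G = 0\<close> the weight is 1 and this is
  the upper bound for probabilities; with \<open>G\<close> the driving field and
  \<open>l = 0\<close> it says that the tilted mass of a closed set avoiding the driven path decays
  exponentially.\<close>

lemma weighted_upper_bound:
  assumes G: "G \<in> C1_on T" and F: "closedin (skorohod_topology T) F"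
    and gap: "\<And>a. a \<in> F \<Longrightarrow> continuous_on {0..T} a \<Longrightarrow> a 0 = m0 \<Longrightarrow> \<exists>H\<in>C1_on T. J_functional T \<gamma> G a + l < J_functional T \<gamma> H a"
  obtains l' C N0 where "l < l'" "0 < C"
    "\<And>N. N0 \<le> N \<Longrightarrow> integral\<^sup>L (M N) (\<lambda>\<omega>. weight G N \<omega> * indicator {\<omega> \<in> space (M N). mpath N \<omega> \<in> F} \<omega>) \<le> C * exp (- l' * real N)"
proof -
  have sub: "F \<subseteq> skorohod_paths T" using F by (auto simp: closedin_def)
  obtain B where B: "0 \<le> B" "\<And>a. a \<in> skorohod_paths T \<Longrightarrow> \<bar>J_functional T \<gamma> G a\<bar> \<le> B"
    using J_bounded[OF T G, of \<gamma>] by metis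
  \<comment> \<open>The weight can be as large as \<open>exp (N B)\<close>, so the oscillation
    events must decay at a rate exceeding \<open>B\<close> by more than \<open>l\<close>.\<close>
  define L where "L = B + \<bar>l\<bar> + 1"
  have L: "0 \<le> L" using B by (simp add: L_def)
  define rare where "rare i n C \<longleftrightarrow> (\<forall>N\<ge>3. {\<omega> \<in> space (M N). osc_bad T n (1 / Suc i) (mpath N \<omega>)} \<in> sets (M N) \<and>
      measure (M N) {\<omega> \<in> space (M N). osc_bad T n (1 / Suc i) (mpath N \<omega>)} \<le> C * exp (- L * real N))" for i n C
  have "\<exists>n C. 0 < n \<and> 0 < C \<and> rare i n C" for i
  proof -
    have p: "0 < 1 / real (Suc i)" by simp
    obtain n C where nC: "0 < n" "0 < C" "\<And>\<alpha> \<beta> N \<eta>0 (M :: 'w measure) Z. exclusion_process \<alpha> \<beta> N T \<eta>0 M Z \<Longrightarrow>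
      {\<omega> \<in> space M. osc_bad T n (1 / Suc i) (mass_path T N (\<lambda>t. Z t \<omega>))} \<in> sets M \<and>
      measure M {\<omega> \<in> space M. osc_bad T n (1 / Suc i) (mass_path T N (\<lambda>t. Z t \<omega>))} \<le> C * exp (- L * real N)"
      by (rule exponential_tightness[OF T p L]) blast
    have "rare i n C" unfolding rare_def by (intro allI impI nC(3)[OF exclusion])
    then show ?thesis using nC(1,2) by blast
  qed
  then obtain n C where n: "\<And>i. 0 < n i" and C: "\<And>i. 0 < C i" and rare: "\<And>i. rare i (n i) (C i)"
    by metis
  have osc: "{\<omega> \<in> space (M N). osc_bad T (n i) (1 / Suc i) (mpath N \<omega>)} \<in> sets (M N) \<and>
      measure (M N) {\<omega> \<in> space (M N). osc_bad T (n i) (1 / Suc i) (mpath N \<omega>)} \<le> C i * exp (- L * real N)"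
    if "3 \<le> N" for i N
    using rare[of i] that unfolding rare_def by blast
  obtain j l1 \<H> where l1: "l < l1" and \<H>: "finite \<H>" "\<H> \<subseteq> C1_on T"
    and cov: "\<And>a. a \<in> F \<Longrightarrow> \<bar>a 0 - m0\<bar> \<le> 1 / Suc j \<Longrightarrow> (\<And>i. i \<le> j \<Longrightarrow> \<not> osc_bad T (n i) (1 / Suc i) a) \<Longrightarrow>
      \<exists>H\<in>\<H>. J_functional T \<gamma> G a + l1 \<le> J_functional T \<gamma> H a"
  proof (rule compactness_gap[OF T \<gamma> G n sub closedin_uniform_limit[OF F] gap])
    fix j l1 \<H>
    assume "l < l1" "finite \<H>" "\<H> \<subseteq> C1_on T"
      "\<And>a. a \<in> F \<Longrightarrow> \<bar>a 0 - m0\<bar> \<le> 1 / Suc j \<Longrightarrow> (\<And>i. i \<le> j \<Longrightarrow> \<not> osc_bad T (n i) (1 / Suc i) a) \<Longrightarrow>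
        \<exists>H\<in>\<H>. J_functional T \<gamma> G a + l1 \<le> J_functional T \<gamma> H a"
    then show thesis by (rule that)
  qed
  have "\<forall>H\<in>\<H>. \<exists>C. \<forall>N\<ge>3. integrable (M N) (weight H N) \<and> integral\<^sup>L (M N) (weight H N) \<le> exp C"
    using \<H>(2) by (metis weight_moments subsetD)
  then obtain CH where CH: "\<And>H N. H \<in> \<H> \<Longrightarrow> 3 \<le> N \<Longrightarrow> integrable (M N) (weight H N) \<and> integral\<^sup>L (M N) (weight H N) \<le> exp (CH H)"
    by metis
  \<comment> \<open>A single decay rate for both kinds of terms: \<open>l1\<close> from the test
    functions, and \<open>L - B\<close> from the oscillation events after the loss of the
    weight.\<close>
  define l2 where "l2 = min l1 (\<bar>l\<bar> + 1)"
  have l2: "l < l2" "l2 \<le> l1" "l2 \<le> L - B" using l1 by (auto simp: l2_def L_def)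
  define C0 where "C0 = (\<Sum>i\<le>j. C i) + (\<Sum>H\<in>\<H>. exp (CH H))"
  have C0: "0 < C0" unfolding C0_def using C by (intro add_pos_nonneg sum_pos sum_nonneg) auto
  have "(\<lambda>N. \<bar>total_mass (empirical_measure N (\<eta> N)) - m0\<bar>) \<longlonglongrightarrow> \<bar>m0 - m0\<bar>"
    by (intro tendsto_intros \<eta>_lim)
  then have "\<forall>\<^sub>F N in sequentially. \<bar>total_mass (empirical_measure N (\<eta> N)) - m0\<bar> < 1 / Suc j"
    by (rule order_tendstoD(2)) simp
  then obtain N1 where N1: "\<And>N. N1 \<le> N \<Longrightarrow> \<bar>total_mass (empirical_measure N (\<eta> N)) - m0\<bar> < 1 / Suc j"
    by (auto simp: eventually_sequentially)
  obtain CG where CG: "\<And>N. 3 \<le> N \<Longrightarrow> integrable (M N) (weight G N) \<and>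
    integral\<^sup>L (M N) (weight G N) \<le> exp CG \<and> exp (- CG) \<le> integral\<^sup>L (M N) (weight G N)"
    using weight_moments[OF G] by metis
  show thesis
  proof (rule that[OF l2(1) C0])
    fix N assume "max N1 3 \<le> N"
    then have large: "N1 \<le> N" "3 \<le> N" by auto
    interpret exclusion_process \<alpha> \<beta> N T "\<eta> N" "M N" "\<zeta> N" by (rule exclusion[OF large(2)])
    define E where "E = {\<omega> \<in> space (M N). mpath N \<omega> \<in> F}"
    define Ob where "Ob i = {\<omega> \<in> space (M N). osc_bad T (n i) (1 / Suc i) (mpath N \<omega>)}" for i
    have E: "E \<in> events" unfolding E_def by (rule event_closed[OF large(2) F])
    have Ob: "Ob i \<in> events" "prob (Ob i) \<le> C i * exp (- L * real N)" for i
      using osc[OF large(2), of i] by (auto simp: Ob_def)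
    \<comment> \<open>On \<open>E\<close> either some window oscillates too much, where the weight
      is at most \<open>exp (N B)\<close>, or the finite cover supplies an \<open>H\<close> with the
      weight of \<open>G\<close> at most \<open>exp (- l1 N)\<close> times that of \<open>H\<close>.
      Summing all alternatives gives a majorant, valid almost surely because the initial condition
      is.\<close>
    define bound where "bound \<omega> = (\<Sum>i\<le>j. exp (real N * B) * indicator (Ob i) \<omega>) + (\<Sum>H\<in>\<H>. exp (- l1 * real N) * weight H N \<omega>)" for \<omega>
    have init: "AE \<omega> in M N. \<bar>mpath N \<omega> 0 - m0\<bar> \<le> 1 / Suc j"
      using AE_initial
    proof eventually_elim
      case (elim \<omega>)
      then have "mpath N \<omega> 0 = total_mass (empirical_measure N (\<eta> N))" using T by (simp add: mass_path_def)
      then show ?case using N1[OF large(1)] by simp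
    qed
    have le: "AE \<omega> in M N. weight G N \<omega> * indicator E \<omega> \<le> bound \<omega>"
      using init AE_space
    proof eventually_elim
      case (elim \<omega>)
      have nn: "0 \<le> (\<Sum>i\<le>j. exp (real N * B) * indicator (Ob i) \<omega>)" "0 \<le> (\<Sum>H\<in>\<H>. exp (- l1 * real N) * weight H N \<omega>)"
        by (intro sum_nonneg; simp add: weight_def)+
      have wB: "weight G N \<omega> \<le> exp (real N * B)"
        using B(2)[OF path_in_paths[OF elim(2)]] by (simp add: weight_def abs_le_iff mult_left_mono)
      show ?case
      proof (cases "\<omega> \<in> E")
        case False
        then show ?thesis using nn by (simp add: bound_def)
      next
        case True
        then have aF: "mpath N \<omega> \<in> F" by (simp add: E_def)
        show ?thesis
        proof (cases "\<exists>i\<le>j. \<omega> \<in> Ob i")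
          case True
          then obtain i where i: "i \<le> j" "\<omega> \<in> Ob i" by blast
          have "exp (real N * B) * indicator (Ob i) \<omega> \<le> (\<Sum>i\<le>j. exp (real N * B) * indicator (Ob i) \<omega>)"
            using i by (intro member_le_sum) auto
          moreover have "exp (real N * B) * indicator (Ob i) \<omega> = exp (real N * B)" using i by simp
          ultimately have "exp (real N * B) \<le> bound \<omega>" unfolding bound_def using nn(2) by linarith
          then show ?thesis using wB \<open>\<omega> \<in> E\<close> by simp
        next
          case False
          then have "\<not> osc_bad T (n i) (1 / Suc i) (mpath N \<omega>)" if "i \<le> j" for i using that elim(2) by (auto simp: Ob_def)
          then obtain H where H: "H \<in> \<H>" "J_functional T \<gamma> G (mpath N \<omega>) + l1 \<le> J_functional T \<gamma> H (mpath N \<omega>)"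
            using cov[OF aF elim(1)] by blast
          have "real N * (J_functional T \<gamma> G (mpath N \<omega>) + l1) \<le> real N * J_functional T \<gamma> H (mpath N \<omega>)"
            using H(2) by (intro mult_left_mono) auto
          then have "weight G N \<omega> \<le> exp (- l1 * real N) * weight H N \<omega>"
            unfolding weight_def mult_exp_exp by (simp add: algebra_simps)
          also have "\<dots> \<le> (\<Sum>H\<in>\<H>. exp (- l1 * real N) * weight H N \<omega>)"
            using H(1) \<H>(1) by (intro member_le_sum) (auto simp: weight_def)
          also have "\<dots> \<le> bound \<omega>" using nn(1) by (simp only: bound_def le_add_same_cancel2)
          finally show ?thesis using \<open>\<omega> \<in> E\<close> by simp
        qed
      qed
    qed
    have iO: "integrable (M N) (\<lambda>\<omega>. exp (real N * B) * indicator (Ob i) \<omega>)" for i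
      using Ob by (intro integrable_mult_right integrable_real_indicator) (auto simp: emeasure_eq_measure)
    have iH: "integrable (M N) (\<lambda>\<omega>. exp (- l1 * real N) * weight H N \<omega>)" if "H \<in> \<H>" for H
      using CH[OF that large(2)] by (intro integrable_mult_right) auto
    have ib: "integrable (M N) bound" unfolding bound_def[abs_def]
      by (intro Bochner_Integration.integrable_add Bochner_Integration.integrable_sum iO iH)
    have iG: "integrable (M N) (\<lambda>\<omega>. weight G N \<omega> * indicator E \<omega>)"
      using integrable_real_mult_indicator[OF E] CG[OF large(2)] by blast
    have "expectation (\<lambda>\<omega>. weight G N \<omega> * indicator E \<omega>) \<le> expectation bound"
      by (rule integral_mono_AE[OF iG ib le])
    also have "expectation bound = (\<Sum>i\<le>j. exp (real N * B) * prob (Ob i)) + (\<Sum>H\<in>\<H>. exp (- l1 * real N) * expectation (weight H N))"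
    proof -
      have "expectation bound = expectation (\<lambda>\<omega>. \<Sum>i\<le>j. exp (real N * B) * indicator (Ob i) \<omega>)
          + expectation (\<lambda>\<omega>. \<Sum>H\<in>\<H>. exp (- l1 * real N) * weight H N \<omega>)"
        unfolding bound_def[abs_def]
        by (intro Bochner_Integration.integral_add Bochner_Integration.integrable_sum iO iH)
      also have "expectation (\<lambda>\<omega>. \<Sum>i\<le>j. exp (real N * B) * indicator (Ob i) \<omega>) = (\<Sum>i\<le>j. exp (real N * B) * prob (Ob i))"
        using iO Ob by (subst Bochner_Integration.integral_sum) auto
      also have "expectation (\<lambda>\<omega>. \<Sum>H\<in>\<H>. exp (- l1 * real N) * weight H N \<omega>) = (\<Sum>H\<in>\<H>. exp (- l1 * real N) * expectation (weight H N))"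
        using iH by (subst Bochner_Integration.integral_sum) auto
      finally show ?thesis .
    qed
    also have "\<dots> \<le> (\<Sum>i\<le>j. C i * exp (- l2 * real N)) + (\<Sum>H\<in>\<H>. exp (CH H) * exp (- l2 * real N))"
    proof (intro add_mono sum_mono)
      fix i
      have "exp (real N * B) * prob (Ob i) \<le> exp (real N * B) * (C i * exp (- L * real N))"
        using Ob by (intro mult_left_mono) auto
      also have "\<dots> = C i * exp (- (L - B) * real N)" by (simp add: mult.left_commute mult_exp_exp algebra_simps)
      also have "\<dots> \<le> C i * exp (- l2 * real N)"
        using mult_right_mono[of "- (L - B)" "- l2" "real N"] l2(3) C[of i] by (intro mult_left_mono) simp_all
      finally show "exp (real N * B) * prob (Ob i) \<le> C i * exp (- l2 * real N)" .
    next
      fix H assume H: "H \<in> \<H>"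
      have "exp (- l1 * real N) * expectation (weight H N) \<le> exp (- l1 * real N) * exp (CH H)"
        using CH[OF H large(2)] by (intro mult_left_mono) auto
      also have "\<dots> \<le> exp (- l2 * real N) * exp (CH H)"
        using l2(2) by (intro mult_right_mono) (auto intro: mult_right_mono)
      finally show "exp (- l1 * real N) * expectation (weight H N) \<le> exp (CH H) * exp (- l2 * real N)" by (simp add: mult.commute)
    qed
    also have "\<dots> = C0 * exp (- l2 * real N)" by (simp add: C0_def sum_distrib_right distrib_right)
    finally show "expectation (\<lambda>\<omega>. weight G N \<omega> * indicator {\<omega> \<in> space (M N). mpath N \<omega> \<in> F} \<omega>) \<le> C0 * exp (- l2 * real N)"
      by (simp add: E_def)
  qed
qed

lemma upper_bound:
  assumes F: "closedin (skorohod_topology T) F"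
  shows "limsup (\<lambda>N. ereal (1 / real N) * ext_log (measure (M N) {\<omega> \<in> space (M N). mpath N \<omega> \<in> F}))
    \<le> - (INF a\<in>F. rate_I_from T \<gamma> m0 a)"
proof -
  have sub: "F \<subseteq> skorohod_paths T" using F by (auto simp: closedin_def)
  have "limsup (\<lambda>N. ereal (1 / real N) * ext_log (measure (M N) {\<omega> \<in> space (M N). mpath N \<omega> \<in> F})) \<le> ereal (- l)"
    if l: "ereal l < (INF a\<in>F. rate_I_from T \<gamma> m0 a)" for l
  proof -
    \<comment> \<open>The zero field has \<open>J_functional\<close> equal to 0, so exceeding
      \<open>l\<close> is the gap condition of \<open>weighted_upper_bound\<close> for weight
      1.\<close>
    have gap: "\<exists>H\<in>C1_on T. J_functional T \<gamma> (\<lambda>_. 0) a + l < J_functional T \<gamma> H a" if a: "a \<in> F" "a 0 = m0" for a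
    proof -
      have "ereal l < rate_I T \<gamma> a" using less_INF_D[OF l a(1)] a(2) by (simp add: rate_I_from_def)
      then obtain H where "H \<in> C1_on T" "ereal l < ereal (J_functional T \<gamma> H a)"
        unfolding rate_I_def less_SUP_iff by blast
      then show ?thesis by (auto simp: J_zero(2)[OF T])
    qed
    obtain l' C N0 where l': "l < l'" "0 < C"
      and up: "\<And>N. N0 \<le> N \<Longrightarrow> integral\<^sup>L (M N) (\<lambda>\<omega>. weight (\<lambda>_. 0) N \<omega> * indicator {\<omega> \<in> space (M N). mpath N \<omega> \<in> F} \<omega>) \<le> C * exp (- l' * real N)"
      by (rule weighted_upper_bound[OF J_zero(1)[OF T] F, of l]) (use gap in blast)+
    have "0 \<le> measure (M N) {\<omega> \<in> space (M N). mpath N \<omega> \<in> F} \<and> measure (M N) {\<omega> \<in> space (M N). mpath N \<omega> \<in> F} \<le> C * exp (- l * real N)"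
      if N: "max N0 3 \<le> N" for N
    proof -
      have "integral\<^sup>L (M N) (\<lambda>\<omega>. weight (\<lambda>_. 0) N \<omega> * indicator {\<omega> \<in> space (M N). mpath N \<omega> \<in> F} \<omega>)
          = measure (M N) {\<omega> \<in> space (M N). mpath N \<omega> \<in> F}"
        using event_closed[OF _ F, of N] N by (simp add: weight_def J_zero(2)[OF T])
      then have "measure (M N) {\<omega> \<in> space (M N). mpath N \<omega> \<in> F} \<le> C * exp (- l' * real N)" using up[of N] N by simp
      also have "\<dots> \<le> C * exp (- l * real N)" using l' by (intro mult_left_mono) (auto intro: mult_right_mono)
      finally show ?thesis by simp
    qed
    then show ?thesis by (intro limsup_ext_log_le[of "max N0 3" _ C l] l'(2))
  qed
  note limsup_le = this
  show ?thesis
  proof (rule ccontr)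
    assume "\<not> ?thesis"
    then have "- (INF a\<in>F. rate_I_from T \<gamma> m0 a)
      < limsup (\<lambda>N. ereal (1 / real N) * ext_log (measure (M N) {\<omega> \<in> space (M N). mpath N \<omega> \<in> F}))"
      by (rule not_le_imp_less)
    from ereal_dense2[OF this] obtain l where l: "- (INF a\<in>F. rate_I_from T \<gamma> m0 a) < ereal l"
      "ereal l < limsup (\<lambda>N. ereal (1 / real N) * ext_log (measure (M N) {\<omega> \<in> space (M N). mpath N \<omega> \<in> F}))"
      by blast
    have "- ereal l < (INF a\<in>F. rate_I_from T \<gamma> m0 a)" using l(1) by (simp only: ereal_uminus_less_reorder)
    then have "ereal (- l) < (INF a\<in>F. rate_I_from T \<gamma> m0 a)" by simp
    from limsup_le[OF this] l(2) show False by simp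
  qed
qed

lemma lower_bound:
  assumes U: "openin (skorohod_topology T) U"
  shows "- (INF a\<in>U. rate_I_from T \<gamma> m0 a) \<le>
    liminf (\<lambda>N. ereal (1 / real N) * ext_log (measure (M N) {\<omega> \<in> space (M N). mpath N \<omega> \<in> U}))"
proof -
  let ?lim = "liminf (\<lambda>N. ereal (1 / real N) * ext_log (measure (M N) {\<omega> \<in> space (M N). mpath N \<omega> \<in> U}))"
  have main: "ereal (- (K + 2 * e)) \<le> ?lim"
    if aU: "a \<in> U" and a0: "a 0 = m0" and K: "\<And>H. H \<in> C1_on T \<Longrightarrow> J_functional T \<gamma> H a \<le> K" and e: "0 < e" for a K e
  proof -
    have a: "a \<in> skorohod_paths T" using U aU unfolding openin_skorohod by blast
    obtain r where r: "0 < r" "\<And>b. b \<in> skorohod_paths T \<Longrightarrow> skorohod_dist T a b < r \<Longrightarrow> b \<in> U"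
      using U aU unfolding openin_skorohod by blast
    \<comment> \<open>Half of the radius \<open>r\<close> is spent on the distance from
      \<open>a\<close> to its smooth approximation, the other half on the ball around the
      latter.\<close>
    define e1 where "e1 = min e (r / 2)"
    have e1: "0 < e1" "e1 \<le> e" "e1 \<le> r / 2" using e r by (auto simp: e1_def)
    obtain c G where c: "c \<in> skorohod_paths T" "continuous_on {0..T} c" "c 0 = m0"
      and ca: "\<And>t. t \<in> {0..T} \<Longrightarrow> \<bar>c t - a t\<bar> \<le> e1"
      and Jc: "\<And>H. H \<in> C1_on T \<Longrightarrow> J_functional T \<gamma> H c \<le> K + e1" and G: "G \<in> C1_on T"
      and c': "\<And>t. t \<in> {0..T} \<Longrightarrow> (c has_real_derivative 2 * \<gamma> * (1 - c t) * exp (G t) - 2 * (1 - \<gamma>) * c t * exp (- G t)) (at t within {0..T})"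
    proof (rule smooth_approximation[OF T \<gamma> a a0 m0 K e1(1)])
      fix c G
      assume "c \<in> skorohod_paths T" "continuous_on {0..T} c" "c 0 = m0"
        "\<And>t. t \<in> {0..T} \<Longrightarrow> \<bar>c t - a t\<bar> \<le> e1"
        "\<And>H. H \<in> C1_on T \<Longrightarrow> J_functional T \<gamma> H c \<le> K + e1" "G \<in> C1_on T"
        "\<And>t. t \<in> {0..T} \<Longrightarrow> (c has_real_derivative 2 * \<gamma> * (1 - c t) * exp (G t) - 2 * (1 - \<gamma>) * c t * exp (- G t)) (at t within {0..T})"
      then show thesis by (rule that)
    qed
    obtain Lp where Lp: "0 < Lp" "\<And>a b d. a \<in> skorohod_paths T \<Longrightarrow> b \<in> skorohod_paths T \<Longrightarrow>
      (\<And>t. t \<in> {0..T} \<Longrightarrow> \<bar>a t - b t\<bar> \<le> d) \<Longrightarrow> \<bar>J_functional T \<gamma> G a - J_functional T \<gamma> G b\<bar> \<le> Lp * d"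
      using J_lipschitz[OF T G, of \<gamma>] by metis
    define e2 where "e2 = (e / 2) / Lp"
    have e2: "0 < e2" "Lp * e2 = e / 2" using e Lp by (auto simp: e2_def)
    have "uniformly_continuous_on {0..T} c" using c(2) by (intro compact_uniformly_continuous) auto
    then obtain d where d: "0 < d" "\<And>s t. s \<in> {0..T} \<Longrightarrow> t \<in> {0..T} \<Longrightarrow> \<bar>s - t\<bar> < d \<Longrightarrow> \<bar>c s - c t\<bar> < e2"
      using e2(1) unfolding uniformly_continuous_on_def dist_real_def by (metis abs_minus_commute)
    \<comment> \<open>A Skorohod ball around the continuous path \<open>c\<close> is uniformly
      small: \<open>d\<close> turns the time distortion into an error \<open>e2\<close>, and the
      vertical distance adds another. So on the ball \<open>J_functional\<close> for
      \<open>G\<close> differs from its value at \<open>c\<close> by at most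
      \<open>2 Lp e2 = e\<close>.\<close>
    define \<rho> where "\<rho> = Min {d, e2, r / 2}"
    have \<rho>: "0 < \<rho>" "\<rho> \<le> d" "\<rho> \<le> e2" "\<rho> \<le> r / 2" using d e2 r by (auto simp: \<rho>_def)
    interpret S: Metric_space "skorohod_paths T" "skorohod_dist T" by (rule Metric_space_skorohod)
    define B where "B = {b \<in> skorohod_paths T. skorohod_dist T c b < \<rho>}"
    have Bopen: "openin (skorohod_topology T) B"
      unfolding openin_skorohod
    proof (intro conjI ballI)
      fix b assume b: "b \<in> B"
      show "\<exists>r>0. \<forall>b'\<in>skorohod_paths T. skorohod_dist T b b' < r \<longrightarrow> b' \<in> B"
      proof (intro exI[of _ "\<rho> - skorohod_dist T c b"] conjI ballI impI)
        fix b' assume b': "b' \<in> skorohod_paths T" "skorohod_dist T b b' < \<rho> - skorohod_dist T c b"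
        have "skorohod_dist T c b' \<le> skorohod_dist T c b + skorohod_dist T b b'" using b c b' by (intro S.triangle) (auto simp: B_def)
        then show "b' \<in> B" using b' by (simp add: B_def)
      qed (use b in \<open>simp add: B_def\<close>)
    qed (auto simp: B_def)
    have BU: "B \<subseteq> U"
    proof
      fix b assume b: "b \<in> B"
      then have bp: "b \<in> skorohod_paths T" by (simp add: B_def)
      have "skorohod_dist T a c \<le> r / 2"
      proof (rule skorohod_dist_uniform[OF a c(1)])
        fix t assume "t \<in> {0..T}"
        from ca[OF this] show "\<bar>a t - c t\<bar> \<le> r / 2" using e1(3) by linarith
      qed (use r in simp)
      moreover have "skorohod_dist T a b \<le> skorohod_dist T a c + skorohod_dist T c b" by (rule S.triangle[OF a c(1) bp])
      ultimately show "b \<in> U" using b \<rho>(4) by (intro r(2)[OF bp]) (auto simp: B_def)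
    qed
    have JB: "J_functional T \<gamma> G b \<le> K + 2 * e" if b: "b \<in> B" for b
    proof -
      have bp: "b \<in> skorohod_paths T" and "skorohod_dist T c b < \<rho>" using b by (auto simp: B_def)
      then obtain q where q: "skorohod_close T c b q" "q < \<rho>" using skorohod_dist_lessD[OF c(1) bp] by metis
      obtain lt where lt: "lt \<in> time_changes T" and ltc: "\<And>t. t \<in> {0..T} \<Longrightarrow> \<bar>lt t - t\<bar> \<le> q \<and> \<bar>c t - b (lt t)\<bar> \<le> q"
        using q(1) by (auto simp: skorohod_close_def)
      have "\<bar>b s - c s\<bar> \<le> 2 * e2" if s: "s \<in> {0..T}" for s
      proof -
        have "s \<in> lt ` {0..T}" using lt s by (simp add: time_changes_def)
        then obtain t where t: "t \<in> {0..T}" "s = lt t" by blast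
        have "\<bar>c s - c t\<bar> < e2" using ltc[OF t(1)] t q(2) \<rho>(2) s by (intro d(2)) auto
        moreover have "\<bar>c t - b s\<bar> \<le> e2" using ltc[OF t(1)] t q(2) \<rho>(3) by auto
        ultimately show ?thesis by linarith
      qed
      then have "\<bar>J_functional T \<gamma> G b - J_functional T \<gamma> G c\<bar> \<le> Lp * (2 * e2)" by (rule Lp(2)[OF bp c(1)])
      then show ?thesis using e2(2) Jc[OF G] e1(2) by (simp add: mult.left_commute[of Lp])
    qed
    define F where "F = skorohod_paths T - B"
    have F: "closedin (skorohod_topology T) F"
      using openin_closedin_eq[of "skorohod_topology T" B] Bopen by (simp add: F_def)
    \<comment> \<open>Here \<open>l = 0\<close>: a path outside the ball for which \<open>G\<close>
      were optimal would coincide with \<open>c\<close> by uniqueness, but \<open>c\<close> lies in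
      the ball.\<close>
    have gap: "\<exists>H\<in>C1_on T. J_functional T \<gamma> G b + 0 < J_functional T \<gamma> H b"
      if b: "b \<in> F" "continuous_on {0..T} b" "b 0 = m0" for b
    proof (rule ccontr)
      assume "\<not> ?thesis"
      then have max: "\<And>H. H \<in> C1_on T \<Longrightarrow> J_functional T \<gamma> H b \<le> J_functional T \<gamma> G b" by (auto simp: not_less)
      have bp: "b \<in> skorohod_paths T" using b by (simp add: F_def)
      have "b = c" by (rule optimal_path_unique[OF T \<gamma> bp b(2) c(1) G c' _ max]) (use b c in auto)
      moreover have "c \<in> B" using c \<rho> S.mdist_zero[OF c(1)] by (simp add: B_def)
      ultimately show False using b by (simp add: F_def)
    qed
    obtain l' C N0 where l': "0 < l'" "0 < C"
      and up: "\<And>N. N0 \<le> N \<Longrightarrow> integral\<^sup>L (M N) (\<lambda>\<omega>. weight G N \<omega> * indicator {\<omega> \<in> space (M N). mpath N \<omega> \<in> F} \<omega>) \<le> C * exp (- l' * real N)"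
      by (rule weighted_upper_bound[OF G F, of 0]) (use gap in blast)+
    obtain CG where CG: "\<And>N. 3 \<le> N \<Longrightarrow> integrable (M N) (weight G N) \<and>
      integral\<^sup>L (M N) (weight G N) \<le> exp CG \<and> exp (- CG) \<le> integral\<^sup>L (M N) (weight G N)"
      using weight_moments[OF G] by metis
    \<comment> \<open>From \<open>N2\<close> on, the weighted mass outside the ball is at most half
      of the lower bound \<open>exp (- CG)\<close> for the total mass, so the ball retains the other
      half.\<close>
    obtain N2 where N2: "ln (2 * C * exp CG) / l' < real N2" using reals_Archimedean2 by blast
    have small: "C * exp (- l' * real N) \<le> exp (- CG) / 2" if "N2 \<le> N" for N
    proof -
      have "ln (2 * C * exp CG) < real N * l'" using N2 that l' by (simp add: divide_less_eq) (meson less_le_trans mult_le_cancel_right_pos of_nat_mono)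
      then have "exp (ln (2 * C * exp CG)) < exp (real N * l')" by simp
      then have "2 * C * exp CG < exp (real N * l')" using l'(2) by simp
      then show ?thesis by (simp add: exp_minus field_simps)
    qed
    have lower: "exp (- CG) / 2 * exp (- (K + 2 * e) * real N) \<le> measure (M N) {\<omega> \<in> space (M N). mpath N \<omega> \<in> U}"
      if "max (max N0 N2) 3 \<le> N" for N
    proof -
      have large: "N0 \<le> N" "N2 \<le> N" "3 \<le> N" using that by auto
      interpret exclusion_process \<alpha> \<beta> N T "\<eta> N" "M N" "\<zeta> N" by (rule exclusion[OF large(3)])
      define EF where "EF = {\<omega> \<in> space (M N). mpath N \<omega> \<in> F}"
      define EB where "EB = {\<omega> \<in> space (M N). mpath N \<omega> \<in> B}"
      have EF: "EF \<in> events" unfolding EF_def by (rule event_closed[OF large(3) F])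
      have EB: "EB \<in> events" unfolding EB_def by (rule event_path_open[OF Bopen])
      have EU: "{\<omega> \<in> space (M N). mpath N \<omega> \<in> U} \<in> events" by (rule event_path_open[OF U])
      have iw: "integrable (M N) (weight G N)" using CG[OF large(3)] by blast
      have iF: "integrable (M N) (\<lambda>\<omega>. weight G N \<omega> * indicator EF \<omega>)"
        using integrable_real_mult_indicator[OF EF iw] .
      have iB: "integrable (M N) (\<lambda>\<omega>. exp (real N * (K + 2 * e)) * indicator EB \<omega>)"
        using EB by (intro integrable_mult_right integrable_real_indicator) (auto simp: emeasure_eq_measure)
      \<comment> \<open>The weight is kept as it is outside the ball and replaced by its maximum
        \<open>exp (N (K + 2 e))\<close> inside. Division by this maximum turns weighted mass into a
        lower bound for the probability.\<close>
      have "expectation (weight G N) \<le> expectation (\<lambda>\<omega>. weight G N \<omega> * indicator EF \<omega> + exp (real N * (K + 2 * e)) * indicator EB \<omega>)"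
      proof (rule integral_mono[OF iw Bochner_Integration.integrable_add[OF iF iB]])
        fix \<omega> assume \<omega>: "\<omega> \<in> space (M N)"
        show "weight G N \<omega> \<le> weight G N \<omega> * indicator EF \<omega> + exp (real N * (K + 2 * e)) * indicator EB \<omega>"
        proof (cases "mpath N \<omega> \<in> B")
          case True
          then have "\<omega> \<in> EB" "\<omega> \<notin> EF" using \<omega> by (auto simp: EB_def EF_def F_def)
          then show ?thesis using JB[OF True] by (simp add: weight_def mult_left_mono)
        next
          case False
          then have "\<omega> \<in> EF" using \<omega> path_in_paths[OF \<omega>] by (auto simp: EF_def F_def)
          then show ?thesis by simp
        qed
      qed
      also have "\<dots> = expectation (\<lambda>\<omega>. weight G N \<omega> * indicator EF \<omega>) + exp (real N * (K + 2 * e)) * prob EB"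
        using EB by (subst Bochner_Integration.integral_add[OF iF iB]) simp
      also have "\<dots> \<le> exp (- CG) / 2 + exp (real N * (K + 2 * e)) * prob EB"
        using up[OF large(1)] small[OF large(2)] by (simp add: EF_def)
      finally have "exp (- CG) / 2 \<le> exp (real N * (K + 2 * e)) * prob EB" using CG[OF large(3)] by linarith
      then have "exp (- CG) / 2 * exp (- (K + 2 * e) * real N) \<le> exp (real N * (K + 2 * e)) * prob EB * exp (- (K + 2 * e) * real N)"
        by (intro mult_right_mono) auto
      also have "\<dots> = prob EB * (exp (real N * (K + 2 * e)) * exp (- (K + 2 * e) * real N))" by (simp only: mult_ac)
      also have "exp (real N * (K + 2 * e)) * exp (- (K + 2 * e) * real N) = 1"
        unfolding mult_exp_exp by (simp add: algebra_simps)
      also have "prob EB * 1 \<le> prob {\<omega> \<in> space (M N). mpath N \<omega> \<in> U}"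
        using BU EU by (simp add: EB_def) (intro finite_measure_mono, auto)
      finally show ?thesis .
    qed
    show ?thesis by (rule liminf_ext_log_ge[of "max (max N0 N2) 3" "exp (- CG) / 2"]) (use lower in auto)
  qed
  have "- rate_I_from T \<gamma> m0 a \<le> ?lim" if aU: "a \<in> U" for a
  proof (cases "rate_I_from T \<gamma> m0 a = \<infinity>")
    case True
    then show ?thesis by simp
  next
    case False
    then have a0: "a 0 = m0" and I: "rate_I T \<gamma> a \<noteq> \<infinity>" by (auto simp: rate_I_from_def split: if_splits)
    \<comment> \<open>Comparison with the zero field excludes the value minus infinity, so a rate
      different from infinity is a real number \<open>K\<close>.\<close>
    have "ereal (J_functional T \<gamma> (\<lambda>_. 0) a) \<le> rate_I T \<gamma> a"
      unfolding rate_I_def by (rule SUP_upper[OF J_zero(1)[OF T]])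
    then have "0 \<le> rate_I T \<gamma> a" by (simp add: J_zero(2)[OF T] zero_ereal_def)
    then obtain K where K: "rate_I T \<gamma> a = ereal K" using I by (cases "rate_I T \<gamma> a") auto
    have JK: "J_functional T \<gamma> H a \<le> K" if "H \<in> C1_on T" for H
    proof -
      have "ereal (J_functional T \<gamma> H a) \<le> rate_I T \<gamma> a" unfolding rate_I_def by (rule SUP_upper[OF that])
      then show ?thesis by (simp add: K)
    qed
    have "ereal (- K) \<le> ?lim"
    proof (rule ereal_le_epsilon2)
      fix e :: real assume e: "0 < e"
      have "ereal (- (K + 2 * (e / 2))) \<le> ?lim" by (rule main[OF aU a0 JK]) (use e in auto)
      then have "ereal (- (K + 2 * (e / 2))) + ereal e \<le> ?lim + ereal e" by (rule add_right_mono)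
      then show "ereal (- K) \<le> ?lim + ereal e" by simp
    qed
    then show ?thesis using a0 K by (simp add: rate_I_from_def)
  qed
  then have "- ?lim \<le> rate_I_from T \<gamma> m0 a" if "a \<in> U" for a
    using that by (subst ereal_uminus_le_reorder) blast
  then have "- ?lim \<le> (INF a\<in>U. rate_I_from T \<gamma> m0 a)" by (rule INF_greatest)
  then show ?thesis by (subst ereal_uminus_le_reorder)
qed

end

theorem theorem2p8:
  fixes T \<alpha> \<beta> \<gamma> m0 :: real
    and \<eta> :: "nat \<Rightarrow> nat \<Rightarrow> nat"
    and M :: "nat \<Rightarrow> 'w measure"
    and \<zeta> :: "nat \<Rightarrow> real \<Rightarrow> 'w \<Rightarrow> nat \<Rightarrow> nat"
  assumes "0 < T"
    and "0 < \<alpha>" "\<alpha> < 1" "0 < \<beta>" "\<beta> < 1"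
    and "\<gamma> = (\<alpha> + \<beta>) / 2"
    and "0 < m0" "m0 < 1"
    and "\<And>N. 3 \<le> N \<Longrightarrow> \<eta> N \<in> configs N"
    and "(\<lambda>N. total_mass (empirical_measure N (\<eta> N))) \<longlonglongrightarrow> m0"
    and "\<And>N. 3 \<le> N \<Longrightarrow>
      markov_process T (configs N) (accelerated_gen \<alpha> \<beta> N) (return_pmf (\<eta> N)) (M N) (\<zeta> N)"
  shows "(\<forall>F. closedin (skorohod_topology T) F \<longrightarrow>
            limsup (\<lambda>N. ereal (1 / real N) *
              ext_log (measure (M N) {\<omega> \<in> space (M N). mass_path T N (\<lambda>t. \<zeta> N t \<omega>) \<in> F}))
            \<le> - (INF a\<in>F. rate_I_from T \<gamma> m0 a))
       \<and> (\<forall>U. openin (skorohod_topology T) U \<longrightarrow>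
            liminf (\<lambda>N. ereal (1 / real N) *
              ext_log (measure (M N) {\<omega> \<in> space (M N). mass_path T N (\<lambda>t. \<zeta> N t \<omega>) \<in> U}))
            \<ge> - (INF a\<in>U. rate_I_from T \<gamma> m0 a))"
proof -
  interpret mass_process T \<alpha> \<beta> \<gamma> m0 \<eta> M \<zeta> using assms by unfold_locales
  show ?thesis using upper_bound lower_bound by blast
qed

end
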